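(* Let $L/K$ be a finite Galois extension with Galois group $G$ and let $X$ be a topological space. The functor $$\Phi_{L/K}^G\colon\mathrm{D}^{\mathrm b}(K_X)\to\mathrm{D}^{\mathrm b}(L_X)^G,\qquad \mathcal{G}\mapsto\big(L_X\otimes_{K_X}\mathcal{G},(g\otimes\mathrm{id}_{\mathcal{G}})_{g\in G}\big)$$ is fully faithful.
   Context: All topological spaces are assumed good: Hausdorff, locally compact, second countable and of finite cohomological dimension. For a field $k$, $k_X$ is the constant sheaf, $\mathrm{Mod}(k_X)$ the category of sheaves of $k$-vector spaces on $X$ and $\mathrm{D}^{\mathrm b}(k_X)$ its bounded derived category. For $g\in G$ and an $L$-vector space $V$, $\overline{V}^g$ is the $K$-vector space $V$ with $L$-action $\ell\cdot v:=g(\ell)v$. For $\mathcal{F}\in\mathrm{Mod}(L_X)$, $\overline{\mathcal{F}}^g$ is the sheaf $U\mapsto\overline{\mathcal{F}(U)}^g$; this functor is exact and extends to $\mathrm{D}^{\mathrm b}(L_X)$, and $\overline{\overline{\mathcal{F}}^g}^h=\overline{\mathcal{F}}^{gh}$. A $G$-structure on $\mathcal{F}\in\mathrm{D}^{\mathrm b}(L_X)$ is a family of isomorphisms $\varphi_g\colon\mathcal{F}\to\overline{\mathcal{F}}^g$ ($g\in G$) in $\mathrm{D}^{\mathrm b}(L_X)$ with $\varphi_{gh}=\overline{\varphi_g}^h\circ\varphi_h$ for all $g,h\in G$. $\mathrm{D}^{\mathrm b}(L_X)^G$ is the category of pairs $(\mathcal{F},(\varphi_g)_{g\in G})$; a morphism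 $(\mathcal{F},(\varphi_g))\to(\mathcal{F}',(\varphi'_g))$ is a morphism $f\colon\mathcal{F}\to\mathcal{F}'$ in $\mathrm{D}^{\mathrm b}(L_X)$ with $\varphi'_g\circ f=\overline{f}^g\circ\varphi_g$ for all $g\in G$. For $\mathcal{G}\in\mathrm{Mod}(K_X)$, $L_X\otimes_{K_X}\mathcal{G}$ is the sheafification of $U\mapsto L\otimes_K\mathcal{G}(U)$, with $L$ acting on the first factor; this is exact and extends to derived categories. The natural $G$-structure is $g\otimes\mathrm{id}_{\mathcal{G}}\colon L_X\otimes_{K_X}\mathcal{G}\to\overline{L_X}^g\otimes_{K_X}\mathcal{G}=\overline{L_X\otimes_{K_X}\mathcal{G}}^g$, where $g\colon L_X\to\overline{L_X}^g$ is induced by $\ell\mapsto g(\ell)$. *)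

theory Defs
  imports
    "HOL-Algebra.Embedded_Algebras"
    "HOL-Algebra.IntRing"
    "HOL-Analysis.Abstract_Topological_Spaces"
    "HOL-Combinatorics.Permutations"
begin

section \<open>Categories, functors and localization\<close>

text \<open>Composition and functors on morphisms take the endpoints as explicit arguments, so hom-sets
  need not be disjoint. \<open>Cmp C a b c g f\<close> is \<open>g \<circ> f\<close> for \<open>f : a \<rightarrow> b\<close> and \<open>g : b \<rightarrow> c\<close>.\<close>

record ('o, 'm) cat =
  Ob :: "'o set"
  Hom :: "'o \<Rightarrow> 'o \<Rightarrow> 'm set"
  Idt :: "'o \<Rightarrow> 'm"
  Cmp :: "'o \<Rightarrow> 'o \<Rightarrow> 'o \<Rightarrow> 'm \<Rightarrow> 'm \<Rightarrow> 'm"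

definition is_iso :: "('o, 'm) cat \<Rightarrow> 'o \<Rightarrow> 'o \<Rightarrow> 'm \<Rightarrow> bool" where
  "is_iso C a b f \<longleftrightarrow> f \<in> Hom C a b \<and>
     (\<exists>g \<in> Hom C b a. Cmp C a b a g f = Idt C a \<and> Cmp C b a b f g = Idt C b)"

definition is_functor ::
  "('o, 'm) cat \<Rightarrow> ('p, 'n) cat \<Rightarrow> ('o \<Rightarrow> 'p) \<Rightarrow> ('o \<Rightarrow> 'o \<Rightarrow> 'm \<Rightarrow> 'n) \<Rightarrow> bool" where
  "is_functor C D Fo Fm \<longleftrightarrow>
     (\<forall>a \<in> Ob C. Fo a \<in> Ob D) \<and>
     (\<forall>a \<in> Ob C. \<forall>b \<in> Ob C. \<forall>f \<in> Hom C a b. Fm a b f \<in> Hom D (Fo a) (Fo b)) \<and>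
     (\<forall>a \<in> Ob C. Fm a a (Idt C a) = Idt D (Fo a)) \<and>
     (\<forall>a \<in> Ob C. \<forall>b \<in> Ob C. \<forall>c \<in> Ob C. \<forall>f \<in> Hom C a b. \<forall>g \<in> Hom C b c.
        Fm a c (Cmp C a b c g f) = Cmp D (Fo a) (Fo b) (Fo c) (Fm b c g) (Fm a b f))"

definition fully_faithful_functor ::
  "('o, 'm) cat \<Rightarrow> ('p, 'n) cat \<Rightarrow> ('o \<Rightarrow> 'p) \<Rightarrow> ('o \<Rightarrow> 'o \<Rightarrow> 'm \<Rightarrow> 'n) \<Rightarrow> bool" where
  "fully_faithful_functor C D Fo Fm \<longleftrightarrow> is_functor C D Fo Fm \<and>
     (\<forall>a \<in> Ob C. \<forall>b \<in> Ob C. bij_betw (Fm a b) (Hom C a b) (Hom D (Fo a) (Fo b)))"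

text \<open>The localization of \<open>C\<close> at a family \<open>W\<close> of morphisms (\<open>W a b \<subseteq> Hom C a b\<close>), constructed as in
  Gabriel--Zisman: a morphism is a class of paths whose steps are morphisms of \<open>C\<close> or formal
  inverses of morphisms in \<open>W\<close>. Both \<open>Fwd a f b\<close> and \<open>Bwd a w b\<close> lead from \<open>a\<close> to \<open>b\<close>; in the
  second case \<open>w : b \<rightarrow> a\<close>.\<close>

datatype ('o, 'm) step = Fwd 'o 'm 'o | Bwd 'o 'm 'o

inductive zigzag :: "('o, 'm) cat \<Rightarrow> ('o \<Rightarrow> 'o \<Rightarrow> 'm set) \<Rightarrow> 'o \<Rightarrow> ('o, 'm) step list \<Rightarrow> 'o \<Rightarrow> bool"
  for C W where
  nil: "a \<in> Ob C \<Longrightarrow> zigzag C W a [] a"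
| fwd: "a \<in> Ob C \<Longrightarrow> b \<in> Ob C \<Longrightarrow> f \<in> Hom C a b \<Longrightarrow> zigzag C W b p c
    \<Longrightarrow> zigzag C W a (Fwd a f b # p) c"
| bwd: "a \<in> Ob C \<Longrightarrow> b \<in> Ob C \<Longrightarrow> w \<in> W b a \<Longrightarrow> zigzag C W b p c
    \<Longrightarrow> zigzag C W a (Bwd a w b # p) c"

inductive zigzag_eq ::
  "('o, 'm) cat \<Rightarrow> ('o \<Rightarrow> 'o \<Rightarrow> 'm set) \<Rightarrow> 'o \<Rightarrow> 'o \<Rightarrow>
   ('o, 'm) step list \<Rightarrow> ('o, 'm) step list \<Rightarrow> bool"
  for C W a z where
  refl: "zigzag C W a p z \<Longrightarrow> zigzag_eq C W a z p p"
| sym: "zigzag_eq C W a z p q \<Longrightarrow> zigzag_eq C W a z q p"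
| trans: "zigzag_eq C W a z p q \<Longrightarrow> zigzag_eq C W a z q r \<Longrightarrow> zigzag_eq C W a z p r"
| ident: "zigzag C W a p b \<Longrightarrow> zigzag C W b q z
    \<Longrightarrow> zigzag_eq C W a z (p @ Fwd b (Idt C b) b # q) (p @ q)"
| comp: "zigzag C W a p b \<Longrightarrow> c \<in> Ob C \<Longrightarrow> zigzag C W d q z
    \<Longrightarrow> f \<in> Hom C b c \<Longrightarrow> g \<in> Hom C c d
    \<Longrightarrow> zigzag_eq C W a z (p @ Fwd b f c # Fwd c g d # q) (p @ Fwd b (Cmp C b c d g f) d # q)"
| inv1: "zigzag C W a p b \<Longrightarrow> c \<in> Ob C \<Longrightarrow> zigzag C W b q z \<Longrightarrow> w \<in> W b c
    \<Longrightarrow> zigzag_eq C W a z (p @ Fwd b w c # Bwd c w b # q) (p @ q)"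
| inv2: "zigzag C W a p c \<Longrightarrow> b \<in> Ob C \<Longrightarrow> zigzag C W c q z \<Longrightarrow> w \<in> W b c
    \<Longrightarrow> zigzag_eq C W a z (p @ Bwd c w b # Fwd b w c # q) (p @ q)"

definition zigzag_class ::
  "('o, 'm) cat \<Rightarrow> ('o \<Rightarrow> 'o \<Rightarrow> 'm set) \<Rightarrow> 'o \<Rightarrow> 'o \<Rightarrow>
   ('o, 'm) step list \<Rightarrow> ('o, 'm) step list set" where
  "zigzag_class C W a b p = {q. zigzag_eq C W a b p q}"

definition localization ::
  "('o, 'm) cat \<Rightarrow> ('o \<Rightarrow> 'o \<Rightarrow> 'm set) \<Rightarrow> ('o, ('o, 'm) step list set) cat" where
  "localization C W = \<lparr>
     Ob = Ob C,
     Hom = (\<lambda>a b. {zigzag_class C W a b p | p. zigzag C W a p b}),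
     Idt = (\<lambda>a. zigzag_class C W a a []),
     Cmp = (\<lambda>a b c \<beta> \<alpha>. \<Union>p \<in> \<alpha>. \<Union>q \<in> \<beta>. zigzag_class C W a c (p @ q))\<rparr>"

definition loc_arrow ::
  "('o, 'm) cat \<Rightarrow> ('o \<Rightarrow> 'o \<Rightarrow> 'm set) \<Rightarrow> 'o \<Rightarrow> 'o \<Rightarrow> 'm \<Rightarrow> ('o, 'm) step list set" where
  "loc_arrow C W a b f = zigzag_class C W a b [Fwd a f b]"

primrec map_zstep ::
  "('o \<Rightarrow> 'p) \<Rightarrow> ('o \<Rightarrow> 'o \<Rightarrow> 'm \<Rightarrow> 'n) \<Rightarrow> ('o, 'm) step \<Rightarrow> ('p, 'n) step" where
  "map_zstep To Tm (Fwd a f b) = Fwd (To a) (Tm a b f) (To b)"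
| "map_zstep To Tm (Bwd a w b) = Bwd (To a) (Tm b a w) (To b)"

text \<open>The action on morphisms of the functor into \<open>localization D W\<close> induced by a functor
  \<open>(To, Tm)\<close> to \<open>D\<close> that respects the inverted morphisms.\<close>

definition loc_map ::
  "('p, 'n) cat \<Rightarrow> ('p \<Rightarrow> 'p \<Rightarrow> 'n set) \<Rightarrow> ('o \<Rightarrow> 'p) \<Rightarrow> ('o \<Rightarrow> 'o \<Rightarrow> 'm \<Rightarrow> 'n) \<Rightarrow>
   'o \<Rightarrow> 'o \<Rightarrow> ('o, 'm) step list set \<Rightarrow> ('p, 'n) step list set" where
  "loc_map D W To Tm a b \<alpha> =
     (\<Union>p \<in> \<alpha>. zigzag_class D W (To a) (To b) (map (map_zstep To Tm) p))"


section \<open>Sheaves of modules\<close>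

definition mod_hom :: "'k ring \<Rightarrow> ('k, 'u) module \<Rightarrow> ('k, 'v) module \<Rightarrow> ('u \<Rightarrow> 'v) set" where
  "mod_hom R M N = {f \<in> carrier M \<rightarrow> carrier N.
     (\<forall>x \<in> carrier M. \<forall>y \<in> carrier M. f (x \<oplus>\<^bsub>M\<^esub> y) = f x \<oplus>\<^bsub>N\<^esub> f y) \<and>
     (\<forall>k \<in> carrier R. \<forall>x \<in> carrier M. f (k \<odot>\<^bsub>M\<^esub> x) = k \<odot>\<^bsub>N\<^esub> f x)}"

text \<open>\<open>sec F U\<close> is the module of sections over \<open>U\<close> and \<open>rst F U V\<close> the restriction map from \<open>U\<close> to
  \<open>V \<subseteq> U\<close>. Values at sets that are not open are irrelevant.\<close>

record ('x, 'k, 'u) psheaf =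
  sec :: "'x set \<Rightarrow> ('k, 'u) module"
  rst :: "'x set \<Rightarrow> 'x set \<Rightarrow> 'u \<Rightarrow> 'u"

definition presheaf :: "'k ring \<Rightarrow> 'x topology \<Rightarrow> ('x, 'k, 'u) psheaf \<Rightarrow> bool" where
  "presheaf R X F \<longleftrightarrow>
     (\<forall>U. openin X U \<longrightarrow> module R (sec F U)) \<and>
     (\<forall>U V. openin X U \<and> openin X V \<and> V \<subseteq> U \<longrightarrow> rst F U V \<in> mod_hom R (sec F U) (sec F V)) \<and>
     (\<forall>U. openin X U \<longrightarrow> (\<forall>s \<in> carrier (sec F U). rst F U U s = s)) \<and>
     (\<forall>U V W. openin X U \<and> openin X V \<and> openin X W \<and> W \<subseteq> V \<and> V \<subseteq> U \<longrightarrow>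
        (\<forall>s \<in> carrier (sec F U). rst F V W (rst F U V s) = rst F U W s))"

definition sheaf :: "'k ring \<Rightarrow> 'x topology \<Rightarrow> ('x, 'k, 'u) psheaf \<Rightarrow> bool" where
  "sheaf R X F \<longleftrightarrow> presheaf R X F \<and>
     (\<forall>\<U> s. (\<forall>V \<in> \<U>. openin X V \<and> s V \<in> carrier (sec F V)) \<and>
        (\<forall>V \<in> \<U>. \<forall>W \<in> \<U>. rst F V (V \<inter> W) (s V) = rst F W (V \<inter> W) (s W)) \<longrightarrow>
        (\<exists>!t. t \<in> carrier (sec F (\<Union>\<U>)) \<and> (\<forall>V \<in> \<U>. rst F (\<Union>\<U>) V t = s V)))"

text \<open>Morphisms of presheaves are families of maps indexed by the open sets. They are made
  extensional, so that equality of morphisms is equality in the logic.\<close>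

definition ext_mor ::
  "'x topology \<Rightarrow> ('x, 'k, 'u) psheaf \<Rightarrow> ('x set \<Rightarrow> 'u \<Rightarrow> 'v) \<Rightarrow> 'x set \<Rightarrow> 'u \<Rightarrow> 'v" where
  "ext_mor X F f = (\<lambda>U \<in> Collect (openin X). \<lambda>s \<in> carrier (sec F U). f U s)"

definition psheaf_hom ::
  "'k ring \<Rightarrow> 'x topology \<Rightarrow> ('x, 'k, 'u) psheaf \<Rightarrow> ('x, 'k, 'v) psheaf \<Rightarrow>
   ('x set \<Rightarrow> 'u \<Rightarrow> 'v) set" where
  "psheaf_hom R X F G = {f. ext_mor X F f = f \<and>
     (\<forall>U. openin X U \<longrightarrow> f U \<in> mod_hom R (sec F U) (sec G U)) \<and>
     (\<forall>U V. openin X U \<and> openin X V \<and> V \<subseteq> U \<longrightarrow>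
        (\<forall>s \<in> carrier (sec F U). rst G U V (f U s) = f V (rst F U V s)))}"

definition Shv :: "'k ring \<Rightarrow> 'x topology \<Rightarrow> (('x, 'k, 'u) psheaf, 'x set \<Rightarrow> 'u \<Rightarrow> 'u) cat" where
  "Shv R X = \<lparr>
     Ob = {F. sheaf R X F},
     Hom = psheaf_hom R X,
     Idt = (\<lambda>F. ext_mor X F (\<lambda>U s. s)),
     Cmp = (\<lambda>F G H g f. ext_mor X F (\<lambda>U s. g U (f U s)))\<rparr>"

definition zero_sheaf_p :: "'x topology \<Rightarrow> ('x, 'k, 'u) psheaf \<Rightarrow> bool" where
  "zero_sheaf_p X F \<longleftrightarrow> (\<forall>U. openin X U \<longrightarrow> carrier (sec F U) = {\<zero>\<^bsub>sec F U\<^esub>})"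


subsection \<open>Sheafification\<close>

definition germ ::
  "'x topology \<Rightarrow> ('x, 'k, 'u) psheaf \<Rightarrow> 'x \<Rightarrow> 'x set \<Rightarrow> 'u \<Rightarrow> ('x set \<times> 'u) set" where
  "germ X P x U s = {(V, t). openin X V \<and> x \<in> V \<and> t \<in> carrier (sec P V) \<and>
     (\<exists>W. openin X W \<and> x \<in> W \<and> W \<subseteq> U \<inter> V \<and> rst P U W s = rst P V W t)}"

definition stalk ::
  "'x topology \<Rightarrow> ('x, 'k, 'u) psheaf \<Rightarrow> 'x \<Rightarrow> ('k, ('x set \<times> 'u) set) module" where
  "stalk X P x = \<lparr>
     carrier = {germ X P x U s | U s. openin X U \<and> x \<in> U \<and> s \<in> carrier (sec P U)},
     monoid.mult = undefined, one = undefined,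
     zero = germ X P x (topspace X) \<zero>\<^bsub>sec P (topspace X)\<^esub>,
     add = (\<lambda>A B. \<Union>{germ X P x U (s \<oplus>\<^bsub>sec P U\<^esub> t) | U s t. (U, s) \<in> A \<and> (U, t) \<in> B}),
     smult = (\<lambda>k A. \<Union>{germ X P x U (k \<odot>\<^bsub>sec P U\<^esub> s) | U s. (U, s) \<in> A})\<rparr>"

text \<open>Sections over \<open>U\<close> of the sheafification are the families of germs at the points of \<open>U\<close> that are
  locally given by sections of the presheaf; outside \<open>U\<close> the family takes the dummy value \<open>{}\<close>.\<close>

definition sheafify ::
  "'x topology \<Rightarrow> ('x, 'k, 'u) psheaf \<Rightarrow> ('x, 'k, 'x \<Rightarrow> ('x set \<times> 'u) set) psheaf" where
  "sheafify X P = \<lparr>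
     sec = (\<lambda>U. \<lparr>
       carrier = {\<sigma>. (\<forall>x. x \<notin> U \<longrightarrow> \<sigma> x = {}) \<and>
         (\<forall>x \<in> U. \<exists>V t. openin X V \<and> x \<in> V \<and> V \<subseteq> U \<and> t \<in> carrier (sec P V) \<and>
            (\<forall>y \<in> V. \<sigma> y = germ X P y V t))},
       monoid.mult = undefined, one = undefined,
       zero = (\<lambda>x. if x \<in> U then \<zero>\<^bsub>stalk X P x\<^esub> else {}),
       add = (\<lambda>\<sigma> \<tau> x. if x \<in> U then \<sigma> x \<oplus>\<^bsub>stalk X P x\<^esub> \<tau> x else {}),
       smult = (\<lambda>k \<sigma> x. if x \<in> U then k \<odot>\<^bsub>stalk X P x\<^esub> \<sigma> x else {})\<rparr>),
     rst = (\<lambda>U V \<sigma> x. if x \<in> V then \<sigma> x else {})\<rparr>"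

text \<open>The map on sections over \<open>U\<close> of the sheafifications induced by a family of maps
  \<open>f V : P(V) \<rightarrow> Q(V)\<close> that commutes with restrictions.\<close>

definition sheafify_map ::
  "'x topology \<Rightarrow> ('x, 'k, 'v) psheaf \<Rightarrow> ('x set \<Rightarrow> 'u \<Rightarrow> 'v) \<Rightarrow>
   'x set \<Rightarrow> ('x \<Rightarrow> ('x set \<times> 'u) set) \<Rightarrow> 'x \<Rightarrow> ('x set \<times> 'v) set" where
  "sheafify_map X Q f U \<sigma> = (\<lambda>x. if x \<in> U then \<Union>(V, t) \<in> \<sigma> x. germ X Q x V (f V t) else {})"


section \<open>Complexes and the bounded derived category\<close>

record ('x, 'k, 'u) cplx =
  ob :: "int \<Rightarrow> ('x, 'k, 'u) psheaf"
  df :: "int \<Rightarrow> 'x set \<Rightarrow> 'u \<Rightarrow> 'u"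

definition cochain_complex :: "'k ring \<Rightarrow> 'x topology \<Rightarrow> ('x, 'k, 'u) cplx \<Rightarrow> bool" where
  "cochain_complex R X C \<longleftrightarrow>
     (\<forall>n. sheaf R X (ob C n)) \<and>
     (\<forall>n. df C n \<in> psheaf_hom R X (ob C n) (ob C (n + 1))) \<and>
     (\<forall>n U. openin X U \<longrightarrow>
        (\<forall>s \<in> carrier (sec (ob C n) U).
           df C (n + 1) U (df C n U s) = \<zero>\<^bsub>sec (ob C (n + 2)) U\<^esub>))"

definition bounded_complex :: "'k ring \<Rightarrow> 'x topology \<Rightarrow> ('x, 'k, 'u) cplx \<Rightarrow> bool" where
  "bounded_complex R X C \<longleftrightarrow> cochain_complex R X C \<and>
     (\<exists>a b. \<forall>n. n < a \<or> b < n \<longrightarrow> zero_sheaf_p X (ob C n))"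

definition chain_map ::
  "'k ring \<Rightarrow> 'x topology \<Rightarrow> ('x, 'k, 'u) cplx \<Rightarrow> ('x, 'k, 'u) cplx \<Rightarrow>
   (int \<Rightarrow> 'x set \<Rightarrow> 'u \<Rightarrow> 'u) set" where
  "chain_map R X C D = {f.
     (\<forall>n. f n \<in> psheaf_hom R X (ob C n) (ob D n)) \<and>
     (\<forall>n U. openin X U \<longrightarrow>
        (\<forall>s \<in> carrier (sec (ob C n) U). df D n U (f n U s) = f (n + 1) U (df C n U s)))}"

definition Cb ::
  "'k ring \<Rightarrow> 'x topology \<Rightarrow> (('x, 'k, 'u) cplx, int \<Rightarrow> 'x set \<Rightarrow> 'u \<Rightarrow> 'u) cat" where
  "Cb R X = \<lparr>
     Ob = {C. bounded_complex R X C},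
     Hom = chain_map R X,
     Idt = (\<lambda>C n. Idt (Shv R X) (ob C n)),
     Cmp = (\<lambda>C D E g f n. Cmp (Shv R X) (ob C n) (ob D n) (ob E n) (g n) (f n))\<rparr>"

definition cycles :: "('x, 'k, 'u) cplx \<Rightarrow> int \<Rightarrow> 'x set \<Rightarrow> 'u set" where
  "cycles C n U = {z \<in> carrier (sec (ob C n) U). df C n U z = \<zero>\<^bsub>sec (ob C (n + 1)) U\<^esub>}"

definition boundaries :: "('x, 'k, 'u) cplx \<Rightarrow> int \<Rightarrow> 'x set \<Rightarrow> 'u set" where
  "boundaries C n U = df C (n - 1) U ` carrier (sec (ob C (n - 1)) U)"

definition cohomology_class :: "('x, 'k, 'u) cplx \<Rightarrow> int \<Rightarrow> 'x set \<Rightarrow> 'u \<Rightarrow> 'u set" where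
  "cohomology_class C n U z = boundaries C n U +>\<^bsub>sec (ob C n) U\<^esub> z"

definition cohomology_presheaf :: "('x, 'k, 'u) cplx \<Rightarrow> int \<Rightarrow> ('x, 'k, 'u set) psheaf" where
  "cohomology_presheaf C n = \<lparr>
     sec = (\<lambda>U. \<lparr>
       carrier = cohomology_class C n U ` cycles C n U,
       monoid.mult = undefined, one = undefined,
       zero = boundaries C n U,
       add = (\<lambda>A B. A <+>\<^bsub>sec (ob C n) U\<^esub> B),
       smult = (\<lambda>k A. \<Union>z \<in> A. cohomology_class C n U (k \<odot>\<^bsub>sec (ob C n) U\<^esub> z))\<rparr>),
     rst = (\<lambda>U V A. \<Union>z \<in> A. cohomology_class C n V (rst (ob C n) U V z))\<rparr>"

definition cohomology_sheaf ::
  "'x topology \<Rightarrow> ('x, 'k, 'u) cplx \<Rightarrow> int \<Rightarrow> ('x, 'k, 'x \<Rightarrow> ('x set \<times> 'u set) set) psheaf" where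
  "cohomology_sheaf X C n = sheafify X (cohomology_presheaf C n)"

definition cohomology_map ::
  "'x topology \<Rightarrow> ('x, 'k, 'u) cplx \<Rightarrow> ('x, 'k, 'u) cplx \<Rightarrow> (int \<Rightarrow> 'x set \<Rightarrow> 'u \<Rightarrow> 'u) \<Rightarrow> int \<Rightarrow>
   'x set \<Rightarrow> ('x \<Rightarrow> ('x set \<times> 'u set) set) \<Rightarrow> 'x \<Rightarrow> ('x set \<times> 'u set) set" where
  "cohomology_map X C D f n = ext_mor X (cohomology_sheaf X C n)
     (sheafify_map X (cohomology_presheaf D n)
        (\<lambda>U A. \<Union>z \<in> A. cohomology_class D n U (f n U z)))"

definition quasi_isos ::
  "'k ring \<Rightarrow> 'x topology \<Rightarrow> ('x, 'k, 'u) cplx \<Rightarrow> ('x, 'k, 'u) cplx \<Rightarrow>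
   (int \<Rightarrow> 'x set \<Rightarrow> 'u \<Rightarrow> 'u) set" where
  "quasi_isos R X C D = {f \<in> chain_map R X C D.
     \<forall>n. is_iso (Shv R X) (cohomology_sheaf X C n) (cohomology_sheaf X D n)
       (cohomology_map X C D f n)}"

type_synonym ('x, 'k, 'u) dmor =
  "(('x, 'k, 'u) cplx, int \<Rightarrow> 'x set \<Rightarrow> 'u \<Rightarrow> 'u) step list set"

definition Db :: "'k ring \<Rightarrow> 'x topology \<Rightarrow> (('x, 'k, 'u) cplx, ('x, 'k, 'u) dmor) cat" where
  "Db R X = localization (Cb R X) (quasi_isos R X)"


section \<open>Finite Galois extensions\<close>

text \<open>Elements of the Galois group are the identity outside \<open>carrier L\<close>, so that the group operation
  is plain composition of functions. A finite extension \<open>L/K\<close> is Galois if \<open>K\<close> is the fixed field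
  of the group of \<open>K\<close>-automorphisms of \<open>L\<close>.\<close>

definition galois_group :: "'l ring \<Rightarrow> 'l set \<Rightarrow> ('l \<Rightarrow> 'l) set" where
  "galois_group L K = {g. g permutes carrier L \<and> g \<in> ring_hom L L \<and> (\<forall>k \<in> K. g k = k)}"

definition finite_galois_extension :: "'l ring \<Rightarrow> 'l set \<Rightarrow> bool" where
  "finite_galois_extension L K \<longleftrightarrow>
     field L \<and> subfield K L \<and> ring.finite_dimension L K (carrier L) \<and>
     {x \<in> carrier L. \<forall>g \<in> galois_group L K. g x = x} = K"

section \<open>\<open>G\<close>-structures\<close>

definition conj_sheaf :: "('l \<Rightarrow> 'l) \<Rightarrow> ('x, 'l, 'u) psheaf \<Rightarrow> ('x, 'l, 'u) psheaf" where
  "conj_sheaf g F = F\<lparr>sec := (\<lambda>U. (sec F U)\<lparr>smult := (\<lambda>l v. g l \<odot>\<^bsub>sec F U\<^esub> v)\<rparr>)\<rparr>"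

definition conj_cplx :: "('l \<Rightarrow> 'l) \<Rightarrow> ('x, 'l, 'u) cplx \<Rightarrow> ('x, 'l, 'u) cplx" where
  "conj_cplx g C = C\<lparr>ob := (\<lambda>n. conj_sheaf g (ob C n))\<rparr>"

text \<open>Conjugation does not change the underlying maps of a morphism of complexes.\<close>

definition conj_Db ::
  "'l ring \<Rightarrow> 'x topology \<Rightarrow> ('l \<Rightarrow> 'l) \<Rightarrow> ('x, 'l, 'u) cplx \<Rightarrow> ('x, 'l, 'u) cplx \<Rightarrow>
   ('x, 'l, 'u) dmor \<Rightarrow> ('x, 'l, 'u) dmor" where
  "conj_Db L X g = loc_map (Cb L X) (quasi_isos L X) (conj_cplx g) (\<lambda>C D f. f)"

definition G_structure ::
  "'l ring \<Rightarrow> 'l set \<Rightarrow> 'x topology \<Rightarrow> ('x, 'l, 'u) cplx \<Rightarrow> (('l \<Rightarrow> 'l) \<Rightarrow> ('x, 'l, 'u) dmor) \<Rightarrow> bool"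
  where
  "G_structure L K X C \<phi> \<longleftrightarrow>
     (\<forall>g \<in> galois_group L K. is_iso (Db L X) C (conj_cplx g C) (\<phi> g)) \<and>
     (\<forall>g \<in> galois_group L K. \<forall>h \<in> galois_group L K.
        \<phi> (g \<circ> h) = Cmp (Db L X) C (conj_cplx h C) (conj_cplx (g \<circ> h) C)
          (conj_Db L X h C (conj_cplx g C) (\<phi> g)) (\<phi> h))"

definition DbG ::
  "'l ring \<Rightarrow> 'l set \<Rightarrow> 'x topology \<Rightarrow>
   (('x, 'l, 'u) cplx \<times> (('l \<Rightarrow> 'l) \<Rightarrow> ('x, 'l, 'u) dmor), ('x, 'l, 'u) dmor) cat" where
  "DbG L K X = \<lparr>
     Ob = {(C, \<phi>). C \<in> Ob (Db L X) \<and> G_structure L K X C \<phi>},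
     Hom = (\<lambda>(C, \<phi>) (D, \<psi>). {f \<in> Hom (Db L X) C D.
       \<forall>g \<in> galois_group L K.
         Cmp (Db L X) C D (conj_cplx g D) (\<psi> g) f =
         Cmp (Db L X) C (conj_cplx g C) (conj_cplx g D) (conj_Db L X g C D f) (\<phi> g)}),
     Idt = (\<lambda>(C, \<phi>). Idt (Db L X) C),
     Cmp = (\<lambda>(C, _) (D, _) (E, _). Cmp (Db L X) C D E)\<rparr>"


section \<open>Extension of scalars\<close>

text \<open>An element of \<open>L \<otimes>\<^sub>K V\<close> is a class of lists of pairs, the list \<open>[(l\<^sub>1, v\<^sub>1), \<dots>, (l\<^sub>n, v\<^sub>n)]\<close>
  standing for the formal sum of the \<open>l\<^sub>i \<otimes> v\<^sub>i\<close>.\<close>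

inductive tensor_eq ::
  "'l ring \<Rightarrow> 'l set \<Rightarrow> ('l, 'u) module \<Rightarrow> ('l \<times> 'u) list \<Rightarrow> ('l \<times> 'u) list \<Rightarrow> bool"
  for L K V where
  refl: "set ts \<subseteq> carrier L \<times> carrier V \<Longrightarrow> tensor_eq L K V ts ts"
| sym: "tensor_eq L K V ts us \<Longrightarrow> tensor_eq L K V us ts"
| trans: "tensor_eq L K V ts us \<Longrightarrow> tensor_eq L K V us ws \<Longrightarrow> tensor_eq L K V ts ws"
| cong: "l \<in> carrier L \<Longrightarrow> v \<in> carrier V \<Longrightarrow> tensor_eq L K V ts us
    \<Longrightarrow> tensor_eq L K V ((l, v) # ts) ((l, v) # us)"
| swap: "set ts \<subseteq> carrier L \<times> carrier V \<Longrightarrow> l \<in> carrier L \<Longrightarrow> v \<in> carrier V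
    \<Longrightarrow> l' \<in> carrier L \<Longrightarrow> v' \<in> carrier V
    \<Longrightarrow> tensor_eq L K V ((l, v) # (l', v') # ts) ((l', v') # (l, v) # ts)"
| zero: "v \<in> carrier V \<Longrightarrow> tensor_eq L K V [(\<zero>\<^bsub>L\<^esub>, v)] []"
| add_l: "l \<in> carrier L \<Longrightarrow> l' \<in> carrier L \<Longrightarrow> v \<in> carrier V
    \<Longrightarrow> tensor_eq L K V [(l \<oplus>\<^bsub>L\<^esub> l', v)] [(l, v), (l', v)]"
| add_r: "l \<in> carrier L \<Longrightarrow> v \<in> carrier V \<Longrightarrow> v' \<in> carrier V
    \<Longrightarrow> tensor_eq L K V [(l, v \<oplus>\<^bsub>V\<^esub> v')] [(l, v), (l, v')]"
| scal: "l \<in> carrier L \<Longrightarrow> k \<in> K \<Longrightarrow> v \<in> carrier V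
    \<Longrightarrow> tensor_eq L K V [(l \<otimes>\<^bsub>L\<^esub> k, v)] [(l, k \<odot>\<^bsub>V\<^esub> v)]"
| append: "tensor_eq L K V ts us \<Longrightarrow> set ws \<subseteq> carrier L \<times> carrier V
    \<Longrightarrow> tensor_eq L K V (ts @ ws) (us @ ws)"

definition tensor_class ::
  "'l ring \<Rightarrow> 'l set \<Rightarrow> ('l, 'u) module \<Rightarrow> ('l \<times> 'u) list \<Rightarrow> ('l \<times> 'u) list set" where
  "tensor_class L K V ts = {us. tensor_eq L K V ts us}"

definition tensor :: "'l ring \<Rightarrow> 'l set \<Rightarrow> ('l, 'u) module \<Rightarrow> ('l, ('l \<times> 'u) list set) module" where
  "tensor L K V = \<lparr>
     carrier = {tensor_class L K V ts | ts. set ts \<subseteq> carrier L \<times> carrier V},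
     monoid.mult = undefined, one = undefined,
     zero = tensor_class L K V [],
     add = (\<lambda>A B. \<Union>ts \<in> A. \<Union>us \<in> B. tensor_class L K V (ts @ us)),
     smult = (\<lambda>l A. \<Union>ts \<in> A. tensor_class L K V (map (map_prod (\<lambda>a. l \<otimes>\<^bsub>L\<^esub> a) id) ts))\<rparr>"

text \<open>The map \<open>g \<otimes> f\<close> with values in \<open>L \<otimes>\<^sub>K V\<close>.\<close>

definition tensor_map ::
  "'l ring \<Rightarrow> 'l set \<Rightarrow> ('l, 'v) module \<Rightarrow> ('l \<Rightarrow> 'l) \<Rightarrow> ('u \<Rightarrow> 'v) \<Rightarrow>
   ('l \<times> 'u) list set \<Rightarrow> ('l \<times> 'v) list set" where
  "tensor_map L K V g f A = (\<Union>ts \<in> A. tensor_class L K V (map (map_prod g f) ts))"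

definition tensor_presheaf ::
  "'l ring \<Rightarrow> 'l set \<Rightarrow> ('x, 'l, 'u) psheaf \<Rightarrow> ('x, 'l, ('l \<times> 'u) list set) psheaf" where
  "tensor_presheaf L K F = \<lparr>
     sec = (\<lambda>U. tensor L K (sec F U)),
     rst = (\<lambda>U V. tensor_map L K (sec F V) id (rst F U V))\<rparr>"


subsection \<open>A type of sections closed under extension of scalars\<close>

text \<open>In order that \<open>\<G>\<close> and \<open>L\<^sub>X \<otimes> \<G>\<close> have sections in the same type (which plays the role of a
  universe), sections are taken in a datatype that contains an arbitrary type \<open>'b\<close> and is closed
  under forming sections of the sheafification of \<open>U \<mapsto> L \<otimes>\<^sub>K \<G>(U)\<close>. Such a section is encoded by
  choosing at each point a representative of its germ, and in turn a list representing the tensor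
  so obtained. The encoding is injective on sections, and the module structure is transported
  along it.\<close>

datatype ('x, 'l, 'b) univ =
    Atom 'b
  | Germs "'x \<Rightarrow> 'x set \<times> ('l \<times> ('x, 'l, 'b) univ) list"

definition encode ::
  "('x \<Rightarrow> ('x set \<times> ('l \<times> ('x, 'l, 'b) univ) list set) set) \<Rightarrow> ('x, 'l, 'b) univ" where
  "encode \<sigma> = Germs (\<lambda>x. let (V, A) = (SOME p. p \<in> \<sigma> x) in (V, SOME ts. ts \<in> A))"

definition transport_module :: "('u \<Rightarrow> 'v) \<Rightarrow> ('k, 'u) module \<Rightarrow> ('k, 'v) module" where
  "transport_module e M = (let d = inv_into (carrier M) e in \<lparr>
     carrier = e ` carrier M,
     monoid.mult = undefined, one = undefined,
     zero = e \<zero>\<^bsub>M\<^esub>,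
     add = (\<lambda>a b. e (d a \<oplus>\<^bsub>M\<^esub> d b)),
     smult = (\<lambda>k a. e (k \<odot>\<^bsub>M\<^esub> d a))\<rparr>)"

definition transport_psheaf :: "('u \<Rightarrow> 'v) \<Rightarrow> ('x, 'k, 'u) psheaf \<Rightarrow> ('x, 'k, 'v) psheaf" where
  "transport_psheaf e F = \<lparr>
     sec = (\<lambda>U. transport_module e (sec F U)),
     rst = (\<lambda>U V a. e (rst F U V (inv_into (carrier (sec F U)) e a)))\<rparr>"

definition ext_sheaf ::
  "'l ring \<Rightarrow> 'l set \<Rightarrow> 'x topology \<Rightarrow>
   ('x, 'l, ('x, 'l, 'b) univ) psheaf \<Rightarrow> ('x, 'l, ('x, 'l, 'b) univ) psheaf" where
  "ext_sheaf L K X F = transport_psheaf encode (sheafify X (tensor_presheaf L K F))"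

text \<open>The family of maps \<open>g \<otimes> f\<close> from \<open>L\<^sub>X \<otimes> F\<close> to \<open>L\<^sub>X \<otimes> F'\<close>, for \<open>g : L \<rightarrow> L\<close> and \<open>f : F \<rightarrow> F'\<close>.\<close>

definition ext_mor_tensor ::
  "'l ring \<Rightarrow> 'l set \<Rightarrow> 'x topology \<Rightarrow> ('l \<Rightarrow> 'l) \<Rightarrow>
   ('x, 'l, ('x, 'l, 'b) univ) psheaf \<Rightarrow> ('x, 'l, ('x, 'l, 'b) univ) psheaf \<Rightarrow>
   ('x set \<Rightarrow> ('x, 'l, 'b) univ \<Rightarrow> ('x, 'l, 'b) univ) \<Rightarrow>
   'x set \<Rightarrow> ('x, 'l, 'b) univ \<Rightarrow> ('x, 'l, 'b) univ" where
  "ext_mor_tensor L K X g F F' f = ext_mor X (ext_sheaf L K X F) (\<lambda>U a.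
     encode (sheafify_map X (tensor_presheaf L K F') (\<lambda>V. tensor_map L K (sec F' V) g (f V)) U
       (inv_into (carrier (sec (sheafify X (tensor_presheaf L K F)) U)) encode a)))"

definition ext_cplx ::
  "'l ring \<Rightarrow> 'l set \<Rightarrow> 'x topology \<Rightarrow>
   ('x, 'l, ('x, 'l, 'b) univ) cplx \<Rightarrow> ('x, 'l, ('x, 'l, 'b) univ) cplx" where
  "ext_cplx L K X C = \<lparr>
     ob = (\<lambda>n. ext_sheaf L K X (ob C n)),
     df = (\<lambda>n. ext_mor_tensor L K X id (ob C n) (ob C (n + 1)) (df C n))\<rparr>"

definition ext_Db ::
  "'l ring \<Rightarrow> 'l set \<Rightarrow> 'x topology \<Rightarrow>
   ('x, 'l, ('x, 'l, 'b) univ) cplx \<Rightarrow> ('x, 'l, ('x, 'l, 'b) univ) cplx \<Rightarrow>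
   ('x, 'l, ('x, 'l, 'b) univ) dmor \<Rightarrow> ('x, 'l, ('x, 'l, 'b) univ) dmor" where
  "ext_Db L K X = loc_map (Cb L X) (quasi_isos L X) (ext_cplx L K X)
     (\<lambda>C D f n. ext_mor_tensor L K X id (ob C n) (ob D n) (f n))"

definition natural_G_structure ::
  "'l ring \<Rightarrow> 'l set \<Rightarrow> 'x topology \<Rightarrow>
   ('x, 'l, ('x, 'l, 'b) univ) cplx \<Rightarrow> ('l \<Rightarrow> 'l) \<Rightarrow> ('x, 'l, ('x, 'l, 'b) univ) dmor" where
  "natural_G_structure L K X C g =
     loc_arrow (Cb L X) (quasi_isos L X) (ext_cplx L K X C) (conj_cplx g (ext_cplx L K X C))
       (\<lambda>n. ext_mor_tensor L K X g (ob C n) (ob C n) (\<lambda>U s. s))"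

definition Phi_ob ::
  "'l ring \<Rightarrow> 'l set \<Rightarrow> 'x topology \<Rightarrow> ('x, 'l, ('x, 'l, 'b) univ) cplx \<Rightarrow>
   ('x, 'l, ('x, 'l, 'b) univ) cplx \<times> (('l \<Rightarrow> 'l) \<Rightarrow> ('x, 'l, ('x, 'l, 'b) univ) dmor)" where
  "Phi_ob L K X C = (ext_cplx L K X C, natural_G_structure L K X C)"

definition Phi_mor ::
  "'l ring \<Rightarrow> 'l set \<Rightarrow> 'x topology \<Rightarrow>
   ('x, 'l, ('x, 'l, 'b) univ) cplx \<Rightarrow> ('x, 'l, ('x, 'l, 'b) univ) cplx \<Rightarrow>
   ('x, 'l, ('x, 'l, 'b) univ) dmor \<Rightarrow> ('x, 'l, ('x, 'l, 'b) univ) dmor" where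
  "Phi_mor L K X = ext_Db L K X"


section \<open>Good topological spaces\<close>

definition flabby :: "'x topology \<Rightarrow> ('x, 'k, 'u) psheaf \<Rightarrow> bool" where
  "flabby X F \<longleftrightarrow> (\<forall>U. openin X U \<longrightarrow>
     rst F (topspace X) U ` carrier (sec F (topspace X)) = carrier (sec F U))"

definition zero_module :: "('k, 'u) module" where
  "zero_module = \<lparr>carrier = {undefined}, monoid.mult = undefined, one = undefined, zero = undefined,
     add = (\<lambda>_ _. undefined), smult = (\<lambda>_ _. undefined)\<rparr>"

definition concentrated :: "'x topology \<Rightarrow> ('x, 'k, 'u) psheaf \<Rightarrow> ('x, 'k, 'u) cplx" where
  "concentrated X F = (let Q = (\<lambda>n::int. if n = 0 then F
       else \<lparr>sec = (\<lambda>_. zero_module), rst = (\<lambda>_ _ _. undefined)\<rparr>) in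
     \<lparr>ob = Q, df = (\<lambda>n. ext_mor X (Q n) (\<lambda>U _. \<zero>\<^bsub>sec (Q (n + 1)) U\<^esub>))\<rparr>)"

definition flabby_resolution ::
  "'k ring \<Rightarrow> 'x topology \<Rightarrow> ('x, 'k, 'u) psheaf \<Rightarrow> ('x, 'k, 'u) cplx \<Rightarrow>
   (int \<Rightarrow> 'x set \<Rightarrow> 'u \<Rightarrow> 'u) \<Rightarrow> bool" where
  "flabby_resolution R X F I e \<longleftrightarrow> cochain_complex R X I \<and>
     (\<forall>n < 0. zero_sheaf_p X (ob I n)) \<and> (\<forall>n. flabby X (ob I n)) \<and>
     e \<in> quasi_isos R X (concentrated X F) I"

text \<open>There is \<open>n\<close> such that \<open>H\<^sup>j(X; F) = 0\<close> for all sheaves of abelian groups \<open>F\<close> and \<open>j > n\<close>, where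
  the cohomology is computed by flabby resolutions (whose complexes of global sections have
  cohomology independent of the choice). The type \<open>('x, int, unit) univ\<close> of sections is closed under
  the construction of Godement resolutions.\<close>

definition finite_cohomological_dimension :: "'x topology \<Rightarrow> bool" where
  "finite_cohomological_dimension X \<longleftrightarrow>
     (\<exists>n. \<forall>(F :: ('x, int, ('x, int, unit) univ) psheaf) I e j.
        sheaf \<Z> X F \<and> flabby_resolution \<Z> X F I e \<and> j > n \<longrightarrow>
        cycles I j (topspace X) = boundaries I j (topspace X))"

definition good_space :: "'x topology \<Rightarrow> bool" where
  "good_space X \<longleftrightarrow> Hausdorff_space X \<and> locally_compact_space X \<and> second_countable X \<and>
     finite_cohomological_dimension X"

end

theory Submission
  imports Defs "HOL-Algebra.Polynomial_Divisibility" "HOL-Algebra.Finite_Extensions"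
begin

text \<open>
  Write \<open>E(C) = L \<otimes>\<^sub>K C\<close> for a complex \<open>C\<close> over \<open>K\<close>, and let \<open>M\<^sup>g\<close> be the conjugate of a complex \<open>M\<close>
  over \<open>L\<close>. Everything rests on two splittings.

  The first one splits the unit \<open>C \<rightarrow> E(C)\<close>, \<open>v \<mapsto> 1 \<otimes> v\<close>, over \<open>K\<close>: if \<open>c\<close> has trace \<open>1\<close>, then
  \<open>a \<otimes> v \<mapsto> Tr(c a) v\<close> is a retraction (\<open>trace_unit\<close>). As the unit is natural, a morphism \<open>q\<close> of the
  derived category over \<open>K\<close> is the composite of the unit of its source, \<open>E(q)\<close> and the retraction of
  its target. So \<open>E\<close> is faithful (\<open>Phi_mor_inj\<close>).

  The second one is Galois descent. For a complex \<open>M\<close> over \<open>L\<close> there are \<open>L\<close>-linear maps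
  \<open>E(M) \<rightarrow> M\<^sup>g\<close>, \<open>a \<otimes> m \<mapsto> g(a) m\<close>, and maps \<open>M\<^sup>g \<rightarrow> E(M)\<close> in the other direction such that the sum over
  \<open>g\<close> of the composites is the identity of \<open>E(M)\<close> (\<open>sum_coact_act\<close>). Hence a morphism of the derived
  category into \<open>E(M)\<close> is determined by its composites with the maps to the \<open>M\<^sup>g\<close>
  (\<open>act_jointly_monic\<close>). Now let \<open>p : E(C) \<rightarrow> E(D)\<close> be compatible with the \<open>G\<close>-structures, and let \<open>q\<close>
  be the composite over \<open>K\<close> of the unit of \<open>C\<close>, of \<open>p\<close> and of the retraction of \<open>D\<close>. To show \<open>E(q) = p\<close>
  it is enough to see that \<open>E(p)\<close> after \<open>E(unit\<^sub>C)\<close> equals \<open>E(unit\<^sub>D)\<close> after \<open>p\<close>, as morphisms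
  \<open>E(C) \<rightarrow> E(E(D))\<close>. After composition with \<open>E(E(D)) \<rightarrow> E(D)\<^sup>g\<close>, naturality and the fact that
  \<open>E(C) \<rightarrow> E(E(C)) \<rightarrow> E(C)\<^sup>g\<close> is \<open>g \<otimes> id\<close> (\<open>act_unit\<close>) turn this equation into the compatibility of \<open>p\<close>
  with the \<open>G\<close>-structures at \<open>g\<close> (\<open>Phi_mor_surj\<close>).

  Morphisms of the derived category are classes of zigzags. Natural transformations are extended to
  zigzags step by step (\<open>zigzag_eq_natural\<close>), and the additive structure enters through direct sums,
  the diagonal and the codiagonal (\<open>zigzag_eq_sum\<close>). That \<open>E\<close> respects quasi-isomorphisms is seen on coordinates: a Galois extension has
  elements \<open>x\<^sub>i\<close> and functionals \<open>t\<^sub>i\<close> with \<open>\<Sum>\<^sub>i x\<^sub>i t\<^sub>i(a) = a\<close>, so tensors are determined by finitely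
  many coordinates. This also shows that the presheaf \<open>U \<mapsto> L \<otimes>\<^sub>K F(U)\<close> is already a sheaf, which allows
  one to compute with global formal sums instead of germs.
\<close>

no_notation var (\<open>X\<index>\<close>)

section \<open>Germs and isomorphisms of sheafifications\<close>

lemma mod_homD:
  assumes "f \<in> mod_hom R M N"
  shows "x \<in> carrier M \<Longrightarrow> f x \<in> carrier N"
    and "\<lbrakk>x \<in> carrier M; y \<in> carrier M\<rbrakk> \<Longrightarrow> f (x \<oplus>\<^bsub>M\<^esub> y) = f x \<oplus>\<^bsub>N\<^esub> f y"
    and "\<lbrakk>k \<in> carrier R; x \<in> carrier M\<rbrakk> \<Longrightarrow> f (k \<odot>\<^bsub>M\<^esub> x) = k \<odot>\<^bsub>N\<^esub> f x"
  using assms unfolding mod_hom_def by blast+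

lemma psheaf_homD:
  assumes "f \<in> psheaf_hom R X F G"
  shows "openin X U \<Longrightarrow> f U \<in> mod_hom R (sec F U) (sec G U)"
    and "\<lbrakk>openin X U; openin X V; V \<subseteq> U; s \<in> carrier (sec F U)\<rbrakk> \<Longrightarrow> rst G U V (f U s) = f V (rst F U V s)"
    and "ext_mor X F f = f"
  using assms unfolding psheaf_hom_def by blast+

text \<open>The part of the presheaf axioms on which the operations on germs depend. It is isolated because for
  the presheaf of cohomology classes it can be verified directly on representatives.\<close>

locale operations_presheaf =
  fixes R :: "'k ring" and X :: "'x topology" and P :: "('x, 'k, 'u) psheaf"
  assumes add_closed: "\<lbrakk>openin X U; s \<in> carrier (sec P U); t \<in> carrier (sec P U)\<rbrakk>
      \<Longrightarrow> s \<oplus>\<^bsub>sec P U\<^esub> t \<in> carrier (sec P U)"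
    and smult_closed: "\<lbrakk>openin X U; k \<in> carrier R; s \<in> carrier (sec P U)\<rbrakk>
      \<Longrightarrow> k \<odot>\<^bsub>sec P U\<^esub> s \<in> carrier (sec P U)"
    and rst_hom: "\<lbrakk>openin X U; openin X V; V \<subseteq> U\<rbrakk> \<Longrightarrow> rst P U V \<in> mod_hom R (sec P U) (sec P V)"
    and rst_self: "\<lbrakk>openin X U; s \<in> carrier (sec P U)\<rbrakk> \<Longrightarrow> rst P U U s = s"
    and rst_rst: "\<lbrakk>openin X U; openin X V; openin X W; W \<subseteq> V; V \<subseteq> U; s \<in> carrier (sec P U)\<rbrakk>
      \<Longrightarrow> rst P V W (rst P U V s) = rst P U W s"
begin

lemma rst_closed:
  "\<lbrakk>openin X U; openin X V; V \<subseteq> U; s \<in> carrier (sec P U)\<rbrakk> \<Longrightarrow> rst P U V s \<in> carrier (sec P V)"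
  using rst_hom[of U V] by (auto simp: mod_hom_def)

lemma rst_add:
  "\<lbrakk>openin X U; openin X V; V \<subseteq> U; s \<in> carrier (sec P U); t \<in> carrier (sec P U)\<rbrakk>
    \<Longrightarrow> rst P U V (s \<oplus>\<^bsub>sec P U\<^esub> t) = rst P U V s \<oplus>\<^bsub>sec P V\<^esub> rst P U V t"
  using rst_hom[of U V] by (auto simp: mod_hom_def)

lemma rst_smult:
  "\<lbrakk>openin X U; openin X V; V \<subseteq> U; k \<in> carrier R; s \<in> carrier (sec P U)\<rbrakk>
    \<Longrightarrow> rst P U V (k \<odot>\<^bsub>sec P U\<^esub> s) = k \<odot>\<^bsub>sec P V\<^esub> rst P U V s"
  using rst_hom[of U V] by (auto simp: mod_hom_def)

lemma germ_self: "\<lbrakk>openin X U; x \<in> U; s \<in> carrier (sec P U)\<rbrakk> \<Longrightarrow> (U, s) \<in> germ X P x U s"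
  unfolding germ_def by auto

lemma germ_eq_of_local:
  assumes "openin X U" "openin X V" "openin X W" "x \<in> W" "W \<subseteq> U \<inter> V"
    and s: "s \<in> carrier (sec P U)" and t: "t \<in> carrier (sec P V)"
    and eq: "rst P U W s = rst P V W t"
  shows "germ X P x U s \<subseteq> germ X P x V t"
proof
  fix p assume "p \<in> germ X P x U s"
  then obtain V' t' W' where p: "p = (V', t')" and V': "openin X V'" "x \<in> V'"
    and t': "t' \<in> carrier (sec P V')" and W': "openin X W'" "x \<in> W'" "W' \<subseteq> U \<inter> V'"
    and eq': "rst P U W' s = rst P V' W' t'"
    unfolding germ_def by blast
  have o: "openin X (W \<inter> W')" using assms W' by blast
  have "rst P V (W \<inter> W') t = rst P W (W \<inter> W') (rst P V W t)"
    using assms o by (intro rst_rst[symmetric]) auto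
  also have "\<dots> = rst P U (W \<inter> W') s"
    unfolding eq[symmetric] using assms o by (intro rst_rst) auto
  also have "\<dots> = rst P W' (W \<inter> W') (rst P U W' s)"
    using assms W' o by (intro rst_rst[symmetric]) auto
  also have "\<dots> = rst P V' (W \<inter> W') t'"
    unfolding eq' using V' W' t' o by (intro rst_rst) auto
  finally have "rst P V (W \<inter> W') t = rst P V' (W \<inter> W') t'" .
  moreover have "x \<in> W \<inter> W'" "W \<inter> W' \<subseteq> V \<inter> V'" using assms W' by auto
  ultimately show "p \<in> germ X P x V t"
    unfolding germ_def p using V' t' o by blast
qed

lemma germ_eq_iff:
  assumes "openin X U" "x \<in> U" "openin X V" "x \<in> V"
    and s: "s \<in> carrier (sec P U)" and t: "t \<in> carrier (sec P V)"
  shows "germ X P x U s = germ X P x V t \<longleftrightarrow>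
    (\<exists>W. openin X W \<and> x \<in> W \<and> W \<subseteq> U \<inter> V \<and> rst P U W s = rst P V W t)" (is "?L \<longleftrightarrow> ?R")
proof
  assume ?L
  then have "(V, t) \<in> germ X P x U s" using germ_self[of V x t] assms by simp
  then show ?R unfolding germ_def by auto
next
  assume ?R
  then obtain W where "openin X W" "x \<in> W" "W \<subseteq> U \<inter> V" "rst P U W s = rst P V W t" by blast
  then show ?L
    using germ_eq_of_local[of U V W x s t] germ_eq_of_local[of V U W x t s] assms by auto
qed

lemma germ_rst:
  assumes "openin X U" "openin X V" "x \<in> V" "V \<subseteq> U" "s \<in> carrier (sec P U)"
  shows "germ X P x V (rst P U V s) = germ X P x U s"
proof (rule germ_eq_iff[THEN iffD2])
  show "\<exists>W. openin X W \<and> x \<in> W \<and> W \<subseteq> V \<inter> U \<and> rst P V W (rst P U V s) = rst P U W s"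
    using assms rst_self[of V "rst P U V s"] rst_closed by (intro exI[of _ V]) auto
qed (use assms rst_closed in auto)

lemma mem_germ:
  assumes "(V, t) \<in> germ X P x U s" and "openin X U" "x \<in> U" "s \<in> carrier (sec P U)"
  shows "openin X V" "x \<in> V" "t \<in> carrier (sec P V)" "germ X P x V t = germ X P x U s"
proof -
  show 1: "openin X V" "x \<in> V" "t \<in> carrier (sec P V)" using assms by (auto simp: germ_def)
  have "germ X P x U s = germ X P x V t"
    using assms 1 by (subst germ_eq_iff) (auto simp: germ_def)
  then show "germ X P x V t = germ X P x U s" by simp
qed

lemma germ_common:
  assumes "(W, s') \<in> germ X P x U s" and "(W, t') \<in> germ X P x V t"
    and U: "openin X U" "x \<in> U" "s \<in> carrier (sec P U)" and V: "openin X V" "x \<in> V" "t \<in> carrier (sec P V)"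
  shows "\<exists>N. openin X N \<and> x \<in> N \<and> N \<subseteq> W \<inter> U \<inter> V \<and> rst P W N s' = rst P U N s \<and> rst P W N t' = rst P V N t"
proof -
  obtain A where A: "openin X A" "x \<in> A" "A \<subseteq> U \<inter> W" "rst P U A s = rst P W A s'"
    and W: "openin X W" and s': "s' \<in> carrier (sec P W)"
    using assms(1) unfolding germ_def by auto
  obtain B where B: "openin X B" "x \<in> B" "B \<subseteq> V \<inter> W" "rst P V B t = rst P W B t'"
    and t': "t' \<in> carrier (sec P W)"
    using assms(2) unfolding germ_def by auto
  have o: "openin X (A \<inter> B)" using A B by blast
  have "rst P W (A \<inter> B) s' = rst P A (A \<inter> B) (rst P W A s')"
    using A B W s' o by (intro rst_rst[symmetric]) auto
  also have "\<dots> = rst P U (A \<inter> B) s"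
    unfolding A(4)[symmetric] using A B U o by (intro rst_rst) auto
  finally have 1: "rst P W (A \<inter> B) s' = rst P U (A \<inter> B) s" .
  have "rst P W (A \<inter> B) t' = rst P B (A \<inter> B) (rst P W B t')"
    using A B W t' o by (intro rst_rst[symmetric]) auto
  also have "\<dots> = rst P V (A \<inter> B) t"
    unfolding B(4)[symmetric] using A B V o by (intro rst_rst) auto
  finally have 2: "rst P W (A \<inter> B) t' = rst P V (A \<inter> B) t" .
  show ?thesis using 1 2 o A(2,3) B(2,3) by (intro exI[of _ "A \<inter> B"]) auto
qed

lemma stalk_add_germ:
  assumes U: "openin X U" "x \<in> U" and s: "s \<in> carrier (sec P U)" and t: "t \<in> carrier (sec P U)"
  shows "germ X P x U s \<oplus>\<^bsub>stalk X P x\<^esub> germ X P x U t = germ X P x U (s \<oplus>\<^bsub>sec P U\<^esub> t)"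
proof -
  have eq: "germ X P x W (s' \<oplus>\<^bsub>sec P W\<^esub> t') = germ X P x U (s \<oplus>\<^bsub>sec P U\<^esub> t)"
    if m: "(W, s') \<in> germ X P x U s" "(W, t') \<in> germ X P x U t" for W s' t'
  proof -
    obtain N where N: "openin X N" "x \<in> N" "N \<subseteq> W \<inter> U \<inter> U"
      and e: "rst P W N s' = rst P U N s" "rst P W N t' = rst P U N t"
      using germ_common[OF m U s U t] by blast
    note W = mem_germ[OF m(1) U s] mem_germ[OF m(2) U t]
    have "rst P W N (s' \<oplus>\<^bsub>sec P W\<^esub> t') = rst P U N (s \<oplus>\<^bsub>sec P U\<^esub> t)"
      using N W U s t e by (simp add: rst_add)
    then show ?thesis using N W U s t add_closed by (subst germ_eq_iff) auto
  qed
  have m: "(U, s) \<in> germ X P x U s" "(U, t) \<in> germ X P x U t" using germ_self U s t by auto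
  have "\<Union>{germ X P x V (s' \<oplus>\<^bsub>sec P V\<^esub> t') | V s' t'.
      (V, s') \<in> germ X P x U s \<and> (V, t') \<in> germ X P x U t} = germ X P x U (s \<oplus>\<^bsub>sec P U\<^esub> t)"
    (is "\<Union>?A = ?g")
  proof
    show "\<Union>?A \<subseteq> ?g" using eq by (intro Union_least) auto
    show "?g \<subseteq> \<Union>?A" using m by (intro Union_upper) blast
  qed
  then show ?thesis by (simp add: stalk_def)
qed

lemma stalk_smult_germ:
  assumes U: "openin X U" "x \<in> U" and s: "s \<in> carrier (sec P U)" and k: "k \<in> carrier R"
  shows "k \<odot>\<^bsub>stalk X P x\<^esub> germ X P x U s = germ X P x U (k \<odot>\<^bsub>sec P U\<^esub> s)"
proof -
  have eq: "germ X P x W (k \<odot>\<^bsub>sec P W\<^esub> s') = germ X P x U (k \<odot>\<^bsub>sec P U\<^esub> s)"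
    if m: "(W, s') \<in> germ X P x U s" for W s'
  proof -
    obtain N where N: "openin X N" "x \<in> N" "N \<subseteq> W \<inter> U \<inter> U"
      and e: "rst P W N s' = rst P U N s"
      using germ_common[OF m m U s U s] by blast
    note W = mem_germ[OF m U s]
    have "rst P W N (k \<odot>\<^bsub>sec P W\<^esub> s') = rst P U N (k \<odot>\<^bsub>sec P U\<^esub> s)"
      using N W U s e k by (simp add: rst_smult)
    then show ?thesis using N W U s k smult_closed by (subst germ_eq_iff) auto
  qed
  have m: "(U, s) \<in> germ X P x U s" using germ_self U s by auto
  have "\<Union>{germ X P x V (k \<odot>\<^bsub>sec P V\<^esub> s') | V s'. (V, s') \<in> germ X P x U s} =
      germ X P x U (k \<odot>\<^bsub>sec P U\<^esub> s)" (is "\<Union>?A = ?g")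
  proof
    show "\<Union>?A \<subseteq> ?g" using eq by (intro Union_least) auto
    show "?g \<subseteq> \<Union>?A" using m by (intro Union_upper) blast
  qed
  then show ?thesis by (simp add: stalk_def)
qed

lemma sheafify_local:
  assumes "\<sigma> \<in> carrier (sec (sheafify X P) U)" "x \<in> U"
  shows "\<exists>V t. openin X V \<and> x \<in> V \<and> V \<subseteq> U \<and> t \<in> carrier (sec P V) \<and> (\<forall>y\<in>V. \<sigma> y = germ X P y V t)"
  using assms by (simp add: sheafify_def)

lemma sheafify_local2:
  assumes "\<sigma> \<in> carrier (sec (sheafify X P) U)" "\<tau> \<in> carrier (sec (sheafify X P) U)" "x \<in> U"
  shows "\<exists>V s t. openin X V \<and> x \<in> V \<and> V \<subseteq> U \<and> s \<in> carrier (sec P V) \<and> t \<in> carrier (sec P V) \<and>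
    (\<forall>y\<in>V. \<sigma> y = germ X P y V s) \<and> (\<forall>y\<in>V. \<tau> y = germ X P y V t)"
proof -
  obtain A s where A: "openin X A" "x \<in> A" "A \<subseteq> U" "s \<in> carrier (sec P A)"
    "\<forall>y\<in>A. \<sigma> y = germ X P y A s" using sheafify_local[OF assms(1,3)] by blast
  obtain B t where B: "openin X B" "x \<in> B" "B \<subseteq> U" "t \<in> carrier (sec P B)"
    "\<forall>y\<in>B. \<tau> y = germ X P y B t" using sheafify_local[OF assms(2,3)] by blast
  have o: "openin X (A \<inter> B)" using A B by blast
  have "\<forall>y\<in>A \<inter> B. \<sigma> y = germ X P y (A \<inter> B) (rst P A (A \<inter> B) s)"
    "\<forall>y\<in>A \<inter> B. \<tau> y = germ X P y (A \<inter> B) (rst P B (A \<inter> B) t)"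
    using A B o by (auto simp: germ_rst)
  then show ?thesis
    using A B o rst_closed[of A "A \<inter> B" s] rst_closed[of B "A \<inter> B" t]
    by (intro exI[of _ "A \<inter> B"] exI[of _ "rst P A (A \<inter> B) s"] exI[of _ "rst P B (A \<inter> B) t"]) auto
qed

lemma sheafify_carrierI:
  assumes "\<And>x. x \<notin> U \<Longrightarrow> \<sigma> x = {}"
    and "\<And>x. x \<in> U \<Longrightarrow> \<exists>V t. openin X V \<and> x \<in> V \<and> V \<subseteq> U \<and> t \<in> carrier (sec P V) \<and>
      (\<forall>y \<in> V. \<sigma> y = germ X P y V t)"
  shows "\<sigma> \<in> carrier (sec (sheafify X P) U)"
  using assms by (simp add: sheafify_def)

lemma sheafify_add_apply:
  "x \<in> U \<Longrightarrow> (\<sigma> \<oplus>\<^bsub>sec (sheafify X P) U\<^esub> \<tau>) x = \<sigma> x \<oplus>\<^bsub>stalk X P x\<^esub> \<tau> x"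
  by (simp add: sheafify_def)

lemma sheafify_smult_apply:
  "x \<in> U \<Longrightarrow> (k \<odot>\<^bsub>sec (sheafify X P) U\<^esub> \<sigma>) x = k \<odot>\<^bsub>stalk X P x\<^esub> \<sigma> x"
  by (simp add: sheafify_def)

lemma sheafify_rst_apply: "x \<in> V \<Longrightarrow> rst (sheafify X P) U V \<sigma> x = \<sigma> x"
  by (simp add: sheafify_def)

lemma sheafify_add_closed:
  assumes "\<sigma> \<in> carrier (sec (sheafify X P) U)" "\<tau> \<in> carrier (sec (sheafify X P) U)"
  shows "\<sigma> \<oplus>\<^bsub>sec (sheafify X P) U\<^esub> \<tau> \<in> carrier (sec (sheafify X P) U)"
proof (rule sheafify_carrierI)
  fix x assume x: "x \<in> U"
  obtain V s t where V: "openin X V" "x \<in> V" "V \<subseteq> U" "s \<in> carrier (sec P V)"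
    "t \<in> carrier (sec P V)" "\<forall>y\<in>V. \<sigma> y = germ X P y V s" "\<forall>y\<in>V. \<tau> y = germ X P y V t"
    using sheafify_local2[OF assms x] by blast
  have "\<forall>y \<in> V. (\<sigma> \<oplus>\<^bsub>sec (sheafify X P) U\<^esub> \<tau>) y = germ X P y V (s \<oplus>\<^bsub>sec P V\<^esub> t)"
  proof
    fix y assume y: "y \<in> V"
    then have "y \<in> U" using V(3) by blast
    then show "(\<sigma> \<oplus>\<^bsub>sec (sheafify X P) U\<^esub> \<tau>) y = germ X P y V (s \<oplus>\<^bsub>sec P V\<^esub> t)"
      by (simp add: sheafify_add_apply V(6,7)[rule_format, OF y] stalk_add_germ[OF V(1) y V(4,5)])
  qed
  then show "\<exists>V t. openin X V \<and> x \<in> V \<and> V \<subseteq> U \<and> t \<in> carrier (sec P V) \<and>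
      (\<forall>y \<in> V. (\<sigma> \<oplus>\<^bsub>sec (sheafify X P) U\<^esub> \<tau>) y = germ X P y V t)"
    using V(1-3) add_closed[OF V(1,4,5)] by blast
qed (simp add: sheafify_def)

lemma sheafify_smult_closed:
  assumes "\<sigma> \<in> carrier (sec (sheafify X P) U)" and k: "k \<in> carrier R"
  shows "k \<odot>\<^bsub>sec (sheafify X P) U\<^esub> \<sigma> \<in> carrier (sec (sheafify X P) U)"
proof (rule sheafify_carrierI)
  fix x assume x: "x \<in> U"
  obtain V s where V: "openin X V" "x \<in> V" "V \<subseteq> U" "s \<in> carrier (sec P V)"
    "\<forall>y\<in>V. \<sigma> y = germ X P y V s"
    using sheafify_local[OF assms(1) x] by blast
  have "\<forall>y \<in> V. (k \<odot>\<^bsub>sec (sheafify X P) U\<^esub> \<sigma>) y = germ X P y V (k \<odot>\<^bsub>sec P V\<^esub> s)"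
  proof
    fix y assume y: "y \<in> V"
    then have "y \<in> U" using V(3) by blast
    then show "(k \<odot>\<^bsub>sec (sheafify X P) U\<^esub> \<sigma>) y = germ X P y V (k \<odot>\<^bsub>sec P V\<^esub> s)"
      by (simp add: sheafify_smult_apply V(5)[rule_format, OF y] stalk_smult_germ[OF V(1) y V(4) k])
  qed
  then show "\<exists>V t. openin X V \<and> x \<in> V \<and> V \<subseteq> U \<and> t \<in> carrier (sec P V) \<and>
      (\<forall>y \<in> V. (k \<odot>\<^bsub>sec (sheafify X P) U\<^esub> \<sigma>) y = germ X P y V t)"
    using V(1-3) smult_closed[OF V(1) k V(4)] by blast
qed (simp add: sheafify_def)

lemma sheafify_rst_closed:
  assumes "\<sigma> \<in> carrier (sec (sheafify X P) U)" and "openin X V" "V \<subseteq> U"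
  shows "rst (sheafify X P) U V \<sigma> \<in> carrier (sec (sheafify X P) V)"
proof (rule sheafify_carrierI)
  fix x assume x: "x \<in> V"
  then have x': "x \<in> U" using assms by blast
  obtain N s where N: "openin X N" "x \<in> N" "N \<subseteq> U" "s \<in> carrier (sec P N)"
    "\<forall>y\<in>N. \<sigma> y = germ X P y N s"
    using sheafify_local[OF assms(1) x'] by blast
  have o: "openin X (N \<inter> V)" using N assms by blast
  have "\<forall>y \<in> N \<inter> V. rst (sheafify X P) U V \<sigma> y = germ X P y (N \<inter> V) (rst P N (N \<inter> V) s)"
    using N(1,4,5) o by (simp add: sheafify_rst_apply germ_rst)
  then show "\<exists>V' t. openin X V' \<and> x \<in> V' \<and> V' \<subseteq> V \<and> t \<in> carrier (sec P V') \<and>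
      (\<forall>y \<in> V'. rst (sheafify X P) U V \<sigma> y = germ X P y V' t)"
    using N(1,2,4) o x rst_closed[of N "N \<inter> V" s]
    by (intro exI[of _ "N \<inter> V"] exI[of _ "rst P N (N \<inter> V) s"]) simp
qed (simp add: sheafify_def)

end

lemma presheaf_module: "presheaf R X P \<Longrightarrow> openin X U \<Longrightarrow> module R (sec P U)"
  unfolding presheaf_def by (drule conjunct1) simp

lemma presheaf_operations:
  assumes P: "presheaf R X P"
  shows "operations_presheaf R X P"
proof
  fix U s t assume U: "openin X U" and st: "s \<in> carrier (sec P U)" "t \<in> carrier (sec P U)"
  then show "s \<oplus>\<^bsub>sec P U\<^esub> t \<in> carrier (sec P U)"
    using abelian_monoid.a_closed[OF abelian_group.axioms(1)[OF module.axioms(2)[OF presheaf_module[OF P U]]]]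
    by simp
next
  fix U k s assume U: "openin X U" and "k \<in> carrier R" "s \<in> carrier (sec P U)"
  then show "k \<odot>\<^bsub>sec P U\<^esub> s \<in> carrier (sec P U)" using module.smult_closed[OF presheaf_module[OF P U]] by simp
next
  fix U V assume "openin X U" "openin X V" "V \<subseteq> U"
  then show "rst P U V \<in> mod_hom R (sec P U) (sec P V)"
    using P[unfolded presheaf_def, THEN conjunct2, THEN conjunct1] by blast
next
  fix U s assume "openin X U" "s \<in> carrier (sec P U)"
  then show "rst P U U s = s"
    using P[unfolded presheaf_def, THEN conjunct2, THEN conjunct2, THEN conjunct1] by blast
next
  fix U V W s
  assume "openin X U" "openin X V" "openin X W" "W \<subseteq> V" "V \<subseteq> U" "s \<in> carrier (sec P U)"
  then show "rst P V W (rst P U V s) = rst P U W s"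
    using P[unfolded presheaf_def, THEN conjunct2, THEN conjunct2, THEN conjunct2] by blast
qed

locale operations_presheaf_map = P: operations_presheaf R X P + Q: operations_presheaf R X Q
  for R :: "'k ring" and X :: "'x topology" and P :: "('x, 'k, 'u) psheaf" and Q :: "('x, 'k, 'v) psheaf" +
  fixes f :: "'x set \<Rightarrow> 'u \<Rightarrow> 'v"
  assumes map_hom: "openin X U \<Longrightarrow> f U \<in> mod_hom R (sec P U) (sec Q U)"
    and map_rst: "\<lbrakk>openin X U; openin X V; V \<subseteq> U; s \<in> carrier (sec P U)\<rbrakk>
      \<Longrightarrow> rst Q U V (f U s) = f V (rst P U V s)"
begin

lemma map_closed: "\<lbrakk>openin X U; s \<in> carrier (sec P U)\<rbrakk> \<Longrightarrow> f U s \<in> carrier (sec Q U)"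
  using map_hom[of U] by (auto simp: mod_hom_def)

lemma map_add: "\<lbrakk>openin X U; s \<in> carrier (sec P U); t \<in> carrier (sec P U)\<rbrakk>
    \<Longrightarrow> f U (s \<oplus>\<^bsub>sec P U\<^esub> t) = f U s \<oplus>\<^bsub>sec Q U\<^esub> f U t"
  using map_hom[of U] by (auto simp: mod_hom_def)

lemma map_smult: "\<lbrakk>openin X U; k \<in> carrier R; s \<in> carrier (sec P U)\<rbrakk>
    \<Longrightarrow> f U (k \<odot>\<^bsub>sec P U\<^esub> s) = k \<odot>\<^bsub>sec Q U\<^esub> f U s"
  using map_hom[of U] by (auto simp: mod_hom_def)

lemma germ_map_cong:
  assumes U: "openin X U" "x \<in> U" "s \<in> carrier (sec P U)" and V: "openin X V" "x \<in> V" "t \<in> carrier (sec P V)"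
    and eq: "germ X P x U s = germ X P x V t"
  shows "germ X Q x U (f U s) = germ X Q x V (f V t)"
proof -
  obtain W where W: "openin X W" "x \<in> W" "W \<subseteq> U \<inter> V" and eq': "rst P U W s = rst P V W t"
    using P.germ_eq_iff[OF U(1,2) V(1,2) U(3) V(3)] eq by blast
  have "rst Q U W (f U s) = rst Q V W (f V t)"
    using U V W eq' by (simp add: map_rst)
  with W show ?thesis
    using Q.germ_eq_iff[OF U(1,2) V(1,2) map_closed[OF U(1,3)] map_closed[OF V(1,3)]] by blast
qed

lemma germ_map:
  assumes U: "openin X U" "x \<in> U" "s \<in> carrier (sec P U)"
  shows "(\<Union>(V, t) \<in> germ X P x U s. germ X Q x V (f V t)) = germ X Q x U (f U s)"
proof -
  have "germ X Q x V (f V t) = germ X Q x U (f U s)" if "(V, t) \<in> germ X P x U s" for V t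
    by (rule germ_map_cong[OF P.mem_germ(1-3)[OF that U] U P.mem_germ(4)[OF that U]])
  then show ?thesis using P.germ_self[OF U] by blast
qed

lemma sheafify_map_local:
  assumes "V \<subseteq> U" "openin X V" "s \<in> carrier (sec P V)" "\<forall>y\<in>V. \<sigma> y = germ X P y V s" "y \<in> V"
  shows "sheafify_map X Q f U \<sigma> y = germ X Q y V (f V s)"
proof -
  have "y \<in> U" "\<sigma> y = germ X P y V s" using assms by auto
  then show ?thesis using germ_map[OF assms(2,5,3)] by (simp add: sheafify_map_def)
qed

lemma sheafify_map_closed:
  assumes "\<sigma> \<in> carrier (sec (sheafify X P) U)"
  shows "sheafify_map X Q f U \<sigma> \<in> carrier (sec (sheafify X Q) U)"
proof (rule Q.sheafify_carrierI)
  fix x assume x: "x \<in> U"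
  obtain V s where V: "openin X V" "x \<in> V" "V \<subseteq> U" "s \<in> carrier (sec P V)"
    "\<forall>y\<in>V. \<sigma> y = germ X P y V s"
    using P.sheafify_local[OF assms x] by blast
  have "\<forall>y \<in> V. sheafify_map X Q f U \<sigma> y = germ X Q y V (f V s)"
    using sheafify_map_local[OF V(3,1,4,5)] by simp
  with V(1-3) map_closed[OF V(1,4)]
  show "\<exists>V t. openin X V \<and> x \<in> V \<and> V \<subseteq> U \<and> t \<in> carrier (sec Q V) \<and>
      (\<forall>y \<in> V. sheafify_map X Q f U \<sigma> y = germ X Q y V t)"
    by (intro exI[of _ V] exI[of _ "f V s"] conjI)
qed (simp add: sheafify_map_def)

lemma sheafify_map_hom:
  "ext_mor X (sheafify X P) (sheafify_map X Q f) \<in> psheaf_hom R X (sheafify X P) (sheafify X Q)"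
proof -
  have add: "sheafify_map X Q f U (\<sigma> \<oplus>\<^bsub>sec (sheafify X P) U\<^esub> \<tau>) =
      sheafify_map X Q f U \<sigma> \<oplus>\<^bsub>sec (sheafify X Q) U\<^esub> sheafify_map X Q f U \<tau>" (is "?l = ?r")
    if \<sigma>: "\<sigma> \<in> carrier (sec (sheafify X P) U)" and \<tau>: "\<tau> \<in> carrier (sec (sheafify X P) U)" for U \<sigma> \<tau>
  proof
    fix x
    show "?l x = ?r x"
    proof (cases "x \<in> U")
      case True
      obtain V s t where V: "openin X V" "x \<in> V" "V \<subseteq> U" "s \<in> carrier (sec P V)"
        "t \<in> carrier (sec P V)" "\<forall>y\<in>V. \<sigma> y = germ X P y V s" "\<forall>y\<in>V. \<tau> y = germ X P y V t"
        using P.sheafify_local2[OF \<sigma> \<tau> True] by blast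
      have "(\<sigma> \<oplus>\<^bsub>sec (sheafify X P) U\<^esub> \<tau>) y = germ X P y V (s \<oplus>\<^bsub>sec P V\<^esub> t)" if "y \<in> V" for y
        using V(6,7) that P.sheafify_add_apply[of y U \<sigma> \<tau>] P.stalk_add_germ[OF V(1) that V(4,5)] V(3)
        by auto
      then have "?l x = germ X Q x V (f V (s \<oplus>\<^bsub>sec P V\<^esub> t))"
        using V P.add_closed by (intro sheafify_map_local) auto
      also have "\<dots> = germ X Q x V (f V s) \<oplus>\<^bsub>stalk X Q x\<^esub> germ X Q x V (f V t)"
        using V map_closed by (simp add: map_add Q.stalk_add_germ)
      also have "\<dots> = ?r x"
        using V True sheafify_map_local[OF V(3,1,4,6,2)] sheafify_map_local[OF V(3,1,5,7,2)]
        by (simp add: Q.sheafify_add_apply Q.sheafify_smult_apply)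
      finally show ?thesis .
    qed (simp add: sheafify_map_def sheafify_def)
  qed
  have smult: "sheafify_map X Q f U (k \<odot>\<^bsub>sec (sheafify X P) U\<^esub> \<sigma>) =
      k \<odot>\<^bsub>sec (sheafify X Q) U\<^esub> sheafify_map X Q f U \<sigma>" (is "?l = ?r")
    if \<sigma>: "\<sigma> \<in> carrier (sec (sheafify X P) U)" and k: "k \<in> carrier R" for U k \<sigma>
  proof
    fix x
    show "?l x = ?r x"
    proof (cases "x \<in> U")
      case True
      obtain V s where V: "openin X V" "x \<in> V" "V \<subseteq> U" "s \<in> carrier (sec P V)"
        "\<forall>y\<in>V. \<sigma> y = germ X P y V s"
        using P.sheafify_local[OF \<sigma> True] by blast
      have "(k \<odot>\<^bsub>sec (sheafify X P) U\<^esub> \<sigma>) y = germ X P y V (k \<odot>\<^bsub>sec P V\<^esub> s)" if "y \<in> V" for y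
        using V(5) that P.sheafify_smult_apply[of y U k \<sigma>] P.stalk_smult_germ[OF V(1) that V(4) k] V(3)
        by auto
      then have "?l x = germ X Q x V (f V (k \<odot>\<^bsub>sec P V\<^esub> s))"
        using V k P.smult_closed by (intro sheafify_map_local) auto
      also have "\<dots> = k \<odot>\<^bsub>stalk X Q x\<^esub> germ X Q x V (f V s)"
        using V k map_closed by (simp add: map_smult Q.stalk_smult_germ)
      also have "\<dots> = ?r x"
        using V True sheafify_map_local[OF V(3,1,4,5,2)] by (simp add: Q.sheafify_smult_apply)
      finally show ?thesis .
    qed (simp add: sheafify_map_def sheafify_def)
  qed
  have rst: "rst (sheafify X Q) U V (sheafify_map X Q f U \<sigma>) =
      sheafify_map X Q f V (rst (sheafify X P) U V \<sigma>)" if "V \<subseteq> U" for U V \<sigma>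
    using that by (auto simp: sheafify_def sheafify_map_def fun_eq_iff)
  show ?thesis
    unfolding psheaf_hom_def mod_hom_def ext_mor_def
    using P.sheafify_add_closed P.sheafify_smult_closed P.sheafify_rst_closed
    by (auto simp: sheafify_map_closed add smult rst)
qed

end

text \<open>The inverse of a family of bijections that commutes with the operations does so as well.\<close>

lemma is_iso_Shv_iff:
  assumes f: "f \<in> psheaf_hom R X F G"
    and add_closed: "\<And>U s t. \<lbrakk>openin X U; s \<in> carrier (sec F U); t \<in> carrier (sec F U)\<rbrakk>
      \<Longrightarrow> s \<oplus>\<^bsub>sec F U\<^esub> t \<in> carrier (sec F U)"
    and smult_closed: "\<And>U k s. \<lbrakk>openin X U; k \<in> carrier R; s \<in> carrier (sec F U)\<rbrakk>
      \<Longrightarrow> k \<odot>\<^bsub>sec F U\<^esub> s \<in> carrier (sec F U)"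
    and rst_closed: "\<And>U V s. \<lbrakk>openin X U; openin X V; V \<subseteq> U; s \<in> carrier (sec F U)\<rbrakk>
      \<Longrightarrow> rst F U V s \<in> carrier (sec F V)"
  shows "is_iso (Shv R X) F G f \<longleftrightarrow>
    (\<forall>U. openin X U \<longrightarrow> bij_betw (f U) (carrier (sec F U)) (carrier (sec G U)))"
proof
  assume "is_iso (Shv R X) F G f"
  then obtain g where g: "g \<in> psheaf_hom R X G F"
    and gf: "ext_mor X F (\<lambda>U s. g U (f U s)) = ext_mor X F (\<lambda>U s. s)"
    and fg: "ext_mor X G (\<lambda>U s. f U (g U s)) = ext_mor X G (\<lambda>U s. s)"
    unfolding is_iso_def Shv_def by auto
  have gf': "g U (f U s) = s" if "openin X U" "s \<in> carrier (sec F U)" for U s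
    using fun_cong[OF fun_cong[OF gf, of U], of s] that by (simp add: ext_mor_def)
  have fg': "f U (g U s) = s" if "openin X U" "s \<in> carrier (sec G U)" for U s
    using fun_cong[OF fun_cong[OF fg, of U], of s] that by (simp add: ext_mor_def)
  have c: "f U \<in> carrier (sec F U) \<rightarrow> carrier (sec G U)" "g U \<in> carrier (sec G U) \<rightarrow> carrier (sec F U)"
    if "openin X U" for U
    using f g that by (auto simp: psheaf_hom_def mod_hom_def)
  show "\<forall>U. openin X U \<longrightarrow> bij_betw (f U) (carrier (sec F U)) (carrier (sec G U))"
  proof (intro allI impI)
    fix U assume U: "openin X U"
    show "bij_betw (f U) (carrier (sec F U)) (carrier (sec G U))"
      using gf'[OF U] fg'[OF U] c[OF U] by (intro bij_betw_byWitness[where f' = "g U"]) auto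
  qed
next
  assume bij: "\<forall>U. openin X U \<longrightarrow> bij_betw (f U) (carrier (sec F U)) (carrier (sec G U))"
  define h where "h U = inv_into (carrier (sec F U)) (f U)" for U
  have fh: "f U (h U s) = s" and h: "h U s \<in> carrier (sec F U)"
    if "openin X U" "s \<in> carrier (sec G U)" for U s
    using bij that by (auto simp: h_def bij_betw_def f_inv_into_f inv_into_into)
  have hf: "h U (f U s) = s" if "openin X U" "s \<in> carrier (sec F U)" for U s
    using bij that by (auto simp: h_def bij_betw_def)
  have f_closed: "f U s \<in> carrier (sec G U)" if "openin X U" "s \<in> carrier (sec F U)" for U s
    using f that by (auto simp: psheaf_hom_def mod_hom_def)
  have add: "h U (s \<oplus>\<^bsub>sec G U\<^esub> t) = h U s \<oplus>\<^bsub>sec F U\<^esub> h U t"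
    "s \<oplus>\<^bsub>sec G U\<^esub> t \<in> carrier (sec G U)"
    if U: "openin X U" and s: "s \<in> carrier (sec G U)" and t: "t \<in> carrier (sec G U)" for U s t
  proof -
    have "f U (h U s \<oplus>\<^bsub>sec F U\<^esub> h U t) = s \<oplus>\<^bsub>sec G U\<^esub> t"
      using f U h[OF U s] h[OF U t] fh[OF U s] fh[OF U t] by (auto simp: psheaf_hom_def mod_hom_def)
    then show "h U (s \<oplus>\<^bsub>sec G U\<^esub> t) = h U s \<oplus>\<^bsub>sec F U\<^esub> h U t"
      "s \<oplus>\<^bsub>sec G U\<^esub> t \<in> carrier (sec G U)"
      using hf[OF U add_closed[OF U h[OF U s] h[OF U t]]] f_closed[OF U add_closed[OF U h[OF U s] h[OF U t]]]
      by auto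
  qed
  have smult: "h U (k \<odot>\<^bsub>sec G U\<^esub> s) = k \<odot>\<^bsub>sec F U\<^esub> h U s"
    "k \<odot>\<^bsub>sec G U\<^esub> s \<in> carrier (sec G U)"
    if U: "openin X U" and k: "k \<in> carrier R" and s: "s \<in> carrier (sec G U)" for U k s
  proof -
    have "f U (k \<odot>\<^bsub>sec F U\<^esub> h U s) = k \<odot>\<^bsub>sec G U\<^esub> s"
      using f U h[OF U s] fh[OF U s] k by (auto simp: psheaf_hom_def mod_hom_def)
    then show "h U (k \<odot>\<^bsub>sec G U\<^esub> s) = k \<odot>\<^bsub>sec F U\<^esub> h U s"
      "k \<odot>\<^bsub>sec G U\<^esub> s \<in> carrier (sec G U)"
      using hf[OF U smult_closed[OF U k h[OF U s]]] f_closed[OF U smult_closed[OF U k h[OF U s]]] by auto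
  qed
  have rst: "rst F U V (h U s) = h V (rst G U V s)" "rst G U V s \<in> carrier (sec G V)"
    if U: "openin X U" and V: "openin X V" "V \<subseteq> U" and s: "s \<in> carrier (sec G U)" for U V s
  proof -
    have "f V (rst F U V (h U s)) = rst G U V s"
      using psheaf_homD(2)[OF f U V h[OF U s]] fh[OF U s] by simp
    then show "rst F U V (h U s) = h V (rst G U V s)" "rst G U V s \<in> carrier (sec G V)"
      using hf[OF V(1) rst_closed[OF U V h[OF U s]]] f_closed[OF V(1) rst_closed[OF U V h[OF U s]]] by auto
  qed
  let ?g = "ext_mor X G h"
  have "?g \<in> psheaf_hom R X G F"
    unfolding psheaf_hom_def mod_hom_def
    using h by (auto simp: ext_mor_def add smult rst)
  moreover have "ext_mor X F (\<lambda>U s. ?g U (f U s)) = ext_mor X F (\<lambda>U s. s)"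
    using hf f_closed by (auto simp: ext_mor_def fun_eq_iff)
  moreover have "ext_mor X G (\<lambda>U s. f U (?g U s)) = ext_mor X G (\<lambda>U s. s)"
    using fh by (auto simp: ext_mor_def fun_eq_iff)
  ultimately show "is_iso (Shv R X) F G f"
    using f unfolding is_iso_def Shv_def by auto
qed

text \<open>A map of sheafifications is bijective on sections iff it is bijective on germs. Preimages of germs are
  only locally given by sections; injectivity makes the local choices agree, hence glue.\<close>

lemma is_iso_sheafify_map_iff:
  fixes P Q :: "('x, 'k, 'u) psheaf"
  assumes "operations_presheaf_map R X P Q f"
  shows "is_iso (Shv R X) (sheafify X P) (sheafify X Q) (ext_mor X (sheafify X P) (sheafify_map X Q f)) \<longleftrightarrow>
    (\<forall>U x s t. openin X U \<and> x \<in> U \<and> s \<in> carrier (sec P U) \<and> t \<in> carrier (sec P U) \<and>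
      germ X Q x U (f U s) = germ X Q x U (f U t) \<longrightarrow> germ X P x U s = germ X P x U t) \<and>
    (\<forall>U x t. openin X U \<and> x \<in> U \<and> t \<in> carrier (sec Q U) \<longrightarrow>
      (\<exists>V s. openin X V \<and> x \<in> V \<and> V \<subseteq> U \<and> s \<in> carrier (sec P V) \<and>
        germ X Q x V (f V s) = germ X Q x U t))" (is "?iso \<longleftrightarrow> ?inj \<and> ?surj")
proof -
  interpret operations_presheaf_map R X P Q f by fact
  let ?S = "\<lambda>U. carrier (sec (sheafify X P) U)" and ?T = "\<lambda>U. carrier (sec (sheafify X Q) U)"
  let ?f = "sheafify_map X Q f"
  have iso: "?iso \<longleftrightarrow> (\<forall>U. openin X U \<longrightarrow> bij_betw (?f U) (?S U) (?T U))"
    using is_iso_Shv_iff[OF sheafify_map_hom] P.sheafify_add_closed P.sheafify_smult_closed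
      P.sheafify_rst_closed by (simp add: ext_mor_def cong: bij_betw_cong)
  have const: "(\<lambda>x. if x \<in> U then germ X P x U s else {}) \<in> ?S U"
    if "openin X U" "s \<in> carrier (sec P U)" for U s
    using that by (intro P.sheafify_carrierI) auto
  have constQ: "(\<lambda>x. if x \<in> U then germ X Q x U s else {}) \<in> ?T U"
    if "openin X U" "s \<in> carrier (sec Q U)" for U s
    using that by (intro Q.sheafify_carrierI) auto
  have map_const: "?f U (\<lambda>x. if x \<in> U then germ X P x U s else {}) =
      (\<lambda>x. if x \<in> U then germ X Q x U (f U s) else {})"
    if "openin X U" "s \<in> carrier (sec P U)" for U s
    using that sheafify_map_local[of U U s "\<lambda>x. if x \<in> U then germ X P x U s else {}"]
    by (auto simp: fun_eq_iff) (simp add: sheafify_map_def)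
  show ?thesis
    unfolding iso
  proof (intro iffI conjI allI impI)
    assume bij: "\<forall>U. openin X U \<longrightarrow> bij_betw (?f U) (?S U) (?T U)"
    {
      fix U x s t
      assume *: "openin X U \<and> x \<in> U \<and> s \<in> carrier (sec P U) \<and> t \<in> carrier (sec P U) \<and>
        germ X Q x U (f U s) = germ X Q x U (f U t)"
      then obtain W where W: "openin X W" "x \<in> W" "W \<subseteq> U"
        and eq: "rst Q U W (f U s) = rst Q U W (f U t)"
        using Q.germ_eq_iff[of U x U "f U s" "f U t"] map_closed by auto
      let ?s = "rst P U W s" and ?t = "rst P U W t"
      have st: "?s \<in> carrier (sec P W)" "?t \<in> carrier (sec P W)" using * W P.rst_closed by auto
      have e2: "f W ?s = f W ?t" using eq * W by (simp add: map_rst)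
      have "?f W (\<lambda>x. if x \<in> W then germ X P x W ?s else {}) = ?f W (\<lambda>x. if x \<in> W then germ X P x W ?t else {})"
        unfolding map_const[OF W(1) st(1)] map_const[OF W(1) st(2)] e2 ..
      then have "(\<lambda>x. if x \<in> W then germ X P x W ?s else {}) = (\<lambda>x. if x \<in> W then germ X P x W ?t else {})"
        using inj_onD[OF bij_betw_imp_inj_on[OF bij[rule_format, OF W(1)]] _ const[OF W(1) st(1)]
            const[OF W(1) st(2)]] by blast
      from fun_cong[OF this, of x] show "germ X P x U s = germ X P x U t"
        using * W by (simp add: P.germ_rst)
    next
      fix U x t assume *: "openin X U \<and> x \<in> U \<and> t \<in> carrier (sec Q U)"
      then obtain \<sigma> where \<sigma>: "\<sigma> \<in> ?S U" and eq: "?f U \<sigma> = (\<lambda>x. if x \<in> U then germ X Q x U t else {})"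
        using bij constQ[of U t] by (metis (no_types, lifting) bij_betw_def imageE)
      obtain V s where V: "openin X V" "x \<in> V" "V \<subseteq> U" "s \<in> carrier (sec P V)"
        "\<forall>y\<in>V. \<sigma> y = germ X P y V s" using P.sheafify_local[OF \<sigma>, of x] * by blast
      have "germ X Q x V (f V s) = germ X Q x U t"
        using sheafify_map_local[OF V(3,1,4,5,2)] fun_cong[OF eq, of x] * by simp
      then show "\<exists>V s. openin X V \<and> x \<in> V \<and> V \<subseteq> U \<and> s \<in> carrier (sec P V) \<and>
          germ X Q x V (f V s) = germ X Q x U t" using V by blast
    }
  next
    fix U assume "?inj \<and> ?surj" and U: "openin X U"
    then have inj: ?inj and surj: ?surj by blast+
    show "bij_betw (?f U) (?S U) (?T U)"
      unfolding bij_betw_def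
    proof
      show "inj_on (?f U) (?S U)"
      proof (rule inj_onI, rule ext)
        fix \<sigma> \<tau> x assume \<sigma>: "\<sigma> \<in> ?S U" and \<tau>: "\<tau> \<in> ?S U" and eq: "?f U \<sigma> = ?f U \<tau>"
        show "\<sigma> x = \<tau> x"
        proof (cases "x \<in> U")
          case True
          obtain V s t where V: "openin X V" "x \<in> V" "V \<subseteq> U" "s \<in> carrier (sec P V)"
            "t \<in> carrier (sec P V)" "\<forall>y\<in>V. \<sigma> y = germ X P y V s" "\<forall>y\<in>V. \<tau> y = germ X P y V t"
            using P.sheafify_local2[OF \<sigma> \<tau> True] by blast
          have "germ X Q x V (f V s) = germ X Q x V (f V t)"
            using fun_cong[OF eq, of x] sheafify_map_local[OF V(3,1,4,6,2)] sheafify_map_local[OF V(3,1,5,7,2)]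
            by simp
          then have "germ X P x V s = germ X P x V t" using inj V by blast
          then show ?thesis using V by simp
        next
          case False
          then show ?thesis using \<sigma> \<tau> by (simp add: sheafify_def)
        qed
      qed
      show "?f U ` ?S U = ?T U"
      proof (intro equalityI subsetI)
        fix \<tau> assume \<tau>: "\<tau> \<in> ?T U"
        define good where "good x A \<longleftrightarrow> (\<exists>V s. openin X V \<and> x \<in> V \<and> V \<subseteq> U \<and> s \<in> carrier (sec P V) \<and>
          A = germ X P x V s \<and> germ X Q x V (f V s) = \<tau> x)" for x A
        have unique: "A = B" if A: "good x A" and B: "good x B" for x A B
        proof -
          obtain V s where V: "openin X V" "x \<in> V" "s \<in> carrier (sec P V)" "A = germ X P x V s"
            "germ X Q x V (f V s) = \<tau> x" using A by (auto simp: good_def)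
          obtain W t where W: "openin X W" "x \<in> W" "t \<in> carrier (sec P W)" "B = germ X P x W t"
            "germ X Q x W (f W t) = \<tau> x" using B by (auto simp: good_def)
          have o: "openin X (V \<inter> W)" using V W by blast
          have "germ X Q x (V \<inter> W) (f (V \<inter> W) (rst P V (V \<inter> W) s)) = \<tau> x"
            using V W o map_closed by (simp add: map_rst[symmetric] Q.germ_rst)
          moreover have "germ X Q x (V \<inter> W) (f (V \<inter> W) (rst P W (V \<inter> W) t)) = \<tau> x"
            using V W o map_closed by (simp add: map_rst[symmetric] Q.germ_rst)
          ultimately have "germ X P x (V \<inter> W) (rst P V (V \<inter> W) s) = germ X P x (V \<inter> W) (rst P W (V \<inter> W) t)"
            using inj[rule_format, of "V \<inter> W" x "rst P V (V \<inter> W) s" "rst P W (V \<inter> W) t"]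
              P.rst_closed[OF V(1) o _ V(3)] P.rst_closed[OF W(1) o _ W(3)] o V(2) W(2) by simp
          then show ?thesis using V W o by (simp add: P.germ_rst)
        qed
        define \<sigma> where "\<sigma> x = (if x \<in> U then THE A. good x A else {})" for x
        have local: "\<exists>V s. openin X V \<and> x \<in> V \<and> V \<subseteq> U \<and> s \<in> carrier (sec P V) \<and>
            (\<forall>y \<in> V. \<sigma> y = germ X P y V s \<and> germ X Q y V (f V s) = \<tau> y)" if x: "x \<in> U" for x
        proof -
          obtain V t where V: "openin X V" "x \<in> V" "V \<subseteq> U" "t \<in> carrier (sec Q V)"
            "\<forall>y\<in>V. \<tau> y = germ X Q y V t" using Q.sheafify_local[OF \<tau> x] by blast
          obtain V' s where V': "openin X V'" "x \<in> V'" "V' \<subseteq> V" "s \<in> carrier (sec P V')"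
            "germ X Q x V' (f V' s) = germ X Q x V t"
            using surj[rule_format, of V x t] V(1,2,4) by blast
          then obtain W where W: "openin X W" "x \<in> W" "W \<subseteq> V'" and eq: "rst Q V' W (f V' s) = rst Q V W t"
            using Q.germ_eq_iff[OF V'(1,2) V(1,2) map_closed[OF V'(1,4)] V(4)] by blast
          have W': "W \<subseteq> V" "W \<subseteq> U" using W V' V by blast+
          note r = P.rst_closed[OF V'(1) W(1,3) V'(4)]
          have g: "germ X Q y W (f W (rst P V' W s)) = \<tau> y" if y: "y \<in> W" for y
          proof -
            have "f W (rst P V' W s) = rst Q V W t" using eq map_rst[OF V'(1) W(1,3) V'(4)] by simp
            then show ?thesis using Q.germ_rst[OF V(1) W(1) y W'(1) V(4)] V(5) W'(1) y by auto
          qed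
          have good: "good y (germ X P y W (rst P V' W s))" if "y \<in> W" for y
            unfolding good_def using that W(1) W'(2) r g[OF that]
            by (intro exI[of _ W] exI[of _ "rst P V' W s"]) simp
          have "(THE A. good y A) = germ X P y W (rst P V' W s)" if "y \<in> W" for y
            by (rule the_equality[where P = "good y", OF good[OF that] unique[OF _ good[OF that]]])
          then have "\<sigma> y = germ X P y W (rst P V' W s)" if "y \<in> W" for y
            using that W'(2) by (auto simp: \<sigma>_def)
          then show ?thesis using g W(1,2) W'(2) r by (intro exI[of _ W] exI[of _ "rst P V' W s"]) simp
        qed
        have "\<sigma> \<in> ?S U"
        proof (rule P.sheafify_carrierI)
          fix x assume x: "x \<in> U"
          show "\<exists>V t. openin X V \<and> x \<in> V \<and> V \<subseteq> U \<and> t \<in> carrier (sec P V) \<and>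
            (\<forall>y \<in> V. \<sigma> y = germ X P y V t)" using local[OF x] by meson
        qed (simp add: \<sigma>_def)
        moreover have "?f U \<sigma> x = \<tau> x" for x
        proof (cases "x \<in> U")
          case True
          obtain V s where V: "openin X V" "x \<in> V" "V \<subseteq> U" "s \<in> carrier (sec P V)"
            "\<forall>y \<in> V. \<sigma> y = germ X P y V s \<and> germ X Q y V (f V s) = \<tau> y" using local[OF True] by blast
          then have "\<forall>y \<in> V. \<sigma> y = germ X P y V s" by blast
          then show ?thesis using sheafify_map_local[OF V(3,1,4) _ V(2)] V(2,5) by simp
        next
          case False
          then show ?thesis using \<tau> by (simp add: sheafify_map_def sheafify_def)
        qed
        ultimately show "\<tau> \<in> ?f U ` ?S U" by (metis ext image_eqI)
      qed (use sheafify_map_closed in blast)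
    qed
  qed
qed


section \<open>Quasi-isomorphisms\<close>

lemma mod_hom_zero:
  assumes M: "module R M" and N: "module R N" and f: "f \<in> mod_hom R M N"
  shows "f \<zero>\<^bsub>M\<^esub> = \<zero>\<^bsub>N\<^esub>"
proof -
  interpret M: module R M by fact
  interpret N: module R N by fact
  have c: "f \<zero>\<^bsub>M\<^esub> \<in> carrier N" using mod_homD(1)[OF f] by simp
  have "f \<zero>\<^bsub>M\<^esub> \<oplus>\<^bsub>N\<^esub> f \<zero>\<^bsub>M\<^esub> = f \<zero>\<^bsub>M\<^esub>"
    using mod_homD(2)[OF f M.zero_closed M.zero_closed] by simp
  then show ?thesis using c N.add.r_cancel_one' by metis
qed

lemma mod_hom_minus:
  assumes M: "module R M" and N: "module R N" and f: "f \<in> mod_hom R M N" and x: "x \<in> carrier M"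
  shows "f (\<ominus>\<^bsub>M\<^esub> x) = \<ominus>\<^bsub>N\<^esub> f x"
proof -
  interpret M: module R M by fact
  interpret N: module R N by fact
  have "f (\<ominus>\<^bsub>M\<^esub> x) \<oplus>\<^bsub>N\<^esub> f x = \<zero>\<^bsub>N\<^esub>"
    using mod_homD(2)[OF f, of "\<ominus>\<^bsub>M\<^esub> x" x] x mod_hom_zero[OF M N f] by (simp add: M.l_neg)
  then show ?thesis using mod_homD(1)[OF f] x N.minus_equality by auto
qed

locale sheaf_complex =
  fixes R :: "'k ring" and X :: "'x topology" and C :: "('x, 'k, 'u) cplx"
  assumes complex: "cochain_complex R X C"
begin

lemma ob_sheaf: "sheaf R X (ob C n)"
  using complex unfolding cochain_complex_def by blast

lemma ob_presheaf: "presheaf R X (ob C n)"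
  using ob_sheaf unfolding sheaf_def by blast

sublocale ops: operations_presheaf R X "ob C n" for n
  by (rule presheaf_operations[OF ob_presheaf])

lemma sec_module: "openin X U \<Longrightarrow> module R (sec (ob C n) U)"
  by (rule presheaf_module[OF ob_presheaf])

lemma sec_abelian_group: "openin X U \<Longrightarrow> abelian_group (sec (ob C n) U)"
  by (rule module.axioms(2)[OF sec_module])

lemma df_psheaf_hom: "df C n \<in> psheaf_hom R X (ob C n) (ob C (n + 1))"
  using complex unfolding cochain_complex_def by blast

lemmas df_mod_hom = psheaf_homD(1)[OF df_psheaf_hom]
lemmas df_closed = mod_homD(1)[OF df_mod_hom]
lemmas df_add = mod_homD(2)[OF df_mod_hom]
lemmas df_smult = mod_homD(3)[OF df_mod_hom]
lemmas df_rst = psheaf_homD(2)[OF df_psheaf_hom]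

lemma df_zero: "openin X U \<Longrightarrow> df C n U \<zero>\<^bsub>sec (ob C n) U\<^esub> = \<zero>\<^bsub>sec (ob C (n + 1)) U\<^esub>"
  by (intro mod_hom_zero[OF _ _ df_mod_hom] sec_module)

lemma df_df: "\<lbrakk>openin X U; s \<in> carrier (sec (ob C n) U)\<rbrakk>
    \<Longrightarrow> df C (n + 1) U (df C n U s) = \<zero>\<^bsub>sec (ob C (n + 2)) U\<^esub>"
  using complex unfolding cochain_complex_def by blast

lemma rst_zero: "\<lbrakk>openin X U; openin X V; V \<subseteq> U\<rbrakk>
    \<Longrightarrow> rst (ob C n) U V \<zero>\<^bsub>sec (ob C n) U\<^esub> = \<zero>\<^bsub>sec (ob C n) V\<^esub>"
  by (intro mod_hom_zero[OF _ _ ops.rst_hom] sec_module)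

lemma zero_closed: "openin X U \<Longrightarrow> \<zero>\<^bsub>sec (ob C n) U\<^esub> \<in> carrier (sec (ob C n) U)"
  by (rule abelian_monoid.zero_closed[OF abelian_group.axioms(1)[OF sec_abelian_group]])

lemma cycles_carrier: "z \<in> cycles C n U \<Longrightarrow> z \<in> carrier (sec (ob C n) U)"
  unfolding cycles_def by blast

lemma boundaries_carrier: "\<lbrakk>openin X U; b \<in> boundaries C n U\<rbrakk> \<Longrightarrow> b \<in> carrier (sec (ob C n) U)"
  unfolding boundaries_def using df_closed[of U _ "n - 1"] by auto

lemma boundariesI: "\<lbrakk>s \<in> carrier (sec (ob C (n - 1)) U); b = df C (n - 1) U s\<rbrakk> \<Longrightarrow> b \<in> boundaries C n U"
  unfolding boundaries_def by blast

lemma cycles_zero: "openin X U \<Longrightarrow> \<zero>\<^bsub>sec (ob C n) U\<^esub> \<in> cycles C n U"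
  unfolding cycles_def using df_zero zero_closed by blast

lemma cycles_add:
  assumes U: "openin X U" and z: "z \<in> cycles C n U" and z': "z' \<in> cycles C n U"
  shows "z \<oplus>\<^bsub>sec (ob C n) U\<^esub> z' \<in> cycles C n U"
proof -
  interpret N: module R "sec (ob C (n + 1)) U" by (rule sec_module[OF U])
  show ?thesis using z z' ops.add_closed[OF U] unfolding cycles_def by (simp add: df_add U)
qed

lemma cycles_smult:
  assumes U: "openin X U" and k: "k \<in> carrier R" and z: "z \<in> cycles C n U"
  shows "k \<odot>\<^bsub>sec (ob C n) U\<^esub> z \<in> cycles C n U"
proof -
  interpret N: module R "sec (ob C (n + 1)) U" by (rule sec_module[OF U])
  show ?thesis using z k ops.smult_closed[OF U k] unfolding cycles_def by (simp add: df_smult U)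
qed

lemma cycles_rst:
  assumes U: "openin X U" and V: "openin X V" "V \<subseteq> U" and z: "z \<in> cycles C n U"
  shows "rst (ob C n) U V z \<in> cycles C n V"
  using z ops.rst_closed[OF U V] df_rst[OF U V, symmetric] rst_zero[OF U V] unfolding cycles_def by simp

lemma boundaries_add:
  assumes U: "openin X U" and b: "b \<in> boundaries C n U" "b' \<in> boundaries C n U"
  shows "b \<oplus>\<^bsub>sec (ob C n) U\<^esub> b' \<in> boundaries C n U"
proof -
  obtain s s' where s: "s \<in> carrier (sec (ob C (n - 1)) U)" "b = df C (n - 1) U s"
    "s' \<in> carrier (sec (ob C (n - 1)) U)" "b' = df C (n - 1) U s'"
    using b unfolding boundaries_def by blast
  then show ?thesis
    using df_add[OF U s(1,3)] ops.add_closed[OF U s(1,3)] by (intro boundariesI[OF ops.add_closed[OF U s(1,3)]]) simp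
qed

lemma boundaries_smult:
  assumes U: "openin X U" and k: "k \<in> carrier R" and b: "b \<in> boundaries C n U"
  shows "k \<odot>\<^bsub>sec (ob C n) U\<^esub> b \<in> boundaries C n U"
proof -
  obtain s where s: "s \<in> carrier (sec (ob C (n - 1)) U)" "b = df C (n - 1) U s"
    using b unfolding boundaries_def by blast
  then show ?thesis
    using df_smult[OF U k s(1)] by (intro boundariesI[OF ops.smult_closed[OF U k s(1)]]) simp
qed

lemma boundaries_rst:
  assumes U: "openin X U" and V: "openin X V" "V \<subseteq> U" and b: "b \<in> boundaries C n U"
  shows "rst (ob C n) U V b \<in> boundaries C n V"
proof -
  obtain s where s: "s \<in> carrier (sec (ob C (n - 1)) U)" "b = df C (n - 1) U s"
    using b unfolding boundaries_def by blast
  then show ?thesis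
    using df_rst[OF U V s(1)] ops.rst_closed[OF U V s(1)] by (intro boundariesI) auto
qed

lemma boundaries_zero: "openin X U \<Longrightarrow> \<zero>\<^bsub>sec (ob C n) U\<^esub> \<in> boundaries C n U"
  using df_zero[of U "n - 1"] zero_closed[of U "n - 1"] by (intro boundariesI) auto

lemma boundaries_subgroup:
  assumes U: "openin X U"
  shows "abelian_subgroup (boundaries C n U) (sec (ob C n) U)"
proof (intro abelian_subgroupI3 additive_subgroupI)
  interpret M: module R "sec (ob C n) U" by (rule sec_module[OF U])
  interpret M': module R "sec (ob C (n - 1)) U" by (rule sec_module[OF U])
  show "abelian_group (sec (ob C n) U)" by (rule sec_abelian_group[OF U])
  show "subgroup (boundaries C n U) (add_monoid (sec (ob C n) U))"
  proof (rule M.add.subgroupI)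
    show "boundaries C n U \<subseteq> carrier (sec (ob C n) U)" using boundaries_carrier[OF U] by blast
    show "boundaries C n U \<noteq> {}" using boundaries_zero[OF U] by blast
    show "\<ominus>\<^bsub>sec (ob C n) U\<^esub> b \<in> boundaries C n U" if "b \<in> boundaries C n U" for b
    proof -
      obtain s where s: "s \<in> carrier (sec (ob C (n - 1)) U)" "b = df C (n - 1) U s"
        using \<open>b \<in> boundaries C n U\<close> unfolding boundaries_def by blast
      have "\<ominus>\<^bsub>sec (ob C n) U\<^esub> b = df C (n - 1) U (\<ominus>\<^bsub>sec (ob C (n - 1)) U\<^esub> s)"
        using mod_hom_minus[OF sec_module[OF U] sec_module[OF U] df_mod_hom[OF U] s(1)] s(2) by simp
      then show ?thesis using s by (intro boundariesI[of "\<ominus>\<^bsub>sec (ob C (n - 1)) U\<^esub> s"]) auto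
    qed
  qed (use boundaries_add[OF U] in auto)
qed

lemma cohomology_class_eq_iff:
  assumes U: "openin X U" and z: "z \<in> carrier (sec (ob C n) U)" and z': "z' \<in> carrier (sec (ob C n) U)"
  shows "cohomology_class C n U z = cohomology_class C n U z' \<longleftrightarrow>
    (\<exists>b \<in> boundaries C n U. z = b \<oplus>\<^bsub>sec (ob C n) U\<^esub> z')"
proof -
  interpret B: abelian_subgroup "boundaries C n U" "sec (ob C n) U" by (rule boundaries_subgroup[OF U])
  have mem: "y \<in> cohomology_class C n U z' \<longleftrightarrow> (\<exists>b \<in> boundaries C n U. y = b \<oplus>\<^bsub>sec (ob C n) U\<^esub> z')" for y
    unfolding cohomology_class_def a_r_coset_def' by blast
  show ?thesis
  proof
    assume "cohomology_class C n U z = cohomology_class C n U z'"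
    moreover have "z \<in> cohomology_class C n U z"
      unfolding cohomology_class_def by (rule B.a_rcos_self[OF z])
    ultimately show "\<exists>b \<in> boundaries C n U. z = b \<oplus>\<^bsub>sec (ob C n) U\<^esub> z'" using mem by simp
  next
    assume "\<exists>b \<in> boundaries C n U. z = b \<oplus>\<^bsub>sec (ob C n) U\<^esub> z'"
    then have "z \<in> cohomology_class C n U z'" using mem by simp
    then show "cohomology_class C n U z = cohomology_class C n U z'"
      unfolding cohomology_class_def using B.a_repr_independence[OF _ z' B.a_subgroup] z by simp
  qed
qed

lemma cohomology_class_self:
  assumes "openin X U" "z \<in> carrier (sec (ob C n) U)"
  shows "z \<in> cohomology_class C n U z"
  unfolding cohomology_class_def
  by (rule abelian_subgroup.a_rcos_self[OF boundaries_subgroup[OF assms(1)] assms(2)])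

lemma mem_cohomology_class:
  "y \<in> cohomology_class C n U z \<longleftrightarrow> (\<exists>b \<in> boundaries C n U. y = b \<oplus>\<^bsub>sec (ob C n) U\<^esub> z)"
  unfolding cohomology_class_def a_r_coset_def' by blast

end

text \<open>The operations on cohomology are unions over representatives. Such a union is a single class as
  soon as \<open>h\<close> moves boundaries into boundaries.\<close>

lemma UN_cohomology_class:
  assumes C: "sheaf_complex R X C" and D: "sheaf_complex R X D" and U: "openin X U" and V: "openin X V"
    and z: "z \<in> carrier (sec (ob C n) U)" and hz: "h z \<in> carrier (sec (ob D n) V)"
    and h: "\<And>b. b \<in> boundaries C n U \<Longrightarrow>
      \<exists>b' \<in> boundaries D n V. h (b \<oplus>\<^bsub>sec (ob C n) U\<^esub> z) = b' \<oplus>\<^bsub>sec (ob D n) V\<^esub> h z"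
  shows "(\<Union>y \<in> cohomology_class C n U z. cohomology_class D n V (h y)) = cohomology_class D n V (h z)"
proof -
  interpret C: sheaf_complex R X C by fact
  interpret D: sheaf_complex R X D by fact
  have "cohomology_class D n V (h y) = cohomology_class D n V (h z)"
    if "y \<in> cohomology_class C n U z" for y
  proof -
    obtain b where "b \<in> boundaries C n U" and y: "y = b \<oplus>\<^bsub>sec (ob C n) U\<^esub> z"
      using \<open>y \<in> _\<close> C.mem_cohomology_class by blast
    then obtain b' where b': "b' \<in> boundaries D n V" "h y = b' \<oplus>\<^bsub>sec (ob D n) V\<^esub> h z" using h by blast
    have "h y \<in> carrier (sec (ob D n) V)"
      unfolding b'(2) by (intro D.ops.add_closed V D.boundaries_carrier b' hz)
    then show ?thesis using D.cohomology_class_eq_iff[OF V _ hz] b' by blast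
  qed
  then show ?thesis using C.cohomology_class_self[OF U z] by blast
qed

context sheaf_complex
begin

lemma cohomology_presheaf_carrier:
  "carrier (sec (cohomology_presheaf C n) U) = cohomology_class C n U ` cycles C n U"
  by (simp add: cohomology_presheaf_def)

lemma cohomology_presheaf_add:
  assumes U: "openin X U" and z: "z \<in> cycles C n U" "z' \<in> cycles C n U"
  shows "cohomology_class C n U z \<oplus>\<^bsub>sec (cohomology_presheaf C n) U\<^esub> cohomology_class C n U z' =
    cohomology_class C n U (z \<oplus>\<^bsub>sec (ob C n) U\<^esub> z')"
  using abelian_subgroup.a_rcos_sum[OF boundaries_subgroup[OF U] cycles_carrier cycles_carrier] z
  by (simp add: cohomology_presheaf_def cohomology_class_def)

lemma cohomology_presheaf_smult:
  assumes U: "openin X U" and k: "k \<in> carrier R" and z: "z \<in> cycles C n U"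
  shows "k \<odot>\<^bsub>sec (cohomology_presheaf C n) U\<^esub> cohomology_class C n U z =
    cohomology_class C n U (k \<odot>\<^bsub>sec (ob C n) U\<^esub> z)"
proof -
  interpret M: module R "sec (ob C n) U" by (rule sec_module[OF U])
  note z' = cycles_carrier[OF z]
  have "(\<Union>y \<in> cohomology_class C n U z. cohomology_class C n U (k \<odot>\<^bsub>sec (ob C n) U\<^esub> y)) =
    cohomology_class C n U (k \<odot>\<^bsub>sec (ob C n) U\<^esub> z)"
    using boundaries_smult[OF U k] M.smult_r_distr[OF k boundaries_carrier[OF U] z'] k z'
    by (intro UN_cohomology_class[OF sheaf_complex_axioms sheaf_complex_axioms U U]) auto
  then show ?thesis by (simp add: cohomology_presheaf_def)
qed

lemma cohomology_presheaf_rst: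
  assumes U: "openin X U" and V: "openin X V" "V \<subseteq> U" and z: "z \<in> cycles C n U"
  shows "rst (cohomology_presheaf C n) U V (cohomology_class C n U z) =
    cohomology_class C n V (rst (ob C n) U V z)"
proof -
  note z' = cycles_carrier[OF z]
  have "(\<Union>y \<in> cohomology_class C n U z. cohomology_class C n V (rst (ob C n) U V y)) =
    cohomology_class C n V (rst (ob C n) U V z)"
    using boundaries_rst[OF U V] ops.rst_add[OF U V boundaries_carrier[OF U] z'] ops.rst_closed[OF U V z'] z'
    by (intro UN_cohomology_class[OF sheaf_complex_axioms sheaf_complex_axioms U V(1)]) auto
  then show ?thesis by (simp add: cohomology_presheaf_def)
qed

sublocale cohomology: operations_presheaf R X "cohomology_presheaf C n" for n
proof
  fix U s t assume U: "openin X U"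
    and st: "s \<in> carrier (sec (cohomology_presheaf C n) U)" "t \<in> carrier (sec (cohomology_presheaf C n) U)"
  then show "s \<oplus>\<^bsub>sec (cohomology_presheaf C n) U\<^esub> t \<in> carrier (sec (cohomology_presheaf C n) U)"
    unfolding cohomology_presheaf_carrier
    using cohomology_presheaf_add[OF U] cycles_add[OF U] by auto
next
  fix U k s assume U: "openin X U" and k: "k \<in> carrier R"
    and s: "s \<in> carrier (sec (cohomology_presheaf C n) U)"
  then show "k \<odot>\<^bsub>sec (cohomology_presheaf C n) U\<^esub> s \<in> carrier (sec (cohomology_presheaf C n) U)"
    unfolding cohomology_presheaf_carrier
    using cohomology_presheaf_smult[OF U k] cycles_smult[OF U k] by auto
next
  fix U V assume UV: "openin X U" "openin X V" "V \<subseteq> U"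
  show "rst (cohomology_presheaf C n) U V \<in>
      mod_hom R (sec (cohomology_presheaf C n) U) (sec (cohomology_presheaf C n) V)"
    unfolding mod_hom_def cohomology_presheaf_carrier
    using UV cohomology_presheaf_rst[OF UV] cycles_rst[OF UV]
    by (auto simp: cohomology_presheaf_add cohomology_presheaf_smult cycles_add cycles_smult
        ops.rst_add ops.rst_smult cycles_carrier)
next
  fix U s assume U: "openin X U" and s: "s \<in> carrier (sec (cohomology_presheaf C n) U)"
  then show "rst (cohomology_presheaf C n) U U s = s"
    unfolding cohomology_presheaf_carrier
    using cohomology_presheaf_rst[OF U U subset_refl] ops.rst_self[OF U cycles_carrier] by auto
next
  fix U V W s
  assume U: "openin X U" and V: "openin X V" and W: "openin X W" "W \<subseteq> V" "V \<subseteq> U"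
    and s: "s \<in> carrier (sec (cohomology_presheaf C n) U)"
  have "W \<subseteq> U" using W by blast
  with s show "rst (cohomology_presheaf C n) V W (rst (cohomology_presheaf C n) U V s) =
      rst (cohomology_presheaf C n) U W s"
    unfolding cohomology_presheaf_carrier
    using cohomology_presheaf_rst[OF U V W(3)] cohomology_presheaf_rst[OF V W(1,2)]
      cohomology_presheaf_rst[OF U W(1)] cycles_rst[OF U V W(3)]
      ops.rst_rst[OF U V W(1-3) cycles_carrier] by auto
qed

lemma germ_cohomology_eq_iff:
  assumes U: "openin X U" "x \<in> U" "z \<in> cycles C n U" and V: "openin X V" "x \<in> V" "z' \<in> cycles C n V"
  shows "germ X (cohomology_presheaf C n) x U (cohomology_class C n U z) =
      germ X (cohomology_presheaf C n) x V (cohomology_class C n V z') \<longleftrightarrow>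
    (\<exists>W. openin X W \<and> x \<in> W \<and> W \<subseteq> U \<inter> V \<and> (\<exists>b \<in> boundaries C n W.
      rst (ob C n) U W z = b \<oplus>\<^bsub>sec (ob C n) W\<^esub> rst (ob C n) V W z'))"
proof -
  have "rst (cohomology_presheaf C n) U W (cohomology_class C n U z) =
      rst (cohomology_presheaf C n) V W (cohomology_class C n V z') \<longleftrightarrow>
      (\<exists>b \<in> boundaries C n W. rst (ob C n) U W z = b \<oplus>\<^bsub>sec (ob C n) W\<^esub> rst (ob C n) V W z')"
    if W: "openin X W" "W \<subseteq> U \<inter> V" for W
    using W cohomology_presheaf_rst[OF U(1) W(1) _ U(3)] cohomology_presheaf_rst[OF V(1) W(1) _ V(3)]
      cohomology_class_eq_iff[OF W(1) ops.rst_closed[OF U(1) W(1) _ cycles_carrier[OF U(3)]]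
        ops.rst_closed[OF V(1) W(1) _ cycles_carrier[OF V(3)]]] by simp
  then show ?thesis
    using cohomology.germ_eq_iff[OF U(1,2) V(1,2)] U(3) V(3) unfolding cohomology_presheaf_carrier
    by (metis (no_types, lifting) imageI)
qed

end

text \<open>A morphism of complexes is a quasi-isomorphism if locally no class is killed and locally every
  class is hit. This is what iso of the sheafified cohomology amounts to.\<close>

definition local_quasi_iso ::
  "'x topology \<Rightarrow> ('x, 'k, 'u) cplx \<Rightarrow> ('x, 'k, 'u) cplx \<Rightarrow> (int \<Rightarrow> 'x set \<Rightarrow> 'u \<Rightarrow> 'u) \<Rightarrow> int \<Rightarrow> bool" where
  "local_quasi_iso X C D f n \<longleftrightarrow> (\<forall>U x. openin X U \<and> x \<in> U \<longrightarrow>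
     (\<forall>z \<in> cycles C n U. f n U z \<in> boundaries D n U \<longrightarrow>
        (\<exists>W. openin X W \<and> x \<in> W \<and> W \<subseteq> U \<and> rst (ob C n) U W z \<in> boundaries C n W)) \<and>
     (\<forall>w \<in> cycles D n U. \<exists>W z b. openin X W \<and> x \<in> W \<and> W \<subseteq> U \<and> z \<in> cycles C n W \<and>
        b \<in> boundaries D n W \<and> rst (ob D n) U W w = b \<oplus>\<^bsub>sec (ob D n) W\<^esub> f n W z))"

locale complex_map = C: sheaf_complex R X C + D: sheaf_complex R X D
  for R :: "'k ring" and X :: "'x topology" and C D :: "('x, 'k, 'u) cplx" +
  fixes f :: "int \<Rightarrow> 'x set \<Rightarrow> 'u \<Rightarrow> 'u"
  assumes chain_map: "f \<in> chain_map R X C D"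
begin

lemma f_psheaf_hom: "f n \<in> psheaf_hom R X (ob C n) (ob D n)"
  using chain_map unfolding chain_map_def by blast

lemma f_df: "\<lbrakk>openin X U; s \<in> carrier (sec (ob C n) U)\<rbrakk> \<Longrightarrow> df D n U (f n U s) = f (n + 1) U (df C n U s)"
  using chain_map unfolding chain_map_def by blast

lemmas f_mod_hom = psheaf_homD(1)[OF f_psheaf_hom]
lemmas f_closed = mod_homD(1)[OF f_mod_hom]
lemmas f_add = mod_homD(2)[OF f_mod_hom]
lemmas f_smult = mod_homD(3)[OF f_mod_hom]
lemmas f_rst = psheaf_homD(2)[OF f_psheaf_hom]

lemma f_zero: "openin X U \<Longrightarrow> f n U \<zero>\<^bsub>sec (ob C n) U\<^esub> = \<zero>\<^bsub>sec (ob D n) U\<^esub>"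
  by (intro mod_hom_zero[OF _ _ f_mod_hom] C.sec_module D.sec_module)

lemma f_cycles: "\<lbrakk>openin X U; z \<in> cycles C n U\<rbrakk> \<Longrightarrow> f n U z \<in> cycles D n U"
  unfolding cycles_def using f_df[of U z n] f_closed[of U z n] f_zero[of U "n + 1"] by simp

lemma f_boundaries:
  assumes U: "openin X U" and b: "b \<in> boundaries C n U"
  shows "f n U b \<in> boundaries D n U"
proof -
  obtain s where s: "s \<in> carrier (sec (ob C (n - 1)) U)" "b = df C (n - 1) U s"
    using b unfolding boundaries_def by blast
  then show ?thesis
    using f_df[OF U s(1)] f_closed[OF U s(1)] by (intro D.boundariesI) auto
qed

abbreviation "class_map n \<equiv> \<lambda>U A. \<Union>z \<in> A. cohomology_class D n U (f n U z)"

lemma class_map: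
  assumes U: "openin X U" and z: "z \<in> cycles C n U"
  shows "class_map n U (cohomology_class C n U z) = cohomology_class D n U (f n U z)"
proof -
  note z' = C.cycles_carrier[OF z]
  show ?thesis
    using f_boundaries[OF U] f_add[OF U C.boundaries_carrier[OF U] z'] f_closed[OF U z'] z'
    by (intro UN_cohomology_class[OF C.sheaf_complex_axioms D.sheaf_complex_axioms U U]) auto
qed

sublocale cohomology: operations_presheaf_map R X "cohomology_presheaf C n" "cohomology_presheaf D n"
  "class_map n" for n
proof
  fix U assume U: "openin X U"
  show "class_map n U \<in> mod_hom R (sec (cohomology_presheaf C n) U) (sec (cohomology_presheaf D n) U)"
    unfolding mod_hom_def C.cohomology_presheaf_carrier D.cohomology_presheaf_carrier
    using U class_map[OF U] f_cycles[OF U]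
    by (auto simp: C.cohomology_presheaf_add D.cohomology_presheaf_add C.cohomology_presheaf_smult
        D.cohomology_presheaf_smult C.cycles_add C.cycles_smult f_add f_smult C.cycles_carrier
        simp del: UN_iff UN_simps)
next
  fix U V s assume UV: "openin X U" "openin X V" "V \<subseteq> U" and "s \<in> carrier (sec (cohomology_presheaf C n) U)"
  then obtain z where z: "z \<in> cycles C n U" "s = cohomology_class C n U z"
    unfolding C.cohomology_presheaf_carrier by blast
  have "f n V (rst (ob C n) U V z) = rst (ob D n) U V (f n U z)"
    using f_rst[OF UV C.cycles_carrier[OF z(1)]] by simp
  then show "rst (cohomology_presheaf D n) U V (class_map n U s) =
      class_map n V (rst (cohomology_presheaf C n) U V s)"
    unfolding z(2) class_map[OF UV(1) z(1)] C.cohomology_presheaf_rst[OF UV z(1)]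
      class_map[OF UV(2) C.cycles_rst[OF UV z(1)]]
      D.cohomology_presheaf_rst[OF UV f_cycles[OF UV(1) z(1)]] by simp
qed

text \<open>Equality of germs of cohomology classes means that representatives differ by a boundary on a smaller
  open set; so the criterion on germs becomes one about cycles and boundaries.\<close>

lemma is_iso_cohomology_map_iff:
  "is_iso (Shv R X) (cohomology_sheaf X C n) (cohomology_sheaf X D n) (cohomology_map X C D f n) \<longleftrightarrow>
    local_quasi_iso X C D f n"
proof -
  let ?P = "cohomology_presheaf C n" and ?Q = "cohomology_presheaf D n"
  let ?c = "cohomology_class C n" and ?d = "cohomology_class D n"
  have "is_iso (Shv R X) (cohomology_sheaf X C n) (cohomology_sheaf X D n) (cohomology_map X C D f n) \<longleftrightarrow>
    (\<forall>U x z z'. openin X U \<and> x \<in> U \<and> z \<in> cycles C n U \<and> z' \<in> cycles C n U \<and>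
      germ X ?Q x U (?d U (f n U z)) = germ X ?Q x U (?d U (f n U z')) \<longrightarrow>
      germ X ?P x U (?c U z) = germ X ?P x U (?c U z')) \<and>
    (\<forall>U x w. openin X U \<and> x \<in> U \<and> w \<in> cycles D n U \<longrightarrow>
      (\<exists>V z. openin X V \<and> x \<in> V \<and> V \<subseteq> U \<and> z \<in> cycles C n V \<and>
        germ X ?Q x U (?d U w) = germ X ?Q x V (?d V (f n V z))))" (is "_ \<longleftrightarrow> ?inj \<and> ?surj")
  proof -
    show ?thesis
      unfolding cohomology_map_def cohomology_sheaf_def
        is_iso_sheafify_map_iff[OF cohomology.operations_presheaf_map_axioms]
        C.cohomology_presheaf_carrier D.cohomology_presheaf_carrier
    proof (intro arg_cong2[where f = "(\<and>)"] iffI allI impI; elim conjE)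
      fix U x z z'
      assume *: "\<forall>U x s t. openin X U \<and> x \<in> U \<and> s \<in> ?c U ` cycles C n U \<and> t \<in> ?c U ` cycles C n U \<and>
          germ X ?Q x U (class_map n U s) = germ X ?Q x U (class_map n U t) \<longrightarrow>
          germ X ?P x U s = germ X ?P x U t"
        and U: "openin X U" "x \<in> U" and z: "z \<in> cycles C n U" "z' \<in> cycles C n U"
        and eq: "germ X ?Q x U (?d U (f n U z)) = germ X ?Q x U (?d U (f n U z'))"
      show "germ X ?P x U (?c U z) = germ X ?P x U (?c U z')"
        using *[rule_format, of U x "?c U z" "?c U z'"] U z eq
        unfolding class_map[OF U(1) z(1)] class_map[OF U(1) z(2)] by simp
    next
      fix U x s t
      assume inj: ?inj and U: "openin X U" "x \<in> U"
        and st: "s \<in> ?c U ` cycles C n U" "t \<in> ?c U ` cycles C n U"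
        and eq: "germ X ?Q x U (class_map n U s) = germ X ?Q x U (class_map n U t)"
      obtain z z' where z: "s = ?c U z" "z \<in> cycles C n U" "t = ?c U z'" "z' \<in> cycles C n U"
        using st by blast
      show "germ X ?P x U s = germ X ?P x U t"
        using inj[rule_format, of U x z z'] U z eq
        unfolding z(1,3) class_map[OF U(1) z(2)] class_map[OF U(1) z(4)] by simp
    next
      fix U x w
      assume *: "\<forall>U x t. openin X U \<and> x \<in> U \<and> t \<in> ?d U ` cycles D n U \<longrightarrow>
          (\<exists>V s. openin X V \<and> x \<in> V \<and> V \<subseteq> U \<and> s \<in> ?c V ` cycles C n V \<and>
            germ X ?Q x V (class_map n V s) = germ X ?Q x U t)"
        and U: "openin X U" "x \<in> U" and w: "w \<in> cycles D n U"
      obtain V z where V: "openin X V" "x \<in> V" "V \<subseteq> U" and z: "z \<in> cycles C n V"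
        and eq: "germ X ?Q x V (class_map n V (?c V z)) = germ X ?Q x U (?d U w)"
        using *[rule_format, of U x "?d U w"] U w by blast
      show "\<exists>V z. openin X V \<and> x \<in> V \<and> V \<subseteq> U \<and> z \<in> cycles C n V \<and>
          germ X ?Q x U (?d U w) = germ X ?Q x V (?d V (f n V z))"
        using V z eq[unfolded class_map[OF V(1) z], symmetric] by blast
    next
      fix U x t
      assume surj: ?surj and U: "openin X U" "x \<in> U" and t: "t \<in> ?d U ` cycles D n U"
      obtain w where w: "t = ?d U w" "w \<in> cycles D n U" using t by blast
      obtain V z where V: "openin X V" "x \<in> V" "V \<subseteq> U" and z: "z \<in> cycles C n V"
        and eq: "germ X ?Q x U (?d U w) = germ X ?Q x V (?d V (f n V z))"
        using surj[rule_format, of U x w] U w(2) by blast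
      have "germ X ?Q x V (class_map n V (?c V z)) = germ X ?Q x U t"
        unfolding class_map[OF V(1) z] w(1) using eq by simp
      then show "\<exists>V s. openin X V \<and> x \<in> V \<and> V \<subseteq> U \<and> s \<in> ?c V ` cycles C n V \<and>
            germ X ?Q x V (class_map n V s) = germ X ?Q x U t"
        using V z by blast
    qed
  qed
  also have "\<dots> \<longleftrightarrow> local_quasi_iso X C D f n"
  proof (intro iffI conjI)
    assume "?inj \<and> ?surj"
    then have inj: ?inj and surj: ?surj by blast+
    show "local_quasi_iso X C D f n"
      unfolding local_quasi_iso_def
    proof (intro allI impI, elim conjE, intro conjI ballI impI)
      fix U x z assume U: "openin X U" "x \<in> U" and z: "z \<in> cycles C n U" and fz: "f n U z \<in> boundaries D n U"
      let ?o = "\<zero>\<^bsub>sec (ob C n) U\<^esub>"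
      interpret M: module R "sec (ob C n) U" by (rule C.sec_module[OF U(1)])
      interpret N: module R "sec (ob D n) U" by (rule D.sec_module[OF U(1)])
      have "f n U z = f n U z \<oplus>\<^bsub>sec (ob D n) U\<^esub> f n U ?o"
        using f_zero[OF U(1)] f_closed[OF U(1) C.cycles_carrier[OF z]] by simp
      then have "?d U (f n U z) = ?d U (f n U ?o)"
        using D.cohomology_class_eq_iff[OF U(1) f_closed[OF U(1) C.cycles_carrier[OF z]]
            f_closed[OF U(1) C.zero_closed[OF U(1)]]] fz by blast
      then have "germ X ?P x U (?c U z) = germ X ?P x U (?c U ?o)"
        using inj U z C.cycles_zero[OF U(1)] by metis
      then obtain W b where W: "openin X W" "x \<in> W" "W \<subseteq> U" and b: "b \<in> boundaries C n W"
        and eq: "rst (ob C n) U W z = b \<oplus>\<^bsub>sec (ob C n) W\<^esub> rst (ob C n) U W ?o"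
        using C.germ_cohomology_eq_iff[OF U z U C.cycles_zero[OF U(1)]] by auto
      interpret MW: module R "sec (ob C n) W" by (rule C.sec_module[OF W(1)])
      have "rst (ob C n) U W z = b"
        using eq C.rst_zero[OF U(1) W(1,3)] C.boundaries_carrier[OF W(1) b] by simp
      then show "\<exists>W. openin X W \<and> x \<in> W \<and> W \<subseteq> U \<and> rst (ob C n) U W z \<in> boundaries C n W"
        using W b by blast
    next
      fix U x w assume U: "openin X U" "x \<in> U" and w: "w \<in> cycles D n U"
      then obtain V z where V: "openin X V" "x \<in> V" "V \<subseteq> U" and z: "z \<in> cycles C n V"
        and eq: "germ X ?Q x U (?d U w) = germ X ?Q x V (?d V (f n V z))" using surj by metis
      obtain W b where W: "openin X W" "x \<in> W" "W \<subseteq> U \<inter> V" and b: "b \<in> boundaries D n W"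
        and eq: "rst (ob D n) U W w = b \<oplus>\<^bsub>sec (ob D n) W\<^esub> rst (ob D n) V W (f n V z)"
        using D.germ_cohomology_eq_iff[OF U w V(1,2) f_cycles[OF V(1) z]] eq by blast
      have WV: "W \<subseteq> V" "W \<subseteq> U" using W by auto
      show "\<exists>W z b. openin X W \<and> x \<in> W \<and> W \<subseteq> U \<and> z \<in> cycles C n W \<and> b \<in> boundaries D n W \<and>
          rst (ob D n) U W w = b \<oplus>\<^bsub>sec (ob D n) W\<^esub> f n W z"
        using W(1,2) WV(2) b eq C.cycles_rst[OF V(1) W(1) WV(1) z]
          f_rst[OF V(1) W(1) WV(1) C.cycles_carrier[OF z]] by metis
    qed
  next
    assume l: "local_quasi_iso X C D f n"
    show ?inj
    proof (intro allI impI, elim conjE)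
      fix U x z z' assume U: "openin X U" "x \<in> U" and z: "z \<in> cycles C n U" and z': "z' \<in> cycles C n U"
        and eq: "germ X ?Q x U (?d U (f n U z)) = germ X ?Q x U (?d U (f n U z'))"
      then obtain W b where W: "openin X W" "x \<in> W" "W \<subseteq> U" and b: "b \<in> boundaries D n W"
        and eq: "rst (ob D n) U W (f n U z) = b \<oplus>\<^bsub>sec (ob D n) W\<^esub> rst (ob D n) U W (f n U z')"
        using D.germ_cohomology_eq_iff[OF U f_cycles[OF U(1) z] U f_cycles[OF U(1) z']] by auto
      interpret M: module R "sec (ob C n) W" by (rule C.sec_module[OF W(1)])
      interpret N: module R "sec (ob D n) W" by (rule D.sec_module[OF W(1)])
      let ?z = "rst (ob C n) U W z" and ?z' = "rst (ob C n) U W z'"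
      define y where "y = ?z \<oplus>\<^bsub>sec (ob C n) W\<^esub> (\<ominus>\<^bsub>R\<^esub> \<one>\<^bsub>R\<^esub>) \<odot>\<^bsub>sec (ob C n) W\<^esub> ?z'"
      have zW: "?z \<in> cycles C n W" "?z' \<in> cycles C n W" using C.cycles_rst[OF U(1) W(1,3)] z z' by auto
      note zc = C.cycles_carrier[OF zW(1)] C.cycles_carrier[OF zW(2)]
      have y: "y \<in> cycles C n W"
        unfolding y_def by (intro C.cycles_add C.cycles_smult W(1) zW) simp
      have y': "y = ?z \<ominus>\<^bsub>sec (ob C n) W\<^esub> ?z'"
        using zc by (simp add: y_def M.smult_l_minus a_minus_def)
      have "f n W y = f n W ?z \<ominus>\<^bsub>sec (ob D n) W\<^esub> f n W ?z'"
        using zc f_add[OF W(1) zc(1)] f_smult[OF W(1) _ zc(2)] f_closed[OF W(1)]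
        by (simp add: y_def N.smult_l_minus a_minus_def)
      also have "\<dots> = b"
        using eq f_rst[OF U(1) W(1,3) C.cycles_carrier[OF z]] f_rst[OF U(1) W(1,3) C.cycles_carrier[OF z']]
          f_closed[OF W(1) zc(2)] D.boundaries_carrier[OF W(1) b]
        by (simp add: a_minus_def N.a_assoc N.r_neg)
      finally obtain W' where W': "openin X W'" "x \<in> W'" "W' \<subseteq> W" and b': "rst (ob C n) W W' y \<in> boundaries C n W'"
        using l[unfolded local_quasi_iso_def, rule_format, OF conjI[OF W(1,2)], THEN conjunct1,
            rule_format, OF y] b by blast
      have "?z = y \<oplus>\<^bsub>sec (ob C n) W\<^esub> ?z'"
        unfolding y' using zc by (simp add: a_minus_def M.a_assoc M.l_neg)
      then have "rst (ob C n) W W' ?z = rst (ob C n) W W' y \<oplus>\<^bsub>sec (ob C n) W'\<^esub> rst (ob C n) W W' ?z'"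
        using C.ops.rst_add[OF W(1) W'(1,3) C.cycles_carrier[OF y] zc(2)] by simp
      then have "rst (ob C n) U W' z = rst (ob C n) W W' y \<oplus>\<^bsub>sec (ob C n) W'\<^esub> rst (ob C n) U W' z'"
        using C.ops.rst_rst[OF U(1) W(1) W'(1,3) W(3) C.cycles_carrier] z z' by simp
      moreover have "W' \<subseteq> U \<inter> U" using W'(3) W(3) by blast
      ultimately show "germ X ?P x U (?c U z) = germ X ?P x U (?c U z')"
        using C.germ_cohomology_eq_iff[OF U z U z'] W'(1,2) b' by blast
    qed
    show ?surj
    proof (intro allI impI, elim conjE)
      fix U x w assume U: "openin X U" "x \<in> U" and w: "w \<in> cycles D n U"
      then obtain W z b where W: "openin X W" "x \<in> W" "W \<subseteq> U" and z: "z \<in> cycles C n W"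
        and b: "b \<in> boundaries D n W" and eq: "rst (ob D n) U W w = b \<oplus>\<^bsub>sec (ob D n) W\<^esub> f n W z"
        using l[unfolded local_quasi_iso_def, rule_format, OF conjI[OF U], THEN conjunct2,
            rule_format, OF w] by blast
      have "rst (ob D n) U W w = b \<oplus>\<^bsub>sec (ob D n) W\<^esub> rst (ob D n) W W (f n W z)"
        using eq D.ops.rst_self[OF W(1) f_closed[OF W(1) C.cycles_carrier[OF z]]] by simp
      moreover have "W \<subseteq> U \<inter> W" using W(3) by blast
      ultimately have "germ X ?Q x U (?d U w) = germ X ?Q x W (?d W (f n W z))"
        using D.germ_cohomology_eq_iff[OF U w W(1,2) f_cycles[OF W(1) z]] W(1,2) b by blast
      then show "\<exists>V z. openin X V \<and> x \<in> V \<and> V \<subseteq> U \<and> z \<in> cycles C n V \<and>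
          germ X ?Q x U (?d U w) = germ X ?Q x V (?d V (f n V z))" using W z by blast
    qed
  qed
  finally show ?thesis .
qed

end

lemma mem_quasi_isos_iff:
  assumes "cochain_complex R X C" "cochain_complex R X D"
  shows "f \<in> quasi_isos R X C D \<longleftrightarrow> f \<in> chain_map R X C D \<and> (\<forall>n. local_quasi_iso X C D f n)"
proof (cases "f \<in> chain_map R X C D")
  case True
  then interpret complex_map R X C D f
    using assms by unfold_locales
  show ?thesis using True is_iso_cohomology_map_iff by (simp add: quasi_isos_def)
qed (simp add: quasi_isos_def)


section \<open>Sums over lists\<close>

definition lsum :: "('a, 'b) ring_scheme \<Rightarrow> ('i \<Rightarrow> 'a) \<Rightarrow> 'i list \<Rightarrow> 'a" where
  "lsum M f is = foldr (\<lambda>i s. f i \<oplus>\<^bsub>M\<^esub> s) is \<zero>\<^bsub>M\<^esub>"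

lemma lsum_simps [simp]:
  "lsum M f [] = \<zero>\<^bsub>M\<^esub>"
  "lsum M f (i # is) = f i \<oplus>\<^bsub>M\<^esub> lsum M f is"
  by (simp_all add: lsum_def)

lemma lsum_map: "lsum M f (map h is) = lsum M (\<lambda>i. f (h i)) is"
  by (induction "is") simp_all

lemma lsum_cong: "(\<And>i. i \<in> set is \<Longrightarrow> f i = h i) \<Longrightarrow> lsum M f is = lsum M h is"
  by (induction "is") simp_all

lemma lsum_cong_simp:
  "\<lbrakk>is = js; \<And>i. i \<in> set js =simp=> f i = h i\<rbrakk> \<Longrightarrow> lsum M f is = lsum M h js"
  unfolding simp_implies_def by (auto intro: lsum_cong)

context abelian_monoid
begin

lemma lsum_closed: "(\<And>i. i \<in> set is \<Longrightarrow> f i \<in> carrier G) \<Longrightarrow> lsum G f is \<in> carrier G"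
  by (induction "is") simp_all

lemma lsum_append:
  "(\<And>i. i \<in> set is \<union> set js \<Longrightarrow> f i \<in> carrier G) \<Longrightarrow> lsum G f (is @ js) = lsum G f is \<oplus> lsum G f js"
  by (induction "is") (simp_all add: lsum_closed a_assoc)

lemma lsum_zero: "lsum G (\<lambda>_. \<zero>) is = \<zero>"
  by (induction "is") simp_all

lemma lsum_add:
  "\<lbrakk>\<And>i. i \<in> set is \<Longrightarrow> f i \<in> carrier G; \<And>i. i \<in> set is \<Longrightarrow> h i \<in> carrier G\<rbrakk>
    \<Longrightarrow> lsum G (\<lambda>i. f i \<oplus> h i) is = lsum G f is \<oplus> lsum G h is"
  by (induction "is") (simp_all add: lsum_closed a_ac)

lemma lsum_swap:
  "(\<And>i j. \<lbrakk>i \<in> set is; j \<in> set js\<rbrakk> \<Longrightarrow> f i j \<in> carrier G)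
    \<Longrightarrow> lsum G (\<lambda>i. lsum G (f i) js) is = lsum G (\<lambda>j. lsum G (\<lambda>i. f i j) is) js"
  by (induction "is") (simp_all add: lsum_zero lsum_add lsum_closed)

lemma lsum_single:
  assumes "distinct is" "i \<in> set is" "f i \<in> carrier G"
  shows "lsum G (\<lambda>j. if j = i then f j else \<zero>) is = f i"
proof -
  have zero: "lsum G (\<lambda>j. if j = i then f j else \<zero>) js = \<zero>" if "i \<notin> set js" for js
    using that by (induction js) auto
  show ?thesis using assms
  proof (induction "is")
    case (Cons k "is")
    then show ?case by (cases "k = i") (auto simp: zero)
  qed simp
qed

lemma lsum_eq_finsum:
  "\<lbrakk>distinct is; \<And>i. i \<in> set is \<Longrightarrow> f i \<in> carrier G\<rbrakk> \<Longrightarrow> lsum G f is = finsum G f (set is)"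
  by (induction "is") auto

lemma lsum_reindex:
  assumes "distinct is" "distinct js" "set is = set js" "\<And>i. i \<in> set is \<Longrightarrow> f i \<in> carrier G"
  shows "lsum G f is = lsum G f js"
  using lsum_eq_finsum[OF assms(1,4)] lsum_eq_finsum[OF assms(2)] assms(3,4) by simp

end

lemma lsum_hom:
  assumes M: "abelian_monoid M" and zero: "h \<zero>\<^bsub>M\<^esub> = \<zero>\<^bsub>N\<^esub>"
    and add: "\<And>x y. \<lbrakk>x \<in> carrier M; y \<in> carrier M\<rbrakk> \<Longrightarrow> h (x \<oplus>\<^bsub>M\<^esub> y) = h x \<oplus>\<^bsub>N\<^esub> h y"
    and f: "\<And>i. i \<in> set is \<Longrightarrow> f i \<in> carrier M"
  shows "h (lsum M f is) = lsum N (\<lambda>i. h (f i)) is"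
  using f
proof (induction "is")
  case (Cons i "is")
  then have "lsum M f is \<in> carrier M" by (intro abelian_monoid.lsum_closed[OF M]) auto
  then show ?case using Cons by (simp add: add)
qed (simp add: zero)

lemma (in ring) lsum_ldistr:
  "\<lbrakk>a \<in> carrier R; \<And>i. i \<in> set is \<Longrightarrow> f i \<in> carrier R\<rbrakk> \<Longrightarrow> a \<otimes> lsum R f is = lsum R (\<lambda>i. a \<otimes> f i) is"
  by (rule lsum_hom) (auto intro: abelian_monoid_axioms simp: r_distr)

lemma (in ring) lsum_rdistr:
  "\<lbrakk>a \<in> carrier R; \<And>i. i \<in> set is \<Longrightarrow> f i \<in> carrier R\<rbrakk> \<Longrightarrow> lsum R f is \<otimes> a = lsum R (\<lambda>i. f i \<otimes> a) is"
  by (rule lsum_hom[where h = "\<lambda>x. x \<otimes> a"]) (auto intro: abelian_monoid_axioms simp: l_distr)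

lemma mod_hom_lsum:
  assumes "module R M" "module R N" "f \<in> mod_hom R M N" "\<And>i. i \<in> set is \<Longrightarrow> h i \<in> carrier M"
  shows "f (lsum M h is) = lsum N (\<lambda>i. f (h i)) is"
  using assms mod_hom_zero[OF assms(1-3)] mod_homD(2)[OF assms(3)]
  by (intro lsum_hom) (auto dest: module.axioms(2) abelian_group.axioms(1))

lemma (in module) smult_lsum:
  assumes "k \<in> carrier R" "\<And>i. i \<in> set is \<Longrightarrow> f i \<in> carrier M"
  shows "k \<odot>\<^bsub>M\<^esub> lsum M f is = lsum M (\<lambda>i. k \<odot>\<^bsub>M\<^esub> f i) is"
  using assms by (intro lsum_hom) (auto simp: M.abelian_monoid_axioms smult_r_distr)

lemma (in module) lsum_smult:
  assumes "v \<in> carrier M" "\<And>i. i \<in> set is \<Longrightarrow> f i \<in> carrier R"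
  shows "lsum R f is \<odot>\<^bsub>M\<^esub> v = lsum M (\<lambda>i. f i \<odot>\<^bsub>M\<^esub> v) is"
  using assms by (intro lsum_hom[where h = "\<lambda>k. k \<odot>\<^bsub>M\<^esub> v"]) (auto simp: R.abelian_monoid_axioms smult_l_distr)


section \<open>The tensor product in coordinates\<close>

declare tensor_eq.trans [trans]

text \<open>The map out of \<open>L \<otimes>\<^sub>K V\<close> given by \<open>B\<close>, evaluated on a formal sum.\<close>

definition tensor_lift :: "('w, 'b) ring_scheme \<Rightarrow> ('l \<Rightarrow> 'u \<Rightarrow> 'w) \<Rightarrow> ('l \<times> 'u) list \<Rightarrow> 'w" where
  "tensor_lift W B ts = lsum W (\<lambda>p. B (fst p) (snd p)) ts"

lemma tensor_lift_simps [simp]: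
  "tensor_lift W B [] = \<zero>\<^bsub>W\<^esub>"
  "tensor_lift W B ((a, v) # ts) = B a v \<oplus>\<^bsub>W\<^esub> tensor_lift W B ts"
  by (simp_all add: tensor_lift_def)

definition balanced ::
  "'l ring \<Rightarrow> 'l set \<Rightarrow> ('l, 'u) module \<Rightarrow> ('w, 'b) ring_scheme \<Rightarrow> ('l \<Rightarrow> 'u \<Rightarrow> 'w) \<Rightarrow> bool" where
  "balanced L K V W B \<longleftrightarrow>
     (\<forall>a \<in> carrier L. \<forall>v \<in> carrier V. B a v \<in> carrier W) \<and>
     (\<forall>a \<in> carrier L. \<forall>b \<in> carrier L. \<forall>v \<in> carrier V. B (a \<oplus>\<^bsub>L\<^esub> b) v = B a v \<oplus>\<^bsub>W\<^esub> B b v) \<and>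
     (\<forall>a \<in> carrier L. \<forall>v \<in> carrier V. \<forall>w \<in> carrier V. B a (v \<oplus>\<^bsub>V\<^esub> w) = B a v \<oplus>\<^bsub>W\<^esub> B a w) \<and>
     (\<forall>a \<in> carrier L. \<forall>k \<in> K. \<forall>v \<in> carrier V. B (a \<otimes>\<^bsub>L\<^esub> k) v = B a (k \<odot>\<^bsub>V\<^esub> v))"

lemma balancedI:
  assumes "\<And>a v. \<lbrakk>a \<in> carrier L; v \<in> carrier V\<rbrakk> \<Longrightarrow> B a v \<in> carrier W"
    and "\<And>a b v. \<lbrakk>a \<in> carrier L; b \<in> carrier L; v \<in> carrier V\<rbrakk> \<Longrightarrow> B (a \<oplus>\<^bsub>L\<^esub> b) v = B a v \<oplus>\<^bsub>W\<^esub> B b v"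
    and "\<And>a v w. \<lbrakk>a \<in> carrier L; v \<in> carrier V; w \<in> carrier V\<rbrakk> \<Longrightarrow> B a (v \<oplus>\<^bsub>V\<^esub> w) = B a v \<oplus>\<^bsub>W\<^esub> B a w"
    and "\<And>a k v. \<lbrakk>a \<in> carrier L; k \<in> K; v \<in> carrier V\<rbrakk> \<Longrightarrow> B (a \<otimes>\<^bsub>L\<^esub> k) v = B a (k \<odot>\<^bsub>V\<^esub> v)"
  shows "balanced L K V W B"
  using assms unfolding balanced_def by blast

lemma balancedD:
  assumes "balanced L K V W B"
  shows "\<lbrakk>a \<in> carrier L; v \<in> carrier V\<rbrakk> \<Longrightarrow> B a v \<in> carrier W"
    and "\<lbrakk>a \<in> carrier L; b \<in> carrier L; v \<in> carrier V\<rbrakk> \<Longrightarrow> B (a \<oplus>\<^bsub>L\<^esub> b) v = B a v \<oplus>\<^bsub>W\<^esub> B b v"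
    and "\<lbrakk>a \<in> carrier L; v \<in> carrier V; w \<in> carrier V\<rbrakk> \<Longrightarrow> B a (v \<oplus>\<^bsub>V\<^esub> w) = B a v \<oplus>\<^bsub>W\<^esub> B a w"
    and "\<lbrakk>a \<in> carrier L; k \<in> K; v \<in> carrier V\<rbrakk> \<Longrightarrow> B (a \<otimes>\<^bsub>L\<^esub> k) v = B a (k \<odot>\<^bsub>V\<^esub> v)"
  using assms unfolding balanced_def by blast+

abbreviation formal_sums :: "'l ring \<Rightarrow> ('l, 'u) module \<Rightarrow> ('l \<times> 'u) list set" where
  "formal_sums L V \<equiv> {ts. set ts \<subseteq> carrier L \<times> carrier V}"

text \<open>Finitely many \<open>x\<^sub>i\<close> with \<open>K\<close>-linear coordinate functionals \<open>t\<^sub>i\<close>. Unlike for a basis, \<open>t\<^sub>i(x\<^sub>j)\<close> is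
  arbitrary, so that the dual pairs of the trace form provide an example without choosing a basis.\<close>

locale frame =
  fixes L :: "'l ring" and K :: "'l set" and x :: "'i \<Rightarrow> 'l" and t :: "'i \<Rightarrow> 'l \<Rightarrow> 'l" and I :: "'i list"
  assumes field: "field L" and subfield: "subfield K L"
    and x_closed: "i \<in> set I \<Longrightarrow> x i \<in> carrier L"
    and t_closed: "\<lbrakk>i \<in> set I; a \<in> carrier L\<rbrakk> \<Longrightarrow> t i a \<in> K"
    and t_add: "\<lbrakk>i \<in> set I; a \<in> carrier L; b \<in> carrier L\<rbrakk> \<Longrightarrow> t i (a \<oplus>\<^bsub>L\<^esub> b) = t i a \<oplus>\<^bsub>L\<^esub> t i b"
    and t_scal: "\<lbrakk>i \<in> set I; a \<in> carrier L; k \<in> K\<rbrakk> \<Longrightarrow> t i (a \<otimes>\<^bsub>L\<^esub> k) = t i a \<otimes>\<^bsub>L\<^esub> k"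
    and frame: "a \<in> carrier L \<Longrightarrow> lsum L (\<lambda>i. x i \<otimes>\<^bsub>L\<^esub> t i a) I = a"
begin

sublocale L: field L by (rule field)

abbreviation "RK \<equiv> L\<lparr>carrier := K\<rparr>"

lemma K_carrier: "k \<in> K \<Longrightarrow> k \<in> carrier L"
  using subfieldE(3)[OF subfield] by blast

lemma RK_cring: "cring RK"
  using subfieldE(1)[OF subfield] L.subcring_iff[OF subfieldE(3)[OF subfield]]
    L.subfield_iff(2)[OF subfield] by (simp add: cring.axioms field.axioms domain.axioms(1) fieldE(1))

context
  fixes V :: "('l, 'u) module"
  assumes V: "module RK V"
begin

interpretation V: module RK V by (rule V)

lemma tensor_eq_formal_sums:
  "tensor_eq L K V ts us \<Longrightarrow> ts \<in> formal_sums L V \<and> us \<in> formal_sums L V"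
  by (induction rule: tensor_eq.induct) (auto simp: K_carrier)

lemma tensor_lift_closed:
  assumes "abelian_group W" "balanced L K V W B" "ts \<in> formal_sums L V"
  shows "tensor_lift W B ts \<in> carrier W"
  unfolding tensor_lift_def
  using assms(3) balancedD(1)[OF assms(2)]
  by (intro abelian_monoid.lsum_closed abelian_group.axioms(1) assms(1)) auto

lemma tensor_lift_append:
  assumes "abelian_group W" "balanced L K V W B" "ts \<in> formal_sums L V" "us \<in> formal_sums L V"
  shows "tensor_lift W B (ts @ us) = tensor_lift W B ts \<oplus>\<^bsub>W\<^esub> tensor_lift W B us"
  unfolding tensor_lift_def
  using assms(3,4) balancedD(1)[OF assms(2)]
  by (intro abelian_monoid.lsum_append abelian_group.axioms(1) assms(1)) auto

lemma tensor_lift_cong: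
  "\<lbrakk>\<And>a v. \<lbrakk>a \<in> carrier L; v \<in> carrier V\<rbrakk> \<Longrightarrow> B a v = B' a v; ts \<in> formal_sums L V\<rbrakk>
    \<Longrightarrow> tensor_lift W B ts = tensor_lift W B' ts"
  unfolding tensor_lift_def by (intro lsum_cong) auto

lemma tensor_lift_eq:
  assumes "tensor_eq L K V ts us" and W: "abelian_group W" and B: "balanced L K V W B"
  shows "tensor_lift W B ts = tensor_lift W B us"
  using assms(1)
proof (induction rule: tensor_eq.induct)
  interpret W: abelian_group W by (rule W)
  note c = balancedD(1)[OF B]
  {
    case (swap ts l v l' v')
    then have "tensor_lift W B ts \<in> carrier W" using tensor_lift_closed[OF W B] by simp
    then show ?case using swap c by (simp add: W.a_lcomm)
  next
    case (zero v)
    have "B \<zero>\<^bsub>L\<^esub> v \<oplus>\<^bsub>W\<^esub> B \<zero>\<^bsub>L\<^esub> v = B \<zero>\<^bsub>L\<^esub> v"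
      using balancedD(2)[OF B, of "\<zero>\<^bsub>L\<^esub>" "\<zero>\<^bsub>L\<^esub>" v] zero by simp
    then have "B \<zero>\<^bsub>L\<^esub> v = \<zero>\<^bsub>W\<^esub>" using c[of "\<zero>\<^bsub>L\<^esub>" v] zero W.add.r_cancel_one' L.zero_closed by metis
    then show ?case by simp
  next
    case (add_l l l' v)
    then show ?case using balancedD(2)[OF B, of l l' v] c by simp
  next
    case (add_r l v v')
    then show ?case using balancedD(3)[OF B, of l v v'] c by simp
  next
    case (scal l k v)
    then show ?case using balancedD(4)[OF B, of l k v] c by simp
  next
    case (append ts us ws)
    then show ?case using tensor_eq_formal_sums[OF append(1)] tensor_lift_append[OF W B] by simp
  }
qed auto

lemma tensor_eq_append_left:
  assumes "tensor_eq L K V ts us" "ws \<in> formal_sums L V"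
  shows "tensor_eq L K V (ws @ ts) (ws @ us)"
  using assms(2) by (induction ws) (auto intro: tensor_eq.cong assms(1))

lemma tensor_eq_append2:
  assumes "tensor_eq L K V ts us" "tensor_eq L K V ts' us'"
  shows "tensor_eq L K V (ts @ ts') (us @ us')"
  using tensor_eq.append[OF assms(1), of ts'] tensor_eq_append_left[OF assms(2), of us]
    tensor_eq_formal_sums[OF assms(1)] tensor_eq_formal_sums[OF assms(2)]
  by (auto intro: tensor_eq.trans)

lemma tensor_eq_move:
  assumes "ts \<in> formal_sums L V" "us \<in> formal_sums L V" "a \<in> carrier L" "v \<in> carrier V"
  shows "tensor_eq L K V (ts @ (a, v) # us) ((a, v) # ts @ us)"
  using assms(1)
proof (induction ts)
  case Nil
  then show ?case using assms by (simp add: tensor_eq.refl)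
next
  case (Cons p ts)
  obtain b w where p: "p = (b, w)" by (cases p)
  have "tensor_eq L K V ((b, w) # ts @ (a, v) # us) ((b, w) # (a, v) # ts @ us)"
    using Cons p by (intro tensor_eq.cong) auto
  also have "tensor_eq L K V \<dots> ((a, v) # (b, w) # ts @ us)"
    using Cons p assms by (intro tensor_eq.swap) auto
  finally show ?case by (simp add: p)
qed

lemma tensor_eq_merge:
  assumes "\<And>i. i \<in> set J \<Longrightarrow> y i \<in> carrier L" "\<And>i. i \<in> set J \<Longrightarrow> v i \<in> carrier V"
    "\<And>i. i \<in> set J \<Longrightarrow> w i \<in> carrier V"
  shows "tensor_eq L K V (map (\<lambda>i. (y i, v i)) J @ map (\<lambda>i. (y i, w i)) J)
    (map (\<lambda>i. (y i, v i \<oplus>\<^bsub>V\<^esub> w i)) J)"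
  using assms
proof (induction J)
  case Nil
  then show ?case by (auto intro: tensor_eq.refl)
next
  case (Cons j J)
  let ?v = "map (\<lambda>i. (y i, v i)) J" and ?w = "map (\<lambda>i. (y i, w i)) J"
  have vw: "?v \<in> formal_sums L V" "?w \<in> formal_sums L V" using Cons by auto
  have "tensor_eq L K V ((y j, v j) # ?v @ (y j, w j) # ?w) ((y j, v j) # (y j, w j) # ?v @ ?w)"
    using Cons vw by (intro tensor_eq.cong tensor_eq_move) auto
  also have "tensor_eq L K V \<dots> ((y j, v j) # (y j, w j) # map (\<lambda>i. (y i, v i \<oplus>\<^bsub>V\<^esub> w i)) J)"
    using Cons by (intro tensor_eq.cong) auto
  also have "\<dots> = [(y j, v j), (y j, w j)] @ map (\<lambda>i. (y i, v i \<oplus>\<^bsub>V\<^esub> w i)) J" by simp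
  also have "tensor_eq L K V \<dots> ([(y j, v j \<oplus>\<^bsub>V\<^esub> w j)] @ map (\<lambda>i. (y i, v i \<oplus>\<^bsub>V\<^esub> w i)) J)"
    using Cons by (intro tensor_eq.append[OF tensor_eq.sym[OF tensor_eq.add_r]]) auto
  finally show ?case by simp
qed

lemma tensor_eq_lsum:
  assumes "\<And>i. i \<in> set J \<Longrightarrow> f i \<in> carrier L" "v \<in> carrier V"
  shows "tensor_eq L K V [(lsum L f J, v)] (map (\<lambda>i. (f i, v)) J)"
  using assms(1)
proof (induction J)
  case Nil
  then show ?case using tensor_eq.zero[OF assms(2)] by simp
next
  case (Cons j J)
  have "tensor_eq L K V [(f j \<oplus>\<^bsub>L\<^esub> lsum L f J, v)] [(f j, v), (lsum L f J, v)]"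
    using Cons assms(2) by (intro tensor_eq.add_l L.lsum_closed) auto
  also have "tensor_eq L K V \<dots> ((f j, v) # map (\<lambda>i. (f i, v)) J)"
    using Cons assms(2) by (intro tensor_eq.cong) auto
  finally show ?case by simp
qed

lemma tensor_eq_map_scal:
  assumes "\<And>i. i \<in> set J \<Longrightarrow> y i \<in> carrier L" "\<And>i. i \<in> set J \<Longrightarrow> k i \<in> K" "v \<in> carrier V"
  shows "tensor_eq L K V (map (\<lambda>i. (y i \<otimes>\<^bsub>L\<^esub> k i, v)) J) (map (\<lambda>i. (y i, k i \<odot>\<^bsub>V\<^esub> v)) J)"
  using assms(1,2)
proof (induction J)
  case Nil
  then show ?case by (auto intro: tensor_eq.refl)
next
  case (Cons j J)
  have "tensor_eq L K V ([(y j \<otimes>\<^bsub>L\<^esub> k j, v)] @ map (\<lambda>i. (y i \<otimes>\<^bsub>L\<^esub> k i, v)) J)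
    ([(y j, k j \<odot>\<^bsub>V\<^esub> v)] @ map (\<lambda>i. (y i, k i \<odot>\<^bsub>V\<^esub> v)) J)"
    using Cons assms(3) by (intro tensor_eq_append2 tensor_eq.scal) auto
  then show ?case by simp
qed

definition coord :: "'i \<Rightarrow> ('l \<times> 'u) list \<Rightarrow> 'u" where
  "coord i ts = tensor_lift V (\<lambda>a v. t i a \<odot>\<^bsub>V\<^esub> v) ts"

lemma balanced_coord: "i \<in> set I \<Longrightarrow> balanced L K V V (\<lambda>a v. t i a \<odot>\<^bsub>V\<^esub> v)"
  using V.smult_l_distr V.smult_r_distr V.smult_assoc1
  by (intro balancedI) (auto simp: t_closed t_add t_scal)

lemma coord_closed: "\<lbrakk>i \<in> set I; ts \<in> formal_sums L V\<rbrakk> \<Longrightarrow> coord i ts \<in> carrier V"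
  unfolding coord_def by (intro tensor_lift_closed balanced_coord V.abelian_group_axioms)

lemma coord_Cons: "coord i ((a, v) # ts) = t i a \<odot>\<^bsub>V\<^esub> v \<oplus>\<^bsub>V\<^esub> coord i ts"
  by (simp add: coord_def)

text \<open>Expanding the left factors in the frame, \<open>\<Sum> a \<otimes> v = \<Sum>\<^sub>i x\<^sub>i \<otimes> (\<Sum> t\<^sub>i(a) v)\<close>.\<close>

lemma tensor_eq_coord:
  assumes "ts \<in> formal_sums L V"
  shows "tensor_eq L K V ts (map (\<lambda>i. (x i, coord i ts)) I)"
  using assms
proof (induction ts)
  case Nil
  have "tensor_eq L K V (map (\<lambda>i. (x i, \<zero>\<^bsub>V\<^esub>)) J) []" if "set J \<subseteq> set I" for J
    using that
  proof (induction J)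
    case (Cons j J)
    have "tensor_eq L K V [(x j, \<zero>\<^bsub>L\<^esub> \<odot>\<^bsub>V\<^esub> \<zero>\<^bsub>V\<^esub>)] [(x j \<otimes>\<^bsub>L\<^esub> \<zero>\<^bsub>L\<^esub>, \<zero>\<^bsub>V\<^esub>)]"
      using Cons x_closed V.R.zero_closed by (intro tensor_eq.sym[OF tensor_eq.scal]) auto
    moreover have "tensor_eq L K V [(x j \<otimes>\<^bsub>L\<^esub> \<zero>\<^bsub>L\<^esub>, \<zero>\<^bsub>V\<^esub>)] []"
      using Cons x_closed tensor_eq.zero[of "\<zero>\<^bsub>V\<^esub>" V L K] by simp
    ultimately have "tensor_eq L K V [(x j, \<zero>\<^bsub>V\<^esub>)] []"
      using V.smult_l_null[of "\<zero>\<^bsub>V\<^esub>"] by (auto intro: tensor_eq.trans)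
    from tensor_eq_append2[OF this Cons.IH] show ?case using Cons by simp
  qed (auto intro: tensor_eq.refl)
  then show ?case by (auto simp: coord_def intro: tensor_eq.sym)
next
  case (Cons p ts)
  obtain a v where p: "p = (a, v)" by (cases p)
  have av: "a \<in> carrier L" "v \<in> carrier V" and ts: "ts \<in> formal_sums L V" using Cons p by auto
  have "tensor_eq L K V [(a, v)] (map (\<lambda>i. (x i \<otimes>\<^bsub>L\<^esub> t i a, v)) I)"
    using tensor_eq_lsum[of I "\<lambda>i. x i \<otimes>\<^bsub>L\<^esub> t i a" v] av frame[OF av(1)] x_closed t_closed K_carrier by simp
  also have "tensor_eq L K V \<dots> (map (\<lambda>i. (x i, t i a \<odot>\<^bsub>V\<^esub> v)) I)"
    using av by (intro tensor_eq_map_scal x_closed t_closed)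
  finally have 1: "tensor_eq L K V [(a, v)] (map (\<lambda>i. (x i, t i a \<odot>\<^bsub>V\<^esub> v)) I)" .
  have "tensor_eq L K V ([(a, v)] @ ts)
    (map (\<lambda>i. (x i, t i a \<odot>\<^bsub>V\<^esub> v)) I @ map (\<lambda>i. (x i, coord i ts)) I)"
    using Cons ts by (intro tensor_eq_append2 1) auto
  also have "tensor_eq L K V \<dots> (map (\<lambda>i. (x i, t i a \<odot>\<^bsub>V\<^esub> v \<oplus>\<^bsub>V\<^esub> coord i ts)) I)"
    using av t_closed by (intro tensor_eq_merge x_closed coord_closed ts V.smult_closed) auto
  finally show ?case by (simp add: p coord_Cons)
qed

text \<open>The coordinates of a frame separate tensors, although they need not be independent.\<close>

lemma tensor_eq_iff_coord:
  assumes "ts \<in> formal_sums L V" "us \<in> formal_sums L V"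
  shows "tensor_eq L K V ts us \<longleftrightarrow> (\<forall>i \<in> set I. coord i ts = coord i us)"
proof
  assume "tensor_eq L K V ts us"
  then show "\<forall>i \<in> set I. coord i ts = coord i us"
    unfolding coord_def using tensor_lift_eq V.abelian_group_axioms balanced_coord by blast
next
  assume "\<forall>i \<in> set I. coord i ts = coord i us"
  then have "map (\<lambda>i. (x i, coord i ts)) I = map (\<lambda>i. (x i, coord i us)) I" by simp
  then show "tensor_eq L K V ts us"
    using tensor_eq_coord[OF assms(1)] tensor_eq_coord[OF assms(2)]
    by (metis tensor_eq.sym tensor_eq.trans)
qed

lemma tensor_class_eq_iff:
  assumes "ts \<in> formal_sums L V"
  shows "tensor_class L K V ts = tensor_class L K V us \<longleftrightarrow> tensor_eq L K V ts us"
proof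
  assume "tensor_class L K V ts = tensor_class L K V us"
  then have "ts \<in> tensor_class L K V us"
    using tensor_eq.refl[of ts L V K] assms unfolding tensor_class_def by auto
  then show "tensor_eq L K V ts us" unfolding tensor_class_def by (auto intro: tensor_eq.sym)
next
  assume e: "tensor_eq L K V ts us"
  show "tensor_class L K V ts = tensor_class L K V us"
    unfolding tensor_class_def using tensor_eq.trans[OF e] tensor_eq.trans[OF tensor_eq.sym[OF e]] by blast
qed

lemma tensor_class_self: "ts \<in> formal_sums L V \<Longrightarrow> ts \<in> tensor_class L K V ts"
  unfolding tensor_class_def by (auto intro: tensor_eq.refl)

lemma tensor_classD: "us \<in> tensor_class L K V ts \<Longrightarrow> tensor_eq L K V ts us \<and> us \<in> formal_sums L V"
  using tensor_eq_formal_sums unfolding tensor_class_def by blast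

lemma tensor_carrier: "carrier (tensor L K V) = tensor_class L K V ` formal_sums L V"
  unfolding tensor_def by auto

lemma tensor_zero: "\<zero>\<^bsub>tensor L K V\<^esub> = tensor_class L K V []"
  by (simp add: tensor_def)

lemma tensor_add:
  assumes ts: "ts \<in> formal_sums L V" and us: "us \<in> formal_sums L V"
  shows "tensor_class L K V ts \<oplus>\<^bsub>tensor L K V\<^esub> tensor_class L K V us = tensor_class L K V (ts @ us)"
proof -
  have eq: "tensor_class L K V (ts' @ us') = tensor_class L K V (ts @ us)"
    if "ts' \<in> tensor_class L K V ts" "us' \<in> tensor_class L K V us" for ts' us'
    using tensor_eq_append2[of ts ts' us us'] tensor_classD[OF that(1)] tensor_classD[OF that(2)] ts us
      tensor_class_eq_iff[of "ts @ us" "ts' @ us'"] by auto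
  have "(\<Union>ts' \<in> tensor_class L K V ts. \<Union>us' \<in> tensor_class L K V us. tensor_class L K V (ts' @ us')) =
    tensor_class L K V (ts @ us)"
    by (intro equalityI UN_least equalityD1[OF eq])
      (assumption, assumption, use tensor_class_self[OF ts] tensor_class_self[OF us] in blast)
  then show ?thesis by (simp add: tensor_def)
qed

end

definition linear_on_L :: "('l \<Rightarrow> 'l) \<Rightarrow> bool" where
  "linear_on_L g \<longleftrightarrow> (\<forall>a \<in> carrier L. g a \<in> carrier L) \<and>
     (\<forall>a \<in> carrier L. \<forall>b \<in> carrier L. g (a \<oplus>\<^bsub>L\<^esub> b) = g a \<oplus>\<^bsub>L\<^esub> g b) \<and>
     (\<forall>a \<in> carrier L. \<forall>k \<in> K. g (a \<otimes>\<^bsub>L\<^esub> k) = g a \<otimes>\<^bsub>L\<^esub> k)"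

lemma linear_on_L_id: "linear_on_L id"
  by (simp add: linear_on_L_def)

lemma linear_on_L_mult: "l \<in> carrier L \<Longrightarrow> linear_on_L (\<lambda>a. l \<otimes>\<^bsub>L\<^esub> a)"
  by (auto simp: linear_on_L_def L.r_distr L.m_assoc K_carrier)

lemma map_prod_formal_sums:
  assumes "linear_on_L g" "f \<in> carrier V \<rightarrow> carrier V'" "ts \<in> formal_sums L V"
  shows "map (map_prod g f) ts \<in> formal_sums L V'"
  using assms by (auto simp: linear_on_L_def)

lemma tensor_lift_map:
  "tensor_lift W B (map (map_prod g f) ts) = tensor_lift W (\<lambda>a v. B (g a) (f v)) ts"
  by (simp add: tensor_lift_def lsum_map)

lemma balanced_map:
  assumes g: "linear_on_L g" and f: "f \<in> mod_hom RK V V'" and B: "balanced L K V' W B"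
  shows "balanced L K V W (\<lambda>a v. B (g a) (f v))"
  using g balancedD[OF B] mod_homD[OF f] by (intro balancedI) (auto simp: linear_on_L_def)

lemma tensor_eq_map:
  assumes V: "module RK V" and V': "module RK V'" and g: "linear_on_L g" and f: "f \<in> mod_hom RK V V'"
    and eq: "tensor_eq L K V ts us"
  shows "tensor_eq L K V' (map (map_prod g f) ts) (map (map_prod g f) us)"
proof (rule tensor_eq_iff_coord[OF V', THEN iffD2])
  have f': "f \<in> carrier V \<rightarrow> carrier V'" using mod_homD(1)[OF f] by blast
  note w = tensor_eq_formal_sums[OF V eq]
  show "map (map_prod g f) ts \<in> formal_sums L V'" "map (map_prod g f) us \<in> formal_sums L V'"
    using map_prod_formal_sums[OF g f'] w by blast+
  show "\<forall>i \<in> set I. coord V' i (map (map_prod g f) ts) = coord V' i (map (map_prod g f) us)"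
    unfolding coord_def[OF V'] tensor_lift_map
    using tensor_lift_eq[OF V eq module.axioms(2)[OF V'] balanced_map[OF g f balanced_coord[OF V']]]
    by blast
qed

lemma tensor_map_class:
  assumes V: "module RK V" and V': "module RK V'" and g: "linear_on_L g" and f: "f \<in> mod_hom RK V V'"
    and ts: "ts \<in> formal_sums L V"
  shows "tensor_map L K V' g f (tensor_class L K V ts) = tensor_class L K V' (map (map_prod g f) ts)"
proof -
  have f': "f \<in> carrier V \<rightarrow> carrier V'" using mod_homD(1)[OF f] by blast
  have eq: "tensor_class L K V' (map (map_prod g f) us) = tensor_class L K V' (map (map_prod g f) ts)"
    if "us \<in> tensor_class L K V ts" for us
    using tensor_class_eq_iff[OF V' map_prod_formal_sums[OF g f' ts]]
      tensor_eq_map[OF V V' g f, of ts us] tensor_classD[OF V that] by blast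
  show ?thesis
    unfolding tensor_map_def
    by (intro equalityI UN_least equalityD1[OF eq]) (assumption, use tensor_class_self[OF V ts] in blast)
qed

lemma tensor_smult:
  assumes V: "module RK V" and l: "l \<in> carrier L" and ts: "ts \<in> formal_sums L V"
  shows "l \<odot>\<^bsub>tensor L K V\<^esub> tensor_class L K V ts =
    tensor_class L K V (map (map_prod (\<lambda>a. l \<otimes>\<^bsub>L\<^esub> a) id) ts)"
proof -
  have "id \<in> mod_hom RK V V" by (simp add: mod_hom_def)
  from tensor_map_class[OF V V linear_on_L_mult[OF l] this ts] show ?thesis
    by (simp add: tensor_def tensor_map_def)
qed

text \<open>Both sides of each axiom are classes of formal sums, which are compared by rearranging and merging
  their terms.\<close>

lemma tensor_module:
  assumes V: "module RK V"
  shows "module L (tensor L K V)"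
proof -
  interpret V: module RK V by (rule V)
  let ?T = "tensor L K V" and ?c = "tensor_class L K V"
  let ?s = "\<lambda>l. map (map_prod (\<lambda>a. l \<otimes>\<^bsub>L\<^esub> a) id) :: ('l \<times> 'b) list \<Rightarrow> ('l \<times> 'b) list"
  note car = tensor_carrier[OF V] and add = tensor_add[OF V] and smult = tensor_smult[OF V]
  have rep: "\<exists>ts. A = ?c ts \<and> ts \<in> formal_sums L V" if "A \<in> carrier ?T" for A
    using that unfolding car by (rule imageE) blast
  have eqI: "?c ts = ?c us"
    if "ts \<in> formal_sums L V" "us \<in> formal_sums L V" "\<And>i. i \<in> set I \<Longrightarrow> coord V i ts = coord V i us" for ts us
    using tensor_class_eq_iff[OF V that(1)] tensor_eq_iff_coord[OF V that(1,2)] that(3) by blast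
  have app: "coord V i (ts @ us) = coord V i ts \<oplus>\<^bsub>V\<^esub> coord V i us"
    if "i \<in> set I" "ts \<in> formal_sums L V" "us \<in> formal_sums L V" for i ts us
    unfolding coord_def[OF V]
    using tensor_lift_append[OF V V.abelian_group_axioms balanced_coord[OF V]] that by blast
  note cc = coord_closed[OF V]
  have sw: "?s l ts \<in> formal_sums L V" if "l \<in> carrier L" "ts \<in> formal_sums L V" for l ts
    using that by auto
  have cs: "coord V i (?s l ts) = tensor_lift V (\<lambda>a v. t i (l \<otimes>\<^bsub>L\<^esub> a) \<odot>\<^bsub>V\<^esub> v) ts" for i l ts
    by (simp add: coord_def[OF V] tensor_lift_map)
  show ?thesis
  proof (rule moduleI)
    show "cring L" by (rule L.is_cring)
    show "abelian_group ?T"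
    proof (rule abelian_groupI)
      fix A B assume AB: "A \<in> carrier ?T" "B \<in> carrier ?T"
      obtain ts us where *: "A = ?c ts" "B = ?c us" "ts \<in> formal_sums L V" "us \<in> formal_sums L V"
        using rep[OF AB(1)] rep[OF AB(2)] by blast
      show "A \<oplus>\<^bsub>?T\<^esub> B \<in> carrier ?T"
        unfolding *(1,2) add[OF *(3,4)] car using *(3,4) by simp
      show "A \<oplus>\<^bsub>?T\<^esub> B = B \<oplus>\<^bsub>?T\<^esub> A"
        unfolding * add[OF *(3,4)] add[OF *(4,3)]
        using * by (intro eqI) (auto simp: app cc V.a_comm)
    next
      show "\<zero>\<^bsub>?T\<^esub> \<in> carrier ?T" using car tensor_zero[OF V] by auto
    next
      fix A B C assume ABC: "A \<in> carrier ?T" "B \<in> carrier ?T" "C \<in> carrier ?T"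
      obtain ts us ws where *: "A = ?c ts" "B = ?c us" "C = ?c ws" "ts \<in> formal_sums L V"
        "us \<in> formal_sums L V" "ws \<in> formal_sums L V"
        using rep[OF ABC(1)] rep[OF ABC(2)] rep[OF ABC(3)] by blast
      show "A \<oplus>\<^bsub>?T\<^esub> B \<oplus>\<^bsub>?T\<^esub> C = A \<oplus>\<^bsub>?T\<^esub> (B \<oplus>\<^bsub>?T\<^esub> C)"
        using add[OF *(4,5)] add[OF *(5,6)] add[of "ts @ us" ws] add[of ts "us @ ws"] *(4-6)
        unfolding *(1-3) by simp
    next
      fix A assume "A \<in> carrier ?T"
      then obtain ts where *: "A = ?c ts" "ts \<in> formal_sums L V" using rep by blast
      then show "\<zero>\<^bsub>?T\<^esub> \<oplus>\<^bsub>?T\<^esub> A = A" using add[of "[]" ts] tensor_zero[OF V] by simp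
      let ?n = "map (\<lambda>i. (x i, \<ominus>\<^bsub>V\<^esub> coord V i ts)) I" and ?m = "map (\<lambda>i. (x i, coord V i ts)) I"
      have n: "?n \<in> formal_sums L V" "?m \<in> formal_sums L V" using *(2) by (auto simp: x_closed cc)
      have "?c ts = ?c ?m" using tensor_class_eq_iff[OF V *(2)] tensor_eq_coord[OF V *(2)] by blast
      moreover have "?c (?n @ ?m) = ?c []"
      proof -
        have "tensor_eq L K V (?n @ ?m) (map (\<lambda>i. (x i, \<ominus>\<^bsub>V\<^esub> coord V i ts \<oplus>\<^bsub>V\<^esub> coord V i ts)) I)"
          using *(2) by (intro tensor_eq_merge[OF V]) (auto simp: x_closed cc)
        moreover have "map (\<lambda>i. (x i, \<ominus>\<^bsub>V\<^esub> coord V i ts \<oplus>\<^bsub>V\<^esub> coord V i ts)) I = map (\<lambda>i. (x i, coord V i [])) I"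
          using V.l_neg[OF cc[OF _ *(2)]] by (simp add: coord_def[OF V, of _ "[]"])
        ultimately have "tensor_eq L K V (?n @ ?m) []"
          using tensor_eq_coord[OF V, of "[]"] by (auto intro: tensor_eq.sym tensor_eq.trans)
        then show ?thesis using tensor_class_eq_iff[OF V, of "?n @ ?m"] n by auto
      qed
      ultimately have "?c ?n \<oplus>\<^bsub>?T\<^esub> A = \<zero>\<^bsub>?T\<^esub>" using add[OF n] *(1) tensor_zero[OF V] by simp
      then show "\<exists>B \<in> carrier ?T. B \<oplus>\<^bsub>?T\<^esub> A = \<zero>\<^bsub>?T\<^esub>" using n(1) unfolding car by blast
    qed
  next
    fix l A assume l: "l \<in> carrier L" and "A \<in> carrier ?T"
    then obtain ts where *: "A = ?c ts" "ts \<in> formal_sums L V" using rep by blast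
    then show "l \<odot>\<^bsub>?T\<^esub> A \<in> carrier ?T" using smult[OF l *(2)] sw[OF l *(2)] car by simp
  next
    fix l l' A assume l: "l \<in> carrier L" "l' \<in> carrier L" and "A \<in> carrier ?T"
    then obtain ts where *: "A = ?c ts" "ts \<in> formal_sums L V" using rep by blast
    have "coord V i (?s (l \<oplus>\<^bsub>L\<^esub> l') ts) = coord V i (?s l ts @ ?s l' ts)" if i: "i \<in> set I" for i
    proof -
      have "tensor_lift V (\<lambda>a v. t i ((l \<oplus>\<^bsub>L\<^esub> l') \<otimes>\<^bsub>L\<^esub> a) \<odot>\<^bsub>V\<^esub> v) ts =
        tensor_lift V (\<lambda>a v. t i (l \<otimes>\<^bsub>L\<^esub> a) \<odot>\<^bsub>V\<^esub> v \<oplus>\<^bsub>V\<^esub> t i (l' \<otimes>\<^bsub>L\<^esub> a) \<odot>\<^bsub>V\<^esub> v) ts"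
        using i l *(2) V.smult_l_distr
        by (intro tensor_lift_cong[OF V]) (auto simp: L.l_distr t_add t_closed)
      also have "\<dots> = tensor_lift V (\<lambda>a v. t i (l \<otimes>\<^bsub>L\<^esub> a) \<odot>\<^bsub>V\<^esub> v) ts \<oplus>\<^bsub>V\<^esub>
          tensor_lift V (\<lambda>a v. t i (l' \<otimes>\<^bsub>L\<^esub> a) \<odot>\<^bsub>V\<^esub> v) ts"
        unfolding tensor_lift_def using i l *(2) t_closed by (intro V.lsum_add) (auto intro!: V.smult_closed)
      finally show ?thesis using cs app[OF i sw[OF l(1) *(2)] sw[OF l(2) *(2)]] by simp
    qed
    then show "(l \<oplus>\<^bsub>L\<^esub> l') \<odot>\<^bsub>?T\<^esub> A = l \<odot>\<^bsub>?T\<^esub> A \<oplus>\<^bsub>?T\<^esub> l' \<odot>\<^bsub>?T\<^esub> A"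
      unfolding *(1) smult[OF l(1) *(2)] smult[OF l(2) *(2)] smult[OF L.a_closed[OF l] *(2)]
        add[OF sw[OF l(1) *(2)] sw[OF l(2) *(2)]]
      using sw[OF l(1) *(2)] sw[OF l(2) *(2)] sw[OF L.a_closed[OF l] *(2)] by (intro eqI) auto
  next
    fix l A B assume l: "l \<in> carrier L" and AB: "A \<in> carrier ?T" "B \<in> carrier ?T"
    obtain ts us where *: "A = ?c ts" "B = ?c us" "ts \<in> formal_sums L V" "us \<in> formal_sums L V"
      using rep[OF AB(1)] rep[OF AB(2)] by blast
    have "l \<odot>\<^bsub>?T\<^esub> ?c (ts @ us) = ?c (?s l ts @ ?s l us)"
      using smult[OF l, of "ts @ us"] *(3,4) by simp
    then show "l \<odot>\<^bsub>?T\<^esub> (A \<oplus>\<^bsub>?T\<^esub> B) = l \<odot>\<^bsub>?T\<^esub> A \<oplus>\<^bsub>?T\<^esub> l \<odot>\<^bsub>?T\<^esub> B"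
      unfolding *(1,2) add[OF *(3,4)] smult[OF l *(3)] smult[OF l *(4)]
        add[OF sw[OF l *(3)] sw[OF l *(4)]] .
  next
    fix l l' A assume l: "l \<in> carrier L" "l' \<in> carrier L" and "A \<in> carrier ?T"
    then obtain ts where *: "A = ?c ts" "ts \<in> formal_sums L V" using rep by blast
    have e: "?s (l \<otimes>\<^bsub>L\<^esub> l') ts = ?s l (?s l' ts)"
      unfolding map_map using *(2) l by (intro map_cong[OF HOL.refl]) (force simp: L.m_assoc)
    show "(l \<otimes>\<^bsub>L\<^esub> l') \<odot>\<^bsub>?T\<^esub> A = l \<odot>\<^bsub>?T\<^esub> (l' \<odot>\<^bsub>?T\<^esub> A)"
      unfolding *(1) smult[OF L.m_closed[OF l] *(2)] smult[OF l(2) *(2)] smult[OF l(1) sw[OF l(2) *(2)]] e ..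
  next
    fix A assume "A \<in> carrier ?T"
    then obtain ts where *: "A = ?c ts" "ts \<in> formal_sums L V" using rep by blast
    have "?s \<one>\<^bsub>L\<^esub> ts = ts" using *(2) by (intro map_idI) auto
    then show "\<one>\<^bsub>L\<^esub> \<odot>\<^bsub>?T\<^esub> A = A" unfolding *(1) smult[OF L.one_closed *(2)] by simp
  qed
qed

end


section \<open>Galois descent for vector spaces\<close>

locale galois_extension =
  fixes L :: "'l ring" and K :: "'l set"
  assumes galois: "finite_galois_extension L K"
begin

abbreviation "G \<equiv> galois_group L K"

lemma field_L: "field L" and subfield_K: "subfield K L"
  and finite_dimension_L: "ring.finite_dimension L K (carrier L)"
  using galois unfolding finite_galois_extension_def by blast+

sublocale L: field L by (rule field_L)

lemma fixed_field: "x \<in> carrier L \<Longrightarrow> (\<And>g. g \<in> G \<Longrightarrow> g x = x) \<Longrightarrow> x \<in> K"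
  using galois unfolding finite_galois_extension_def by blast

lemma K_carrier: "k \<in> K \<Longrightarrow> k \<in> carrier L"
  using subfieldE(3)[OF subfield_K] by blast

lemma G_closed: "\<lbrakk>g \<in> G; a \<in> carrier L\<rbrakk> \<Longrightarrow> g a \<in> carrier L"
  unfolding galois_group_def ring_hom_def by blast

lemma G_add: "\<lbrakk>g \<in> G; a \<in> carrier L; b \<in> carrier L\<rbrakk> \<Longrightarrow> g (a \<oplus>\<^bsub>L\<^esub> b) = g a \<oplus>\<^bsub>L\<^esub> g b"
  unfolding galois_group_def ring_hom_def by blast

lemma G_mult: "\<lbrakk>g \<in> G; a \<in> carrier L; b \<in> carrier L\<rbrakk> \<Longrightarrow> g (a \<otimes>\<^bsub>L\<^esub> b) = g a \<otimes>\<^bsub>L\<^esub> g b"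
  unfolding galois_group_def ring_hom_def by blast

lemma G_one: "g \<in> G \<Longrightarrow> g \<one>\<^bsub>L\<^esub> = \<one>\<^bsub>L\<^esub>"
  unfolding galois_group_def ring_hom_def by blast

lemma G_fix: "\<lbrakk>g \<in> G; k \<in> K\<rbrakk> \<Longrightarrow> g k = k"
  unfolding galois_group_def by blast

lemma K_zero: "\<zero>\<^bsub>L\<^esub> \<in> K"
  using subringE(2)[OF subfieldE(1)[OF subfield_K]] .

lemma K_one: "\<one>\<^bsub>L\<^esub> \<in> K"
  using subringE(3)[OF subfieldE(1)[OF subfield_K]] .

lemma G_zero: "g \<in> G \<Longrightarrow> g \<zero>\<^bsub>L\<^esub> = \<zero>\<^bsub>L\<^esub>"
  using G_fix[OF _ K_zero] .

lemma G_permutes: "g \<in> G \<Longrightarrow> g permutes carrier L"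
  unfolding galois_group_def by blast

lemma G_inj: "\<lbrakk>g \<in> G; g a = g b\<rbrakk> \<Longrightarrow> a = b"
  using permutes_inj[OF G_permutes] by (auto dest: injD)

lemma G_eqI:
  assumes "g \<in> G" "h \<in> G" "\<And>a. a \<in> carrier L \<Longrightarrow> g a = h a"
  shows "g = h"
proof
  show "g a = h a" for a
    using assms(3) permutes_not_in[OF G_permutes[OF assms(1)]] permutes_not_in[OF G_permutes[OF assms(2)]]
    by (cases "a \<in> carrier L") auto
qed

lemma G_id: "id \<in> G"
  unfolding galois_group_def by (auto simp: permutes_id ring_hom_def)

lemma G_comp:
  assumes g: "g \<in> G" and h: "h \<in> G"
  shows "g \<circ> h \<in> G"
  using permutes_compose[OF G_permutes[OF h] G_permutes[OF g]] G_closed[OF g] G_closed[OF h]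
    G_mult[OF g] G_mult[OF h] G_add[OF g] G_add[OF h] G_one[OF g] G_one[OF h] G_fix[OF g] G_fix[OF h]
  unfolding galois_group_def[of L K] ring_hom_def[of L L] by simp

lemma G_inv_apply: "g \<in> G \<Longrightarrow> g (inv_into UNIV g a) = a" "g \<in> G \<Longrightarrow> inv_into UNIV g (g a) = a"
  using permutes_inverses[OF G_permutes] by auto

lemma G_inv:
  assumes g: "g \<in> G"
  shows "inv_into UNIV g \<in> G"
proof -
  have p: "inv_into UNIV g permutes carrier L" using permutes_inv[OF G_permutes[OF g]] .
  note c = permutes_in_image[OF p]
  have "inv_into UNIV g (a \<oplus>\<^bsub>L\<^esub> b) = inv_into UNIV g a \<oplus>\<^bsub>L\<^esub> inv_into UNIV g b" if "a \<in> carrier L" "b \<in> carrier L" for a b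
    by (rule G_inj[OF g]) (use that c in \<open>simp add: G_add[OF g] G_inv_apply(1)[OF g]\<close>)
  moreover have "inv_into UNIV g (a \<otimes>\<^bsub>L\<^esub> b) = inv_into UNIV g a \<otimes>\<^bsub>L\<^esub> inv_into UNIV g b" if "a \<in> carrier L" "b \<in> carrier L" for a b
    by (rule G_inj[OF g]) (use that c in \<open>simp add: G_mult[OF g] G_inv_apply(1)[OF g]\<close>)
  moreover have "inv_into UNIV g k = k" if "k \<in> K" for k
    by (rule G_inj[OF g]) (use that in \<open>simp add: G_fix[OF g] G_inv_apply(1)[OF g]\<close>)
  ultimately show ?thesis
    unfolding galois_group_def ring_hom_def using p c K_one by simp
qed

lemma G_lsum:
  assumes "g \<in> G" "\<And>i. i \<in> set is \<Longrightarrow> f i \<in> carrier L"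
  shows "g (lsum L f is) = lsum L (\<lambda>i. g (f i)) is"
  using assms by (intro lsum_hom L.abelian_monoid_axioms G_zero G_add)

lemma G_pow: "\<lbrakk>g \<in> G; a \<in> carrier L\<rbrakk> \<Longrightarrow> g (a [^]\<^bsub>L\<^esub> (n :: nat)) = g a [^]\<^bsub>L\<^esub> n"
  by (induction n) (auto simp: G_one G_mult)

lemma G_eval:
  assumes g: "g \<in> G" and p: "set p \<subseteq> K" and a: "a \<in> carrier L"
  shows "g (L.eval p a) = L.eval p (g a)"
  using p
proof (induction p)
  case (Cons k p)
  then have "set p \<subseteq> carrier L" "k \<in> carrier L" using K_carrier by auto
  then show ?case
    using Cons g a L.eval_in_carrier[of p a] by (simp add: G_add G_mult G_pow G_fix)
qed (simp add: G_zero g)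

text \<open>An automorphism is determined by the images of a finite spanning set, and each of these images is a
  root of a fixed nonzero polynomial over \<open>K\<close>.\<close>

lemma finite_G: "finite G"
proof -
  obtain us where us: "set us \<subseteq> carrier L" and span: "L.Span K us = carrier L"
    using L.exists_base[OF subfield_K] finite_dimension_L by blast
  define roots where "roots u = {b. \<exists>g \<in> G. b = g u}" for u
  have fin: "finite (roots u)" if u: "u \<in> carrier L" for u
  proof -
    have "(L.algebraic over K) u"
      by (rule L.finite_dimension_imp_algebraic[OF subfield_K L.carrier_is_subring finite_dimension_L u])
    then obtain p where p: "p \<in> carrier (K[X]\<^bsub>L\<^esub>)" "p \<noteq> []" "L.eval p u = \<zero>\<^bsub>L\<^esub>"
      using L.algebraicE[OF subfieldE(1)[OF subfield_K] u] by blast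
    then have pK: "set p \<subseteq> K" unfolding univ_poly_carrier[symmetric] polynomial_def by auto
    have "p \<in> carrier (poly_ring L)"
      using p(1,2) K_carrier unfolding univ_poly_carrier[symmetric] polynomial_def by auto
    then have "finite {b. L.is_root p b}" by (rule L.finite_number_of_roots)
    moreover have "roots u \<subseteq> {b. L.is_root p b}"
      using G_eval[OF _ pK u, symmetric] p u G_closed G_zero by (auto simp: roots_def L.is_root_def)
    ultimately show ?thesis by (rule finite_subset[rotated])
  qed
  have det: "g a = h a" if g: "g \<in> G" and h: "h \<in> G" and eq: "map g us = map h us" and a: "a \<in> carrier L" for g h a
  proof -
    have "g a = h a \<and> a \<in> carrier L" if "set vs \<subseteq> set us" "a \<in> L.Span K vs" for vs a
      using that
    proof (induction vs arbitrary: a)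
      case (Cons v vs)
      then obtain k b where k: "k \<in> K" and b: "b \<in> L.Span K vs" and a: "a = k \<otimes>\<^bsub>L\<^esub> v \<oplus>\<^bsub>L\<^esub> b"
        using L.line_extension_mem_iff by auto
      moreover have "v \<in> carrier L" "g v = h v" using Cons(2) us eq by auto
      ultimately show ?case
        using Cons.IH[OF _ b] Cons(2) K_carrier[OF k] g h by (simp add: G_add G_mult G_fix)
    qed (simp add: G_zero g h)
    then show ?thesis using a span by blast
  qed
  have "inj_on (\<lambda>g. map g us) G" using det by (intro inj_onI G_eqI) auto
  moreover have "(\<lambda>g. map g us) ` G \<subseteq> {bs. set bs \<subseteq> (\<Union>u \<in> set us. roots u) \<and> length bs = length us}"
    by (fastforce simp: roots_def)
  moreover have "finite (\<Union>u \<in> set us. roots u)" using fin us by blast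
  ultimately show ?thesis
    using finite_imageD[OF finite_subset[OF _ finite_lists_length_eq]] by blast
qed

definition gs :: "('l \<Rightarrow> 'l) list" where
  "gs = (SOME gs. set gs = G \<and> distinct gs)"

lemma gs: "set gs = G" "distinct gs"
proof -
  have "\<exists>gs. set gs = G \<and> distinct gs" by (rule finite_distinct_list[OF finite_G])
  then have "set gs = G \<and> distinct gs" unfolding gs_def by (rule someI_ex)
  then show "set gs = G" "distinct gs" by simp_all
qed

abbreviation pairing :: "('l \<Rightarrow> 'l) \<Rightarrow> ('l \<times> 'l) list \<Rightarrow> 'l" where
  "pairing g ps \<equiv> lsum L (\<lambda>p. fst p \<otimes>\<^bsub>L\<^esub> g (snd p)) ps"

text \<open>The tensor \<open>\<Sum> x \<otimes> y\<close> is a product over \<open>h \<noteq> 1\<close> of factors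
  \<open>(1 \<otimes> a - h(a) \<otimes> 1) / (a - h(a))\<close> with \<open>h(a) \<noteq> a\<close>: the map \<open>x \<otimes> y \<mapsto> x g(y)\<close> is multiplicative, sends
  each factor to \<open>1\<close> for \<open>g = 1\<close>, and kills the factor of \<open>h\<close> for \<open>g = h\<close>.\<close>

lemma ex_separating:
  assumes "finite S" "S \<subseteq> G - {id}"
  shows "\<exists>ps. set ps \<subseteq> carrier L \<times> carrier L \<and> pairing id ps = \<one>\<^bsub>L\<^esub> \<and> (\<forall>g \<in> S. pairing g ps = \<zero>\<^bsub>L\<^esub>)"
  using assms
proof (induction S rule: finite_induct)
  case empty
  show ?case by (intro exI[of _ "[(\<one>\<^bsub>L\<^esub>, \<one>\<^bsub>L\<^esub>)]"]) simp
next
  case (insert h S)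
  then obtain ps where ps: "set ps \<subseteq> carrier L \<times> carrier L" "pairing id ps = \<one>\<^bsub>L\<^esub>"
    "\<forall>g \<in> S. pairing g ps = \<zero>\<^bsub>L\<^esub>" by auto
  have h: "h \<in> G" "h \<noteq> id" using insert by auto
  then obtain a where a: "a \<in> carrier L" "h a \<noteq> a" using G_eqI[OF h(1) G_id] by auto
  define c where "c = inv\<^bsub>L\<^esub> (a \<ominus>\<^bsub>L\<^esub> h a)"
  have ha: "h a \<in> carrier L" using h a G_closed by blast
  have "a \<ominus>\<^bsub>L\<^esub> h a \<in> Units L" using a ha L.field_Units L.r_right_minus_eq[of a "h a"] by auto
  then have c: "c \<in> carrier L" "(a \<ominus>\<^bsub>L\<^esub> h a) \<otimes>\<^bsub>L\<^esub> c = \<one>\<^bsub>L\<^esub>" by (auto simp: c_def)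
  let ?ps = "map (\<lambda>p. (fst p \<otimes>\<^bsub>L\<^esub> c, snd p \<otimes>\<^bsub>L\<^esub> a)) ps @
    map (\<lambda>p. (\<ominus>\<^bsub>L\<^esub> (fst p \<otimes>\<^bsub>L\<^esub> c \<otimes>\<^bsub>L\<^esub> h a), snd p)) ps"
  have ev: "pairing g ?ps = pairing g ps \<otimes>\<^bsub>L\<^esub> ((g a \<ominus>\<^bsub>L\<^esub> h a) \<otimes>\<^bsub>L\<^esub> c)" if g: "g \<in> G" for g
  proof -
    have ga: "g a \<in> carrier L" using g a G_closed by blast
    have gp: "fst p \<in> carrier L" "snd p \<in> carrier L" "g (snd p) \<in> carrier L" if "p \<in> set ps" for p
      using ps(1) that g G_closed by auto
    have "pairing g ?ps = lsum L (\<lambda>p. fst p \<otimes>\<^bsub>L\<^esub> c \<otimes>\<^bsub>L\<^esub> g (snd p \<otimes>\<^bsub>L\<^esub> a)) ps \<oplus>\<^bsub>L\<^esub>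
        lsum L (\<lambda>p. \<ominus>\<^bsub>L\<^esub> (fst p \<otimes>\<^bsub>L\<^esub> c \<otimes>\<^bsub>L\<^esub> h a) \<otimes>\<^bsub>L\<^esub> g (snd p)) ps"
      using gp c a ha ga G_mult[OF g] by (subst L.lsum_append) (auto simp: lsum_map)
    also have "\<dots> = lsum L (\<lambda>p. fst p \<otimes>\<^bsub>L\<^esub> c \<otimes>\<^bsub>L\<^esub> g (snd p \<otimes>\<^bsub>L\<^esub> a) \<oplus>\<^bsub>L\<^esub>
        \<ominus>\<^bsub>L\<^esub> (fst p \<otimes>\<^bsub>L\<^esub> c \<otimes>\<^bsub>L\<^esub> h a) \<otimes>\<^bsub>L\<^esub> g (snd p)) ps"
      using gp c a ha ga G_mult[OF g] by (intro L.lsum_add[symmetric]) auto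
    also have "\<dots> = lsum L (\<lambda>p. fst p \<otimes>\<^bsub>L\<^esub> g (snd p) \<otimes>\<^bsub>L\<^esub> ((g a \<ominus>\<^bsub>L\<^esub> h a) \<otimes>\<^bsub>L\<^esub> c)) ps"
    proof (rule lsum_cong)
      fix p assume "p \<in> set ps"
      note gp = gp[OF this]
      show "fst p \<otimes>\<^bsub>L\<^esub> c \<otimes>\<^bsub>L\<^esub> g (snd p \<otimes>\<^bsub>L\<^esub> a) \<oplus>\<^bsub>L\<^esub> \<ominus>\<^bsub>L\<^esub> (fst p \<otimes>\<^bsub>L\<^esub> c \<otimes>\<^bsub>L\<^esub> h a) \<otimes>\<^bsub>L\<^esub> g (snd p) =
          fst p \<otimes>\<^bsub>L\<^esub> g (snd p) \<otimes>\<^bsub>L\<^esub> ((g a \<ominus>\<^bsub>L\<^esub> h a) \<otimes>\<^bsub>L\<^esub> c)"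
        using gp c(1) a(1) ha ga G_mult[OF g gp(2) a(1)] by (simp, algebra)
    qed
    also have "\<dots> = pairing g ps \<otimes>\<^bsub>L\<^esub> ((g a \<ominus>\<^bsub>L\<^esub> h a) \<otimes>\<^bsub>L\<^esub> c)"
      using gp c a ha ga by (intro L.lsum_rdistr[symmetric]) auto
    finally show ?thesis .
  qed
  have "pairing id ?ps = \<one>\<^bsub>L\<^esub>" using ev[OF G_id] ps(2) c(2) by simp
  moreover have "pairing h ?ps = \<zero>\<^bsub>L\<^esub>"
  proof -
    have "pairing h ps \<in> carrier L" using ps(1) G_closed[OF h(1)] by (intro L.lsum_closed) auto
    then show ?thesis using ev[OF h(1)] ha c by (simp add: a_minus_def L.r_neg)
  qed
  moreover have "pairing g ?ps = \<zero>\<^bsub>L\<^esub>" if "g \<in> S" for g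
  proof -
    have g: "g \<in> G" using that insert by auto
    have "(g a \<ominus>\<^bsub>L\<^esub> h a) \<otimes>\<^bsub>L\<^esub> c \<in> carrier L" using c a ha G_closed[OF g] by simp
    then show ?thesis using ev[OF g] ps(3) that by simp
  qed
  moreover have "set ?ps \<subseteq> carrier L \<times> carrier L" using ps(1) c a ha by auto
  ultimately show ?case by (intro exI[of _ ?ps]) simp
qed

text \<open>The separability idempotent \<open>\<Sum> x \<otimes> y\<close> of \<open>L\<close> over \<open>K\<close>: under \<open>L \<otimes>\<^sub>K L = \<Prod>\<^sub>g L\<close> it is the unit of the
  factor \<open>g = 1\<close>. Its components are dual to each other under the trace form.\<close>

definition ps :: "('l \<times> 'l) list" where
  "ps = (SOME ps. set ps \<subseteq> carrier L \<times> carrier L \<and>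
     (\<forall>g \<in> G. pairing g ps = (if g = id then \<one>\<^bsub>L\<^esub> else \<zero>\<^bsub>L\<^esub>)))"

lemma ps: "set ps \<subseteq> carrier L \<times> carrier L"
  "g \<in> G \<Longrightarrow> pairing g ps = (if g = id then \<one>\<^bsub>L\<^esub> else \<zero>\<^bsub>L\<^esub>)"
proof -
  have "\<exists>ps. set ps \<subseteq> carrier L \<times> carrier L \<and>
      (\<forall>g \<in> G. pairing g ps = (if g = id then \<one>\<^bsub>L\<^esub> else \<zero>\<^bsub>L\<^esub>))"
    using ex_separating[of "G - {id}"] finite_G by auto
  then have "set ps \<subseteq> carrier L \<times> carrier L \<and>
      (\<forall>g \<in> G. pairing g ps = (if g = id then \<one>\<^bsub>L\<^esub> else \<zero>\<^bsub>L\<^esub>))"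
    unfolding ps_def by (rule someI_ex)
  then show "set ps \<subseteq> carrier L \<times> carrier L"
    "g \<in> G \<Longrightarrow> pairing g ps = (if g = id then \<one>\<^bsub>L\<^esub> else \<zero>\<^bsub>L\<^esub>)" by blast+
qed

lemma ps_closed: "p \<in> set ps \<Longrightarrow> fst p \<in> carrier L" "p \<in> set ps \<Longrightarrow> snd p \<in> carrier L"
  using ps(1) by auto

lemma ps_swapped:
  assumes g: "g \<in> G"
  shows "lsum L (\<lambda>p. g (fst p) \<otimes>\<^bsub>L\<^esub> snd p) ps = (if g = id then \<one>\<^bsub>L\<^esub> else \<zero>\<^bsub>L\<^esub>)"
proof -
  have "lsum L (\<lambda>p. g (fst p) \<otimes>\<^bsub>L\<^esub> snd p) ps = lsum L (\<lambda>p. g (fst p \<otimes>\<^bsub>L\<^esub> inv_into UNIV g (snd p))) ps"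
    by (intro lsum_cong) (simp add: G_mult[OF g] ps_closed G_closed[OF G_inv[OF g]] G_inv_apply[OF g])
  also have "\<dots> = g (pairing (inv_into UNIV g) ps)"
    by (intro G_lsum[OF g, symmetric]) (simp add: ps_closed G_closed[OF G_inv[OF g]])
  also have "\<dots> = (if g = id then \<one>\<^bsub>L\<^esub> else \<zero>\<^bsub>L\<^esub>)"
  proof -
    have "inv_into UNIV g = id \<longleftrightarrow> g = id" using G_inv_apply[OF g] by (metis eq_id_iff)
    then show ?thesis using ps(2)[OF G_inv[OF g]] G_one[OF g] G_zero[OF g] by simp
  qed
  finally show ?thesis .
qed

definition Tr :: "'l \<Rightarrow> 'l" where
  "Tr a = lsum L (\<lambda>g. g a) gs"

lemma Tr_closed: "a \<in> carrier L \<Longrightarrow> Tr a \<in> carrier L"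
  unfolding Tr_def by (intro L.lsum_closed) (auto simp: gs G_closed)

lemma Tr_add: "\<lbrakk>a \<in> carrier L; b \<in> carrier L\<rbrakk> \<Longrightarrow> Tr (a \<oplus>\<^bsub>L\<^esub> b) = Tr a \<oplus>\<^bsub>L\<^esub> Tr b"
  unfolding Tr_def by (subst L.lsum_add[symmetric]) (auto simp: gs G_closed G_add intro!: lsum_cong)

lemma Tr_scal: "\<lbrakk>a \<in> carrier L; k \<in> K\<rbrakk> \<Longrightarrow> Tr (a \<otimes>\<^bsub>L\<^esub> k) = Tr a \<otimes>\<^bsub>L\<^esub> k"
  unfolding Tr_def
  by (subst L.lsum_rdistr) (auto simp: gs G_closed G_mult G_fix K_carrier intro!: lsum_cong)

lemma Tr_K: "a \<in> carrier L \<Longrightarrow> Tr a \<in> K"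
proof (rule fixed_field[OF Tr_closed])
  fix h assume a: "a \<in> carrier L" and h: "h \<in> G"
  have inj: "inj_on (\<lambda>g. h \<circ> g) G"
    by (rule inj_onI) (metis G_inj[OF h] comp_apply ext)
  have "(\<lambda>g. h \<circ> g) ` G = G"
    using inj finite_G G_comp[OF h] by (intro card_subset_eq) (auto simp: card_image)
  then have "lsum L (\<lambda>g. g a) (map (\<lambda>g. h \<circ> g) gs) = lsum L (\<lambda>g. g a) gs"
    using inj gs a by (intro L.lsum_reindex) (auto simp: distinct_map G_closed G_comp[OF h])
  then show "h (Tr a) = Tr a"
    unfolding Tr_def using G_lsum[OF h, of gs "\<lambda>g. g a"] gs a by (simp add: lsum_map G_closed)
qed

text \<open>Exchanging the sum over \<open>g\<close> hidden in the trace with the sum over the dual pairs gives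
  \<open>\<Sum>\<^sub>g (\<Sum> x g(y)) g(a)\<close>, in which only \<open>g = 1\<close> contributes.\<close>

lemma Tr_frame:
  assumes a: "a \<in> carrier L"
  shows "lsum L (\<lambda>p. fst p \<otimes>\<^bsub>L\<^esub> Tr (snd p \<otimes>\<^bsub>L\<^esub> a)) ps = a"
proof -
  have "lsum L (\<lambda>p. fst p \<otimes>\<^bsub>L\<^esub> Tr (snd p \<otimes>\<^bsub>L\<^esub> a)) ps =
      lsum L (\<lambda>p. lsum L (\<lambda>g. fst p \<otimes>\<^bsub>L\<^esub> g (snd p) \<otimes>\<^bsub>L\<^esub> g a) gs) ps"
    unfolding Tr_def using a
    by (intro lsum_cong, subst L.lsum_ldistr)
      (simp_all add: ps_closed gs G_closed G_mult L.m_assoc cong: lsum_cong_simp)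
  also have "\<dots> = lsum L (\<lambda>g. lsum L (\<lambda>p. fst p \<otimes>\<^bsub>L\<^esub> g (snd p) \<otimes>\<^bsub>L\<^esub> g a) ps) gs"
    using a by (intro L.lsum_swap) (auto simp: ps_closed gs G_closed)
  also have "\<dots> = lsum L (\<lambda>g. pairing g ps \<otimes>\<^bsub>L\<^esub> g a) gs"
    using a by (intro lsum_cong L.lsum_rdistr[symmetric]) (auto simp: ps_closed gs G_closed)
  also have "\<dots> = lsum L (\<lambda>g. if g = id then g a else \<zero>\<^bsub>L\<^esub>) gs"
    using a by (intro lsum_cong) (auto simp: ps(2) gs G_closed)
  also have "\<dots> = a"
    using a gs G_id by (subst L.lsum_single[where f = "\<lambda>g. g a"]) auto
  finally show ?thesis .
qed

lemma Tr_frame_swapped: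
  assumes a: "a \<in> carrier L"
  shows "lsum L (\<lambda>p. Tr (a \<otimes>\<^bsub>L\<^esub> fst p) \<otimes>\<^bsub>L\<^esub> snd p) ps = a"
proof -
  have "lsum L (\<lambda>p. Tr (a \<otimes>\<^bsub>L\<^esub> fst p) \<otimes>\<^bsub>L\<^esub> snd p) ps =
      lsum L (\<lambda>p. lsum L (\<lambda>g. g a \<otimes>\<^bsub>L\<^esub> (g (fst p) \<otimes>\<^bsub>L\<^esub> snd p)) gs) ps"
    unfolding Tr_def using a
    by (intro lsum_cong, subst L.lsum_rdistr)
      (simp_all add: ps_closed gs G_closed G_mult L.m_assoc cong: lsum_cong_simp)
  also have "\<dots> = lsum L (\<lambda>g. lsum L (\<lambda>p. g a \<otimes>\<^bsub>L\<^esub> (g (fst p) \<otimes>\<^bsub>L\<^esub> snd p)) ps) gs"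
    using a by (intro L.lsum_swap) (auto simp: ps_closed gs G_closed)
  also have "\<dots> = lsum L (\<lambda>g. g a \<otimes>\<^bsub>L\<^esub> lsum L (\<lambda>p. g (fst p) \<otimes>\<^bsub>L\<^esub> snd p) ps) gs"
    using a by (intro lsum_cong L.lsum_ldistr[symmetric]) (auto simp: ps_closed gs G_closed)
  also have "\<dots> = lsum L (\<lambda>g. if g = id then g a else \<zero>\<^bsub>L\<^esub>) gs"
    using a by (intro lsum_cong) (auto simp: ps_swapped gs G_closed)
  also have "\<dots> = a"
    using a gs G_id by (subst L.lsum_single[where f = "\<lambda>g. g a"]) auto
  finally show ?thesis .
qed

sublocale frame L K fst "\<lambda>p a. Tr (snd p \<otimes>\<^bsub>L\<^esub> a)" ps
proof (rule frame.intro)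
  show "Tr (snd p \<otimes>\<^bsub>L\<^esub> (a \<otimes>\<^bsub>L\<^esub> k)) = Tr (snd p \<otimes>\<^bsub>L\<^esub> a) \<otimes>\<^bsub>L\<^esub> k"
    if "p \<in> set ps" "a \<in> carrier L" "k \<in> K" for p a k
    using that Tr_scal[of "snd p \<otimes>\<^bsub>L\<^esub> a" k] by (simp add: L.m_assoc ps_closed K_carrier)
qed (auto simp: field_L subfield_K ps_closed Tr_K Tr_frame L.r_distr Tr_add)

text \<open>The trace is not zero, for otherwise \<open>Tr_frame\<close> would give \<open>1 = 0\<close>; its values lie in \<open>K\<close>, so
  that it can be normalized.\<close>

lemma ex_Tr_one: "\<exists>c \<in> carrier L. Tr c = \<one>\<^bsub>L\<^esub>"
proof -
  have "\<exists>p \<in> set ps. Tr (snd p) \<noteq> \<zero>\<^bsub>L\<^esub>"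
  proof (rule ccontr)
    assume "\<not> (\<exists>p \<in> set ps. Tr (snd p) \<noteq> \<zero>\<^bsub>L\<^esub>)"
    then have "lsum L (\<lambda>p. fst p \<otimes>\<^bsub>L\<^esub> Tr (snd p \<otimes>\<^bsub>L\<^esub> \<one>\<^bsub>L\<^esub>)) ps = lsum L (\<lambda>_. \<zero>\<^bsub>L\<^esub>) ps"
      by (intro lsum_cong) (auto simp: ps_closed)
    then show False using Tr_frame[OF L.one_closed] L.lsum_zero[of ps] L.one_not_zero by metis
  qed
  then obtain y where y: "y \<in> carrier L" "Tr y \<noteq> \<zero>\<^bsub>L\<^esub>" using ps_closed by blast
  have inv: "inv\<^bsub>L\<^esub> (Tr y) \<in> K" "Tr y \<otimes>\<^bsub>L\<^esub> inv\<^bsub>L\<^esub> (Tr y) = \<one>\<^bsub>L\<^esub>"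
    using L.subfield_m_inv[OF subfield_K, of "Tr y"] Tr_K[OF y(1)] y(2) by auto
  then show ?thesis
    using Tr_scal[OF y(1) inv(1)] y(1) K_carrier[OF inv(1)]
    by (intro bexI[of _ "y \<otimes>\<^bsub>L\<^esub> inv\<^bsub>L\<^esub> (Tr y)"]) auto
qed

end


section \<open>Extension of scalars for sheaves\<close>

lemma sheaf_presheaf: "sheaf R X F \<Longrightarrow> presheaf R X F"
  unfolding sheaf_def by blast

lemma sheaf_glue:
  assumes "sheaf R X F" and "\<And>V. V \<in> \<U> \<Longrightarrow> openin X V" and "\<And>V. V \<in> \<U> \<Longrightarrow> s V \<in> carrier (sec F V)"
    and "\<And>V W. \<lbrakk>V \<in> \<U>; W \<in> \<U>\<rbrakk> \<Longrightarrow> rst F V (V \<inter> W) (s V) = rst F W (V \<inter> W) (s W)"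
  shows "\<exists>!t. t \<in> carrier (sec F (\<Union>\<U>)) \<and> (\<forall>V \<in> \<U>. rst F (\<Union>\<U>) V t = s V)"
  using assms(1)[unfolded sheaf_def, THEN conjunct2, rule_format, of \<U> s] assms(2-4) by blast

text \<open>Uniqueness of gluing, applied to the cover by the open sets on which \<open>s\<close> and \<open>t\<close> agree.\<close>

lemma sheaf_eqI:
  assumes F: "sheaf R X F" and U: "openin X U" and s: "s \<in> carrier (sec F U)" and t: "t \<in> carrier (sec F U)"
    and local: "\<And>x. x \<in> U \<Longrightarrow> \<exists>W. openin X W \<and> x \<in> W \<and> W \<subseteq> U \<and> rst F U W s = rst F U W t"
  shows "s = t"
proof -
  interpret operations_presheaf R X F by (rule presheaf_operations[OF sheaf_presheaf[OF F]])
  define \<U> where "\<U> = {W. openin X W \<and> W \<subseteq> U \<and> rst F U W s = rst F U W t}"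
  have V: "openin X V" "V \<subseteq> U" "rst F U V s = rst F U V t" if "V \<in> \<U>" for V
    using that by (auto simp: \<U>_def)
  have union: "\<Union>\<U> = U"
  proof
    show "U \<subseteq> \<Union>\<U>" using local by (auto simp: \<U>_def)
  qed (use V in blast)
  have "\<exists>!r. r \<in> carrier (sec F (\<Union>\<U>)) \<and> (\<forall>V \<in> \<U>. rst F (\<Union>\<U>) V r = rst F U V s)"
  proof (rule sheaf_glue[OF F V(1)])
    fix V W assume VW: "V \<in> \<U>" "W \<in> \<U>"
    have o: "openin X (V \<inter> W)" using V(1) VW by blast
    show "rst F V (V \<inter> W) (rst F U V s) = rst F W (V \<inter> W) (rst F U W s)"
      using rst_rst[OF U V(1)[OF VW(1)] o _ V(2)[OF VW(1)] s] rst_rst[OF U V(1)[OF VW(2)] o _ V(2)[OF VW(2)] s]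
      by simp
  qed (assumption, intro rst_closed[OF U _ _ s] V)
  then obtain r where r: "\<And>r'. \<lbrakk>r' \<in> carrier (sec F U); \<forall>V \<in> \<U>. rst F U V r' = rst F U V s\<rbrakk> \<Longrightarrow> r' = r"
    unfolding union by (elim ex1E) blast
  have "s = r" by (rule r[OF s]) simp
  moreover have "t = r" by (rule r[OF t]) (simp add: V(3))
  ultimately show ?thesis by simp
qed

definition germs_of :: "'x topology \<Rightarrow> ('x, 'k, 'u) psheaf \<Rightarrow> 'x set \<Rightarrow> 'u \<Rightarrow> 'x \<Rightarrow> ('x set \<times> 'u) set" where
  "germs_of X P U s = (\<lambda>x. if x \<in> U then germ X P x U s else {})"

lemma germs_of_apply: "x \<in> U \<Longrightarrow> germs_of X P U s x = germ X P x U s"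
  by (simp add: germs_of_def)

text \<open>A sheaf is isomorphic to its sheafification: sections with equal germs agree locally, and a
  compatible family of germs glues.\<close>

lemma germs_of_bij:
  assumes P: "sheaf R X P" and U: "openin X U"
  shows "bij_betw (germs_of X P U) (carrier (sec P U)) (carrier (sec (sheafify X P) U))"
proof -
  interpret operations_presheaf R X P by (rule presheaf_operations[OF sheaf_presheaf[OF P]])
  have eqI: "s = t" if U: "openin X U" and s: "s \<in> carrier (sec P U)" and t: "t \<in> carrier (sec P U)"
    and eq: "\<And>x. x \<in> U \<Longrightarrow> germ X P x U s = germ X P x U t" for U s t
  proof (rule sheaf_eqI[OF P U s t])
    fix x assume x: "x \<in> U"
    show "\<exists>W. openin X W \<and> x \<in> W \<and> W \<subseteq> U \<and> rst P U W s = rst P U W t"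
      using germ_eq_iff[OF U x U x s t] eq[OF x] by auto
  qed
  show ?thesis
    unfolding bij_betw_def
  proof
    show "inj_on (germs_of X P U) (carrier (sec P U))"
    proof (rule inj_onI)
      fix s t assume s: "s \<in> carrier (sec P U)" and t: "t \<in> carrier (sec P U)"
        and eq: "germs_of X P U s = germs_of X P U t"
      show "s = t" using fun_cong[OF eq] by (intro eqI[OF U s t]) (metis germs_of_apply)
    qed
    show "germs_of X P U ` carrier (sec P U) = carrier (sec (sheafify X P) U)"
    proof (intro equalityI subsetI)
      fix \<sigma> assume "\<sigma> \<in> germs_of X P U ` carrier (sec P U)"
      then obtain s where s: "s \<in> carrier (sec P U)" "\<sigma> = germs_of X P U s" by blast
      show "\<sigma> \<in> carrier (sec (sheafify X P) U)"
      proof (rule sheafify_carrierI)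
        fix x assume "x \<in> U"
        then show "\<exists>V t. openin X V \<and> x \<in> V \<and> V \<subseteq> U \<and> t \<in> carrier (sec P V) \<and>
            (\<forall>y\<in>V. \<sigma> y = germ X P y V t)"
          using U s by (intro exI[of _ U] exI[of _ s]) (simp add: germs_of_apply)
      qed (simp add: s(2) germs_of_def)
    next
      fix \<sigma> assume \<sigma>: "\<sigma> \<in> carrier (sec (sheafify X P) U)"
      define good where "good V t \<longleftrightarrow> t \<in> carrier (sec P V) \<and> (\<forall>y \<in> V. \<sigma> y = germ X P y V t)" for V t
      define \<U> where "\<U> = {V. openin X V \<and> V \<subseteq> U \<and> (\<exists>t. good V t)}"
      define s where "s V = (SOME t. good V t)" for V
      have V: "openin X V" "V \<subseteq> U" "good V (s V)" if "V \<in> \<U>" for V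
        using that by (auto simp: \<U>_def s_def intro: someI)
      have sc: "s V \<in> carrier (sec P V)" if "V \<in> \<U>" for V using V(3)[OF that] by (simp add: good_def)
      have sg: "germ X P y V (s V) = \<sigma> y" if "V \<in> \<U>" "y \<in> V" for V y
        using V(3)[OF that(1)] that(2) by (simp add: good_def)
      have union: "\<Union>\<U> = U"
      proof
        show "U \<subseteq> \<Union>\<U>"
        proof
          fix x assume "x \<in> U"
          from sheafify_local[OF \<sigma> this] show "x \<in> \<Union>\<U>" unfolding \<U>_def good_def by blast
        qed
      qed (use V in blast)
      have "\<exists>!t. t \<in> carrier (sec P (\<Union>\<U>)) \<and> (\<forall>V \<in> \<U>. rst P (\<Union>\<U>) V t = s V)"
      proof (rule sheaf_glue[OF P V(1) sc])
        fix V W assume VW: "V \<in> \<U>" "W \<in> \<U>"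
        have o: "openin X (V \<inter> W)" using V(1) VW by blast
        show "rst P V (V \<inter> W) (s V) = rst P W (V \<inter> W) (s W)"
        proof (rule eqI[OF o])
          show "rst P V (V \<inter> W) (s V) \<in> carrier (sec P (V \<inter> W))"
            "rst P W (V \<inter> W) (s W) \<in> carrier (sec P (V \<inter> W))"
            using rst_closed[OF V(1)[OF VW(1)] o _ sc[OF VW(1)]]
              rst_closed[OF V(1)[OF VW(2)] o _ sc[OF VW(2)]] by auto
          show "germ X P x (V \<inter> W) (rst P V (V \<inter> W) (s V)) = germ X P x (V \<inter> W) (rst P W (V \<inter> W) (s W))"
            if "x \<in> V \<inter> W" for x
            using germ_rst[OF V(1)[OF VW(1)] o that _ sc[OF VW(1)]]
              germ_rst[OF V(1)[OF VW(2)] o that _ sc[OF VW(2)]] sg VW that by auto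
        qed
      qed
      then obtain t where t: "t \<in> carrier (sec P U)" "\<forall>V \<in> \<U>. rst P U V t = s V"
        unfolding union by blast
      have "germs_of X P U t x = \<sigma> x" for x
      proof (cases "x \<in> U")
        case True
        then obtain V where V': "V \<in> \<U>" "x \<in> V" using union by blast
        then show ?thesis
          using germ_rst[OF U V(1)[OF V'(1)] V'(2) V(2)[OF V'(1)] t(1)] t(2) sg[OF V'] True
          by (simp add: germs_of_apply)
      next
        case False
        then show ?thesis using \<sigma> by (simp add: germs_of_def sheafify_def)
      qed
      then have "\<sigma> = germs_of X P U t" by (rule ext[symmetric])
      then show "\<sigma> \<in> germs_of X P U ` carrier (sec P U)" using t(1) by blast
    qed
  qed
qed

lemma germs_of_add:
  assumes P: "operations_presheaf R X P" and U: "openin X U" "s \<in> carrier (sec P U)" "t \<in> carrier (sec P U)"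
  shows "germs_of X P U s \<oplus>\<^bsub>sec (sheafify X P) U\<^esub> germs_of X P U t = germs_of X P U (s \<oplus>\<^bsub>sec P U\<^esub> t)"
  using operations_presheaf.stalk_add_germ[OF P U(1) _ U(2,3)]
  by (auto simp: germs_of_def sheafify_def fun_eq_iff)

lemma germs_of_smult:
  assumes P: "operations_presheaf R X P" and U: "openin X U" "s \<in> carrier (sec P U)" and k: "k \<in> carrier R"
  shows "k \<odot>\<^bsub>sec (sheafify X P) U\<^esub> germs_of X P U s = germs_of X P U (k \<odot>\<^bsub>sec P U\<^esub> s)"
  using operations_presheaf.stalk_smult_germ[OF P U(1) _ U(2) k]
  by (auto simp: germs_of_def sheafify_def fun_eq_iff)

lemma germs_of_rst:
  assumes P: "operations_presheaf R X P" and U: "openin X U" "openin X V" "V \<subseteq> U" "s \<in> carrier (sec P U)"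
  shows "rst (sheafify X P) U V (germs_of X P U s) = germs_of X P V (rst P U V s)"
  using operations_presheaf.germ_rst[OF P U(1,2) _ U(3,4)] U(3)
  by (auto simp: germs_of_def sheafify_def fun_eq_iff)

lemma germs_of_zero:
  assumes P: "presheaf R X P" and U: "openin X U"
  shows "\<zero>\<^bsub>sec (sheafify X P) U\<^esub> = germs_of X P U \<zero>\<^bsub>sec P U\<^esub>"
proof -
  interpret operations_presheaf R X P by (rule presheaf_operations[OF P])
  have UX: "U \<subseteq> topspace X" using openin_subset[OF U] .
  have z: "\<zero>\<^bsub>sec P (topspace X)\<^esub> \<in> carrier (sec P (topspace X))"
    using module.axioms(2)[OF presheaf_module[OF P openin_topspace]] abelian_group.axioms(1)
      abelian_monoid.zero_closed by blast
  have "rst P (topspace X) U \<zero>\<^bsub>sec P (topspace X)\<^esub> = \<zero>\<^bsub>sec P U\<^esub>"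
    by (rule mod_hom_zero[OF presheaf_module[OF P openin_topspace] presheaf_module[OF P U]
          rst_hom[OF openin_topspace U UX]])
  then have "germ X P x (topspace X) \<zero>\<^bsub>sec P (topspace X)\<^esub> = germ X P x U \<zero>\<^bsub>sec P U\<^esub>" if "x \<in> U" for x
    using germ_rst[OF openin_topspace U that UX z] by simp
  then show ?thesis by (auto simp: germs_of_def sheafify_def stalk_def fun_eq_iff)
qed

lemma module_transport:
  assumes M: "module R M" and bij: "bij_betw \<theta> (carrier M) (carrier N)"
    and zero: "\<theta> \<zero>\<^bsub>M\<^esub> = \<zero>\<^bsub>N\<^esub>"
    and add: "\<And>s t. \<lbrakk>s \<in> carrier M; t \<in> carrier M\<rbrakk> \<Longrightarrow> \<theta> s \<oplus>\<^bsub>N\<^esub> \<theta> t = \<theta> (s \<oplus>\<^bsub>M\<^esub> t)"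
    and smult: "\<And>k s. \<lbrakk>k \<in> carrier R; s \<in> carrier M\<rbrakk> \<Longrightarrow> k \<odot>\<^bsub>N\<^esub> \<theta> s = \<theta> (k \<odot>\<^bsub>M\<^esub> s)"
  shows "module R N"
proof -
  interpret M: module R M by (rule M)
  have car: "carrier N = \<theta> ` carrier M" using bij by (simp add: bij_betw_def)
  show ?thesis
  proof (rule moduleI)
    show "cring R" by (rule M.R.is_cring)
    show "abelian_group N"
    proof (rule abelian_groupI)
      fix y assume "y \<in> carrier N"
      then obtain a where a: "a \<in> carrier M" "y = \<theta> a" unfolding car by blast
      have "\<theta> (\<ominus>\<^bsub>M\<^esub> a) \<oplus>\<^bsub>N\<^esub> y = \<zero>\<^bsub>N\<^esub>"
        using a add[of "\<ominus>\<^bsub>M\<^esub> a" a] zero by (simp add: M.l_neg)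
      then show "\<exists>z \<in> carrier N. z \<oplus>\<^bsub>N\<^esub> y = \<zero>\<^bsub>N\<^esub>" using a unfolding car by auto
    qed (auto simp: car add zero[symmetric] M.a_ac)
  qed (auto simp: car add smult M.smult_l_distr M.smult_r_distr M.smult_assoc1)
qed

lemma sheaf_transport:
  assumes P: "sheaf R X P"
    and bij: "\<And>U. openin X U \<Longrightarrow> bij_betw (\<theta> U) (carrier (sec P U)) (carrier (sec Q U))"
    and zero: "\<And>U. openin X U \<Longrightarrow> \<theta> U \<zero>\<^bsub>sec P U\<^esub> = \<zero>\<^bsub>sec Q U\<^esub>"
    and add: "\<And>U s t. \<lbrakk>openin X U; s \<in> carrier (sec P U); t \<in> carrier (sec P U)\<rbrakk>
      \<Longrightarrow> \<theta> U s \<oplus>\<^bsub>sec Q U\<^esub> \<theta> U t = \<theta> U (s \<oplus>\<^bsub>sec P U\<^esub> t)"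
    and smult: "\<And>U k s. \<lbrakk>openin X U; k \<in> carrier R; s \<in> carrier (sec P U)\<rbrakk>
      \<Longrightarrow> k \<odot>\<^bsub>sec Q U\<^esub> \<theta> U s = \<theta> U (k \<odot>\<^bsub>sec P U\<^esub> s)"
    and rst: "\<And>U V s. \<lbrakk>openin X U; openin X V; V \<subseteq> U; s \<in> carrier (sec P U)\<rbrakk>
      \<Longrightarrow> rst Q U V (\<theta> U s) = \<theta> V (rst P U V s)"
  shows "sheaf R X Q"
proof -
  interpret P: operations_presheaf R X P by (rule presheaf_operations[OF sheaf_presheaf[OF P]])
  have car: "carrier (sec Q U) = \<theta> U ` carrier (sec P U)" if "openin X U" for U
    using bij[OF that] by (simp add: bij_betw_def)
  have inj: "s = t" if "openin X U" "s \<in> carrier (sec P U)" "t \<in> carrier (sec P U)" "\<theta> U s = \<theta> U t" for U s t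
    using bij[OF that(1)] that(2-4) by (auto simp: bij_betw_def dest: inj_onD)
  have "presheaf R X Q"
    unfolding presheaf_def
  proof (intro conjI allI impI; (elim conjE)?)
    fix U assume U: "openin X U"
    show "module R (sec Q U)"
      using module_transport[OF presheaf_module[OF sheaf_presheaf[OF P] U] bij[OF U] zero[OF U] add[OF U] smult[OF U]] .
  next
    fix U V assume U: "openin X U" and V: "openin X V" "V \<subseteq> U"
    show "rst Q U V \<in> mod_hom R (sec Q U) (sec Q V)"
      unfolding mod_hom_def car[OF U] car[OF V(1)]
      using rst[OF U V] P.rst_closed[OF U V] P.add_closed[OF U] P.smult_closed[OF U]
      by (auto simp: add[OF U] add[OF V(1)] smult[OF U] smult[OF V(1)] P.rst_add[OF U V] P.rst_smult[OF U V])
  next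
    fix U assume U: "openin X U"
    show "\<forall>s \<in> carrier (sec Q U). rst Q U U s = s"
      unfolding car[OF U] using rst[OF U U subset_refl] P.rst_self[OF U] by simp
  next
    fix U V W assume U: "openin X U" and V: "openin X V" and W: "openin X W" "W \<subseteq> V" "V \<subseteq> U"
    have "W \<subseteq> U" using W by blast
    then show "\<forall>s \<in> carrier (sec Q U). rst Q V W (rst Q U V s) = rst Q U W s"
      unfolding car[OF U] using rst[OF U V W(3)] rst[OF V W(1,2)] rst[OF U W(1)] P.rst_closed[OF U V W(3)]
        P.rst_rst[OF U V W] by simp
  qed
  moreover have "\<exists>!t. t \<in> carrier (sec Q (\<Union>\<U>)) \<and> (\<forall>V \<in> \<U>. rst Q (\<Union>\<U>) V t = s V)"
    if "(\<forall>V \<in> \<U>. openin X V \<and> s V \<in> carrier (sec Q V)) \<and>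
        (\<forall>V \<in> \<U>. \<forall>W \<in> \<U>. rst Q V (V \<inter> W) (s V) = rst Q W (V \<inter> W) (s W))" for \<U> s
  proof -
    have V: "openin X V" "s V \<in> carrier (sec Q V)" if "V \<in> \<U>" for V using that \<open>_ \<and> _\<close> by blast+
    have comp: "rst Q V (V \<inter> W) (s V) = rst Q W (V \<inter> W) (s W)" if "V \<in> \<U>" "W \<in> \<U>" for V W
      using that \<open>_ \<and> _\<close> by blast
    define r where "r V = inv_into (carrier (sec P V)) (\<theta> V) (s V)" for V
    have r: "r V \<in> carrier (sec P V)" "\<theta> V (r V) = s V" if "V \<in> \<U>" for V
      using V[OF that] car[OF V(1)[OF that]] by (auto simp: r_def inv_into_into f_inv_into_f)
    have U: "openin X (\<Union>\<U>)" using V by blast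
    have "\<exists>!t. t \<in> carrier (sec P (\<Union>\<U>)) \<and> (\<forall>V \<in> \<U>. rst P (\<Union>\<U>) V t = r V)"
    proof (rule sheaf_glue[OF P V(1) r(1)])
      fix V W assume VW: "V \<in> \<U>" "W \<in> \<U>"
      have o: "openin X (V \<inter> W)" using V VW by blast
      show "rst P V (V \<inter> W) (r V) = rst P W (V \<inter> W) (r W)"
        using comp[OF VW] r[OF VW(1)] r[OF VW(2)] rst[OF V(1)[OF VW(1)] o _ r(1)[OF VW(1)]]
          rst[OF V(1)[OF VW(2)] o _ r(1)[OF VW(2)]]
        by (intro inj[OF o] P.rst_closed o V(1) VW) auto
    qed
    then obtain t where t: "t \<in> carrier (sec P (\<Union>\<U>))" "\<forall>V \<in> \<U>. rst P (\<Union>\<U>) V t = r V"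
      and unique: "\<And>t'. \<lbrakk>t' \<in> carrier (sec P (\<Union>\<U>)); \<forall>V \<in> \<U>. rst P (\<Union>\<U>) V t' = r V\<rbrakk> \<Longrightarrow> t' = t" by blast
    show ?thesis
    proof (rule ex1I[of _ "\<theta> (\<Union>\<U>) t"])
      show "\<theta> (\<Union>\<U>) t \<in> carrier (sec Q (\<Union>\<U>)) \<and> (\<forall>V \<in> \<U>. rst Q (\<Union>\<U>) V (\<theta> (\<Union>\<U>) t) = s V)"
        using t r rst[OF U V(1) Union_upper t(1)] car[OF U] by auto
    next
      fix u assume u: "u \<in> carrier (sec Q (\<Union>\<U>)) \<and> (\<forall>V \<in> \<U>. rst Q (\<Union>\<U>) V u = s V)"
      then obtain t' where t': "t' \<in> carrier (sec P (\<Union>\<U>))" "u = \<theta> (\<Union>\<U>) t'" unfolding car[OF U] by blast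
      have "rst P (\<Union>\<U>) V t' = r V" if "V \<in> \<U>" for V
        using u that t' rst[OF U V(1)[OF that] Union_upper[OF that] t'(1)] r[OF that]
          P.rst_closed[OF U V(1)[OF that] Union_upper[OF that] t'(1)]
        by (intro inj[OF V(1)[OF that]]) auto
      then show "u = \<theta> (\<Union>\<U>) t" using unique[OF t'(1)] t'(2) by blast
    qed
  qed
  ultimately show ?thesis unfolding sheaf_def by blast
qed

context frame
begin

lemma module_restrict:
  assumes "module L V"
  shows "module RK V"
proof -
  interpret V: module L V by fact
  show ?thesis
    by (rule moduleI)
      (auto simp: RK_cring V.abelian_group_axioms K_carrier V.smult_l_distr V.smult_r_distr V.smult_assoc1)
qed

lemma mod_hom_restrict: "f \<in> mod_hom L M N \<Longrightarrow> f \<in> mod_hom RK M N"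
  unfolding mod_hom_def using K_carrier by auto

lemma sheaf_restrict:
  assumes "sheaf L X F"
  shows "sheaf RK X F"
  unfolding sheaf_def presheaf_def
proof (intro conjI)
  note p = assms[unfolded sheaf_def presheaf_def]
  show "\<forall>U. openin X U \<longrightarrow> module RK (sec F U)"
    using p[THEN conjunct1, THEN conjunct1] module_restrict by blast
  show "\<forall>U V. openin X U \<and> openin X V \<and> V \<subseteq> U \<longrightarrow> rst F U V \<in> mod_hom RK (sec F U) (sec F V)"
    using p[THEN conjunct1, THEN conjunct2, THEN conjunct1] mod_hom_restrict by blast
  show "\<forall>U. openin X U \<longrightarrow> (\<forall>s \<in> carrier (sec F U). rst F U U s = s)"
    by (rule p[THEN conjunct1, THEN conjunct2, THEN conjunct2, THEN conjunct1])
  show "\<forall>U V W. openin X U \<and> openin X V \<and> openin X W \<and> W \<subseteq> V \<and> V \<subseteq> U \<longrightarrow>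
      (\<forall>s \<in> carrier (sec F U). rst F V W (rst F U V s) = rst F U W s)"
    by (rule p[THEN conjunct1, THEN conjunct2, THEN conjunct2, THEN conjunct2])
qed (rule assms[unfolded sheaf_def, THEN conjunct2])

lemma coord_map:
  assumes V: "module RK V" and V': "module RK V'" and f: "f \<in> mod_hom RK V V'"
    and ts: "ts \<in> formal_sums L V" and i: "i \<in> set I"
  shows "coord V' i (map (map_prod id f) ts) = f (coord V i ts)"
proof -
  have "f (coord V i ts) = lsum V' (\<lambda>p. f (t i (fst p) \<odot>\<^bsub>V\<^esub> snd p)) ts"
    unfolding coord_def[OF V] tensor_lift_def
    using ts balancedD(1)[OF balanced_coord[OF V i]] by (intro mod_hom_lsum[OF V V' f]) auto
  also have "\<dots> = lsum V' (\<lambda>p. t i (fst p) \<odot>\<^bsub>V'\<^esub> f (snd p)) ts"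
    using ts t_closed[OF i] mod_homD(3)[OF f] by (intro lsum_cong) auto
  finally show ?thesis by (simp add: coord_def[OF V'] tensor_lift_map) (simp add: tensor_lift_def)
qed

context
  fixes X :: "'x topology" and F :: "('x, 'l, 'u) psheaf"
  assumes F: "sheaf RK X F"
begin

interpretation F: operations_presheaf RK X F
  by (rule presheaf_operations[OF sheaf_presheaf[OF F]])

lemma sec_mod: "openin X U \<Longrightarrow> module RK (sec F U)"
  by (rule presheaf_module[OF sheaf_presheaf[OF F]])

lemma tensor_presheaf_rst:
  assumes "openin X U" "openin X V" "V \<subseteq> U" "ts \<in> formal_sums L (sec F U)"
  shows "rst (tensor_presheaf L K F) U V (tensor_class L K (sec F U) ts) =
    tensor_class L K (sec F V) (map (map_prod id (rst F U V)) ts)"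
  using assms by (simp add: tensor_presheaf_def tensor_map_class sec_mod linear_on_L_id F.rst_hom)

lemma rst_formal_sums:
  assumes "openin X U" "openin X V" "V \<subseteq> U" "ts \<in> formal_sums L (sec F U)"
  shows "map (map_prod id (rst F U V)) ts \<in> formal_sums L (sec F V)"
  using assms F.rst_closed by (intro map_prod_formal_sums[OF linear_on_L_id]) auto

lemma tensor_presheaf_presheaf: "presheaf L X (tensor_presheaf L K F)"
proof -
  let ?T = "tensor_presheaf L K F"
  have car: "carrier (sec ?T U) = tensor_class L K (sec F U) ` formal_sums L (sec F U)" if "openin X U" for U
    using tensor_carrier[OF sec_mod[OF that]] by (simp add: tensor_presheaf_def)
  show ?thesis
    unfolding presheaf_def
  proof (intro conjI allI impI; (elim conjE)?)
    fix U assume U: "openin X U"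
    show "module L (sec ?T U)" using tensor_module[OF sec_mod[OF U]] by (simp add: tensor_presheaf_def)
    show "\<forall>s \<in> carrier (sec ?T U). rst ?T U U s = s"
    proof
      fix s assume "s \<in> carrier (sec ?T U)"
      then obtain ts where ts: "ts \<in> formal_sums L (sec F U)" "s = tensor_class L K (sec F U) ts"
        unfolding car[OF U] by blast
      have "map (map_prod id (rst F U U)) ts = ts" using ts(1) F.rst_self[OF U] by (intro map_idI) auto
      then show "rst ?T U U s = s" using tensor_presheaf_rst[OF U U subset_refl ts(1)] ts(2) by simp
    qed
  next
    fix U V assume U: "openin X U" and V: "openin X V" "V \<subseteq> U"
    let ?r = "map (map_prod id (rst F U V))"
    have rst: "rst ?T U V (tensor_class L K (sec F U) ts) = tensor_class L K (sec F V) (?r ts)"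
      "?r ts \<in> formal_sums L (sec F V)" if "ts \<in> formal_sums L (sec F U)" for ts
      using tensor_presheaf_rst[OF U V that] rst_formal_sums[OF U V that] by auto
    have T: "sec ?T U = tensor L K (sec F U)" for U by (simp add: tensor_presheaf_def)
    show "rst ?T U V \<in> mod_hom L (sec ?T U) (sec ?T V)"
      unfolding mod_hom_def
    proof (intro CollectI conjI ballI funcsetI)
      fix s assume "s \<in> carrier (sec ?T U)"
      then show "rst ?T U V s \<in> carrier (sec ?T V)" unfolding car[OF U] car[OF V(1)] using rst by auto
    next
      fix s s' assume "s \<in> carrier (sec ?T U)" and s': "s' \<in> carrier (sec ?T U)"
      then obtain ts where ts: "ts \<in> formal_sums L (sec F U)" "s = tensor_class L K (sec F U) ts"
        unfolding car[OF U] by blast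
      obtain us where us: "us \<in> formal_sums L (sec F U)" "s' = tensor_class L K (sec F U) us"
        using s' unfolding car[OF U] by blast
      have "ts @ us \<in> formal_sums L (sec F U)" using ts us by auto
      then show "rst ?T U V (s \<oplus>\<^bsub>sec ?T U\<^esub> s') = rst ?T U V s \<oplus>\<^bsub>sec ?T V\<^esub> rst ?T U V s'"
        using rst[OF ts(1)] rst[OF us(1)] rst[of "ts @ us"] tensor_add[OF sec_mod[OF U] ts(1) us(1)]
          tensor_add[OF sec_mod[OF V(1)] rst(2)[OF ts(1)] rst(2)[OF us(1)]]
        unfolding ts(2) us(2) T by simp
    next
      fix l s assume l: "l \<in> carrier L" and "s \<in> carrier (sec ?T U)"
      then obtain ts where ts: "ts \<in> formal_sums L (sec F U)" "s = tensor_class L K (sec F U) ts"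
        unfolding car[OF U] by blast
      let ?s = "\<lambda>ts. map (map_prod (\<lambda>a. l \<otimes>\<^bsub>L\<^esub> a) id) ts"
      have "?s ts \<in> formal_sums L (sec F U)" using ts l by auto
      moreover have "?r (?s ts) = ?s (?r ts)" by (simp add: case_prod_unfold map_prod_def)
      ultimately show "rst ?T U V (l \<odot>\<^bsub>sec ?T U\<^esub> s) = l \<odot>\<^bsub>sec ?T V\<^esub> rst ?T U V s"
        using rst[OF ts(1)] rst[of "?s ts"] tensor_smult[OF sec_mod[OF U] l ts(1)]
          tensor_smult[OF sec_mod[OF V(1)] l rst(2)[OF ts(1)]]
        unfolding ts(2) T by metis
    qed
  next
    fix U V W assume U: "openin X U" and V: "openin X V" and W: "openin X W" "W \<subseteq> V" "V \<subseteq> U"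
    have WU: "W \<subseteq> U" using W by blast
    show "\<forall>s \<in> carrier (sec ?T U). rst ?T V W (rst ?T U V s) = rst ?T U W s"
    proof
      fix s assume "s \<in> carrier (sec ?T U)"
      then obtain ts where ts: "ts \<in> formal_sums L (sec F U)" "s = tensor_class L K (sec F U) ts"
        unfolding car[OF U] by blast
      have "map (map_prod id (rst F V W)) (map (map_prod id (rst F U V)) ts) = map (map_prod id (rst F U W)) ts"
        unfolding map_map using ts(1) F.rst_rst[OF U V W] by (intro map_cong[OF HOL.refl]) auto
      then show "rst ?T V W (rst ?T U V s) = rst ?T U W s"
        using tensor_presheaf_rst[OF U V W(3) ts(1)] tensor_presheaf_rst[OF U W(1) WU ts(1)]
          tensor_presheaf_rst[OF V W(1,2) rst_formal_sums[OF U V W(3) ts(1)]] ts(2) by metis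
    qed
  qed
qed

text \<open>Coordinates in a frame exhibit the presheaf tensor product as a
  retract of a finite power of the sheaf, so local tensors can be glued coordinatewise.\<close>

lemma tensor_presheaf_sheaf: "sheaf L X (tensor_presheaf L K F)"
  unfolding sheaf_def
proof (intro conjI allI impI tensor_presheaf_presheaf)
  let ?T = "tensor_presheaf L K F"
  fix \<U> s
  assume "(\<forall>V \<in> \<U>. openin X V \<and> s V \<in> carrier (sec ?T V)) \<and>
    (\<forall>V \<in> \<U>. \<forall>W \<in> \<U>. rst ?T V (V \<inter> W) (s V) = rst ?T W (V \<inter> W) (s W))"
  then have V: "openin X V" and s: "s V \<in> carrier (sec ?T V)"
    and comp: "W \<in> \<U> \<Longrightarrow> rst ?T V (V \<inter> W) (s V) = rst ?T W (V \<inter> W) (s W)" if "V \<in> \<U>" for V W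
    using that by blast+
  have U: "openin X (\<Union>\<U>)" using V by blast
  have car: "carrier (sec ?T U) = tensor_class L K (sec F U) ` formal_sums L (sec F U)" if "openin X U" for U
    using tensor_carrier[OF sec_mod[OF that]] by (simp add: tensor_presheaf_def)
  have "\<forall>V \<in> \<U>. \<exists>ts. ts \<in> formal_sums L (sec F V) \<and> s V = tensor_class L K (sec F V) ts"
  proof
    fix V assume V': "V \<in> \<U>"
    from s[OF V'] show "\<exists>ts. ts \<in> formal_sums L (sec F V) \<and> s V = tensor_class L K (sec F V) ts"
      unfolding car[OF V[OF V']] by blast
  qed
  then obtain ts where "\<forall>V \<in> \<U>. ts V \<in> formal_sums L (sec F V) \<and> s V = tensor_class L K (sec F V) (ts V)"
    by (rule bchoice[THEN exE])
  then have ts: "ts V \<in> formal_sums L (sec F V)" "s V = tensor_class L K (sec F V) (ts V)" if "V \<in> \<U>" for V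
    using that by blast+
  have rst_eq: "rst ?T V W (s V) = tensor_class L K (sec F W) us \<longleftrightarrow>
      (\<forall>i \<in> set I. rst F V W (coord (sec F V) i (ts V)) = coord (sec F W) i us)"
    if "V \<in> \<U>" "openin X W" "W \<subseteq> V" "us \<in> formal_sums L (sec F W)" for V W us
    using tensor_presheaf_rst[OF V[OF that(1)] that(2,3) ts(1)[OF that(1)]] ts(2)[OF that(1)]
      tensor_class_eq_iff[OF sec_mod[OF that(2)] rst_formal_sums[OF V[OF that(1)] that(2,3) ts(1)[OF that(1)]]]
      tensor_eq_iff_coord[OF sec_mod[OF that(2)] rst_formal_sums[OF V[OF that(1)] that(2,3) ts(1)[OF that(1)]] that(4)]
      coord_map[OF sec_mod[OF V[OF that(1)]] sec_mod[OF that(2)] F.rst_hom[OF V[OF that(1)] that(2,3)] ts(1)[OF that(1)]]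
    by auto
  have glue: "\<exists>!c. c \<in> carrier (sec F (\<Union>\<U>)) \<and> (\<forall>V \<in> \<U>. rst F (\<Union>\<U>) V c = coord (sec F V) i (ts V))"
    if i: "i \<in> set I" for i
  proof (rule sheaf_glue[OF F V])
    fix V W assume VW: "V \<in> \<U>" "W \<in> \<U>"
    have o: "openin X (V \<inter> W)" using V VW by blast
    have sub: "V \<inter> W \<subseteq> V" "V \<inter> W \<subseteq> W" by auto
    have "rst ?T V (V \<inter> W) (s V) = tensor_class L K (sec F (V \<inter> W)) (map (map_prod id (rst F W (V \<inter> W))) (ts W))"
      using comp[OF VW] tensor_presheaf_rst[OF V[OF VW(2)] o sub(2) ts(1)[OF VW(2)]] ts(2)[OF VW(2)] by simp
    then have "rst F V (V \<inter> W) (coord (sec F V) i (ts V)) =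
        coord (sec F (V \<inter> W)) i (map (map_prod id (rst F W (V \<inter> W))) (ts W))"
      using rst_eq[OF VW(1) o sub(1) rst_formal_sums[OF V[OF VW(2)] o sub(2) ts(1)[OF VW(2)]]] i by simp
    then show "rst F V (V \<inter> W) (coord (sec F V) i (ts V)) = rst F W (V \<inter> W) (coord (sec F W) i (ts W))"
      using coord_map[OF sec_mod[OF V[OF VW(2)]] sec_mod[OF o] F.rst_hom[OF V[OF VW(2)] o sub(2)] ts(1)[OF VW(2)] i]
      by simp
  qed (use coord_closed[OF sec_mod[OF V] i ts(1)] in blast)+
  define c where "c i = (THE c. c \<in> carrier (sec F (\<Union>\<U>)) \<and> (\<forall>V \<in> \<U>. rst F (\<Union>\<U>) V c = coord (sec F V) i (ts V)))" for i
  have c: "c i \<in> carrier (sec F (\<Union>\<U>))" "\<And>V. V \<in> \<U> \<Longrightarrow> rst F (\<Union>\<U>) V (c i) = coord (sec F V) i (ts V)"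
    if "i \<in> set I" for i
    using theI'[OF glue[OF that]] by (auto simp: c_def)
  have cu: "d = c i" if "i \<in> set I" "d \<in> carrier (sec F (\<Union>\<U>))"
    "\<And>V. V \<in> \<U> \<Longrightarrow> rst F (\<Union>\<U>) V d = coord (sec F V) i (ts V)" for i d
    using glue[OF that(1)] c[OF that(1)] that(2,3) by blast
  let ?ts = "map (\<lambda>i. (x i, c i)) I"
  have wf: "?ts \<in> formal_sums L (sec F (\<Union>\<U>))" using c x_closed by auto
  show "\<exists>!u. u \<in> carrier (sec ?T (\<Union>\<U>)) \<and> (\<forall>V \<in> \<U>. rst ?T (\<Union>\<U>) V u = s V)"
  proof (rule ex1I[of _ "tensor_class L K (sec F (\<Union>\<U>)) ?ts"])
    have "rst ?T (\<Union>\<U>) V (tensor_class L K (sec F (\<Union>\<U>)) ?ts) = s V" if V': "V \<in> \<U>" for V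
    proof -
      have "rst ?T (\<Union>\<U>) V (tensor_class L K (sec F (\<Union>\<U>)) ?ts) =
          tensor_class L K (sec F V) (map (\<lambda>i. (x i, coord (sec F V) i (ts V))) I)"
        unfolding tensor_presheaf_rst[OF U V[OF V'] Union_upper[OF V'] wf]
        using c(2)[OF _ V'] by (intro arg_cong[where f = "tensor_class L K (sec F V)"]) simp
      also have "\<dots> = s V"
        unfolding ts(2)[OF V']
        by (rule tensor_class_eq_iff[OF sec_mod[OF V[OF V']] ts(1)[OF V'], THEN iffD2, symmetric])
          (rule tensor_eq_coord[OF sec_mod[OF V[OF V']] ts(1)[OF V']])
      finally show ?thesis .
    qed
    then show "tensor_class L K (sec F (\<Union>\<U>)) ?ts \<in> carrier (sec ?T (\<Union>\<U>)) \<and>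
        (\<forall>V \<in> \<U>. rst ?T (\<Union>\<U>) V (tensor_class L K (sec F (\<Union>\<U>)) ?ts) = s V)"
      using wf unfolding car[OF U] by blast
  next
    fix u assume u: "u \<in> carrier (sec ?T (\<Union>\<U>)) \<and> (\<forall>V \<in> \<U>. rst ?T (\<Union>\<U>) V u = s V)"
    then obtain us where us: "us \<in> formal_sums L (sec F (\<Union>\<U>))" "u = tensor_class L K (sec F (\<Union>\<U>)) us"
      unfolding car[OF U] by blast
    have "coord (sec F (\<Union>\<U>)) i us = c i" if i: "i \<in> set I" for i
    proof (rule cu[OF i coord_closed[OF sec_mod[OF U] i us(1)]])
      fix V assume V': "V \<in> \<U>"
      note r = rst_formal_sums[OF U V[OF V'] Union_upper[OF V'] us(1)]
      have "tensor_class L K (sec F V) (map (map_prod id (rst F (\<Union>\<U>) V)) us) = tensor_class L K (sec F V) (ts V)"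
        using u V' tensor_presheaf_rst[OF U V[OF V'] Union_upper[OF V'] us(1)] us(2) ts(2)[OF V'] by simp
      then have "coord (sec F V) i (map (map_prod id (rst F (\<Union>\<U>) V)) us) = coord (sec F V) i (ts V)"
        using tensor_class_eq_iff[OF sec_mod[OF V[OF V']] r] tensor_eq_iff_coord[OF sec_mod[OF V[OF V']] r ts(1)[OF V']] i
        by simp
      then show "rst F (\<Union>\<U>) V (coord (sec F (\<Union>\<U>)) i us) = coord (sec F V) i (ts V)"
        using coord_map[OF sec_mod[OF U] sec_mod[OF V[OF V']] F.rst_hom[OF U V[OF V'] Union_upper[OF V']] us(1) i] by simp
    qed
    then have e: "map (\<lambda>i. (x i, coord (sec F (\<Union>\<U>)) i us)) I = ?ts" by simp
    show "u = tensor_class L K (sec F (\<Union>\<U>)) ?ts"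
      unfolding us(2) tensor_class_eq_iff[OF sec_mod[OF U] us(1)]
      using tensor_eq_coord[OF sec_mod[OF U] us(1)] unfolding e .
  qed
qed

end

end


context frame
begin

text \<open>The section of \<open>L\<^sub>X \<otimes> F\<close> over \<open>U\<close> given by a formal sum over \<open>U\<close>.\<close>

definition tens ::
  "'x topology \<Rightarrow> ('x, 'l, ('x, 'l, 'b) univ) psheaf \<Rightarrow> 'x set \<Rightarrow> ('l \<times> ('x, 'l, 'b) univ) list \<Rightarrow>
   ('x, 'l, 'b) univ" where
  "tens X F U ts = encode (germs_of X (tensor_presheaf L K F) U (tensor_class L K (sec F U) ts))"

text \<open>A formal sum for a given section; all sections have one because the presheaf tensor product is a
  sheaf.\<close>

definition rep_sum ::
  "'x topology \<Rightarrow> ('x, 'l, ('x, 'l, 'b) univ) psheaf \<Rightarrow> 'x set \<Rightarrow> ('x, 'l, 'b) univ \<Rightarrow>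
   ('l \<times> ('x, 'l, 'b) univ) list" where
  "rep_sum X F U a = (SOME ts. ts \<in> formal_sums L (sec F U) \<and> tens X F U ts = a)"

definition coordinate ::
  "'x topology \<Rightarrow> ('x, 'l, ('x, 'l, 'b) univ) psheaf \<Rightarrow> 'x set \<Rightarrow> 'i \<Rightarrow> ('x, 'l, 'b) univ \<Rightarrow>
   ('x, 'l, 'b) univ" where
  "coordinate X F U i a = tensor_lift (sec F U) (\<lambda>l v. t i l \<odot>\<^bsub>sec F U\<^esub> v) (rep_sum X F U a)"

text \<open>The morphism out of \<open>L\<^sub>X \<otimes> F\<close> given by balanced maps \<open>B U : L \<times> F(U) \<rightarrow> H(U)\<close>.\<close>

definition ext_lift ::
  "'x topology \<Rightarrow> ('x, 'l, ('x, 'l, 'b) univ) psheaf \<Rightarrow> ('x, 'l, ('x, 'l, 'b) univ) psheaf \<Rightarrow>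
   ('x set \<Rightarrow> 'l \<Rightarrow> ('x, 'l, 'b) univ \<Rightarrow> ('x, 'l, 'b) univ) \<Rightarrow>
   'x set \<Rightarrow> ('x, 'l, 'b) univ \<Rightarrow> ('x, 'l, 'b) univ" where
  "ext_lift X F H B = ext_mor X (ext_sheaf L K X F) (\<lambda>U a. tensor_lift (sec H U) (B U) (rep_sum X F U a))"

context
  fixes X :: "'x topology" and F :: "('x, 'l, ('x, 'l, 'b) univ) psheaf"
  assumes F: "sheaf RK X F"
begin

interpretation F: operations_presheaf RK X F
  by (rule presheaf_operations[OF sheaf_presheaf[OF F]])

private abbreviation "T \<equiv> tensor_presheaf L K F"
private abbreviation "E \<equiv> ext_sheaf L K X F"
private abbreviation "fs U \<equiv> formal_sums L (sec F U)"

interpretation T: operations_presheaf L X T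
  by (rule presheaf_operations[OF tensor_presheaf_presheaf[OF F]])

lemma sec_T: "sec T U = tensor L K (sec F U)"
  by (simp add: tensor_presheaf_def)

lemma T_carrier: "openin X U \<Longrightarrow> carrier (sec T U) = tensor_class L K (sec F U) ` fs U"
  using tensor_carrier[OF sec_mod[OF F]] by (simp add: sec_T)

text \<open>From the chosen representative of the chosen representative of a germ, the germ is recovered: it is
  the germ of the class of the list.\<close>

lemma encode_inj:
  assumes U: "openin X U"
  shows "inj_on encode (carrier (sec (sheafify X T) U))"
proof (rule inj_onI, rule ext)
  fix \<sigma> \<tau> x
  assume \<sigma>: "\<sigma> \<in> carrier (sec (sheafify X T) U)" and \<tau>: "\<tau> \<in> carrier (sec (sheafify X T) U)"
    and eq: "encode \<sigma> = encode \<tau>"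
  show "\<sigma> x = \<tau> x"
  proof (cases "x \<in> U")
    case True
    have rep: "\<exists>V A ts. (SOME p. p \<in> \<rho> x) = (V, A) \<and> (SOME ts. ts \<in> A) = ts \<and>
        A = tensor_class L K (sec F V) ts \<and> \<rho> x = germ X T x V A"
      if \<rho>: "\<rho> \<in> carrier (sec (sheafify X T) U)" for \<rho>
    proof -
      obtain W B where W: "openin X W" "x \<in> W" "B \<in> carrier (sec T W)" "\<rho> x = germ X T x W B"
        using T.sheafify_local[OF \<rho> True] by blast
      obtain V A where VA: "(SOME p. p \<in> \<rho> x) = (V, A)" by (cases "SOME p. p \<in> \<rho> x")
      have "(SOME p. p \<in> \<rho> x) \<in> \<rho> x"
        unfolding W(4) by (rule someI[of _ "(W, B)"]) (rule T.germ_self[OF W(1-3)])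
      then have m: "(V, A) \<in> germ X T x W B" unfolding VA using W(4) by simp
      note V = T.mem_germ[OF m W(1-3)]
      obtain us where us: "us \<in> fs V" "A = tensor_class L K (sec F V) us"
        using V(3) unfolding T_carrier[OF V(1)] by blast
      have "us \<in> A" unfolding us(2) by (rule tensor_class_self[OF sec_mod[OF F V(1)] us(1)])
      then have "(SOME ts. ts \<in> A) \<in> A" by (rule someI)
      then have "tensor_eq L K (sec F V) us (SOME ts. ts \<in> A)"
        using tensor_classD[OF sec_mod[OF F V(1)]] us(2) by blast
      then have "A = tensor_class L K (sec F V) (SOME ts. ts \<in> A)"
        using tensor_class_eq_iff[OF sec_mod[OF F V(1)] us(1)] us(2) by simp
      then show ?thesis using VA V(4) W(4) by metis
    qed
    obtain V A ts where 1: "(SOME p. p \<in> \<sigma> x) = (V, A)" "(SOME ts. ts \<in> A) = ts"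
      "A = tensor_class L K (sec F V) ts" "\<sigma> x = germ X T x V A" using rep[OF \<sigma>] by blast
    obtain W B us where 2: "(SOME p. p \<in> \<tau> x) = (W, B)" "(SOME us. us \<in> B) = us"
      "B = tensor_class L K (sec F W) us" "\<tau> x = germ X T x W B" using rep[OF \<tau>] by blast
    have "(V, ts) = (W, us)"
      using eq fun_cong[of "\<lambda>x. let (V, A) = SOME p. p \<in> \<sigma> x in (V, SOME ts. ts \<in> A)"
          "\<lambda>x. let (V, A) = SOME p. p \<in> \<tau> x in (V, SOME ts. ts \<in> A)" x] 1(1,2) 2(1,2)
      unfolding encode_def by simp
    then show ?thesis using 1(3,4) 2(3,4) by simp
  next
    case False
    then show ?thesis using \<sigma> \<tau> by (simp add: sheafify_def)
  qed
qed

private abbreviation "\<theta> U A \<equiv> encode (germs_of X T U A)"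

lemma ext_bij:
  assumes U: "openin X U"
  shows "bij_betw (\<theta> U) (carrier (sec T U)) (carrier (sec E U))"
proof -
  have "carrier (sec E U) = encode ` carrier (sec (sheafify X T) U)"
    by (simp add: ext_sheaf_def transport_psheaf_def transport_module_def Let_def)
  then have "bij_betw encode (carrier (sec (sheafify X T) U)) (carrier (sec E U))"
    using encode_inj[OF U] by (simp add: bij_betw_def)
  from bij_betw_trans[OF germs_of_bij[OF tensor_presheaf_sheaf[OF F] U] this]
  show ?thesis by (simp add: comp_def)
qed

lemma germs_of_mem: "\<lbrakk>openin X U; A \<in> carrier (sec T U)\<rbrakk> \<Longrightarrow> germs_of X T U A \<in> carrier (sec (sheafify X T) U)"
  using germs_of_bij[OF tensor_presheaf_sheaf[OF F]] by (auto simp: bij_betw_def)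

lemma decode_encode:
  "\<lbrakk>openin X U; A \<in> carrier (sec T U)\<rbrakk> \<Longrightarrow>
    inv_into (carrier (sec (sheafify X T) U)) encode (\<theta> U A) = germs_of X T U A"
  by (rule inv_into_f_f[OF encode_inj germs_of_mem])

lemma ext_sheaf_ops:
  "openin X U \<Longrightarrow> \<theta> U \<zero>\<^bsub>sec T U\<^esub> = \<zero>\<^bsub>sec E U\<^esub>"
  "\<lbrakk>openin X U; A \<in> carrier (sec T U); B \<in> carrier (sec T U)\<rbrakk> \<Longrightarrow> \<theta> U A \<oplus>\<^bsub>sec E U\<^esub> \<theta> U B = \<theta> U (A \<oplus>\<^bsub>sec T U\<^esub> B)"
  "\<lbrakk>openin X U; l \<in> carrier L; A \<in> carrier (sec T U)\<rbrakk> \<Longrightarrow> l \<odot>\<^bsub>sec E U\<^esub> \<theta> U A = \<theta> U (l \<odot>\<^bsub>sec T U\<^esub> A)"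
  "\<lbrakk>openin X U; openin X V; V \<subseteq> U; A \<in> carrier (sec T U)\<rbrakk> \<Longrightarrow> rst E U V (\<theta> U A) = \<theta> V (rst T U V A)"
  using germs_of_zero[OF tensor_presheaf_presheaf[OF F], of U]
    germs_of_add[OF T.operations_presheaf_axioms, of U A B]
    germs_of_smult[OF T.operations_presheaf_axioms, of U A l]
    germs_of_rst[OF T.operations_presheaf_axioms, of U V A]
  by (simp_all add: ext_sheaf_def transport_psheaf_def transport_module_def Let_def decode_encode)

lemma ext_sheaf_sheaf: "sheaf L X E"
  by (rule sheaf_transport[OF tensor_presheaf_sheaf[OF F], of "\<theta>"])
    (simp_all add: ext_bij ext_sheaf_ops)

lemma tens_carrier: "openin X U \<Longrightarrow> carrier (sec E U) = tens X F U ` fs U"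
  using ext_bij[of U] by (auto simp: bij_betw_def T_carrier tens_def)

lemma tens_mem: "\<lbrakk>openin X U; ts \<in> fs U\<rbrakk> \<Longrightarrow> tens X F U ts \<in> carrier (sec E U)"
  using tens_carrier by blast

lemma tens_eq_iff_tensor_eq:
  assumes U: "openin X U" and ts: "ts \<in> fs U" and us: "us \<in> fs U"
  shows "tens X F U ts = tens X F U us \<longleftrightarrow> tensor_eq L K (sec F U) ts us"
proof -
  have "tensor_class L K (sec F U) ts \<in> carrier (sec T U)" "tensor_class L K (sec F U) us \<in> carrier (sec T U)"
    using ts us T_carrier[OF U] by auto
  then have "tens X F U ts = tens X F U us \<longleftrightarrow> tensor_class L K (sec F U) ts = tensor_class L K (sec F U) us"
    using ext_bij[OF U] unfolding tens_def bij_betw_def by (auto dest: inj_onD)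
  then show ?thesis using tensor_class_eq_iff[OF sec_mod[OF F U] ts] by simp
qed

lemma tens_add:
  assumes U: "openin X U" and ts: "ts \<in> fs U" and us: "us \<in> fs U"
  shows "tens X F U ts \<oplus>\<^bsub>sec E U\<^esub> tens X F U us = tens X F U (ts @ us)"
  using ext_sheaf_ops(2)[OF U] ts us T_carrier[OF U] tensor_add[OF sec_mod[OF F U] ts us]
  by (simp add: tens_def sec_T)

lemma tens_smult:
  assumes U: "openin X U" and ts: "ts \<in> fs U" and l: "l \<in> carrier L"
  shows "l \<odot>\<^bsub>sec E U\<^esub> tens X F U ts = tens X F U (map (map_prod (\<lambda>a. l \<otimes>\<^bsub>L\<^esub> a) id) ts)"
  using ext_sheaf_ops(3)[OF U l] ts T_carrier[OF U] tensor_smult[OF sec_mod[OF F U] l ts]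
  by (simp add: tens_def sec_T)

lemma tens_zero: "openin X U \<Longrightarrow> \<zero>\<^bsub>sec E U\<^esub> = tens X F U []"
  using ext_sheaf_ops(1)[of U] tensor_zero[OF sec_mod[OF F]] by (simp add: tens_def sec_T)

lemma tens_rst:
  assumes U: "openin X U" "openin X V" "V \<subseteq> U" and ts: "ts \<in> fs U"
  shows "rst E U V (tens X F U ts) = tens X F V (map (map_prod id (rst F U V)) ts)"
  using ext_sheaf_ops(4)[OF U] ts T_carrier[OF U(1)] tensor_presheaf_rst[OF F U ts]
  by (simp add: tens_def)

lemma rep_sum:
  assumes "openin X U" "a \<in> carrier (sec E U)"
  shows "rep_sum X F U a \<in> fs U" "tens X F U (rep_sum X F U a) = a"
proof -
  have "\<exists>ts. ts \<in> fs U \<and> tens X F U ts = a" using assms(2) unfolding tens_carrier[OF assms(1)] by blast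
  then have "rep_sum X F U a \<in> fs U \<and> tens X F U (rep_sum X F U a) = a"
    unfolding rep_sum_def by (rule someI_ex)
  then show "rep_sum X F U a \<in> fs U" "tens X F U (rep_sum X F U a) = a" by blast+
qed

lemma tensor_lift_rep_sum:
  assumes U: "openin X U" and ts: "ts \<in> fs U" and W: "abelian_group W" and B: "balanced L K (sec F U) W B"
  shows "tensor_lift W B (rep_sum X F U (tens X F U ts)) = tensor_lift W B ts"
  using tens_eq_iff_tensor_eq[OF U rep_sum(1)[OF U tens_mem[OF U ts]] ts] rep_sum(2)[OF U tens_mem[OF U ts]]
    tensor_lift_eq[OF sec_mod[OF F U] _ W B] by simp

lemma coordinate_tens:
  assumes U: "openin X U" and ts: "ts \<in> fs U" and i: "i \<in> set I"
  shows "coordinate X F U i (tens X F U ts) = coord (sec F U) i ts"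
  unfolding coordinate_def coord_def[OF sec_mod[OF F U]]
  by (rule tensor_lift_rep_sum[OF U ts module.axioms(2)[OF sec_mod[OF F U]] balanced_coord[OF sec_mod[OF F U] i]])

lemma coordinate_closed:
  assumes U: "openin X U" and a: "a \<in> carrier (sec E U)" and i: "i \<in> set I"
  shows "coordinate X F U i a \<in> carrier (sec F U)"
  using coordinate_tens[OF U rep_sum(1)[OF U a] i] rep_sum(2)[OF U a]
    coord_closed[OF sec_mod[OF F U] i rep_sum(1)[OF U a]] by simp

lemma coordinate_expand:
  assumes U: "openin X U" and a: "a \<in> carrier (sec E U)"
  shows "a = tens X F U (map (\<lambda>i. (x i, coordinate X F U i a)) I)"
proof -
  note r = rep_sum[OF U a]
  have e: "map (\<lambda>i. (x i, coordinate X F U i a)) I = map (\<lambda>i. (x i, coord (sec F U) i (rep_sum X F U a))) I"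
    using coordinate_tens[OF U r(1)] r(2) by simp
  have w: "map (\<lambda>i. (x i, coord (sec F U) i (rep_sum X F U a))) I \<in> fs U"
    using x_closed coord_closed[OF sec_mod[OF F U] _ r(1)] by auto
  have "tens X F U (rep_sum X F U a) = tens X F U (map (\<lambda>i. (x i, coord (sec F U) i (rep_sum X F U a))) I)"
    by (rule tens_eq_iff_tensor_eq[OF U r(1) w, THEN iffD2, OF tensor_eq_coord[OF sec_mod[OF F U] r(1)]])
  then show ?thesis unfolding e r(2) .
qed

lemma coordinate_eqI:
  assumes U: "openin X U" and a: "a \<in> carrier (sec E U)" and b: "b \<in> carrier (sec E U)"
    and "\<And>i. i \<in> set I \<Longrightarrow> coordinate X F U i a = coordinate X F U i b"
  shows "a = b"
proof -
  have "map (\<lambda>i. (x i, coordinate X F U i a)) I = map (\<lambda>i. (x i, coordinate X F U i b)) I"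
    using assms(4) by simp
  then show ?thesis using coordinate_expand[OF U a] coordinate_expand[OF U b] by metis
qed

lemma coordinate_zero: "\<lbrakk>openin X U; i \<in> set I\<rbrakk> \<Longrightarrow> coordinate X F U i \<zero>\<^bsub>sec E U\<^esub> = \<zero>\<^bsub>sec F U\<^esub>"
  using coordinate_tens[of U "[]" i] tens_zero[of U] by (simp add: coord_def[OF sec_mod[OF F]])

lemma coordinate_add:
  assumes U: "openin X U" and a: "a \<in> carrier (sec E U)" and b: "b \<in> carrier (sec E U)" and i: "i \<in> set I"
  shows "coordinate X F U i (a \<oplus>\<^bsub>sec E U\<^esub> b) = coordinate X F U i a \<oplus>\<^bsub>sec F U\<^esub> coordinate X F U i b"
proof -
  note ra = rep_sum[OF U a] and rb = rep_sum[OF U b]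
  have ab: "rep_sum X F U a @ rep_sum X F U b \<in> fs U" using ra(1) rb(1) by simp
  have "coordinate X F U i (a \<oplus>\<^bsub>sec E U\<^esub> b) = coord (sec F U) i (rep_sum X F U a @ rep_sum X F U b)"
    using tens_add[OF U ra(1) rb(1)] coordinate_tens[OF U ab i] ra(2) rb(2) by simp
  also have "\<dots> = coord (sec F U) i (rep_sum X F U a) \<oplus>\<^bsub>sec F U\<^esub> coord (sec F U) i (rep_sum X F U b)"
    unfolding coord_def[OF sec_mod[OF F U]]
    by (rule tensor_lift_append[OF sec_mod[OF F U] module.axioms(2)[OF sec_mod[OF F U]]
          balanced_coord[OF sec_mod[OF F U] i] ra(1) rb(1)])
  finally show ?thesis using coordinate_tens[OF U ra(1) i] coordinate_tens[OF U rb(1) i] ra(2) rb(2) by simp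
qed

lemma coordinate_rst:
  assumes U: "openin X U" "openin X V" "V \<subseteq> U" and a: "a \<in> carrier (sec E U)" and i: "i \<in> set I"
  shows "coordinate X F V i (rst E U V a) = rst F U V (coordinate X F U i a)"
proof -
  note r = rep_sum[OF U(1) a]
  have "rst E U V a = tens X F V (map (map_prod id (rst F U V)) (rep_sum X F U a))"
    using tens_rst[OF U r(1)] r(2) by simp
  then have "coordinate X F V i (rst E U V a) = coord (sec F V) i (map (map_prod id (rst F U V)) (rep_sum X F U a))"
    using coordinate_tens[OF U(2) rst_formal_sums[OF F U r(1)] i] by simp
  also have "\<dots> = rst F U V (coord (sec F U) i (rep_sum X F U a))"
    by (rule coord_map[OF sec_mod[OF F U(1)] sec_mod[OF F U(2)] F.rst_hom[OF U] r(1) i])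
  finally show ?thesis using coordinate_tens[OF U(1) r(1) i] r(2) by simp
qed

lemma ext_lift_tens:
  assumes U: "openin X U" and ts: "ts \<in> fs U" and W: "abelian_group (sec H U)"
    and B: "balanced L K (sec F U) (sec H U) (B U)"
  shows "ext_lift X F H B U (tens X F U ts) = tensor_lift (sec H U) (B U) ts"
  using tensor_lift_rep_sum[OF U ts W B] tens_mem[OF U ts] U by (simp add: ext_lift_def ext_mor_def)

lemma ext_lift_hom:
  assumes H: "sheaf R' X H" and R': "carrier R' \<subseteq> carrier L"
    and B: "\<And>U. openin X U \<Longrightarrow> balanced L K (sec F U) (sec H U) (B U)"
    and natural: "\<And>U V a v. \<lbrakk>openin X U; openin X V; V \<subseteq> U; a \<in> carrier L; v \<in> carrier (sec F U)\<rbrakk>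
      \<Longrightarrow> rst H U V (B U a v) = B V a (rst F U V v)"
    and smult: "\<And>U k a v. \<lbrakk>openin X U; k \<in> carrier R'; a \<in> carrier L; v \<in> carrier (sec F U)\<rbrakk>
      \<Longrightarrow> B U (k \<otimes>\<^bsub>L\<^esub> a) v = k \<odot>\<^bsub>sec H U\<^esub> B U a v"
  shows "ext_lift X F H B \<in> psheaf_hom R' X E H"
proof -
  interpret H: operations_presheaf R' X H by (rule presheaf_operations[OF sheaf_presheaf[OF H]])
  interpret E: operations_presheaf L X E by (rule presheaf_operations[OF sheaf_presheaf[OF ext_sheaf_sheaf]])
  have Hm: "module R' (sec H U)" if "openin X U" for U by (rule presheaf_module[OF sheaf_presheaf[OF H] that])
  note Hg = module.axioms(2)[OF Hm]
  let ?f = "ext_lift X F H B"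
  have ft: "?f U (tens X F U ts) = tensor_lift (sec H U) (B U) ts" if "openin X U" "ts \<in> fs U" for U ts
    by (rule ext_lift_tens[where H = H and B = B, OF that Hg[OF that(1)] B[OF that(1)]])
  have "?f U \<in> mod_hom R' (sec E U) (sec H U)" if U: "openin X U" for U
    unfolding mod_hom_def
  proof (intro CollectI conjI ballI funcsetI)
    fix a assume a: "a \<in> carrier (sec E U)"
    show "?f U a \<in> carrier (sec H U)"
      using ft[OF U rep_sum(1)[OF U a]] rep_sum(2)[OF U a]
        tensor_lift_closed[OF sec_mod[OF F U] Hg[OF U] B[OF U] rep_sum(1)[OF U a]] by simp
  next
    fix a b assume a: "a \<in> carrier (sec E U)" and b: "b \<in> carrier (sec E U)"
    note ra = rep_sum[OF U a] and rb = rep_sum[OF U b]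
    have ab: "rep_sum X F U a @ rep_sum X F U b \<in> fs U" using ra(1) rb(1) by simp
    have "?f U (a \<oplus>\<^bsub>sec E U\<^esub> b) = tensor_lift (sec H U) (B U) (rep_sum X F U a @ rep_sum X F U b)"
      using tens_add[OF U ra(1) rb(1)] ft[OF U ab] ra(2) rb(2) by simp
    also have "\<dots> = tensor_lift (sec H U) (B U) (rep_sum X F U a) \<oplus>\<^bsub>sec H U\<^esub>
        tensor_lift (sec H U) (B U) (rep_sum X F U b)"
      by (rule tensor_lift_append[OF sec_mod[OF F U] Hg[OF U] B[OF U] ra(1) rb(1)])
    finally show "?f U (a \<oplus>\<^bsub>sec E U\<^esub> b) = ?f U a \<oplus>\<^bsub>sec H U\<^esub> ?f U b"
      using ft[OF U ra(1)] ft[OF U rb(1)] ra(2) rb(2) by simp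
  next
    fix k a assume k: "k \<in> carrier R'" and a: "a \<in> carrier (sec E U)"
    have kL: "k \<in> carrier L" using k R' by blast
    note ra = rep_sum[OF U a]
    let ?ts = "rep_sum X F U a"
    have w: "map (map_prod (\<lambda>a. k \<otimes>\<^bsub>L\<^esub> a) id) ?ts \<in> fs U" using ra(1) kL by auto
    have "?f U (k \<odot>\<^bsub>sec E U\<^esub> a) = tensor_lift (sec H U) (B U) (map (map_prod (\<lambda>a. k \<otimes>\<^bsub>L\<^esub> a) id) ?ts)"
      using tens_smult[OF U ra(1) kL] ft[OF U w] ra(2) by simp
    also have "\<dots> = tensor_lift (sec H U) (\<lambda>a v. k \<odot>\<^bsub>sec H U\<^esub> B U a v) ?ts"
      unfolding tensor_lift_map using smult[OF U k] ra(1)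
      by (intro tensor_lift_cong[OF sec_mod[OF F U]]) auto
    also have "\<dots> = k \<odot>\<^bsub>sec H U\<^esub> tensor_lift (sec H U) (B U) ?ts"
      unfolding tensor_lift_def using balancedD(1)[OF B[OF U]] ra(1)
      by (intro module.smult_lsum[OF Hm[OF U] k, symmetric]) auto
    finally show "?f U (k \<odot>\<^bsub>sec E U\<^esub> a) = k \<odot>\<^bsub>sec H U\<^esub> ?f U a"
      using ft[OF U ra(1)] ra(2) by simp
  qed
  moreover have "rst H U V (?f U a) = ?f V (rst E U V a)"
    if U: "openin X U" "openin X V" "V \<subseteq> U" and a: "a \<in> carrier (sec E U)" for U V a
  proof -
    note ra = rep_sum[OF U(1) a]
    have "rst H U V (?f U a) = rst H U V (tensor_lift (sec H U) (B U) (rep_sum X F U a))"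
      using ft[OF U(1) ra(1)] ra(2) by simp
    also have "\<dots> = tensor_lift (sec H V) (\<lambda>a v. rst H U V (B U a v)) (rep_sum X F U a)"
      unfolding tensor_lift_def using balancedD(1)[OF B[OF U(1)]] ra(1)
      by (intro mod_hom_lsum[OF Hm[OF U(1)] Hm[OF U(2)] H.rst_hom[OF U]]) auto
    also have "\<dots> = tensor_lift (sec H V) (\<lambda>a v. B V (id a) (rst F U V v)) (rep_sum X F U a)"
      using natural[OF U] ra(1) by (intro tensor_lift_cong[OF sec_mod[OF F U(1)]]) auto
    also have "\<dots> = ?f V (rst E U V a)"
      using tens_rst[OF U ra(1)] ra(2) ft[OF U(2) rst_formal_sums[OF F U ra(1)]] by (simp add: tensor_lift_map)
    finally show ?thesis .
  qed
  moreover have "ext_mor X E ?f = ?f" by (auto simp: ext_lift_def ext_mor_def fun_eq_iff)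
  ultimately show ?thesis unfolding psheaf_hom_def by blast
qed

text \<open>A morphism into \<open>L\<^sub>X \<otimes> F\<close> of the form \<open>v \<mapsto> \<Sum>\<^sub>j y\<^sub>j \<otimes> c\<^sub>j(v)\<close>.\<close>

lemma ext_into_hom:
  fixes J :: "'j list"
  assumes H: "sheaf R' X H" and R': "carrier R' \<subseteq> carrier L"
    and y: "\<And>j. j \<in> set J \<Longrightarrow> y j \<in> carrier L"
    and c: "\<And>U j v. \<lbrakk>openin X U; j \<in> set J; v \<in> carrier (sec H U)\<rbrakk> \<Longrightarrow> c U j v \<in> carrier (sec F U)"
    and c_add: "\<And>U j v w. \<lbrakk>openin X U; j \<in> set J; v \<in> carrier (sec H U); w \<in> carrier (sec H U)\<rbrakk>
      \<Longrightarrow> c U j (v \<oplus>\<^bsub>sec H U\<^esub> w) = c U j v \<oplus>\<^bsub>sec F U\<^esub> c U j w"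
    and c_rst: "\<And>U V j v. \<lbrakk>openin X U; openin X V; V \<subseteq> U; j \<in> set J; v \<in> carrier (sec H U)\<rbrakk>
      \<Longrightarrow> rst F U V (c U j v) = c V j (rst H U V v)"
    and smult: "\<And>U k v. \<lbrakk>openin X U; k \<in> carrier R'; v \<in> carrier (sec H U)\<rbrakk> \<Longrightarrow>
      tens X F U (map (\<lambda>j. (y j, c U j (k \<odot>\<^bsub>sec H U\<^esub> v))) J) =
      tens X F U (map (\<lambda>j. (k \<otimes>\<^bsub>L\<^esub> y j, c U j v)) J)"
  shows "ext_mor X H (\<lambda>U v. tens X F U (map (\<lambda>j. (y j, c U j v)) J)) \<in> psheaf_hom R' X H E"
proof -
  interpret H: operations_presheaf R' X H by (rule presheaf_operations[OF sheaf_presheaf[OF H]])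
  let ?u = "\<lambda>U v. map (\<lambda>j. (y j, c U j v)) J"
  have w: "?u U v \<in> fs U" if "openin X U" "v \<in> carrier (sec H U)" for U v
    using y c that by auto
  have add: "tens X F U (?u U (v \<oplus>\<^bsub>sec H U\<^esub> v')) = tens X F U (?u U v) \<oplus>\<^bsub>sec E U\<^esub> tens X F U (?u U v')"
    if U: "openin X U" and v: "v \<in> carrier (sec H U)" "v' \<in> carrier (sec H U)" for U v v'
  proof -
    have "tensor_eq L K (sec F U) (?u U v @ ?u U v') (map (\<lambda>j. (y j, c U j v \<oplus>\<^bsub>sec F U\<^esub> c U j v')) J)"
      using y c U v by (intro tensor_eq_merge[OF sec_mod[OF F U]]) auto
    moreover have "map (\<lambda>j. (y j, c U j v \<oplus>\<^bsub>sec F U\<^esub> c U j v')) J = ?u U (v \<oplus>\<^bsub>sec H U\<^esub> v')"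
      using c_add[OF U _ v] by simp
    ultimately show ?thesis
      using tens_add[OF U w[OF U v(1)] w[OF U v(2)]]
        tens_eq_iff_tensor_eq[OF U, of "?u U v @ ?u U v'" "?u U (v \<oplus>\<^bsub>sec H U\<^esub> v')"]
        w[OF U H.add_closed[OF U v]]
        w[OF U v(1)] w[OF U v(2)] by simp
  qed
  have smult': "tens X F U (?u U (k \<odot>\<^bsub>sec H U\<^esub> v)) = k \<odot>\<^bsub>sec E U\<^esub> tens X F U (?u U v)"
    if U: "openin X U" and k: "k \<in> carrier R'" and v: "v \<in> carrier (sec H U)" for U k v
    using smult[OF U k v] tens_smult[OF U w[OF U v], of k] k R' by (auto simp: comp_def)
  have rst: "rst E U V (tens X F U (?u U v)) = tens X F V (?u V (rst H U V v))"
    if U: "openin X U" "openin X V" "V \<subseteq> U" and v: "v \<in> carrier (sec H U)" for U V v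
    using tens_rst[OF U w[OF U(1) v]] c_rst[OF U _ v] by (simp add: comp_def cong: map_cong)
  show ?thesis
    unfolding psheaf_hom_def mod_hom_def
    using w H.add_closed H.smult_closed H.rst_closed add smult' rst tens_mem
    by (auto simp: ext_mor_def restrict_def fun_eq_iff)
qed

end

text \<open>On sections given by formal sums the morphism \<open>g \<otimes> f\<close> acts termwise, as for presheaves.\<close>

lemma ext_mor_tensor_tens:
  fixes F F' :: "('x, 'l, ('x, 'l, 'b) univ) psheaf"
  assumes F: "sheaf RK X F" and F': "sheaf RK X F'" and g: "linear_on_L g"
    and f_hom: "\<And>U. openin X U \<Longrightarrow> f U \<in> mod_hom RK (sec F U) (sec F' U)"
    and f_rst: "\<And>U V s. \<lbrakk>openin X U; openin X V; V \<subseteq> U; s \<in> carrier (sec F U)\<rbrakk> \<Longrightarrow> rst F' U V (f U s) = f V (rst F U V s)"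
    and U: "openin X U" and ts: "ts \<in> formal_sums L (sec F U)"
  shows "ext_mor_tensor L K X g F F' f U (tens X F U ts) = tens X F' U (map (map_prod g (f U)) ts)"
    (is "?l = ?r")
proof -
  let ?T = "tensor_presheaf L K F" and ?T' = "tensor_presheaf L K F'"
  interpret T: operations_presheaf L X ?T
    by (rule presheaf_operations[OF tensor_presheaf_presheaf[OF F]])
  interpret T': operations_presheaf L X ?T'
    by (rule presheaf_operations[OF tensor_presheaf_presheaf[OF F']])
  let ?m = "\<lambda>V. tensor_map L K (sec F' V) g (f V)"
  have m: "?m V (tensor_class L K (sec F V) us) = tensor_class L K (sec F' V) (map (map_prod g (f V)) us)"
    "map (map_prod g (f V)) us \<in> formal_sums L (sec F' V)"
    if "openin X V" "us \<in> formal_sums L (sec F V)" for V us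
    using tensor_map_class[OF sec_mod[OF F that(1)] sec_mod[OF F' that(1)] g f_hom[OF that(1)] that(2)]
      map_prod_formal_sums[OF g _ that(2)] mod_homD(1)[OF f_hom[OF that(1)]] by blast+
  have germ: "germ X ?T' x V (?m V A) = germ X ?T' x U (?m U B)"
    if V: "openin X V" "x \<in> V" "A \<in> carrier (sec ?T V)" and U: "openin X U" "x \<in> U" "B \<in> carrier (sec ?T U)"
      and eq: "germ X ?T x V A = germ X ?T x U B" for V U x A B
  proof -
    have nat: "rst ?T' V W (?m V A) = ?m W (rst ?T V W A)" "?m V A \<in> carrier (sec ?T' V)"
      if V: "openin X V" "openin X W" "W \<subseteq> V" "A \<in> carrier (sec ?T V)" for V W A
    proof -
      obtain us where us: "us \<in> formal_sums L (sec F V)" "A = tensor_class L K (sec F V) us"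
        using V(4) unfolding T_carrier[OF F V(1)] by blast
      have e: "map (map_prod id (rst F' V W)) (map (map_prod g (f V)) us) =
          map (map_prod g (f W)) (map (map_prod id (rst F V W)) us)"
        unfolding map_map using f_rst[OF V(1-3)] us(1) by (intro map_cong[OF HOL.refl]) auto
      show "rst ?T' V W (?m V A) = ?m W (rst ?T V W A)"
        unfolding us(2) m(1)[OF V(1) us(1)] tensor_presheaf_rst[OF F V(1-3) us(1)]
          tensor_presheaf_rst[OF F' V(1-3) m(2)[OF V(1) us(1)]] m(1)[OF V(2) rst_formal_sums[OF F V(1-3) us(1)]]
          e ..
      show "?m V A \<in> carrier (sec ?T' V)"
        unfolding us(2) m(1)[OF V(1) us(1)] T_carrier[OF F' V(1)] using m(2)[OF V(1) us(1)] by blast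
    qed
    obtain W where W: "openin X W" "x \<in> W" "W \<subseteq> V \<inter> U" "rst ?T V W A = rst ?T U W B"
      using eq T.germ_eq_iff[OF V(1,2) U(1,2) V(3) U(3)] by blast
    have "rst ?T' V W (?m V A) = rst ?T' U W (?m U B)"
      using nat(1)[OF V(1) W(1) _ V(3)] nat(1)[OF U(1) W(1) _ U(3)] W(3,4) by simp
    then show ?thesis
      using T'.germ_eq_iff[OF V(1,2) U(1,2) nat(2)[OF V(1,1) subset_refl V(3)] nat(2)[OF U(1,1) subset_refl U(3)]] W
      by blast
  qed
  let ?A = "tensor_class L K (sec F U) ts"
  have A: "?A \<in> carrier (sec ?T U)" using ts T_carrier[OF F U] by blast
  have "sheafify_map X ?T' ?m U (germs_of X ?T U ?A) = germs_of X ?T' U (?m U ?A)"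
  proof
    fix x
    show "sheafify_map X ?T' ?m U (germs_of X ?T U ?A) x = germs_of X ?T' U (?m U ?A) x"
    proof (cases "x \<in> U")
      case True
      have eq: "germ X ?T' x V (?m V B) = germ X ?T' x U (?m U ?A)" if "(V, B) \<in> germ X ?T x U ?A" for V B
        using germ[OF T.mem_germ(1-3)[OF that U True A] U True A T.mem_germ(4)[OF that U True A]] .
      have "(\<Union>(V, B) \<in> germ X ?T x U ?A. germ X ?T' x V (?m V B)) = germ X ?T' x U (?m U ?A)"
        using eq T.germ_self[OF U True A] by blast
      then show ?thesis using True by (simp add: sheafify_map_def germs_of_def)
    qed (simp add: sheafify_map_def germs_of_def)
  qed
  then show ?thesis
    using decode_encode[OF F U A] tens_mem[OF F U ts] U m(1)[OF U ts]
    by (simp add: ext_mor_tensor_def ext_mor_def tens_def)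
qed

end


section \<open>Zigzags in a localization\<close>

declare zigzag_eq.trans [trans]

locale localizing =
  fixes C :: "('o, 'm) cat" and W :: "'o \<Rightarrow> 'o \<Rightarrow> 'm set"
  assumes Idt_Hom: "a \<in> Ob C \<Longrightarrow> Idt C a \<in> Hom C a a"
    and Cmp_Hom: "\<lbrakk>a \<in> Ob C; b \<in> Ob C; c \<in> Ob C; f \<in> Hom C a b; g \<in> Hom C b c\<rbrakk>
      \<Longrightarrow> Cmp C a b c g f \<in> Hom C a c"
    and W_Hom: "\<lbrakk>a \<in> Ob C; b \<in> Ob C; w \<in> W a b\<rbrakk> \<Longrightarrow> w \<in> Hom C a b"
begin

lemma zigzag_Ob: "zigzag C W a p b \<Longrightarrow> a \<in> Ob C \<and> b \<in> Ob C"
  by (induction rule: zigzag.induct) auto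

lemma zigzag_simps:
  "zigzag C W a [] c \<longleftrightarrow> a = c \<and> a \<in> Ob C"
  "zigzag C W a (Fwd a' f b # p) c \<longleftrightarrow>
    a = a' \<and> a \<in> Ob C \<and> b \<in> Ob C \<and> f \<in> Hom C a b \<and> zigzag C W b p c"
  "zigzag C W a (Bwd a' w b # p) c \<longleftrightarrow>
    a = a' \<and> a \<in> Ob C \<and> b \<in> Ob C \<and> w \<in> W b a \<and> zigzag C W b p c"
  by (subst zigzag.simps; auto)+

lemma zigzag_append: "zigzag C W a p b \<Longrightarrow> zigzag C W b q c \<Longrightarrow> zigzag C W a (p @ q) c"
  by (induction rule: zigzag.induct) (auto intro: zigzag.intros)

lemma zigzag_Fwd: "a \<in> Ob C \<Longrightarrow> b \<in> Ob C \<Longrightarrow> f \<in> Hom C a b \<Longrightarrow> zigzag C W a [Fwd a f b] b"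
  by (intro zigzag.intros)

lemma zigzag_Bwd: "a \<in> Ob C \<Longrightarrow> b \<in> Ob C \<Longrightarrow> w \<in> W b a \<Longrightarrow> zigzag C W a [Bwd a w b] b"
  by (intro zigzag.intros)

lemma zigzag_eq_zigzag: "zigzag_eq C W a z p q \<Longrightarrow> zigzag C W a p z \<and> zigzag C W a q z"
proof (induction rule: zigzag_eq.induct)
  case (ident p b q)
  then show ?case
    using zigzag_Ob Idt_Hom by (auto intro!: zigzag_append zigzag.fwd)
next
  case (comp p b c d q f g)
  then show ?case
    using zigzag_Ob Cmp_Hom by (auto intro!: zigzag_append zigzag.fwd)
next
  case (inv1 p b c q w)
  then show ?case
    using zigzag_Ob W_Hom by (auto intro!: zigzag_append zigzag.fwd zigzag.bwd)
next
  case (inv2 p c b q w)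
  then show ?case
    using zigzag_Ob W_Hom by (auto intro!: zigzag_append zigzag.fwd zigzag.bwd)
qed auto

lemma zigzag_eq_append_left:
  assumes "zigzag_eq C W b z p q" and r: "zigzag C W a r b"
  shows "zigzag_eq C W a z (r @ p) (r @ q)"
  using assms(1)
proof (induction rule: zigzag_eq.induct)
  case (refl p) then show ?case using r by (auto intro: zigzag_eq.refl zigzag_append)
next
  case (sym p q) then show ?case by (auto intro: zigzag_eq.sym)
next
  case (trans p q s) then show ?case by (auto intro: zigzag_eq.trans)
next
  case (ident p c q)
  then show ?case using zigzag_eq.ident[OF zigzag_append[OF r ident(1)] ident(2)] by simp
next
  case (comp p c d e q f g)
  then show ?case using zigzag_eq.comp[OF zigzag_append[OF r comp(1)] comp(2-5)] by simp
next
  case (inv1 p c d q w)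
  then show ?case using zigzag_eq.inv1[OF zigzag_append[OF r inv1(1)] inv1(2-4)] by simp
next
  case (inv2 p d c q w)
  then show ?case using zigzag_eq.inv2[OF zigzag_append[OF r inv2(1)] inv2(2-4)] by simp
qed

lemma zigzag_eq_append_right:
  assumes "zigzag_eq C W a b p q" and r: "zigzag C W b r z"
  shows "zigzag_eq C W a z (p @ r) (q @ r)"
  using assms(1)
proof (induction rule: zigzag_eq.induct)
  case (refl p) then show ?case using r by (auto intro: zigzag_eq.refl zigzag_append)
next
  case (sym p q) then show ?case by (auto intro: zigzag_eq.sym)
next
  case (trans p q s) then show ?case by (auto intro: zigzag_eq.trans)
next
  case (ident p c q)
  then show ?case using zigzag_eq.ident[OF ident(1) zigzag_append[OF ident(2) r]] by simp
next
  case (comp p c d e q f g)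
  then show ?case using zigzag_eq.comp[OF comp(1,2) zigzag_append[OF comp(3) r] comp(4,5)] by simp
next
  case (inv1 p c d q w)
  then show ?case using zigzag_eq.inv1[OF inv1(1,2) zigzag_append[OF inv1(3) r] inv1(4)] by simp
next
  case (inv2 p d c q w)
  then show ?case using zigzag_eq.inv2[OF inv2(1,2) zigzag_append[OF inv2(3) r] inv2(4)] by simp
qed

lemma zigzag_eq_append:
  assumes "zigzag_eq C W a b p q" and "zigzag_eq C W b c r s"
  shows "zigzag_eq C W a c (p @ r) (q @ s)"
  using assms zigzag_eq_zigzag
  by (blast intro: zigzag_eq.trans zigzag_eq_append_left zigzag_eq_append_right)

lemma zigzag_eq_mid:
  assumes "zigzag_eq C W b c p q" and "zigzag C W a r b" and "zigzag C W c s z"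
  shows "zigzag_eq C W a z (r @ p @ s) (r @ q @ s)"
  using assms by (intro zigzag_eq_append_left zigzag_eq_append_right)

lemma zigzag_eq_Idt: "a \<in> Ob C \<Longrightarrow> zigzag_eq C W a a [Fwd a (Idt C a) a] []"
  using zigzag_eq.ident[of C W a "[]" a "[]" a] by (auto intro: zigzag.nil)

lemma zigzag_eq_Cmp:
  "\<lbrakk>a \<in> Ob C; b \<in> Ob C; c \<in> Ob C; f \<in> Hom C a b; g \<in> Hom C b c\<rbrakk>
    \<Longrightarrow> zigzag_eq C W a c [Fwd a f b, Fwd b g c] [Fwd a (Cmp C a b c g f) c]"
  using zigzag_eq.comp[of C W a "[]" a b c "[]" c f g] by (auto intro: zigzag.nil)

lemma zigzag_eq_Fwd_Bwd:
  "\<lbrakk>a \<in> Ob C; b \<in> Ob C; w \<in> W a b\<rbrakk> \<Longrightarrow> zigzag_eq C W a a [Fwd a w b, Bwd b w a] []"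
  using zigzag_eq.inv1[of C W a "[]" a b "[]" a w] by (auto intro: zigzag.nil)

lemma zigzag_eq_Bwd_Fwd:
  "\<lbrakk>a \<in> Ob C; b \<in> Ob C; w \<in> W a b\<rbrakk> \<Longrightarrow> zigzag_eq C W b b [Bwd b w a, Fwd a w b] []"
  using zigzag_eq.inv2[of C W b "[]" b a "[]" b w] by (auto intro: zigzag.nil)

lemma zigzag_eq_square:
  assumes "a \<in> Ob C" "b \<in> Ob C" "b' \<in> Ob C" "c \<in> Ob C"
    and "f \<in> Hom C a b" "g \<in> Hom C b c" "f' \<in> Hom C a b'" "g' \<in> Hom C b' c"
    and "Cmp C a b c g f = Cmp C a b' c g' f'"
  shows "zigzag_eq C W a c [Fwd a f b, Fwd b g c] [Fwd a f' b', Fwd b' g' c]"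
  using assms zigzag_eq_Cmp zigzag_eq.sym zigzag_eq.trans by metis

lemma zigzag_eq_square_Bwd:
  assumes ob: "a \<in> Ob C" "b \<in> Ob C" "c \<in> Ob C" "d \<in> Ob C"
    and w: "w \<in> W b a" and v: "v \<in> W d c" and g: "g \<in> Hom C b d" and f: "f \<in> Hom C a c"
    and sq: "Cmp C b d c v g = Cmp C b a c f w"
  shows "zigzag_eq C W a d [Bwd a w b, Fwd b g d] [Fwd a f c, Bwd c v d]"
proof -
  note h = W_Hom[OF ob(2,1) w] W_Hom[OF ob(4,3) v]
  have 1: "zigzag_eq C W b c [Fwd b g d, Fwd d v c] [Fwd b w a, Fwd a f c]"
    using ob h g f sq by (intro zigzag_eq_square)
  have "zigzag_eq C W a d [Bwd a w b, Fwd b g d] ([Bwd a w b, Fwd b g d] @ [Fwd d v c, Bwd c v d])"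
    using zigzag_eq_append_left[OF zigzag_eq_Fwd_Bwd[OF ob(4,3) v, THEN zigzag_eq.sym],
        of a "[Bwd a w b, Fwd b g d]"] ob w g by (simp add: zigzag.intros)
  also have "\<dots> = [Bwd a w b] @ [Fwd b g d, Fwd d v c] @ [Bwd c v d]" by simp
  finally have "zigzag_eq C W a d [Bwd a w b, Fwd b g d]
      ([Bwd a w b] @ [Fwd b g d, Fwd d v c] @ [Bwd c v d])" .
  also have "zigzag_eq C W a d \<dots> ([Bwd a w b] @ [Fwd b w a, Fwd a f c] @ [Bwd c v d])"
    using ob w v by (intro zigzag_eq_mid[OF 1] zigzag_Bwd)
  also have "\<dots> = [Bwd a w b, Fwd b w a] @ [Fwd a f c, Bwd c v d]" by simp
  also have "zigzag_eq C W a d \<dots> ([] @ [Fwd a f c, Bwd c v d])"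
    using ob w v f by (intro zigzag_eq_append_right[where b = a] zigzag_eq_Bwd_Fwd zigzag.intros)
  finally show ?thesis by simp
qed

lemma zigzag_class_eq_iff:
  assumes "zigzag C W a p b"
  shows "zigzag_class C W a b p = zigzag_class C W a b q \<longleftrightarrow> zigzag_eq C W a b p q"
proof
  assume "zigzag_class C W a b p = zigzag_class C W a b q"
  then have "zigzag_eq C W a b q p"
    using zigzag_eq.refl[OF assms] unfolding zigzag_class_def by blast
  then show "zigzag_eq C W a b p q" by (rule zigzag_eq.sym)
next
  assume eq: "zigzag_eq C W a b p q"
  show "zigzag_class C W a b p = zigzag_class C W a b q"
    unfolding zigzag_class_def
    using zigzag_eq.trans[OF eq] zigzag_eq.trans[OF zigzag_eq.sym[OF eq]] by blast
qed

lemma Cmp_localization: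
  assumes p: "zigzag C W a p b" and q: "zigzag C W b q c"
  shows "Cmp (localization C W) a b c (zigzag_class C W b c q) (zigzag_class C W a b p) =
    zigzag_class C W a c (p @ q)"
proof -
  have eq: "zigzag_class C W a c (p' @ q') = zigzag_class C W a c (p @ q)"
    if "p' \<in> zigzag_class C W a b p" and "q' \<in> zigzag_class C W b c q" for p' q'
  proof -
    have "zigzag_eq C W a c (p @ q) (p' @ q')"
      using that by (intro zigzag_eq_append) (simp_all add: zigzag_class_def)
    then show ?thesis by (rule zigzag_class_eq_iff[OF zigzag_append[OF p q], THEN iffD2, symmetric])
  qed
  have mem: "p \<in> zigzag_class C W a b p" "q \<in> zigzag_class C W b c q"
    using p q by (simp_all add: zigzag_class_def zigzag_eq.refl)
  have "(\<Union>p' \<in> zigzag_class C W a b p. \<Union>q' \<in> zigzag_class C W b c q.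
      zigzag_class C W a c (p' @ q')) = zigzag_class C W a c (p @ q)"
    by (intro equalityI UN_least equalityD1[OF eq]) (assumption, assumption, use mem in blast)
  then show ?thesis by (simp add: localization_def)
qed

end

locale localizing_functor = source: localizing C W + target: localizing D V
  for C :: "('o, 'm) cat" and W and D :: "('p, 'n) cat" and V +
  fixes To :: "'o \<Rightarrow> 'p" and Tm :: "'o \<Rightarrow> 'o \<Rightarrow> 'm \<Rightarrow> 'n"
  assumes is_functor: "is_functor C D To Tm"
    and inverts: "\<lbrakk>a \<in> Ob C; b \<in> Ob C; w \<in> W a b\<rbrakk> \<Longrightarrow> Tm a b w \<in> V (To a) (To b)"
begin

lemma To_Ob: "a \<in> Ob C \<Longrightarrow> To a \<in> Ob D"
  using is_functor by (auto simp: is_functor_def)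

lemma Tm_Hom: "\<lbrakk>a \<in> Ob C; b \<in> Ob C; f \<in> Hom C a b\<rbrakk> \<Longrightarrow> Tm a b f \<in> Hom D (To a) (To b)"
  using is_functor by (auto simp: is_functor_def)

lemma zigzag_map: "zigzag C W a p b \<Longrightarrow> zigzag D V (To a) (map (map_zstep To Tm) p) (To b)"
proof (induction rule: zigzag.induct)
  case (nil a) then show ?case by (simp add: zigzag.nil To_Ob)
next
  case (fwd a b f p c) then show ?case by (simp add: zigzag.fwd To_Ob Tm_Hom)
next
  case (bwd a b w p c) then show ?case by (simp add: zigzag.bwd To_Ob inverts)
qed

lemma zigzag_eq_map:
  "zigzag_eq C W a b p q
    \<Longrightarrow> zigzag_eq D V (To a) (To b) (map (map_zstep To Tm) p) (map (map_zstep To Tm) q)"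
proof (induction rule: zigzag_eq.induct)
  case (refl p) then show ?case by (intro zigzag_eq.refl zigzag_map)
next
  case (sym p q) show ?case by (rule zigzag_eq.sym[OF sym.IH])
next
  case (trans p q s) show ?case by (rule zigzag_eq.trans[OF trans.IH])
next
  case (ident p b q)
  have "Tm b b (Idt C b) = Idt D (To b)"
    using is_functor source.zigzag_Ob[OF ident(1)] by (auto simp: is_functor_def)
  then show ?case using zigzag_eq.ident[OF zigzag_map[OF ident(1)] zigzag_map[OF ident(2)]] by simp
next
  case (comp p b c d q f g)
  have b: "b \<in> Ob C" and d: "d \<in> Ob C"
    using source.zigzag_Ob comp by blast+
  have "Tm b d (Cmp C b c d g f) = Cmp D (To b) (To c) (To d) (Tm c d g) (Tm b c f)"
    using is_functor comp b d by (auto simp: is_functor_def)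
  then show ?case
    using zigzag_eq.comp[OF zigzag_map[OF comp(1)] To_Ob[OF comp(2)] zigzag_map[OF comp(3)]
        Tm_Hom[OF b comp(2,4)] Tm_Hom[OF comp(2) d comp(5)]] by simp
next
  case (inv1 p b c q w)
  then have "b \<in> Ob C" using source.zigzag_Ob by blast
  then show ?case
    using zigzag_eq.inv1[OF zigzag_map[OF inv1(1)] To_Ob[OF inv1(2)] zigzag_map[OF inv1(3)]
        inverts[OF _ inv1(2,4)]] by simp
next
  case (inv2 p c b q w)
  then have "c \<in> Ob C" using source.zigzag_Ob by blast
  then show ?case
    using zigzag_eq.inv2[OF zigzag_map[OF inv2(1)] To_Ob[OF inv2(2)] zigzag_map[OF inv2(3)]
        inverts[OF inv2(2) _ inv2(4)]] by simp
qed

lemma loc_map_class: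
  assumes p: "zigzag C W a p b"
  shows "loc_map D V To Tm a b (zigzag_class C W a b p) =
    zigzag_class D V (To a) (To b) (map (map_zstep To Tm) p)"
proof -
  have eq: "zigzag_class D V (To a) (To b) (map (map_zstep To Tm) q) =
      zigzag_class D V (To a) (To b) (map (map_zstep To Tm) p)"
    if "q \<in> zigzag_class C W a b p" for q
  proof -
    have "zigzag_eq C W a b p q" using that by (simp add: zigzag_class_def)
    then show ?thesis
      by (rule zigzag_eq_map[THEN target.zigzag_class_eq_iff[OF zigzag_map[OF p], THEN iffD2], symmetric])
  qed
  have mem: "p \<in> zigzag_class C W a b p"
    using p by (simp_all add: zigzag_class_def zigzag_eq.refl)
  show ?thesis
    unfolding loc_map_def
    by (intro equalityI UN_least equalityD1[OF eq]) (assumption, use mem in blast)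
qed

end

lemma map_zstep_ident: "map_zstep (\<lambda>a. a) (\<lambda>_ _ f. f) = (\<lambda>s. s)"
proof
  show "map_zstep (\<lambda>a. a) (\<lambda>_ _ f. f) s = s" for s :: "('a, 'b) step" by (cases s) auto
qed

text \<open>A transformation that is natural on \<open>C\<close> remains natural on zigzags, because a commuting square
  whose horizontal arrows are inverted still commutes.\<close>

lemma zigzag_eq_natural:
  assumes T: "localizing_functor C W D V To Tm" and S: "localizing_functor C W D V So Sm"
    and \<eta>: "\<And>a. a \<in> Ob C \<Longrightarrow> \<eta> a \<in> Hom D (To a) (So a)"
    and natural: "\<And>a b f. \<lbrakk>a \<in> Ob C; b \<in> Ob C; f \<in> Hom C a b\<rbrakk> \<Longrightarrow>
      Cmp D (To a) (To b) (So b) (\<eta> b) (Tm a b f) = Cmp D (To a) (So a) (So b) (Sm a b f) (\<eta> a)"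
    and p: "zigzag C W a p b"
  shows "zigzag_eq D V (To a) (So b) (map (map_zstep To Tm) p @ [Fwd (To b) (\<eta> b) (So b)])
    (Fwd (To a) (\<eta> a) (So a) # map (map_zstep So Sm) p)"
  using p
proof (induction rule: zigzag.induct)
  interpret T: localizing_functor C W D V To Tm by fact
  interpret S: localizing_functor C W D V So Sm by fact
  {
    case (nil a)
    then show ?case
      by (auto intro!: zigzag_eq.refl T.target.zigzag_Fwd T.To_Ob S.To_Ob \<eta>)
  next
    case (fwd a b f p c)
    note ob = T.To_Ob[OF fwd(1)] T.To_Ob[OF fwd(2)] S.To_Ob[OF fwd(1)] S.To_Ob[OF fwd(2)]
    have 1: "zigzag_eq D V (To a) (So b) [Fwd (To a) (Tm a b f) (To b), Fwd (To b) (\<eta> b) (So b)]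
        [Fwd (To a) (\<eta> a) (So a), Fwd (So a) (Sm a b f) (So b)]"
      using fwd ob by (intro T.target.zigzag_eq_square natural T.Tm_Hom S.Tm_Hom \<eta>)
    have "zigzag_eq D V (To a) (So c)
        ([Fwd (To a) (Tm a b f) (To b)] @ (map (map_zstep To Tm) p @ [Fwd (To c) (\<eta> c) (So c)]))
        ([Fwd (To a) (Tm a b f) (To b)] @ (Fwd (To b) (\<eta> b) (So b) # map (map_zstep So Sm) p))"
      by (rule T.target.zigzag_eq_append_left[OF fwd(5) T.target.zigzag_Fwd[OF ob(1,2) T.Tm_Hom[OF fwd(1-3)]]])
    from zigzag_eq.trans[OF this] T.target.zigzag_eq_append_right[OF 1 S.zigzag_map[OF fwd(4)]]
    show ?case by simp
  next
    case (bwd a b w p c)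
    note ob = T.To_Ob[OF bwd(1)] T.To_Ob[OF bwd(2)] S.To_Ob[OF bwd(1)] S.To_Ob[OF bwd(2)]
    have 1: "zigzag_eq D V (To a) (So b) [Bwd (To a) (Tm b a w) (To b), Fwd (To b) (\<eta> b) (So b)]
        [Fwd (To a) (\<eta> a) (So a), Bwd (So a) (Sm b a w) (So b)]"
      using bwd ob T.source.W_Hom
      by (intro T.target.zigzag_eq_square_Bwd natural[symmetric] T.inverts S.inverts \<eta>)
    have "zigzag_eq D V (To a) (So c)
        ([Bwd (To a) (Tm b a w) (To b)] @ (map (map_zstep To Tm) p @ [Fwd (To c) (\<eta> c) (So c)]))
        ([Bwd (To a) (Tm b a w) (To b)] @ (Fwd (To b) (\<eta> b) (So b) # map (map_zstep So Sm) p))"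
      by (rule T.target.zigzag_eq_append_left[OF bwd(5) T.target.zigzag_Bwd[OF ob(1,2) T.inverts[OF bwd(2,1,3)]]])
    from zigzag_eq.trans[OF this] T.target.zigzag_eq_append_right[OF 1 S.zigzag_map[OF bwd(4)]]
    show ?case by simp
  }
qed

text \<open>A category with binary sums \<open>S a b\<close>, of which only the partial functors \<open>f \<mapsto> f \<oplus> id\<close> (\<open>rm\<close>)
  and \<open>g \<mapsto> id \<oplus> g\<close> (\<open>lm\<close>) and the diagonal \<open>\<Delta>\<close> are recorded. A functor of two variables would need the
  localization of a product category to descend; these functors of one variable descend separately.\<close>

locale localizing_with_sums = localizing C W
  for C :: "('o, 'm) cat" and W +
  fixes S :: "'o \<Rightarrow> 'o \<Rightarrow> 'o" and rm lm :: "'o \<Rightarrow> 'o \<Rightarrow> 'o \<Rightarrow> 'm \<Rightarrow> 'm" and \<Delta> :: "'o \<Rightarrow> 'm"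
  assumes right: "b \<in> Ob C \<Longrightarrow> localizing_functor C W C W (\<lambda>a. S a b) (rm b)"
    and left: "a \<in> Ob C \<Longrightarrow> localizing_functor C W C W (S a) (lm a)"
    and interchange: "\<lbrakk>a \<in> Ob C; a' \<in> Ob C; b \<in> Ob C; b' \<in> Ob C; f \<in> Hom C a a'; g \<in> Hom C b b'\<rbrakk>
      \<Longrightarrow> Cmp C (S a b) (S a' b) (S a' b') (lm a' b b' g) (rm b a a' f) =
          Cmp C (S a b) (S a b') (S a' b') (rm b' a a' f) (lm a b b' g)"
    and diag_Hom: "a \<in> Ob C \<Longrightarrow> \<Delta> a \<in> Hom C a (S a a)"
    and diag_natural: "\<lbrakk>a \<in> Ob C; b \<in> Ob C; f \<in> Hom C a b\<rbrakk> \<Longrightarrow> Cmp C a b (S b b) (\<Delta> b) f =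
      Cmp C a (S a a) (S b b) (Cmp C (S a a) (S b a) (S b b) (lm b a b f) (rm a a b f)) (\<Delta> a)"
begin

abbreviation "rmap b \<equiv> map (map_zstep (\<lambda>a. S a b) (rm b))"
abbreviation "lmap a \<equiv> map (map_zstep (S a) (lm a))"

lemma S_Ob: "a \<in> Ob C \<Longrightarrow> b \<in> Ob C \<Longrightarrow> S a b \<in> Ob C"
  using localizing_functor.To_Ob[OF left] .

lemma lm_Hom: "\<lbrakk>a \<in> Ob C; b \<in> Ob C; b' \<in> Ob C; g \<in> Hom C b b'\<rbrakk> \<Longrightarrow> lm a b b' g \<in> Hom C (S a b) (S a b')"
  using localizing_functor.Tm_Hom[OF left] .

lemma rm_Hom: "\<lbrakk>a \<in> Ob C; b \<in> Ob C; b' \<in> Ob C; g \<in> Hom C b b'\<rbrakk> \<Longrightarrow> rm a b b' g \<in> Hom C (S b a) (S b' a)"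
  using localizing_functor.Tm_Hom[OF right] .

lemma lm_W: "\<lbrakk>a \<in> Ob C; b \<in> Ob C; b' \<in> Ob C; g \<in> W b b'\<rbrakk> \<Longrightarrow> lm a b b' g \<in> W (S a b) (S a b')"
  using localizing_functor.inverts[OF left] .

lemma rm_W: "\<lbrakk>a \<in> Ob C; b \<in> Ob C; b' \<in> Ob C; g \<in> W b b'\<rbrakk> \<Longrightarrow> rm a b b' g \<in> W (S b a) (S b' a)"
  using localizing_functor.inverts[OF right] .

lemma lmap_zigzag: "a \<in> Ob C \<Longrightarrow> zigzag C W b p c \<Longrightarrow> zigzag C W (S a b) (lmap a p) (S a c)"
  using localizing_functor.zigzag_map[OF left] .

lemma rmap_zigzag: "a \<in> Ob C \<Longrightarrow> zigzag C W b p c \<Longrightarrow> zigzag C W (S b a) (rmap a p) (S c a)"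
  using localizing_functor.zigzag_map[OF right] .

lemma rmap_lm:
  assumes ob: "b \<in> Ob C" "b' \<in> Ob C" and g: "g \<in> Hom C b b'" and p: "zigzag C W a p a'"
  shows "zigzag_eq C W (S a b) (S a' b')
    (rmap b p @ [Fwd (S a' b) (lm a' b b' g) (S a' b')])
    (Fwd (S a b) (lm a b b' g) (S a b') # rmap b' p)"
  by (rule zigzag_eq_natural[OF right[OF ob(1)] right[OF ob(2)], of "\<lambda>a. lm a b b' g",
        OF lm_Hom[OF _ ob g] interchange[OF _ _ ob _ g] p])

lemma lmap_rm:
  assumes ob: "a \<in> Ob C" "a' \<in> Ob C" and f: "f \<in> Hom C a a'" and p: "zigzag C W b p b'"
  shows "zigzag_eq C W (S a b) (S a' b')
    (lmap a p @ [Fwd (S a b') (rm b' a a' f) (S a' b')])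
    (Fwd (S a b) (rm b a a' f) (S a' b) # lmap a' p)"
  by (rule zigzag_eq_natural[OF left[OF ob(1)] left[OF ob(2)], of "\<lambda>b. rm b a a' f",
        OF rm_Hom[OF _ ob f] interchange[OF ob _ _ f, symmetric] p])

lemma diag_Fwd:
  assumes ob: "a \<in> Ob C" "b \<in> Ob C" and f: "f \<in> Hom C a b"
  shows "zigzag_eq C W a (S b b) [Fwd a f b, Fwd b (\<Delta> b) (S b b)]
    [Fwd a (\<Delta> a) (S a a), Fwd (S a a) (rm a a b f) (S b a), Fwd (S b a) (lm b a b f) (S b b)]"
proof -
  have "zigzag_eq C W a (S b b) [Fwd a f b, Fwd b (\<Delta> b) (S b b)]
    ([Fwd a (\<Delta> a) (S a a)] @
      [Fwd (S a a) (Cmp C (S a a) (S b a) (S b b) (lm b a b f) (rm a a b f)) (S b b)])"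
    unfolding append_Cons append_Nil
    using ob f by (intro zigzag_eq_square diag_natural diag_Hom S_Ob Cmp_Hom lm_Hom rm_Hom)
  also have "zigzag_eq C W a (S b b) \<dots> ([Fwd a (\<Delta> a) (S a a)] @
      [Fwd (S a a) (rm a a b f) (S b a), Fwd (S b a) (lm b a b f) (S b b)])"
    using ob f
    by (intro zigzag_eq_append_left[where b = "S a a"] zigzag_eq_Cmp[THEN zigzag_eq.sym] zigzag_Fwd
        diag_Hom S_Ob lm_Hom rm_Hom)
  finally show ?thesis by simp
qed

text \<open>The square of the diagonal with \<open>w \<oplus> w\<close> commutes, and the latter is the composite of the inverted
  maps \<open>w \<oplus> id\<close> and \<open>id \<oplus> w\<close>.\<close>

lemma diag_Bwd:
  assumes ob: "a \<in> Ob C" "b \<in> Ob C" and w: "w \<in> W b a"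
  shows "zigzag_eq C W a (S b b) [Bwd a w b, Fwd b (\<Delta> b) (S b b)]
    [Fwd a (\<Delta> a) (S a a), Bwd (S a a) (lm a b a w) (S a b), Bwd (S a b) (rm b b a w) (S b b)]"
proof -
  let ?l = "lm a b a w" and ?r = "rm b b a w"
  have f: "w \<in> Hom C b a" using W_Hom ob w by blast
  note H = diag_Hom S_Ob lm_Hom rm_Hom lm_W rm_W
  have 1: "zigzag_eq C W (S b b) (S b b)
      [Fwd (S b b) ?r (S a b), Fwd (S a b) ?l (S a a), Bwd (S a a) ?l (S a b), Bwd (S a b) ?r (S b b)] []"
  proof -
    have "zigzag_eq C W (S b b) (S b b) ([Fwd (S b b) ?r (S a b)] @
        [Fwd (S a b) ?l (S a a), Bwd (S a a) ?l (S a b)] @ [Bwd (S a b) ?r (S b b)])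
        ([Fwd (S b b) ?r (S a b)] @ [] @ [Bwd (S a b) ?r (S b b)])"
      using ob w f
      by (intro zigzag_eq_mid[where b = "S a b" and c = "S a b"] zigzag_eq_Fwd_Bwd zigzag_Fwd
          zigzag_Bwd H)
    moreover have "zigzag_eq C W (S b b) (S b b) [Fwd (S b b) ?r (S a b), Bwd (S a b) ?r (S b b)] []"
      using ob w by (intro zigzag_eq_Fwd_Bwd H)
    ultimately show ?thesis by (simp add: zigzag_eq.trans)
  qed
  have "zigzag_eq C W a (S b b) ([Bwd a w b, Fwd b (\<Delta> b) (S b b)] @ [])
      ([Bwd a w b, Fwd b (\<Delta> b) (S b b)] @
      [Fwd (S b b) ?r (S a b), Fwd (S a b) ?l (S a a), Bwd (S a a) ?l (S a b), Bwd (S a b) ?r (S b b)])"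
    using ob w by (intro zigzag_eq_append_left[OF zigzag_eq.sym[OF 1]] zigzag.intros H)
  also have "\<dots> = [Bwd a w b] @
      [Fwd b (\<Delta> b) (S b b), Fwd (S b b) ?r (S a b), Fwd (S a b) ?l (S a a)] @
      [Bwd (S a a) ?l (S a b), Bwd (S a b) ?r (S b b)]" by simp
  also have "zigzag_eq C W a (S b b) \<dots> ([Bwd a w b] @ [Fwd b w a, Fwd a (\<Delta> a) (S a a)] @
      [Bwd (S a a) ?l (S a b), Bwd (S a b) ?r (S b b)])"
    using ob w
    by (intro zigzag_eq_mid[where b = b and c = "S a a"] diag_Fwd[THEN zigzag_eq.sym] f
        zigzag.intros H)
  also have "\<dots> = [Bwd a w b, Fwd b w a] @
      [Fwd a (\<Delta> a) (S a a), Bwd (S a a) ?l (S a b), Bwd (S a b) ?r (S b b)]" by simp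
  also have "zigzag_eq C W a (S b b) \<dots> ([] @
      [Fwd a (\<Delta> a) (S a a), Bwd (S a a) ?l (S a b), Bwd (S a b) ?r (S b b)])"
    using ob w by (intro zigzag_eq_append_right[where b = a] zigzag_eq_Bwd_Fwd zigzag.intros H)
  finally show ?thesis by simp
qed

text \<open>The diagonal commutes with a zigzag \<open>p\<close>, where \<open>p \<oplus> p\<close> means applying \<open>p\<close> to the first summand
  and then to the second.\<close>

lemma diag_zigzag:
  assumes "zigzag C W a p b"
  shows "zigzag_eq C W a (S b b) (p @ [Fwd b (\<Delta> b) (S b b)])
    (Fwd a (\<Delta> a) (S a a) # rmap a p @ lmap b p)"
  using assms
proof (induction rule: zigzag.induct)
  case (nil a)
  then show ?case by (auto intro!: zigzag_eq.refl zigzag_Fwd diag_Hom S_Ob)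
next
  case (fwd a b f p c)
  note ob = fwd(1,2) zigzag_Ob[OF fwd(4), THEN conjunct2]
  note H = diag_Hom S_Ob lm_Hom rm_Hom lm_W rm_W
  have "zigzag_eq C W a (S c c) ([Fwd a f b] @ p @ [Fwd c (\<Delta> c) (S c c)])
      ([Fwd a f b] @ Fwd b (\<Delta> b) (S b b) # rmap b p @ lmap c p)"
    by (rule zigzag_eq_append_left[OF fwd.IH zigzag_Fwd[OF fwd(1-3)]])
  also have "\<dots> = [Fwd a f b, Fwd b (\<Delta> b) (S b b)] @ rmap b p @ lmap c p" by simp
  also have "zigzag_eq C W a (S c c) \<dots> ([Fwd a (\<Delta> a) (S a a), Fwd (S a a) (rm a a b f) (S b a),
        Fwd (S b a) (lm b a b f) (S b b)] @ rmap b p @ lmap c p)"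
    by (rule zigzag_eq_append_right[OF diag_Fwd[OF fwd(1-3)]
          zigzag_append[OF rmap_zigzag[OF ob(2) fwd(4)] lmap_zigzag[OF ob(3) fwd(4)]]])
  also have "\<dots> = [Fwd a (\<Delta> a) (S a a), Fwd (S a a) (rm a a b f) (S b a)] @
      (Fwd (S b a) (lm b a b f) (S b b) # rmap b p) @ lmap c p" by simp
  also have "zigzag_eq C W a (S c c) \<dots> ([Fwd a (\<Delta> a) (S a a), Fwd (S a a) (rm a a b f) (S b a)] @
      (rmap a p @ [Fwd (S c a) (lm c a b f) (S c b)]) @ lmap c p)"
    using ob fwd(3)
    by (intro zigzag_eq_mid[OF rmap_lm[OF ob(1,2) fwd(3,4), THEN zigzag_eq.sym]]
        lmap_zigzag[OF ob(3) fwd(4)] zigzag.intros H)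
  finally show ?case by simp
next
  case (bwd a b w p c)
  note ob = bwd(1,2) zigzag_Ob[OF bwd(4), THEN conjunct2]
  have f: "w \<in> Hom C b a" using W_Hom ob bwd(3) by blast
  note H = diag_Hom S_Ob lm_Hom rm_Hom lm_W rm_W
  have zz: "zigzag C W (S b a) (rmap a p) (S c a)" "zigzag C W (S b b) (rmap b p) (S c b)"
    "zigzag C W (S c b) (lmap c p) (S c c)" "zigzag C W (S a a) (rmap a (Bwd a w b # p)) (S c a)"
    "zigzag C W (S c a) (lmap c (Bwd a w b # p)) (S c c)"
    using rmap_zigzag[OF _ bwd(4)] lmap_zigzag[OF _ bwd(4)] ob zigzag.bwd[OF bwd(1-4)]
      rmap_zigzag[OF ob(1)] lmap_zigzag[OF ob(3)] by blast+
  have 1: "zigzag_eq C W (S a b) (S c a) (Bwd (S a b) (rm b b a w) (S b b) # rmap b p @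
      [Fwd (S c b) (lm c b a w) (S c a)]) (Fwd (S a b) (lm a b a w) (S a a) # rmap a (Bwd a w b # p))"
    using rmap_lm[OF ob(2,1) f zigzag.bwd[OF bwd(1-4)]] by simp
  have "zigzag_eq C W a (S c c) ([Bwd a w b] @ p @ [Fwd c (\<Delta> c) (S c c)])
      ([Bwd a w b] @ Fwd b (\<Delta> b) (S b b) # rmap b p @ lmap c p)"
    by (rule zigzag_eq_append_left[OF bwd.IH zigzag_Bwd[OF bwd(1-3)]])
  also have "\<dots> = [Bwd a w b, Fwd b (\<Delta> b) (S b b)] @ rmap b p @ lmap c p" by simp
  also have "zigzag_eq C W a (S c c) \<dots> ([Fwd a (\<Delta> a) (S a a), Bwd (S a a) (lm a b a w) (S a b),
        Bwd (S a b) (rm b b a w) (S b b)] @ rmap b p @ lmap c p)"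
    by (rule zigzag_eq_append_right[OF diag_Bwd[OF bwd(1-3)]
          zigzag_append[OF rmap_zigzag[OF ob(2) bwd(4)] lmap_zigzag[OF ob(3) bwd(4)]]])
  also have "\<dots> = ([Fwd a (\<Delta> a) (S a a), Bwd (S a a) (lm a b a w) (S a b),
        Bwd (S a b) (rm b b a w) (S b b)] @ rmap b p) @ [] @ lmap c p" by simp
  also have "zigzag_eq C W a (S c c) \<dots> (([Fwd a (\<Delta> a) (S a a), Bwd (S a a) (lm a b a w) (S a b),
        Bwd (S a b) (rm b b a w) (S b b)] @ rmap b p) @
        [Fwd (S c b) (lm c b a w) (S c a), Bwd (S c a) (lm c b a w) (S c b)] @ lmap c p)"
    using ob bwd(3)
    by (intro zigzag_eq_mid[where b = "S c b" and c = "S c b"]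
        zigzag_eq_Fwd_Bwd[THEN zigzag_eq.sym] zz zigzag_append[OF _ zz(2)] zigzag.intros H)
  also have "\<dots> = [Fwd a (\<Delta> a) (S a a), Bwd (S a a) (lm a b a w) (S a b)] @
      (Bwd (S a b) (rm b b a w) (S b b) # rmap b p @ [Fwd (S c b) (lm c b a w) (S c a)]) @
      Bwd (S c a) (lm c b a w) (S c b) # lmap c p" by simp
  also have "zigzag_eq C W a (S c c) \<dots> ([Fwd a (\<Delta> a) (S a a), Bwd (S a a) (lm a b a w) (S a b)] @
      (Fwd (S a b) (lm a b a w) (S a a) # rmap a (Bwd a w b # p)) @
      Bwd (S c a) (lm c b a w) (S c b) # lmap c p)"
    using ob bwd(3) by (intro zigzag_eq_mid[OF 1] zz zigzag.intros H)
  also have "\<dots> = [Fwd a (\<Delta> a) (S a a)] @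
      [Bwd (S a a) (lm a b a w) (S a b), Fwd (S a b) (lm a b a w) (S a a)] @
      rmap a (Bwd a w b # p) @ lmap c (Bwd a w b # p)" by simp
  also have "zigzag_eq C W a (S c c) \<dots> ([Fwd a (\<Delta> a) (S a a)] @ [] @
      rmap a (Bwd a w b # p) @ lmap c (Bwd a w b # p))"
    using ob bwd(3)
    by (intro zigzag_eq_mid[where b = "S a a" and c = "S a a"] zigzag_eq_Bwd_Fwd
        zigzag_append[OF zz(4,5)] zigzag_Fwd H)
  finally show ?case by simp
qed

text \<open>With \<open>n\<close> the codiagonal of \<open>q\<close>, the composite below is the sum \<open>u + v\<close>. Hence a morphism of
  the localization is determined after composing with \<open>u + v\<close> by its composites with \<open>u\<close> and \<open>v\<close>.\<close>

lemma zigzag_eq_sum: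
  assumes ob: "p \<in> Ob C" "q \<in> Ob C" and u: "u \<in> Hom C p q" and v: "v \<in> Hom C p q"
    and n: "n \<in> Hom C (S q q) q"
    and s: "s = Cmp C p (S q q) q n (Cmp C p (S q p) (S q q) (lm q p q v)
      (Cmp C p (S p p) (S q p) (rm p p q u) (\<Delta> p)))"
    and \<alpha>: "zigzag C W a \<alpha> p" and \<beta>: "zigzag C W a \<beta> p"
    and eq_u: "zigzag_eq C W a q (\<alpha> @ [Fwd p u q]) (\<beta> @ [Fwd p u q])"
    and eq_v: "zigzag_eq C W a q (\<alpha> @ [Fwd p v q]) (\<beta> @ [Fwd p v q])"
  shows "zigzag_eq C W a q (\<alpha> @ [Fwd p s q]) (\<beta> @ [Fwd p s q])"
proof -
  note H = diag_Hom S_Ob lm_Hom rm_Hom lm_W rm_W Cmp_Hom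
  have a: "a \<in> Ob C" using zigzag_Ob \<alpha> by blast
  have split: "zigzag_eq C W p q [Fwd p s q] [Fwd p (\<Delta> p) (S p p), Fwd (S p p) (rm p p q u) (S q p),
      Fwd (S q p) (lm q p q v) (S q q), Fwd (S q q) n q]" (is "zigzag_eq _ _ _ _ _ ?L")
  proof -
    have "zigzag_eq C W p (S q p) [Fwd p (\<Delta> p) (S p p), Fwd (S p p) (rm p p q u) (S q p)]
        [Fwd p (Cmp C p (S p p) (S q p) (rm p p q u) (\<Delta> p)) (S q p)]"
      using ob u by (intro zigzag_eq_Cmp H)
    from zigzag_eq_append_right[OF this, of "[Fwd (S q p) (lm q p q v) (S q q), Fwd (S q q) n q]" q]
    have "zigzag_eq C W p q ?L ([Fwd p (Cmp C p (S p p) (S q p) (rm p p q u) (\<Delta> p)) (S q p),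
        Fwd (S q p) (lm q p q v) (S q q)] @ [Fwd (S q q) n q])"
      using ob v n by (simp add: zigzag_simps H)
    also have "zigzag_eq C W p q \<dots> ([Fwd p (Cmp C p (S q p) (S q q) (lm q p q v)
      (Cmp C p (S p p) (S q p) (rm p p q u) (\<Delta> p))) (S q q)] @ [Fwd (S q q) n q])"
      using ob u v n by (intro zigzag_eq_append_right[where b = "S q q"] zigzag_eq_Cmp zigzag_Fwd H)
    also have "zigzag_eq C W p q \<dots> [Fwd p s q]"
      unfolding s append_Cons append_Nil using ob u v n by (intro zigzag_eq_Cmp H)
    finally show ?thesis by (rule zigzag_eq.sym)
  qed
  have normal: "zigzag_eq C W a q (\<gamma> @ [Fwd p s q]) ([Fwd a (\<Delta> a) (S a a)] @
      (rmap a (\<gamma> @ [Fwd p u q]) @ lmap q (\<gamma> @ [Fwd p v q])) @ [Fwd (S q q) n q])"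
    if \<gamma>: "zigzag C W a \<gamma> p" for \<gamma>
  proof -
    let ?r = "Fwd (S p p) (rm p p q u) (S q p)" and ?l = "Fwd (S q p) (lm q p q v) (S q q)"
    let ?n = "Fwd (S q q) n q"
    have "zigzag_eq C W a q (\<gamma> @ [Fwd p s q]) (\<gamma> @ ?L)"
      by (rule zigzag_eq_append_left[OF split \<gamma>])
    also have "\<dots> = (\<gamma> @ [Fwd p (\<Delta> p) (S p p)]) @ [?r, ?l, ?n]" by simp
    also have "zigzag_eq C W a q \<dots> ((Fwd a (\<Delta> a) (S a a) # rmap a \<gamma> @ lmap p \<gamma>) @ [?r, ?l, ?n])"
      using ob u v n by (intro zigzag_eq_append_right[OF diag_zigzag[OF \<gamma>]] zigzag.intros H)
    also have "\<dots> = (Fwd a (\<Delta> a) (S a a) # rmap a \<gamma>) @ (lmap p \<gamma> @ [?r]) @ [?l, ?n]" by simp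
    also have "zigzag_eq C W a q \<dots> ((Fwd a (\<Delta> a) (S a a) # rmap a \<gamma>) @
        (Fwd (S p a) (rm a p q u) (S q a) # lmap q \<gamma>) @ [?l, ?n])"
      using ob a u v n
      by (intro zigzag_eq_mid[OF lmap_rm[OF ob u \<gamma>]] zigzag.intros H rmap_zigzag \<gamma>)
    finally show ?thesis by simp
  qed
  have "zigzag_eq C W a q ([Fwd a (\<Delta> a) (S a a)] @
      (rmap a (\<alpha> @ [Fwd p u q]) @ lmap q (\<alpha> @ [Fwd p v q])) @ [Fwd (S q q) n q])
      ([Fwd a (\<Delta> a) (S a a)] @
      (rmap a (\<beta> @ [Fwd p u q]) @ lmap q (\<beta> @ [Fwd p v q])) @ [Fwd (S q q) n q])"
    using ob a n
    by (intro zigzag_eq_mid[OF zigzag_eq_append[OF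
            localizing_functor.zigzag_eq_map[OF right[OF a] eq_u]
            localizing_functor.zigzag_eq_map[OF left[OF ob(2)] eq_v]]] zigzag_Fwd H)
  with normal[OF \<alpha>] normal[OF \<beta>] show ?thesis by (meson zigzag_eq.sym zigzag_eq.trans)
qed

end


section \<open>The category of bounded complexes\<close>

lemma ext_mor_apply: "\<lbrakk>openin X U; s \<in> carrier (sec F U)\<rbrakk> \<Longrightarrow> ext_mor X F f U s = f U s"
  by (simp add: ext_mor_def)

lemma ext_mor_idem: "ext_mor X F (ext_mor X F f) = ext_mor X F f"
  by (auto simp: ext_mor_def fun_eq_iff)

lemma psheaf_homI:
  assumes F: "presheaf R X F"
    and f: "\<And>U. openin X U \<Longrightarrow> f U \<in> mod_hom R (sec F U) (sec G U)"
    and rst: "\<And>U V s. \<lbrakk>openin X U; openin X V; V \<subseteq> U; s \<in> carrier (sec F U)\<rbrakk>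
      \<Longrightarrow> rst G U V (f U s) = f V (rst F U V s)"
  shows "ext_mor X F f \<in> psheaf_hom R X F G"
proof -
  interpret operations_presheaf R X F by (rule presheaf_operations[OF F])
  have "ext_mor X F f U \<in> mod_hom R (sec F U) (sec G U)" if U: "openin X U" for U
    unfolding mod_hom_def using mod_homD[OF f[OF U]] add_closed[OF U] smult_closed[OF U]
    by (auto simp: ext_mor_apply[OF U])
  then show ?thesis
    unfolding psheaf_hom_def using rst rst_closed by (simp add: ext_mor_idem ext_mor_apply)
qed

lemma psheaf_hom_eqI:
  assumes "f \<in> psheaf_hom R X F G" "g \<in> psheaf_hom R X F H"
    and eq: "\<And>U s. \<lbrakk>openin X U; s \<in> carrier (sec F U)\<rbrakk> \<Longrightarrow> f U s = g U s"
  shows "f = g"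
proof -
  have "ext_mor X F f = ext_mor X F g" using eq by (auto simp: ext_mor_def fun_eq_iff)
  then show ?thesis using psheaf_homD(3)[OF assms(1)] psheaf_homD(3)[OF assms(2)] by simp
qed

lemma mod_hom_id: "(\<lambda>s. s) \<in> mod_hom R M M"
  by (simp add: mod_hom_def)

lemma mod_hom_comp:
  assumes f: "f \<in> mod_hom R M N" and g: "g \<in> mod_hom R N P"
  shows "(\<lambda>s. g (f s)) \<in> mod_hom R M P"
  unfolding mod_hom_def[of R M P] using mod_homD[OF f] mod_homD[OF g] by simp

lemma psheaf_hom_comp:
  assumes F: "presheaf R X F" and f: "f \<in> psheaf_hom R X F G" and g: "g \<in> psheaf_hom R X G H"
  shows "ext_mor X F (\<lambda>U s. g U (f U s)) \<in> psheaf_hom R X F H"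
  by (rule psheaf_homI[OF F mod_hom_comp[OF psheaf_homD(1)[OF f] psheaf_homD(1)[OF g]]])
    (simp_all add: psheaf_homD(2)[OF f] psheaf_homD(2)[OF g] mod_homD(1)[OF psheaf_homD(1)[OF f]])

lemma Cb_simps:
  "Ob (Cb R X) = {C. bounded_complex R X C}" "Hom (Cb R X) = chain_map R X"
  "Idt (Cb R X) C n = ext_mor X (ob C n) (\<lambda>U s. s)"
  "Cmp (Cb R X) C D E g f n = ext_mor X (ob C n) (\<lambda>U s. g n U (f n U s))"
  by (simp_all add: Cb_def Shv_def)

lemma bounded_cochain: "bounded_complex R X C \<Longrightarrow> cochain_complex R X C"
  by (simp add: bounded_complex_def)

lemma bounded_sheaf_complex: "bounded_complex R X C \<Longrightarrow> sheaf_complex R X C"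
  by (simp add: bounded_complex_def sheaf_complex_def)

lemma chain_mapI:
  assumes "\<And>n. f n \<in> psheaf_hom R X (ob C n) (ob D n)"
    and "\<And>n U s. \<lbrakk>openin X U; s \<in> carrier (sec (ob C n) U)\<rbrakk> \<Longrightarrow> df D n U (f n U s) = f (n + 1) U (df C n U s)"
  shows "f \<in> chain_map R X C D"
  using assms unfolding chain_map_def by blast

lemma chain_mapD:
  assumes "f \<in> chain_map R X C D"
  shows "f n \<in> psheaf_hom R X (ob C n) (ob D n)"
    and "\<lbrakk>openin X U; s \<in> carrier (sec (ob C n) U)\<rbrakk> \<Longrightarrow> df D n U (f n U s) = f (n + 1) U (df C n U s)"
  using assms unfolding chain_map_def by blast+

lemma chain_map_closed:
  "\<lbrakk>f \<in> chain_map R X C D; openin X U; s \<in> carrier (sec (ob C n) U)\<rbrakk> \<Longrightarrow> f n U s \<in> carrier (sec (ob D n) U)"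
  using mod_homD(1)[OF psheaf_homD(1)[OF chain_mapD(1)]] .

lemma chain_map_eqI:
  assumes "f \<in> chain_map R X C D" "g \<in> chain_map R X C E"
    and "\<And>n U s. \<lbrakk>openin X U; s \<in> carrier (sec (ob C n) U)\<rbrakk> \<Longrightarrow> f n U s = g n U s"
  shows "f = g"
  by (rule ext) (rule psheaf_hom_eqI[OF chain_mapD(1)[OF assms(1)] chain_mapD(1)[OF assms(2)] assms(3)])

lemma Idt_chain_map:
  assumes "cochain_complex R X C"
  shows "Idt (Cb R X) C \<in> chain_map R X C C"
proof -
  interpret sheaf_complex R X C by unfold_locales fact
  show ?thesis
    by (rule chain_mapI) (auto simp: Cb_simps ext_mor_apply df_closed
        intro!: psheaf_homI[OF ob_presheaf] mod_hom_id)
qed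

lemma Cmp_chain_map:
  assumes C: "cochain_complex R X C" and f: "f \<in> chain_map R X C D" and g: "g \<in> chain_map R X D E"
  shows "Cmp (Cb R X) C D E g f \<in> chain_map R X C E"
proof -
  interpret sheaf_complex R X C by unfold_locales fact
  show ?thesis
    by (rule chain_mapI)
      (simp_all add: Cb_simps ext_mor_apply df_closed psheaf_hom_comp[OF ob_presheaf chain_mapD(1)[OF f] chain_mapD(1)[OF g]]
        chain_mapD(2)[OF f] chain_mapD(2)[OF g] chain_map_closed[OF f])
qed

lemma Idt_apply: "\<lbrakk>openin X U; s \<in> carrier (sec (ob C n) U)\<rbrakk> \<Longrightarrow> Idt (Cb R X) C n U s = s"
  by (simp add: Cb_simps ext_mor_apply)

lemma Cmp_apply: "\<lbrakk>openin X U; s \<in> carrier (sec (ob C n) U)\<rbrakk> \<Longrightarrow> Cmp (Cb R X) C D E g f n U s = g n U (f n U s)"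
  by (simp add: Cb_simps ext_mor_apply)

lemma Cb_localizing: "localizing (Cb R X) (quasi_isos R X)"
  by unfold_locales
    (auto simp: Cb_simps(1,2) quasi_isos_def intro: Idt_chain_map Cmp_chain_map bounded_cochain)

text \<open>Squares of chain maps are compared on sections.\<close>

lemma Cmp_eqI:
  assumes C: "cochain_complex R X C"
    and f: "f \<in> chain_map R X C D" "g \<in> chain_map R X D E"
    and f': "f' \<in> chain_map R X C D'" "g' \<in> chain_map R X D' E"
    and eq: "\<And>n U s. \<lbrakk>openin X U; s \<in> carrier (sec (ob C n) U)\<rbrakk> \<Longrightarrow> g n U (f n U s) = g' n U (f' n U s)"
  shows "Cmp (Cb R X) C D E g f = Cmp (Cb R X) C D' E g' f'"
  by (rule chain_map_eqI[OF Cmp_chain_map[OF C f] Cmp_chain_map[OF C f']]) (simp add: Cmp_apply eq)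

lemma quasi_isosI:
  assumes "bounded_complex R X C" "bounded_complex R X D" "f \<in> chain_map R X C D" "\<And>n. local_quasi_iso X C D f n"
  shows "f \<in> quasi_isos R X C D"
  using assms mem_quasi_isos_iff[OF bounded_cochain bounded_cochain] by blast

lemma quasi_isosD:
  assumes "bounded_complex R X C" "bounded_complex R X D" "f \<in> quasi_isos R X C D"
  shows "f \<in> chain_map R X C D" "local_quasi_iso X C D f n"
  using assms mem_quasi_isos_iff[OF bounded_cochain bounded_cochain] by blast+

lemma local_quasi_isoD:
  assumes l: "local_quasi_iso X C D f n" and x: "openin X U" "x \<in> U"
  shows "\<lbrakk>z \<in> cycles C n U; f n U z \<in> boundaries D n U\<rbrakk> \<Longrightarrow>
      \<exists>W. openin X W \<and> x \<in> W \<and> W \<subseteq> U \<and> rst (ob C n) U W z \<in> boundaries C n W"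
    and "w \<in> cycles D n U \<Longrightarrow> \<exists>W z b. openin X W \<and> x \<in> W \<and> W \<subseteq> U \<and> z \<in> cycles C n W \<and>
        b \<in> boundaries D n W \<and> rst (ob D n) U W w = b \<oplus>\<^bsub>sec (ob D n) W\<^esub> f n W z"
  using l[unfolded local_quasi_iso_def, rule_format, OF conjI[OF x], THEN conjunct1, rule_format]
    l[unfolded local_quasi_iso_def, rule_format, OF conjI[OF x], THEN conjunct2, rule_format]
  by blast+

subsection \<open>Direct sums\<close>

text \<open>Pairs are encoded in the type of sections so that direct sums stay in the same universe.\<close>

definition pair :: "('x, 'l, 'b) univ \<Rightarrow> ('x, 'l, 'b) univ \<Rightarrow> ('x, 'l, 'b) univ" where
  "pair a b = Germs (\<lambda>_. ({}, [(undefined, a), (undefined, b)]))"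

definition pfst :: "('x, 'l, 'b) univ \<Rightarrow> ('x, 'l, 'b) univ" where
  "pfst u = (THE a. \<exists>b. u = pair a b)"

definition psnd :: "('x, 'l, 'b) univ \<Rightarrow> ('x, 'l, 'b) univ" where
  "psnd u = (THE b. \<exists>a. u = pair a b)"

lemma pair_eq_iff: "pair a b = pair c d \<longleftrightarrow> a = c \<and> b = d"
  by (auto simp: pair_def fun_eq_iff)

lemma pfst_pair [simp]: "pfst (pair a b) = a" and psnd_pair [simp]: "psnd (pair a b) = b"
  by (auto simp: pfst_def psnd_def pair_eq_iff)

definition dsum ::
  "('x, 'k, ('x, 'l, 'b) univ) psheaf \<Rightarrow> ('x, 'k, ('x, 'l, 'b) univ) psheaf \<Rightarrow> ('x, 'k, ('x, 'l, 'b) univ) psheaf"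
  where
  "dsum F G = \<lparr>
     sec = (\<lambda>U. \<lparr>
       carrier = {pair a b | a b. a \<in> carrier (sec F U) \<and> b \<in> carrier (sec G U)},
       monoid.mult = undefined, one = undefined,
       zero = pair \<zero>\<^bsub>sec F U\<^esub> \<zero>\<^bsub>sec G U\<^esub>,
       add = (\<lambda>u v. pair (pfst u \<oplus>\<^bsub>sec F U\<^esub> pfst v) (psnd u \<oplus>\<^bsub>sec G U\<^esub> psnd v)),
       smult = (\<lambda>k u. pair (k \<odot>\<^bsub>sec F U\<^esub> pfst u) (k \<odot>\<^bsub>sec G U\<^esub> psnd u))\<rparr>),
     rst = (\<lambda>U V u. pair (rst F U V (pfst u)) (rst G U V (psnd u)))\<rparr>"

lemma dsum_simps:
  "u \<in> carrier (sec (dsum F G) U) \<longleftrightarrow> (\<exists>a b. u = pair a b \<and> a \<in> carrier (sec F U) \<and> b \<in> carrier (sec G U))"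
  "\<zero>\<^bsub>sec (dsum F G) U\<^esub> = pair \<zero>\<^bsub>sec F U\<^esub> \<zero>\<^bsub>sec G U\<^esub>"
  "pair a b \<oplus>\<^bsub>sec (dsum F G) U\<^esub> pair c d = pair (a \<oplus>\<^bsub>sec F U\<^esub> c) (b \<oplus>\<^bsub>sec G U\<^esub> d)"
  "k \<odot>\<^bsub>sec (dsum F G) U\<^esub> pair a b = pair (k \<odot>\<^bsub>sec F U\<^esub> a) (k \<odot>\<^bsub>sec G U\<^esub> b)"
  "rst (dsum F G) U V (pair a b) = pair (rst F U V a) (rst G U V b)"
  by (auto simp: dsum_def)

lemma pair_mem: "pair a b \<in> carrier (sec (dsum F G) U) \<longleftrightarrow> a \<in> carrier (sec F U) \<and> b \<in> carrier (sec G U)"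
  by (auto simp: dsum_simps pair_eq_iff)

lemma dsum_module:
  assumes "module R (sec F U)" "module R (sec G U)"
  shows "module R (sec (dsum F G) U)"
proof -
  interpret F: module R "sec F U" by fact
  interpret G: module R "sec G U" by fact
  show ?thesis
  proof (rule moduleI)
    show "cring R" by (rule F.R.is_cring)
    show "abelian_group (sec (dsum F G) U)"
    proof (rule abelian_groupI)
      fix u assume "u \<in> carrier (sec (dsum F G) U)"
      then obtain a b where u: "u = pair a b" "a \<in> carrier (sec F U)" "b \<in> carrier (sec G U)"
        by (auto simp: dsum_simps)
      then show "\<exists>v \<in> carrier (sec (dsum F G) U). v \<oplus>\<^bsub>sec (dsum F G) U\<^esub> u = \<zero>\<^bsub>sec (dsum F G) U\<^esub>"
        by (intro bexI[of _ "pair (\<ominus>\<^bsub>sec F U\<^esub> a) (\<ominus>\<^bsub>sec G U\<^esub> b)"])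
          (simp_all add: dsum_simps(2,3) pair_mem F.l_neg G.l_neg)
    qed (auto simp: dsum_simps pair_eq_iff F.a_ac G.a_ac)
  qed (auto simp: dsum_simps pair_eq_iff F.smult_l_distr G.smult_l_distr F.smult_r_distr G.smult_r_distr
      F.smult_assoc1 G.smult_assoc1)
qed

lemma dsum_sheaf:
  assumes F: "sheaf R X F" and G: "sheaf R X G"
  shows "sheaf R X (dsum F G)"
proof -
  interpret F: operations_presheaf R X F by (rule presheaf_operations[OF sheaf_presheaf[OF F]])
  interpret G: operations_presheaf R X G by (rule presheaf_operations[OF sheaf_presheaf[OF G]])
  have "presheaf R X (dsum F G)"
    unfolding presheaf_def
  proof (intro conjI allI impI; (elim conjE)?)
    fix U assume U: "openin X U"
    show "module R (sec (dsum F G) U)"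
      using dsum_module presheaf_module[OF sheaf_presheaf[OF F] U] presheaf_module[OF sheaf_presheaf[OF G] U] by blast
    show "\<forall>s \<in> carrier (sec (dsum F G) U). rst (dsum F G) U U s = s"
      using F.rst_self[OF U] G.rst_self[OF U] by (auto simp: dsum_simps)
  next
    fix U V assume U: "openin X U" "openin X V" "V \<subseteq> U"
    show "rst (dsum F G) U V \<in> mod_hom R (sec (dsum F G) U) (sec (dsum F G) V)"
      unfolding mod_hom_def using F.rst_closed[OF U] G.rst_closed[OF U] F.rst_add[OF U] G.rst_add[OF U]
        F.rst_smult[OF U] G.rst_smult[OF U]
      by (auto simp: dsum_simps pair_eq_iff)
  next
    fix U V W assume U: "openin X U" "openin X V" "openin X W" "W \<subseteq> V" "V \<subseteq> U"
    show "\<forall>s \<in> carrier (sec (dsum F G) U). rst (dsum F G) V W (rst (dsum F G) U V s) = rst (dsum F G) U W s"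
      using F.rst_rst[OF U] G.rst_rst[OF U] by (auto simp: dsum_simps)
  qed
  moreover have "\<exists>!t. t \<in> carrier (sec (dsum F G) (\<Union>\<U>)) \<and> (\<forall>V \<in> \<U>. rst (dsum F G) (\<Union>\<U>) V t = s V)"
    if a: "(\<forall>V \<in> \<U>. openin X V \<and> s V \<in> carrier (sec (dsum F G) V)) \<and>
        (\<forall>V \<in> \<U>. \<forall>W \<in> \<U>. rst (dsum F G) V (V \<inter> W) (s V) = rst (dsum F G) W (V \<inter> W) (s W))" for \<U> s
  proof -
    have V: "openin X V" if "V \<in> \<U>" for V using that a by blast
    have s: "s V = pair (pfst (s V)) (psnd (s V))" "pfst (s V) \<in> carrier (sec F V)" "psnd (s V) \<in> carrier (sec G V)"
      if "V \<in> \<U>" for V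
      using a[THEN conjunct1, rule_format, OF that, THEN conjunct2] by (auto simp: dsum_simps(1))
    have comp: "rst F V (V \<inter> W) (pfst (s V)) = rst F W (V \<inter> W) (pfst (s W))"
      "rst G V (V \<inter> W) (psnd (s V)) = rst G W (V \<inter> W) (psnd (s W))" if "V \<in> \<U>" "W \<in> \<U>" for V W
      using a[THEN conjunct2, rule_format, OF that]
      unfolding dsum_def by (simp_all add: pair_eq_iff)
    have glF: "\<exists>!t. t \<in> carrier (sec F (\<Union>\<U>)) \<and> (\<forall>V \<in> \<U>. rst F (\<Union>\<U>) V t = pfst (s V))"
      by (rule sheaf_glue[OF F V s(2) comp(1)])
    have glG: "\<exists>!t. t \<in> carrier (sec G (\<Union>\<U>)) \<and> (\<forall>V \<in> \<U>. rst G (\<Union>\<U>) V t = psnd (s V))"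
      by (rule sheaf_glue[OF G V s(3) comp(2)])
    obtain f where f: "f \<in> carrier (sec F (\<Union>\<U>))" "\<forall>V \<in> \<U>. rst F (\<Union>\<U>) V f = pfst (s V)"
      and fu: "\<And>f'. \<lbrakk>f' \<in> carrier (sec F (\<Union>\<U>)); \<forall>V \<in> \<U>. rst F (\<Union>\<U>) V f' = pfst (s V)\<rbrakk> \<Longrightarrow> f' = f"
      using glF by (elim ex1E) blast
    obtain g where g: "g \<in> carrier (sec G (\<Union>\<U>))" "\<forall>V \<in> \<U>. rst G (\<Union>\<U>) V g = psnd (s V)"
      and gu: "\<And>g'. \<lbrakk>g' \<in> carrier (sec G (\<Union>\<U>)); \<forall>V \<in> \<U>. rst G (\<Union>\<U>) V g' = psnd (s V)\<rbrakk> \<Longrightarrow> g' = g"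
      using glG by (elim ex1E) blast
    show ?thesis
    proof (rule ex1I[of _ "pair f g"])
      show "pair f g \<in> carrier (sec (dsum F G) (\<Union>\<U>)) \<and> (\<forall>V \<in> \<U>. rst (dsum F G) (\<Union>\<U>) V (pair f g) = s V)"
        using f g s(1) by (simp add: pair_mem dsum_simps(5))
    next
      fix t assume t: "t \<in> carrier (sec (dsum F G) (\<Union>\<U>)) \<and> (\<forall>V \<in> \<U>. rst (dsum F G) (\<Union>\<U>) V t = s V)"
      then obtain a b where ab: "t = pair a b" "a \<in> carrier (sec F (\<Union>\<U>))" "b \<in> carrier (sec G (\<Union>\<U>))"
        by (auto simp: dsum_simps(1))
      have "pair (rst F (\<Union>\<U>) V a) (rst G (\<Union>\<U>) V b) = s V" if "V \<in> \<U>" for V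
        using t that by (simp add: ab(1) dsum_simps(5))
      then have "rst F (\<Union>\<U>) V a = pfst (s V)" "rst G (\<Union>\<U>) V b = psnd (s V)" if "V \<in> \<U>" for V
        using that by (metis pfst_pair, metis psnd_pair)
      then show "t = pair f g" using fu[OF ab(2)] gu[OF ab(3)] ab(1) by simp
    qed
  qed
  ultimately show ?thesis unfolding sheaf_def by blast
qed

definition dmor ::
  "'x topology \<Rightarrow> ('x, 'k, ('x, 'l, 'b) univ) psheaf \<Rightarrow> ('x, 'k, ('x, 'l, 'b) univ) psheaf \<Rightarrow>
   ('x set \<Rightarrow> ('x, 'l, 'b) univ \<Rightarrow> ('x, 'l, 'b) univ) \<Rightarrow> ('x set \<Rightarrow> ('x, 'l, 'b) univ \<Rightarrow> ('x, 'l, 'b) univ) \<Rightarrow>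
   'x set \<Rightarrow> ('x, 'l, 'b) univ \<Rightarrow> ('x, 'l, 'b) univ" where
  "dmor X F G f g = ext_mor X (dsum F G) (\<lambda>U u. pair (f U (pfst u)) (g U (psnd u)))"

lemma dmor_apply:
  "\<lbrakk>openin X U; a \<in> carrier (sec F U); b \<in> carrier (sec G U)\<rbrakk> \<Longrightarrow> dmor X F G f g U (pair a b) = pair (f U a) (g U b)"
  by (simp add: dmor_def ext_mor_apply pair_mem)

lemma dmor_hom:
  assumes F: "sheaf R X F" and G: "sheaf R X G"
    and f: "f \<in> psheaf_hom R X F F'" and g: "g \<in> psheaf_hom R X G G'"
  shows "dmor X F G f g \<in> psheaf_hom R X (dsum F G) (dsum F' G')"
  unfolding dmor_def
proof (rule psheaf_homI[OF sheaf_presheaf[OF dsum_sheaf[OF F G]]])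
  fix U assume U: "openin X U"
  show "(\<lambda>u. pair (f U (pfst u)) (g U (psnd u))) \<in> mod_hom R (sec (dsum F G) U) (sec (dsum F' G') U)"
    unfolding mod_hom_def using mod_homD[OF psheaf_homD(1)[OF f U]] mod_homD[OF psheaf_homD(1)[OF g U]]
    by (auto simp: dsum_simps pair_eq_iff)
next
  fix U V s assume "openin X U" "openin X V" "V \<subseteq> U" "s \<in> carrier (sec (dsum F G) U)"
  then show "rst (dsum F' G') U V (pair (f U (pfst s)) (g U (psnd s))) =
      pair (f V (pfst (rst (dsum F G) U V s))) (g V (psnd (rst (dsum F G) U V s)))"
    using psheaf_homD(2)[OF f] psheaf_homD(2)[OF g] by (auto simp: dsum_simps pair_eq_iff)
qed

definition dsum_cplx ::
  "'x topology \<Rightarrow> ('x, 'k, ('x, 'l, 'b) univ) cplx \<Rightarrow> ('x, 'k, ('x, 'l, 'b) univ) cplx \<Rightarrow> ('x, 'k, ('x, 'l, 'b) univ) cplx"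
  where
  "dsum_cplx X C D = \<lparr>ob = (\<lambda>n. dsum (ob C n) (ob D n)), df = (\<lambda>n. dmor X (ob C n) (ob D n) (df C n) (df D n))\<rparr>"

definition dmap ::
  "'x topology \<Rightarrow> ('x, 'k, ('x, 'l, 'b) univ) cplx \<Rightarrow> ('x, 'k, ('x, 'l, 'b) univ) cplx \<Rightarrow>
   (int \<Rightarrow> 'x set \<Rightarrow> ('x, 'l, 'b) univ \<Rightarrow> ('x, 'l, 'b) univ) \<Rightarrow>
   (int \<Rightarrow> 'x set \<Rightarrow> ('x, 'l, 'b) univ \<Rightarrow> ('x, 'l, 'b) univ) \<Rightarrow>
   int \<Rightarrow> 'x set \<Rightarrow> ('x, 'l, 'b) univ \<Rightarrow> ('x, 'l, 'b) univ" where
  "dmap X C D f g = (\<lambda>n. dmor X (ob C n) (ob D n) (f n) (g n))"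

lemma dsum_cplx_simps: "ob (dsum_cplx X C D) n = dsum (ob C n) (ob D n)"
  "df (dsum_cplx X C D) n = dmor X (ob C n) (ob D n) (df C n) (df D n)"
  by (simp_all add: dsum_cplx_def)

lemma dsum_cplx_cochain:
  assumes C: "cochain_complex R X C" and D: "cochain_complex R X D"
  shows "cochain_complex R X (dsum_cplx X C D)"
proof -
  interpret C: sheaf_complex R X C by unfold_locales fact
  interpret D: sheaf_complex R X D by unfold_locales fact
  show ?thesis
    unfolding cochain_complex_def dsum_cplx_simps
  proof (intro conjI allI impI ballI)
    fix n U s assume U: "openin X U" and "s \<in> carrier (sec (dsum (ob C n) (ob D n)) U)"
    then obtain a b where s: "s = pair a b" "a \<in> carrier (sec (ob C n) U)" "b \<in> carrier (sec (ob D n) U)"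
      by (auto simp: dsum_simps)
    show "dmor X (ob C (n + 1)) (ob D (n + 1)) (df C (n + 1)) (df D (n + 1)) U
        (dmor X (ob C n) (ob D n) (df C n) (df D n) U s) = \<zero>\<^bsub>sec (dsum (ob C (n + 2)) (ob D (n + 2))) U\<^esub>"
      using s U C.df_closed D.df_closed C.df_df D.df_df by (simp add: dmor_apply dsum_simps(2))
  qed (intro dsum_sheaf dmor_hom C.ob_sheaf D.ob_sheaf C.df_psheaf_hom D.df_psheaf_hom)+
qed

lemma dsum_cplx_bounded:
  assumes C: "bounded_complex R X C" and D: "bounded_complex R X D"
  shows "bounded_complex R X (dsum_cplx X C D)"
proof -
  obtain a b where ab: "\<And>n. n < a \<or> b < n \<Longrightarrow> zero_sheaf_p X (ob C n)" using C by (auto simp: bounded_complex_def)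
  obtain c d where cd: "\<And>n. n < c \<or> d < n \<Longrightarrow> zero_sheaf_p X (ob D n)" using D by (auto simp: bounded_complex_def)
  have "zero_sheaf_p X (ob (dsum_cplx X C D) n)" if "n < min a c \<or> max b d < n" for n
    using ab[of n] cd[of n] that by (auto simp: zero_sheaf_p_def dsum_cplx_simps dsum_simps)
  then show ?thesis
    using dsum_cplx_cochain[OF bounded_cochain[OF C] bounded_cochain[OF D]] unfolding bounded_complex_def by blast
qed

lemma dmap_apply:
  "\<lbrakk>openin X U; a \<in> carrier (sec (ob C n) U); b \<in> carrier (sec (ob D n) U)\<rbrakk>
    \<Longrightarrow> dmap X C D f g n U (pair a b) = pair (f n U a) (g n U b)"
  by (simp add: dmap_def dmor_apply)

lemma dmap_chain_map:
  assumes C: "cochain_complex R X C" and D: "cochain_complex R X D"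
    and f: "f \<in> chain_map R X C C'" and g: "g \<in> chain_map R X D D'"
  shows "dmap X C D f g \<in> chain_map R X (dsum_cplx X C D) (dsum_cplx X C' D')"
proof -
  interpret C: sheaf_complex R X C by unfold_locales fact
  interpret D: sheaf_complex R X D by unfold_locales fact
  show ?thesis
  proof (rule chain_mapI)
    fix n
    show "dmap X C D f g n \<in> psheaf_hom R X (ob (dsum_cplx X C D) n) (ob (dsum_cplx X C' D') n)"
      unfolding dmap_def dsum_cplx_simps
      by (intro dmor_hom C.ob_sheaf D.ob_sheaf chain_mapD(1)[OF f] chain_mapD(1)[OF g])
    fix U s assume U: "openin X U" and "s \<in> carrier (sec (ob (dsum_cplx X C D) n) U)"
    then obtain a b where s: "s = pair a b" "a \<in> carrier (sec (ob C n) U)" "b \<in> carrier (sec (ob D n) U)"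
      by (auto simp: dsum_simps dsum_cplx_simps)
    then show "df (dsum_cplx X C' D') n U (dmap X C D f g n U s) = dmap X C D f g (n + 1) U (df (dsum_cplx X C D) n U s)"
      using U chain_map_closed[OF f U s(2)] chain_map_closed[OF g U s(3)] chain_mapD(2)[OF f U s(2)]
        chain_mapD(2)[OF g U s(3)] C.df_closed[OF U s(2)] D.df_closed[OF U s(3)]
      by (simp add: dsum_cplx_simps dmap_apply dmor_apply)
  qed
qed

lemma dsum_cycles:
  assumes "openin X U"
  shows "pair a b \<in> cycles (dsum_cplx X C D) n U \<longleftrightarrow> a \<in> cycles C n U \<and> b \<in> cycles D n U"
  using assms by (auto simp: cycles_def dsum_cplx_simps dsum_simps(2) pair_mem dmor_apply pair_eq_iff)

lemma dsum_cyclesE: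
  assumes "z \<in> cycles (dsum_cplx X C D) n U"
  obtains a b where "z = pair a b"
  using assms by (auto simp: cycles_def dsum_cplx_simps dsum_simps(1))

lemma dsum_boundaries:
  assumes "openin X U"
  shows "pair a b \<in> boundaries (dsum_cplx X C D) n U \<longleftrightarrow> a \<in> boundaries C n U \<and> b \<in> boundaries D n U"
proof
  assume "pair a b \<in> boundaries (dsum_cplx X C D) n U"
  then show "a \<in> boundaries C n U \<and> b \<in> boundaries D n U"
    using assms by (auto simp: boundaries_def dsum_cplx_simps dsum_simps(1) dmor_apply pair_eq_iff)
next
  assume "a \<in> boundaries C n U \<and> b \<in> boundaries D n U"
  then obtain c d where "c \<in> carrier (sec (ob C (n - 1)) U)" "a = df C (n - 1) U c"
    "d \<in> carrier (sec (ob D (n - 1)) U)" "b = df D (n - 1) U d" unfolding boundaries_def by blast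
  then show "pair a b \<in> boundaries (dsum_cplx X C D) n U"
    unfolding boundaries_def using assms
    by (intro image_eqI[of _ _ "pair c d"]) (simp_all add: dsum_cplx_simps dmor_apply pair_mem)
qed

text \<open>Neighbourhoods that work for each of the two components are intersected.\<close>

lemma dmap_quasi_iso:
  assumes C: "bounded_complex R X C" and D: "bounded_complex R X D"
    and C': "bounded_complex R X C'" and D': "bounded_complex R X D'"
    and f: "f \<in> quasi_isos R X C C'" and g: "g \<in> quasi_isos R X D D'"
  shows "dmap X C D f g \<in> quasi_isos R X (dsum_cplx X C D) (dsum_cplx X C' D')"
proof (rule quasi_isosI[OF dsum_cplx_bounded[OF C D] dsum_cplx_bounded[OF C' D']])
  note f' = quasi_isosD[OF C C' f] and g' = quasi_isosD[OF D D' g]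
  show "dmap X C D f g \<in> chain_map R X (dsum_cplx X C D) (dsum_cplx X C' D')"
    by (rule dmap_chain_map[OF bounded_cochain[OF C] bounded_cochain[OF D] f'(1) g'(1)])
  interpret C: sheaf_complex R X C by (rule bounded_sheaf_complex[OF C])
  interpret D: sheaf_complex R X D by (rule bounded_sheaf_complex[OF D])
  interpret C': sheaf_complex R X C' by (rule bounded_sheaf_complex[OF C'])
  interpret D': sheaf_complex R X D' by (rule bounded_sheaf_complex[OF D'])
  interpret f: complex_map R X C C' f by unfold_locales (rule f')
  interpret g: complex_map R X D D' g by unfold_locales (rule g')
  fix n
  show "local_quasi_iso X (dsum_cplx X C D) (dsum_cplx X C' D') (dmap X C D f g) n"
    unfolding local_quasi_iso_def
  proof (intro allI impI, elim conjE, intro conjI ballI impI)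
    fix U x z assume U: "openin X U" and x: "x \<in> U" and z: "z \<in> cycles (dsum_cplx X C D) n U"
      and fz: "dmap X C D f g n U z \<in> boundaries (dsum_cplx X C' D') n U"
    obtain a b where ab: "z = pair a b" using dsum_cyclesE[OF z] .
    have c: "a \<in> cycles C n U" "b \<in> cycles D n U" using z unfolding ab dsum_cycles[OF U] by blast+
    have "f n U a \<in> boundaries C' n U" "g n U b \<in> boundaries D' n U"
      using fz unfolding ab dmap_apply[OF U C.cycles_carrier[OF c(1)] D.cycles_carrier[OF c(2)]]
        dsum_boundaries[OF U] by blast+
    then obtain V W where V: "openin X V" "x \<in> V" "V \<subseteq> U" "rst (ob C n) U V a \<in> boundaries C n V"
      and W: "openin X W" "x \<in> W" "W \<subseteq> U" "rst (ob D n) U W b \<in> boundaries D n W"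
      using local_quasi_isoD(1)[OF f'(2) U x c(1)] local_quasi_isoD(1)[OF g'(2) U x c(2)] by blast
    have o: "openin X (V \<inter> W)" using V W by blast
    have "rst (ob C n) U (V \<inter> W) a \<in> boundaries C n (V \<inter> W)"
      using C.boundaries_rst[OF V(1) o _ V(4)] C.ops.rst_rst[OF U V(1) o _ V(3) C.cycles_carrier[OF c(1)]] by simp
    moreover have "rst (ob D n) U (V \<inter> W) b \<in> boundaries D n (V \<inter> W)"
      using D.boundaries_rst[OF W(1) o _ W(4)] D.ops.rst_rst[OF U W(1) o _ W(3) D.cycles_carrier[OF c(2)]] by simp
    ultimately show "\<exists>W. openin X W \<and> x \<in> W \<and> W \<subseteq> U \<and>
        rst (ob (dsum_cplx X C D) n) U W z \<in> boundaries (dsum_cplx X C D) n W"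
      using o V(2,3) W(2) by (intro exI[of _ "V \<inter> W"])
        (auto simp: ab dsum_cplx_simps(1) dsum_simps(5) dsum_boundaries[OF o])
  next
    fix U x w assume U: "openin X U" and x: "x \<in> U" and w: "w \<in> cycles (dsum_cplx X C' D') n U"
    obtain a b where ab: "w = pair a b" using dsum_cyclesE[OF w] .
    have c: "a \<in> cycles C' n U" "b \<in> cycles D' n U" using w unfolding ab dsum_cycles[OF U] by blast+
    obtain V z r where V: "openin X V" "x \<in> V" "V \<subseteq> U" and z: "z \<in> cycles C n V" and r: "r \<in> boundaries C' n V"
      and eq: "rst (ob C' n) U V a = r \<oplus>\<^bsub>sec (ob C' n) V\<^esub> f n V z"
      using local_quasi_isoD(2)[OF f'(2) U x c(1)] by blast
    obtain W y s where W: "openin X W" "x \<in> W" "W \<subseteq> U" and y: "y \<in> cycles D n W" and s: "s \<in> boundaries D' n W"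
      and eq': "rst (ob D' n) U W b = s \<oplus>\<^bsub>sec (ob D' n) W\<^esub> g n W y"
      using local_quasi_isoD(2)[OF g'(2) U x c(2)] by blast
    have o: "openin X (V \<inter> W)" using V W by blast
    have sub: "V \<inter> W \<subseteq> V" "V \<inter> W \<subseteq> W" by auto
    have e1: "rst (ob C' n) U (V \<inter> W) a = rst (ob C' n) V (V \<inter> W) r \<oplus>\<^bsub>sec (ob C' n) (V \<inter> W)\<^esub>
        f n (V \<inter> W) (rst (ob C n) V (V \<inter> W) z)"
      using C'.ops.rst_rst[OF U V(1) o sub(1) V(3) C'.cycles_carrier[OF c(1)], symmetric] eq
        C'.ops.rst_add[OF V(1) o sub(1) C'.boundaries_carrier[OF V(1) r] f.f_closed[OF V(1) C.cycles_carrier[OF z]]]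
        f.f_rst[OF V(1) o sub(1) C.cycles_carrier[OF z]] by simp
    have e2: "rst (ob D' n) U (V \<inter> W) b = rst (ob D' n) W (V \<inter> W) s \<oplus>\<^bsub>sec (ob D' n) (V \<inter> W)\<^esub>
        g n (V \<inter> W) (rst (ob D n) W (V \<inter> W) y)"
      using D'.ops.rst_rst[OF U W(1) o sub(2) W(3) D'.cycles_carrier[OF c(2)], symmetric] eq'
        D'.ops.rst_add[OF W(1) o sub(2) D'.boundaries_carrier[OF W(1) s] g.f_closed[OF W(1) D.cycles_carrier[OF y]]]
        g.f_rst[OF W(1) o sub(2) D.cycles_carrier[OF y]] by simp
    note zy = C.cycles_rst[OF V(1) o sub(1) z] D.cycles_rst[OF W(1) o sub(2) y]
    let ?z = "pair (rst (ob C n) V (V \<inter> W) z) (rst (ob D n) W (V \<inter> W) y)"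
    let ?r = "pair (rst (ob C' n) V (V \<inter> W) r) (rst (ob D' n) W (V \<inter> W) s)"
    have "?z \<in> cycles (dsum_cplx X C D) n (V \<inter> W)" unfolding dsum_cycles[OF o] using zy by blast
    moreover have "?r \<in> boundaries (dsum_cplx X C' D') n (V \<inter> W)"
      unfolding dsum_boundaries[OF o]
      using C'.boundaries_rst[OF V(1) o sub(1) r] D'.boundaries_rst[OF W(1) o sub(2) s] by blast
    moreover have "rst (ob (dsum_cplx X C' D') n) U (V \<inter> W) w =
        ?r \<oplus>\<^bsub>sec (ob (dsum_cplx X C' D') n) (V \<inter> W)\<^esub> dmap X C D f g n (V \<inter> W) ?z"
      using e1 e2 C.cycles_carrier[OF zy(1)] D.cycles_carrier[OF zy(2)] o
      by (simp add: ab dsum_cplx_simps dsum_simps dmap_apply)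
    ultimately show "\<exists>W z b. openin X W \<and> x \<in> W \<and> W \<subseteq> U \<and> z \<in> cycles (dsum_cplx X C D) n W \<and>
        b \<in> boundaries (dsum_cplx X C' D') n W \<and>
        rst (ob (dsum_cplx X C' D') n) U W w = b \<oplus>\<^bsub>sec (ob (dsum_cplx X C' D') n) W\<^esub> dmap X C D f g n W z"
      using o V(2,3) W(2) by blast
  qed
qed

lemma Idt_quasi_iso:
  assumes C: "bounded_complex R X C"
  shows "Idt (Cb R X) C \<in> quasi_isos R X C C"
proof (rule quasi_isosI[OF C C Idt_chain_map[OF bounded_cochain[OF C]]])
  interpret C: sheaf_complex R X C by (rule bounded_sheaf_complex[OF C])
  fix n
  show "local_quasi_iso X C C (Idt (Cb R X) C) n"
    unfolding local_quasi_iso_def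
  proof (intro allI impI, elim conjE, intro conjI ballI impI)
    fix U x z assume "openin X U" "x \<in> U" "z \<in> cycles C n U" "Idt (Cb R X) C n U z \<in> boundaries C n U"
    then show "\<exists>W. openin X W \<and> x \<in> W \<and> W \<subseteq> U \<and> rst (ob C n) U W z \<in> boundaries C n W"
      using C.ops.rst_self[of U z n] C.cycles_carrier[of z n U] by (intro exI[of _ U]) (simp add: Idt_apply)
  next
    fix U x w assume U: "openin X U" and x: "x \<in> U" and w: "w \<in> cycles C n U"
    interpret M: module R "sec (ob C n) U" by (rule C.sec_module[OF U])
    show "\<exists>W z b. openin X W \<and> x \<in> W \<and> W \<subseteq> U \<and> z \<in> cycles C n W \<and> b \<in> boundaries C n W \<and>
        rst (ob C n) U W w = b \<oplus>\<^bsub>sec (ob C n) W\<^esub> Idt (Cb R X) C n W z"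
      using U x w C.boundaries_zero[OF U] C.cycles_carrier[OF w] C.ops.rst_self[OF U]
      by (intro exI[of _ U] exI[of _ w] exI[of _ "\<zero>\<^bsub>sec (ob C n) U\<^esub>"]) (simp add: Idt_apply)
  qed
qed

definition diag :: "'x topology \<Rightarrow> ('x, 'k, ('x, 'l, 'b) univ) cplx \<Rightarrow>
    int \<Rightarrow> 'x set \<Rightarrow> ('x, 'l, 'b) univ \<Rightarrow> ('x, 'l, 'b) univ" where
  "diag X C = (\<lambda>n. ext_mor X (ob C n) (\<lambda>U s. pair s s))"

definition codiag :: "'x topology \<Rightarrow> ('x, 'k, ('x, 'l, 'b) univ) cplx \<Rightarrow>
    int \<Rightarrow> 'x set \<Rightarrow> ('x, 'l, 'b) univ \<Rightarrow> ('x, 'l, 'b) univ" where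
  "codiag X C = (\<lambda>n. ext_mor X (dsum (ob C n) (ob C n)) (\<lambda>U u. pfst u \<oplus>\<^bsub>sec (ob C n) U\<^esub> psnd u))"

lemma diag_chain_map:
  assumes "cochain_complex R X C"
  shows "diag X C \<in> chain_map R X C (dsum_cplx X C C)"
proof -
  interpret C: sheaf_complex R X C by unfold_locales fact
  show ?thesis
  proof (rule chain_mapI)
    show "diag X C n \<in> psheaf_hom R X (ob C n) (ob (dsum_cplx X C C) n)" for n
      unfolding diag_def dsum_cplx_simps
      by (rule psheaf_homI[OF C.ob_presheaf]) (auto simp: mod_hom_def dsum_simps pair_eq_iff)
    show "df (dsum_cplx X C C) n U (diag X C n U s) = diag X C (n + 1) U (df C n U s)"
      if "openin X U" "s \<in> carrier (sec (ob C n) U)" for n U s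
      using that by (simp add: diag_def ext_mor_apply dsum_cplx_simps dmor_apply C.df_closed)
  qed
qed

lemma codiag_chain_map:
  assumes "cochain_complex R X C"
  shows "codiag X C \<in> chain_map R X (dsum_cplx X C C) C"
proof -
  interpret C: sheaf_complex R X C by unfold_locales fact
  show ?thesis
  proof (rule chain_mapI)
    fix n
    show "codiag X C n \<in> psheaf_hom R X (ob (dsum_cplx X C C) n) (ob C n)"
      unfolding codiag_def dsum_cplx_simps
    proof (rule psheaf_homI[OF sheaf_presheaf[OF dsum_sheaf[OF C.ob_sheaf C.ob_sheaf]]])
      fix U assume U: "openin X U"
      interpret M: module R "sec (ob C n) U" by (rule C.sec_module[OF U])
      show "(\<lambda>u. pfst u \<oplus>\<^bsub>sec (ob C n) U\<^esub> psnd u) \<in> mod_hom R (sec (dsum (ob C n) (ob C n)) U) (sec (ob C n) U)"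
        by (auto simp: mod_hom_def dsum_simps M.smult_r_distr M.a_ac)
    qed (auto simp: dsum_simps C.ops.rst_add)
    fix U s assume U: "openin X U" and "s \<in> carrier (sec (ob (dsum_cplx X C C) n) U)"
    then obtain a b where s: "s = pair a b" "a \<in> carrier (sec (ob C n) U)" "b \<in> carrier (sec (ob C n) U)"
      by (auto simp: dsum_simps(1) dsum_cplx_simps)
    with U show "df C n U (codiag X C n U s) = codiag X C (n + 1) U (df (dsum_cplx X C C) n U s)"
      by (simp add: codiag_def ext_mor_apply dsum_cplx_simps pair_mem dmor_apply C.df_closed C.df_add)
  qed
qed

lemma Cb_sums:
  fixes R :: "'k ring" and X :: "'x topology"
  shows "localizing_with_sums (Cb R X :: (('x, 'k, ('x, 'l, 'b) univ) cplx, _) cat) (quasi_isos R X) (dsum_cplx X)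
    (\<lambda>D C C' f. dmap X C D f (Idt (Cb R X) D)) (\<lambda>C D D' g. dmap X C D (Idt (Cb R X) C) g) (diag X)"
proof -
  note ob = Cb_simps(1,2)
  note id = Idt_chain_map[OF bounded_cochain]
  note idW = Idt_quasi_iso
  note apps = Idt_apply Cmp_apply
  note cc = Cmp_chain_map[OF bounded_cochain]
  note dm = dmap_chain_map[OF bounded_cochain bounded_cochain]
  show ?thesis
  proof (intro localizing_with_sums.intro localizing_with_sums_axioms.intro localizing_functor.intro
      localizing_functor_axioms.intro Cb_localizing; unfold ob mem_Collect_eq)
    fix D :: "('x, 'k, ('x, 'l, 'b) univ) cplx" assume D: "bounded_complex R X D"
    show "is_functor (Cb R X) (Cb R X) (\<lambda>a. dsum_cplx X a D) (\<lambda>C C' f. dmap X C D f (Idt (Cb R X) D))"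
      unfolding is_functor_def ob mem_Collect_eq
    proof (intro conjI ballI)
      fix C :: "('x, 'k, ('x, 'l, 'b) univ) cplx" assume C: "C \<in> {C. bounded_complex R X C}"
      then have C: "bounded_complex R X C" by simp
      show "bounded_complex R X (dsum_cplx X C D)" by (rule dsum_cplx_bounded[OF C D])
      show "dmap X C D (Idt (Cb R X) C) (Idt (Cb R X) D) = Idt (Cb R X) (dsum_cplx X C D)"
        by (rule chain_map_eqI[OF dm[OF C D id[OF C] id[OF D]] id[OF dsum_cplx_bounded[OF C D]]])
          (auto simp: dsum_cplx_simps dsum_simps(1) dmap_apply apps pair_mem)
      fix C' :: "('x, 'k, ('x, 'l, 'b) univ) cplx" assume "C' \<in> {C. bounded_complex R X C}"
      then have C': "bounded_complex R X C'" by simp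
      fix f assume f: "f \<in> chain_map R X C C'"
      then show "dmap X C D f (Idt (Cb R X) D) \<in> chain_map R X (dsum_cplx X C D) (dsum_cplx X C' D)"
        by (intro dm C D id)
      fix C'' :: "('x, 'k, ('x, 'l, 'b) univ) cplx" and g assume "C'' \<in> {C. bounded_complex R X C}" and g: "g \<in> chain_map R X C' C''"
      show "dmap X C D (Cmp (Cb R X) C C' C'' g f) (Idt (Cb R X) D) = Cmp (Cb R X) (dsum_cplx X C D) (dsum_cplx X C' D)
          (dsum_cplx X C'' D) (dmap X C' D g (Idt (Cb R X) D)) (dmap X C D f (Idt (Cb R X) D))"
        by (rule chain_map_eqI[OF dm[OF C D cc[OF C f g] id[OF D]]
              cc[OF dsum_cplx_bounded[OF C D] dm[OF C D f id[OF D]] dm[OF C' D g id[OF D]]]])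
          (auto simp: dsum_cplx_simps dsum_simps(1) dmap_apply apps pair_mem chain_map_closed[OF f])
    qed
    fix C C' :: "('x, 'k, ('x, 'l, 'b) univ) cplx" and f assume "bounded_complex R X C" "bounded_complex R X C'" "f \<in> quasi_isos R X C C'"
    then show "dmap X C D f (Idt (Cb R X) D) \<in> quasi_isos R X (dsum_cplx X C D) (dsum_cplx X C' D)"
      by (intro dmap_quasi_iso[of R] D idW)
  next
    fix D :: "('x, 'k, ('x, 'l, 'b) univ) cplx" assume D: "bounded_complex R X D"
    show "is_functor (Cb R X) (Cb R X) (dsum_cplx X D) (\<lambda>C C' f. dmap X D C (Idt (Cb R X) D) f)"
      unfolding is_functor_def ob mem_Collect_eq
    proof (intro conjI ballI)
      fix C :: "('x, 'k, ('x, 'l, 'b) univ) cplx" assume C: "C \<in> {C. bounded_complex R X C}"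
      then have C: "bounded_complex R X C" by simp
      show "bounded_complex R X (dsum_cplx X D C)" by (rule dsum_cplx_bounded[OF D C])
      show "dmap X D C (Idt (Cb R X) D) (Idt (Cb R X) C) = Idt (Cb R X) (dsum_cplx X D C)"
        by (rule chain_map_eqI[OF dm[OF D C id[OF D] id[OF C]] id[OF dsum_cplx_bounded[OF D C]]])
          (auto simp: dsum_cplx_simps dsum_simps(1) dmap_apply apps pair_mem)
      fix C' :: "('x, 'k, ('x, 'l, 'b) univ) cplx" assume "C' \<in> {C. bounded_complex R X C}"
      then have C': "bounded_complex R X C'" by simp
      fix f assume f: "f \<in> chain_map R X C C'"
      then show "dmap X D C (Idt (Cb R X) D) f \<in> chain_map R X (dsum_cplx X D C) (dsum_cplx X D C')"
        by (intro dm C D id)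
      fix C'' :: "('x, 'k, ('x, 'l, 'b) univ) cplx" and g assume "C'' \<in> {C. bounded_complex R X C}" and g: "g \<in> chain_map R X C' C''"
      show "dmap X D C (Idt (Cb R X) D) (Cmp (Cb R X) C C' C'' g f) = Cmp (Cb R X) (dsum_cplx X D C) (dsum_cplx X D C')
          (dsum_cplx X D C'') (dmap X D C' (Idt (Cb R X) D) g) (dmap X D C (Idt (Cb R X) D) f)"
        by (rule chain_map_eqI[OF dm[OF D C id[OF D] cc[OF C f g]]
              cc[OF dsum_cplx_bounded[OF D C] dm[OF D C id[OF D] f] dm[OF D C' id[OF D] g]]])
          (auto simp: dsum_cplx_simps dsum_simps(1) dmap_apply apps pair_mem chain_map_closed[OF f])
    qed
    fix C C' :: "('x, 'k, ('x, 'l, 'b) univ) cplx" and f assume "bounded_complex R X C" "bounded_complex R X C'" "f \<in> quasi_isos R X C C'"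
    then show "dmap X D C (Idt (Cb R X) D) f \<in> quasi_isos R X (dsum_cplx X D C) (dsum_cplx X D C')"
      by (intro dmap_quasi_iso[of R] D idW)
  next
    fix A A' B B' :: "('x, 'k, ('x, 'l, 'b) univ) cplx" and f g
    assume A: "bounded_complex R X A" "bounded_complex R X A'" and B: "bounded_complex R X B" "bounded_complex R X B'"
      and f: "f \<in> chain_map R X A A'" and g: "g \<in> chain_map R X B B'"
    show "Cmp (Cb R X) (dsum_cplx X A B) (dsum_cplx X A' B) (dsum_cplx X A' B') (dmap X A' B (Idt (Cb R X) A') g)
        (dmap X A B f (Idt (Cb R X) B)) = Cmp (Cb R X) (dsum_cplx X A B) (dsum_cplx X A B') (dsum_cplx X A' B')
        (dmap X A B' f (Idt (Cb R X) B')) (dmap X A B (Idt (Cb R X) A) g)"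
      by (rule Cmp_eqI[OF bounded_cochain[OF dsum_cplx_bounded[OF A(1) B(1)]]
            dm[OF A(1) B(1) f id[OF B(1)]] dm[OF A(2) B(1) id[OF A(2)] g]
            dm[OF A(1) B(1) id[OF A(1)] g] dm[OF A(1) B(2) f id[OF B(2)]]])
        (auto simp: dsum_cplx_simps dsum_simps(1) dmap_apply Idt_apply chain_map_closed[OF f] chain_map_closed[OF g])
  next
    fix A :: "('x, 'k, ('x, 'l, 'b) univ) cplx" assume A: "bounded_complex R X A"
    show "diag X A \<in> chain_map R X A (dsum_cplx X A A)" by (rule diag_chain_map[OF bounded_cochain[OF A]])
    fix B :: "('x, 'k, ('x, 'l, 'b) univ) cplx" and f assume B: "bounded_complex R X B" and f: "f \<in> chain_map R X A B"
    have 1: "Cmp (Cb R X) (dsum_cplx X A A) (dsum_cplx X B A) (dsum_cplx X B B) (dmap X B A (Idt (Cb R X) B) f) (dmap X A A f (Idt (Cb R X) A))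
        \<in> chain_map R X (dsum_cplx X A A) (dsum_cplx X B B)"
      by (rule cc[OF dsum_cplx_bounded[OF A A] dm[OF A A f id[OF A]] dm[OF B A id[OF B] f]])
    show "Cmp (Cb R X) A B (dsum_cplx X B B) (diag X B) f = Cmp (Cb R X) A (dsum_cplx X A A) (dsum_cplx X B B)
        (Cmp (Cb R X) (dsum_cplx X A A) (dsum_cplx X B A) (dsum_cplx X B B) (dmap X B A (Idt (Cb R X) B) f) (dmap X A A f (Idt (Cb R X) A)))
        (diag X A)"
      by (rule Cmp_eqI[OF bounded_cochain[OF A] f diag_chain_map[OF bounded_cochain[OF B]]
            diag_chain_map[OF bounded_cochain[OF A]] 1])
        (simp add: diag_def ext_mor_apply apps dsum_cplx_simps pair_mem dmap_apply chain_map_closed[OF f])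
  qed
qed


section \<open>Extension, restriction and conjugation as functors on complexes\<close>

text \<open>Finitely many local conditions that persist under shrinking hold on a common neighbourhood.\<close>

lemma common_neighbourhood:
  assumes U: "openin X U" "x \<in> U"
    and P: "\<And>i. i \<in> set J \<Longrightarrow> \<exists>W. openin X W \<and> x \<in> W \<and> W \<subseteq> U \<and> P i W"
    and mono: "\<And>i W W'. \<lbrakk>i \<in> set J; openin X W; W \<subseteq> U; P i W; openin X W'; W' \<subseteq> W\<rbrakk> \<Longrightarrow> P i W'"
  shows "\<exists>W. openin X W \<and> x \<in> W \<and> W \<subseteq> U \<and> (\<forall>i \<in> set J. P i W)"
  using P mono
proof (induction J)
  case Nil
  then show ?case using U by auto
next
  case (Cons j J)
  obtain V where V: "openin X V" "x \<in> V" "V \<subseteq> U" "P j V" using Cons.prems(1)[of j] by auto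
  have "\<exists>W. openin X W \<and> x \<in> W \<and> W \<subseteq> U \<and> (\<forall>i \<in> set J. P i W)"
  proof (rule Cons.IH)
    show "\<exists>W. openin X W \<and> x \<in> W \<and> W \<subseteq> U \<and> P i W" if "i \<in> set J" for i
      by (rule Cons.prems(1)) (use that in simp)
    show "P i W'" if "i \<in> set J" "openin X W" "W \<subseteq> U" "P i W" "openin X W'" "W' \<subseteq> W" for i W W'
      by (rule Cons.prems(2)[of i W]) (use that in simp_all)
  qed
  then obtain W where W: "openin X W" "x \<in> W" "W \<subseteq> U" "\<forall>i \<in> set J. P i W" by blast
  have o: "openin X (V \<inter> W)" using V W by blast
  have "P i (V \<inter> W)" if "i \<in> set (j # J)" for i
  proof (cases "i = j")
    case True
    then show ?thesis using Cons.prems(2)[OF that V(1,3) _ o] V(4) by blast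
  next
    case False
    then show ?thesis using Cons.prems(2)[OF that W(1,3) _ o] W(4) that by auto
  qed
  then show ?case using o V W by (intro exI[of _ "V \<inter> W"]) auto
qed

lemma localizing_functor_comp:
  assumes S: "localizing_functor C W D V To Tm" and T: "localizing_functor D V E Y So Sm"
  shows "localizing_functor C W E Y (\<lambda>a. So (To a)) (\<lambda>a b f. Sm (To a) (To b) (Tm a b f))"
proof -
  interpret S: localizing_functor C W D V To Tm by (rule S)
  interpret T: localizing_functor D V E Y So Sm by (rule T)
  show ?thesis
  proof (intro localizing_functor.intro localizing_functor_axioms.intro S.source.localizing_axioms
      T.target.localizing_axioms)
    show "is_functor C E (\<lambda>a. So (To a)) (\<lambda>a b f. Sm (To a) (To b) (Tm a b f))"
      unfolding is_functor_def
    proof (intro conjI ballI)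
      fix a assume a: "a \<in> Ob C"
      show "So (To a) \<in> Ob E" by (intro T.To_Ob S.To_Ob a)
      show "Sm (To a) (To a) (Tm a a (Idt C a)) = Idt E (So (To a))"
        using S.is_functor T.is_functor S.To_Ob[OF a] a by (simp add: is_functor_def)
      fix b f assume b: "b \<in> Ob C" and f: "f \<in> Hom C a b"
      show "Sm (To a) (To b) (Tm a b f) \<in> Hom E (So (To a)) (So (To b))"
        by (intro T.Tm_Hom S.Tm_Hom S.To_Ob a b f)
      fix c g assume c: "c \<in> Ob C" and g: "g \<in> Hom C b c"
      have "Tm a c (Cmp C a b c g f) = Cmp D (To a) (To b) (To c) (Tm b c g) (Tm a b f)"
        using S.is_functor a b c f g unfolding is_functor_def by blast
      moreover have "Sm (To a) (To c) (Cmp D (To a) (To b) (To c) (Tm b c g) (Tm a b f)) =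
          Cmp E (So (To a)) (So (To b)) (So (To c)) (Sm (To b) (To c) (Tm b c g)) (Sm (To a) (To b) (Tm a b f))"
        using T.is_functor[unfolded is_functor_def, THEN conjunct2, THEN conjunct2, THEN conjunct2]
          S.To_Ob[OF a] S.To_Ob[OF b] S.To_Ob[OF c] S.Tm_Hom[OF a b f] S.Tm_Hom[OF b c g] by blast
      ultimately show "Sm (To a) (To c) (Tm a c (Cmp C a b c g f)) =
          Cmp E (So (To a)) (So (To b)) (So (To c)) (Sm (To b) (To c) (Tm b c g)) (Sm (To a) (To b) (Tm a b f))"
        by simp
    qed
    show "Sm (To a) (To b) (Tm a b w) \<in> Y (So (To a)) (So (To b))"
      if "a \<in> Ob C" "b \<in> Ob C" "w \<in> W a b" for a b w
      using that by (intro T.inverts S.inverts S.To_Ob)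
  qed
qed

lemma conj_sheaf_simps:
  "carrier (sec (conj_sheaf g F) U) = carrier (sec F U)"
  "\<zero>\<^bsub>sec (conj_sheaf g F) U\<^esub> = \<zero>\<^bsub>sec F U\<^esub>"
  "s \<oplus>\<^bsub>sec (conj_sheaf g F) U\<^esub> s' = s \<oplus>\<^bsub>sec F U\<^esub> s'"
  "l \<odot>\<^bsub>sec (conj_sheaf g F) U\<^esub> s = g l \<odot>\<^bsub>sec F U\<^esub> s"
  "rst (conj_sheaf g F) = rst F"
  by (simp_all add: conj_sheaf_def)

lemma conj_cplx_simps: "ob (conj_cplx g C) n = conj_sheaf g (ob C n)" "df (conj_cplx g C) = df C"
  by (simp_all add: conj_cplx_def)

lemma conj_cplx_conj_cplx: "conj_cplx h (conj_cplx g C) = conj_cplx (g \<circ> h) C"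
  by (simp add: conj_cplx_def conj_sheaf_def comp_def)

lemma conj_sheaf_id: "conj_sheaf id F = F"
  by (simp add: conj_sheaf_def)

lemma conj_cplx_id: "conj_cplx id C = C"
  by (simp add: conj_cplx_def conj_sheaf_id)

context frame
begin

lemma psheaf_hom_restrict:
  assumes "f \<in> psheaf_hom L X F G"
  shows "f \<in> psheaf_hom RK X F G"
  unfolding psheaf_hom_def[of RK]
  using psheaf_homD(3)[OF assms] mod_hom_restrict[OF psheaf_homD(1)[OF assms]] psheaf_homD(2)[OF assms] by simp

lemma chain_map_restrict: "f \<in> chain_map L X C D \<Longrightarrow> f \<in> chain_map RK X C D"
  by (rule chain_mapI[OF psheaf_hom_restrict[OF chain_mapD(1)] chain_mapD(2)])

lemma cochain_restrict: "cochain_complex L X C \<Longrightarrow> cochain_complex RK X C"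
  unfolding cochain_complex_def by (intro conjI; elim conjE) (simp_all add: sheaf_restrict psheaf_hom_restrict)

lemma bounded_restrict: "bounded_complex L X C \<Longrightarrow> bounded_complex RK X C"
  using cochain_restrict unfolding bounded_complex_def by blast

lemma quasi_isos_restrict:
  assumes C: "bounded_complex L X C" and D: "bounded_complex L X D" and f: "f \<in> quasi_isos L X C D"
  shows "f \<in> quasi_isos RK X C D"
  using quasi_isosD[OF C D f] by (intro quasi_isosI bounded_restrict C D chain_map_restrict)

text \<open>Modules over \<open>L\<close> are modules over \<open>K\<close> with the same underlying record, so restriction of scalars is
  the identity on complexes and on maps.\<close>

lemma restrict_functor:
  "localizing_functor (Cb L X) (quasi_isos L X) (Cb RK X) (quasi_isos RK X) (\<lambda>C. C) (\<lambda>C D f. f)"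
proof (intro localizing_functor.intro localizing_functor_axioms.intro Cb_localizing;
    (unfold Cb_simps(1,2) mem_Collect_eq)?)
  show "is_functor (Cb L X) (Cb RK X) (\<lambda>C. C) (\<lambda>C D f. f)"
    unfolding is_functor_def Cb_simps(1,2)
    using bounded_restrict chain_map_restrict by (auto simp: Cb_def Shv_def)
qed (rule quasi_isos_restrict)

abbreviation "em X \<equiv> ext_mor_tensor L K X id"

text \<open>If \<open>g\<close> is multiplicative then \<open>g \<otimes> f\<close> is \<open>g\<close>-semilinear, which is linearity into the conjugate.\<close>

lemma ext_mor_tensor_psheaf_hom:
  assumes F: "sheaf RK X F" and F': "sheaf RK X F'" and f: "f \<in> psheaf_hom RK X F F'"
    and g: "linear_on_L g" and mult: "\<And>l a. \<lbrakk>l \<in> carrier L; a \<in> carrier L\<rbrakk> \<Longrightarrow> g (l \<otimes>\<^bsub>L\<^esub> a) = g l \<otimes>\<^bsub>L\<^esub> g a"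
  shows "ext_mor_tensor L K X g F F' f \<in> psheaf_hom L X (ext_sheaf L K X F) (conj_sheaf g (ext_sheaf L K X F'))"
proof -
  let ?f = "ext_mor_tensor L K X g F F' f" and ?E = "ext_sheaf L K X F" and ?E' = "ext_sheaf L K X F'"
  note fh = psheaf_homD(1)[OF f] and fr = psheaf_homD(2)[OF f]
  have ft: "?f U (tens X F U ts) = tens X F' U (map (map_prod g (f U)) ts)"
    "map (map_prod g (f U)) ts \<in> formal_sums L (sec F' U)"
    if "openin X U" "ts \<in> formal_sums L (sec F U)" for U ts
    using ext_mor_tensor_tens[where f = f, OF F F' g fh fr that]
      map_prod_formal_sums[OF g _ that(2)] mod_homD(1)[OF fh[OF that(1)]] by blast+
  have "ext_mor X ?E ?f \<in> psheaf_hom L X ?E (conj_sheaf g ?E')"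
  proof (rule psheaf_homI[OF sheaf_presheaf[OF ext_sheaf_sheaf[OF F]]])
    fix U assume U: "openin X U"
    show "?f U \<in> mod_hom L (sec ?E U) (sec (conj_sheaf g ?E') U)"
      unfolding mod_hom_def conj_sheaf_simps
    proof (intro CollectI conjI ballI funcsetI)
      fix a assume "a \<in> carrier (sec ?E U)"
      then obtain ts where ts: "ts \<in> formal_sums L (sec F U)" "a = tens X F U ts"
        unfolding tens_carrier[OF F U] by blast
      show "?f U a \<in> carrier (sec ?E' U)" unfolding ts(2) ft(1)[OF U ts(1)] by (rule tens_mem[OF F' U ft(2)[OF U ts(1)]])
    next
      fix a b assume "a \<in> carrier (sec ?E U)" and b: "b \<in> carrier (sec ?E U)"
      then obtain ts where ts: "ts \<in> formal_sums L (sec F U)" "a = tens X F U ts"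
        unfolding tens_carrier[OF F U] by blast
      obtain us where us: "us \<in> formal_sums L (sec F U)" "b = tens X F U us"
        using b unfolding tens_carrier[OF F U] by blast
      have "ts @ us \<in> formal_sums L (sec F U)" using ts us by simp
      from ft(1)[OF U this] show "?f U (a \<oplus>\<^bsub>sec ?E U\<^esub> b) = ?f U a \<oplus>\<^bsub>sec ?E' U\<^esub> ?f U b"
        unfolding ts(2) us(2) tens_add[OF F U ts(1) us(1)] ft(1)[OF U ts(1)] ft(1)[OF U us(1)]
          tens_add[OF F' U ft(2)[OF U ts(1)] ft(2)[OF U us(1)]] by simp
    next
      fix l a assume l: "l \<in> carrier L" and "a \<in> carrier (sec ?E U)"
      then obtain ts where ts: "ts \<in> formal_sums L (sec F U)" "a = tens X F U ts"
        unfolding tens_carrier[OF F U] by blast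
      have gl: "g l \<in> carrier L" using g l by (simp add: linear_on_L_def)
      have w: "map (map_prod (\<lambda>a. l \<otimes>\<^bsub>L\<^esub> a) id) ts \<in> formal_sums L (sec F U)" using ts(1) l by auto
      have e: "map (map_prod g (f U)) (map (map_prod (\<lambda>a. l \<otimes>\<^bsub>L\<^esub> a) id) ts) =
          map (map_prod (\<lambda>a. g l \<otimes>\<^bsub>L\<^esub> a) id) (map (map_prod g (f U)) ts)"
        unfolding map_map using ts(1) mult[OF l] by (intro map_cong[OF HOL.refl]) auto
      show "?f U (l \<odot>\<^bsub>sec ?E U\<^esub> a) = g l \<odot>\<^bsub>sec ?E' U\<^esub> ?f U a"
        unfolding ts(2) tens_smult[OF F U ts(1) l] ft(1)[OF U w] ft(1)[OF U ts(1)]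
          tens_smult[OF F' U ft(2)[OF U ts(1)] gl] e ..
    qed
  next
    fix U V a assume U: "openin X U" "openin X V" "V \<subseteq> U" and "a \<in> carrier (sec ?E U)"
    then obtain ts where ts: "ts \<in> formal_sums L (sec F U)" "a = tens X F U ts"
      unfolding tens_carrier[OF F U(1)] by blast
    have e: "map (map_prod id (rst F' U V)) (map (map_prod g (f U)) ts) =
        map (map_prod g (f V)) (map (map_prod id (rst F U V)) ts)"
      unfolding map_map using ts(1) fr[OF U] by (intro map_cong[OF HOL.refl]) auto
    show "rst (conj_sheaf g ?E') U V (?f U a) = ?f V (rst ?E U V a)"
      unfolding conj_sheaf_simps ts(2) ft(1)[OF U(1) ts(1)] tens_rst[OF F U ts(1)]
        tens_rst[OF F' U ft(2)[OF U(1) ts(1)]] ft(1)[OF U(2) rst_formal_sums[OF F U ts(1)]] e ..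
  qed
  then show ?thesis by (simp add: ext_mor_tensor_def ext_mor_idem)
qed

lemma em_psheaf_hom:
  assumes "sheaf RK X F" "sheaf RK X F'" "f \<in> psheaf_hom RK X F F'"
  shows "em X F F' f \<in> psheaf_hom L X (ext_sheaf L K X F) (ext_sheaf L K X F')"
  using ext_mor_tensor_psheaf_hom[OF assms linear_on_L_id] by (simp add: conj_sheaf_id)

lemma em_tens:
  assumes "sheaf RK X F" "sheaf RK X F'" "f \<in> psheaf_hom RK X F F'" "openin X U" "ts \<in> formal_sums L (sec F U)"
  shows "em X F F' f U (tens X F U ts) = tens X F' U (map (map_prod id (f U)) ts)"
  by (rule ext_mor_tensor_tens[where f = f, OF assms(1,2) linear_on_L_id psheaf_homD(1,2)[OF assms(3)] assms(4,5)])

lemma em_closed: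
  assumes "sheaf RK X F" "sheaf RK X F'" "f \<in> psheaf_hom RK X F F'" "openin X U" "a \<in> carrier (sec (ext_sheaf L K X F) U)"
  shows "em X F F' f U a \<in> carrier (sec (ext_sheaf L K X F') U)"
  using mod_homD(1)[OF psheaf_homD(1)[OF em_psheaf_hom[OF assms(1-3)] assms(4)] assms(5)] .

lemma coordinate_em:
  assumes F: "sheaf RK X F" and F': "sheaf RK X F'" and f: "f \<in> psheaf_hom RK X F F'" and U: "openin X U"
    and a: "a \<in> carrier (sec (ext_sheaf L K X F) U)" and i: "i \<in> set I"
  shows "coordinate X F' U i (em X F F' f U a) = f U (coordinate X F U i a)"
proof -
  obtain ts where ts: "ts \<in> formal_sums L (sec F U)" "a = tens X F U ts"
    using a unfolding tens_carrier[OF F U] by blast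
  have w: "map (map_prod id (f U)) ts \<in> formal_sums L (sec F' U)"
    using map_prod_formal_sums[OF linear_on_L_id _ ts(1)] mod_homD(1)[OF psheaf_homD(1)[OF f U]] by blast
  show ?thesis
    unfolding ts(2) em_tens[OF F F' f U ts(1)] coordinate_tens[OF F' U w i] coordinate_tens[OF F U ts(1) i]
    by (rule coord_map[OF sec_mod[OF F U] sec_mod[OF F' U] psheaf_homD(1)[OF f U] ts(1) i])
qed

lemma ext_cplx_simps:
  "ob (ext_cplx L K X C) n = ext_sheaf L K X (ob C n)"
  "df (ext_cplx L K X C) n = em X (ob C n) (ob C (n + 1)) (df C n)"
  by (simp_all add: ext_cplx_def)

lemma ext_cplx_cochain:
  fixes C :: "('x, 'l, ('x, 'l, 'b) univ) cplx"
  assumes C: "cochain_complex RK X C"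
  shows "cochain_complex L X (ext_cplx L K X C)"
proof -
  interpret C: sheaf_complex RK X C by unfold_locales fact
  note S = C.ob_sheaf and d = C.df_psheaf_hom
  have mem: "em X (ob C (n + 1)) (ob C (n + 2)) (df C (n + 1)) U b \<in> carrier (sec (ext_sheaf L K X (ob C (n + 2))) U)"
    if "openin X U" "b \<in> carrier (sec (ext_sheaf L K X (ob C (n + 1))) U)" for n U b
    using em_closed[OF S S d that] by (simp add: add.assoc)
  show ?thesis
    unfolding cochain_complex_def ext_cplx_simps
  proof (intro conjI allI impI ballI ext_sheaf_sheaf S em_psheaf_hom d)
    fix n U a assume U: "openin X U" and a: "a \<in> carrier (sec (ext_sheaf L K X (ob C n)) U)"
    note b = em_closed[OF S S d U a]
    have "em X (ob C (n + 1)) (ob C (n + 2)) (df C (n + 1)) U (em X (ob C n) (ob C (n + 1)) (df C n) U a) =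
        \<zero>\<^bsub>sec (ext_sheaf L K X (ob C (n + 2))) U\<^esub>"
    proof (rule coordinate_eqI[OF S U])
      show "\<zero>\<^bsub>sec (ext_sheaf L K X (ob C (n + 2))) U\<^esub> \<in> carrier (sec (ext_sheaf L K X (ob C (n + 2))) U)"
        unfolding tens_zero[OF S U] by (rule tens_mem[OF S U]) simp
      show "em X (ob C (n + 1)) (ob C (n + 2)) (df C (n + 1)) U (em X (ob C n) (ob C (n + 1)) (df C n) U a)
          \<in> carrier (sec (ext_sheaf L K X (ob C (n + 2))) U)"
        by (rule mem[OF U b])
      fix i assume i: "i \<in> set I"
      have "df C (n + 1) \<in> psheaf_hom RK X (ob C (n + 1)) (ob C (n + 2))" using d[of "n + 1"] by (simp add: add.assoc)
      from coordinate_em[OF S S this U b i]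
      show "coordinate X (ob C (n + 2)) U i (em X (ob C (n + 1)) (ob C (n + 2)) (df C (n + 1)) U
          (em X (ob C n) (ob C (n + 1)) (df C n) U a)) =
        coordinate X (ob C (n + 2)) U i \<zero>\<^bsub>sec (ext_sheaf L K X (ob C (n + 2))) U\<^esub>"
        using coordinate_em[OF S S d U a i] C.df_df[OF U coordinate_closed[OF S U a i]]
          coordinate_zero[OF S U i] by simp
    qed
    then show "em X (ob C (n + 1)) (ob C (n + 1 + 1)) (df C (n + 1)) U (em X (ob C n) (ob C (n + 1)) (df C n) U a) =
        \<zero>\<^bsub>sec (ext_sheaf L K X (ob C (n + 2))) U\<^esub>" by (simp add: add.assoc)
  qed
qed

lemma ext_cplx_bounded:
  fixes C :: "('x, 'l, ('x, 'l, 'b) univ) cplx"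
  assumes C: "bounded_complex RK X C"
  shows "bounded_complex L X (ext_cplx L K X C)"
proof -
  interpret C: sheaf_complex RK X C by (rule bounded_sheaf_complex[OF C])
  note S = C.ob_sheaf
  have "zero_sheaf_p X (ob (ext_cplx L K X C) n)" if z: "zero_sheaf_p X (ob C n)" for n
    unfolding zero_sheaf_p_def ext_cplx_simps
  proof (intro allI impI)
    fix U assume U: "openin X U"
    have o: "\<zero>\<^bsub>sec (ext_sheaf L K X (ob C n)) U\<^esub> \<in> carrier (sec (ext_sheaf L K X (ob C n)) U)"
      unfolding tens_zero[OF S U] by (rule tens_mem[OF S U]) simp
    have "a = \<zero>\<^bsub>sec (ext_sheaf L K X (ob C n)) U\<^esub>" if a: "a \<in> carrier (sec (ext_sheaf L K X (ob C n)) U)" for a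
      using coordinate_closed[OF S U a] coordinate_zero[OF S U] z U
      by (intro coordinate_eqI[OF S U a o]) (auto simp: zero_sheaf_p_def)
    then show "carrier (sec (ext_sheaf L K X (ob C n)) U) = {\<zero>\<^bsub>sec (ext_sheaf L K X (ob C n)) U\<^esub>}"
      using o by blast
  qed
  then show ?thesis
    using C ext_cplx_cochain[OF bounded_cochain[OF C]] unfolding bounded_complex_def by blast
qed

abbreviation "Em X C D f \<equiv> \<lambda>n. em X (ob C n) (ob D n) (f n)"

lemma Em_chain_map:
  fixes C D :: "('x, 'l, ('x, 'l, 'b) univ) cplx"
  assumes C: "cochain_complex RK X C" and D: "cochain_complex RK X D" and f: "f \<in> chain_map RK X C D"
  shows "Em X C D f \<in> chain_map L X (ext_cplx L K X C) (ext_cplx L K X D)"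
proof -
  interpret C: sheaf_complex RK X C by unfold_locales fact
  interpret D: sheaf_complex RK X D by unfold_locales fact
  note S = C.ob_sheaf D.ob_sheaf and d = C.df_psheaf_hom D.df_psheaf_hom and f' = chain_mapD(1)[OF f]
  show ?thesis
  proof (rule chain_mapI; unfold ext_cplx_simps)
    show "em X (ob C n) (ob D n) (f n) \<in> psheaf_hom L X (ext_sheaf L K X (ob C n)) (ext_sheaf L K X (ob D n))" for n
      by (intro em_psheaf_hom S f')
    fix n U a assume U: "openin X U" and a: "a \<in> carrier (sec (ext_sheaf L K X (ob C n)) U)"
    note fa = em_closed[OF S f' U a] and da = em_closed[OF S(1) S(1) d(1) U a]
    show "em X (ob D n) (ob D (n + 1)) (df D n) U (em X (ob C n) (ob D n) (f n) U a) =
        em X (ob C (n + 1)) (ob D (n + 1)) (f (n + 1)) U (em X (ob C n) (ob C (n + 1)) (df C n) U a)"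
    proof (rule coordinate_eqI[OF S(2) U em_closed[OF S(2) S(2) d(2) U fa] em_closed[OF S f' U da]])
      fix i assume i: "i \<in> set I"
      show "coordinate X (ob D (n + 1)) U i (em X (ob D n) (ob D (n + 1)) (df D n) U (em X (ob C n) (ob D n) (f n) U a)) =
        coordinate X (ob D (n + 1)) U i (em X (ob C (n + 1)) (ob D (n + 1)) (f (n + 1)) U (em X (ob C n) (ob C (n + 1)) (df C n) U a))"
        using coordinate_em[OF S(2) S(2) d(2) U fa i] coordinate_em[OF S f' U a i] coordinate_em[OF S f' U da i]
          coordinate_em[OF S(1) S(1) d(1) U a i] chain_mapD(2)[OF f U coordinate_closed[OF S(1) U a i]] by simp
    qed
  qed
qed

context
  fixes X :: "'x topology" and C :: "('x, 'l, ('x, 'l, 'b) univ) cplx"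
  assumes C: "cochain_complex RK X C"
begin

interpretation C: sheaf_complex RK X C by unfold_locales (rule C)

lemma ext_tens_mem:
  assumes U: "openin X U" and b: "\<And>i. i \<in> set I \<Longrightarrow> b i \<in> carrier (sec (ob C n) U)"
  shows "map (\<lambda>i. (x i, b i)) I \<in> formal_sums L (sec (ob C n) U)"
  using b x_closed by auto

lemma ext_tens_df:
  assumes U: "openin X U" and b: "\<And>i. i \<in> set I \<Longrightarrow> b i \<in> carrier (sec (ob C n) U)"
  shows "df (ext_cplx L K X C) n U (tens X (ob C n) U (map (\<lambda>i. (x i, b i)) I)) =
    tens X (ob C (n + 1)) U (map (\<lambda>i. (x i, df C n U (b i))) I)"
proof -
  have w: "map (\<lambda>i. (x i, b i)) I \<in> formal_sums L (sec (ob C n) U)" by (rule ext_tens_mem[OF U b])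
  show ?thesis
    using em_tens[OF C.ob_sheaf C.ob_sheaf C.df_psheaf_hom U w] by (simp add: ext_cplx_simps comp_def)
qed

lemma ext_cycles_coordinate:
  assumes U: "openin X U" and a: "a \<in> cycles (ext_cplx L K X C) n U" and i: "i \<in> set I"
  shows "coordinate X (ob C n) U i a \<in> cycles C n U"
proof -
  have a': "a \<in> carrier (sec (ext_sheaf L K X (ob C n)) U)"
    and "em X (ob C n) (ob C (n + 1)) (df C n) U a = \<zero>\<^bsub>sec (ext_sheaf L K X (ob C (n + 1))) U\<^esub>"
    using a by (simp_all add: cycles_def ext_cplx_simps)
  then show ?thesis
    using coordinate_em[OF C.ob_sheaf C.ob_sheaf C.df_psheaf_hom U a' i] coordinate_zero[OF C.ob_sheaf U i]
      coordinate_closed[OF C.ob_sheaf U a' i] by (simp add: cycles_def)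
qed

lemma ext_boundaries_coordinate:
  assumes U: "openin X U" and a: "a \<in> boundaries (ext_cplx L K X C) n U" and i: "i \<in> set I"
  shows "coordinate X (ob C n) U i a \<in> boundaries C n U"
proof -
  obtain b where b: "b \<in> carrier (sec (ext_sheaf L K X (ob C (n - 1))) U)"
    and "a = em X (ob C (n - 1)) (ob C n) (df C (n - 1)) U b"
    using a by (auto simp: boundaries_def ext_cplx_simps)
  moreover have "df C (n - 1) \<in> psheaf_hom RK X (ob C (n - 1)) (ob C n)" using C.df_psheaf_hom[of "n - 1"] by simp
  ultimately show ?thesis
    using coordinate_em[OF C.ob_sheaf C.ob_sheaf _ U b i] coordinate_closed[OF C.ob_sheaf U b i]
    by (simp add: boundaries_def)
qed

lemma tens_boundaries:
  assumes U: "openin X U" and b: "\<And>i. i \<in> set I \<Longrightarrow> b i \<in> boundaries C n U"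
  shows "tens X (ob C n) U (map (\<lambda>i. (x i, b i)) I) \<in> boundaries (ext_cplx L K X C) n U"
proof -
  have "\<forall>i \<in> set I. \<exists>c. c \<in> carrier (sec (ob C (n - 1)) U) \<and> b i = df C (n - 1) U c"
    using b unfolding boundaries_def by blast
  then obtain c where c: "\<forall>i \<in> set I. c i \<in> carrier (sec (ob C (n - 1)) U) \<and> b i = df C (n - 1) U (c i)"
    by (rule bchoice[THEN exE])
  then have "tens X (ob C n) U (map (\<lambda>i. (x i, b i)) I) =
      tens X (ob C n) U (map (\<lambda>i. (x i, df C (n - 1) U (c i))) I)" by (simp cong: map_cong)
  also have "\<dots> = df (ext_cplx L K X C) (n - 1) U (tens X (ob C (n - 1)) U (map (\<lambda>i. (x i, c i)) I))"
    using ext_tens_df[OF U, of c "n - 1"] c by simp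
  finally have "tens X (ob C n) U (map (\<lambda>i. (x i, b i)) I) =
      df (ext_cplx L K X C) (n - 1) U (tens X (ob C (n - 1)) U (map (\<lambda>i. (x i, c i)) I))" .
  moreover have "tens X (ob C (n - 1)) U (map (\<lambda>i. (x i, c i)) I) \<in> carrier (sec (ob (ext_cplx L K X C) (n - 1)) U)"
    unfolding ext_cplx_simps using c by (intro tens_mem[OF C.ob_sheaf U] ext_tens_mem[OF U]) blast
  ultimately show ?thesis unfolding boundaries_def by blast
qed

lemma tens_cycles:
  assumes U: "openin X U" and b: "\<And>i. i \<in> set I \<Longrightarrow> b i \<in> cycles C n U"
  shows "tens X (ob C n) U (map (\<lambda>i. (x i, b i)) I) \<in> cycles (ext_cplx L K X C) n U"
proof -
  let ?S = "ob C (n + 1)"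
  have o: "\<zero>\<^bsub>sec (ext_sheaf L K X ?S) U\<^esub> \<in> carrier (sec (ext_sheaf L K X ?S) U)"
    unfolding tens_zero[OF C.ob_sheaf U] by (rule tens_mem[OF C.ob_sheaf U]) simp
  have bc: "b i \<in> carrier (sec (ob C n) U)" if "i \<in> set I" for i using b[OF that] C.cycles_carrier by blast
  have e: "map (\<lambda>i. (x i, df C n U (b i))) I = map (\<lambda>i. (x i, coordinate X ?S U i \<zero>\<^bsub>sec (ext_sheaf L K X ?S) U\<^esub>)) I"
    using b coordinate_zero[OF C.ob_sheaf U] by (simp add: cycles_def)
  have "df (ext_cplx L K X C) n U (tens X (ob C n) U (map (\<lambda>i. (x i, b i)) I)) =
      \<zero>\<^bsub>sec (ext_sheaf L K X ?S) U\<^esub>"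
  proof -
    have "df (ext_cplx L K X C) n U (tens X (ob C n) U (map (\<lambda>i. (x i, b i)) I)) =
        tens X ?S U (map (\<lambda>i. (x i, df C n U (b i))) I)" by (rule ext_tens_df[OF U bc])
    also have "\<dots> = \<zero>\<^bsub>sec (ext_sheaf L K X ?S) U\<^esub>"
      unfolding e by (rule coordinate_expand[OF C.ob_sheaf U o, symmetric])
    finally show ?thesis .
  qed
  moreover have "map (\<lambda>i. (x i, b i)) I \<in> formal_sums L (sec (ob C n) U)" by (rule ext_tens_mem[OF U bc])
  ultimately show ?thesis
    using tens_mem[OF C.ob_sheaf U] by (simp add: cycles_def ext_cplx_simps)
qed

end

text \<open>A tensor is locally a boundary once each of its finitely many coordinates is.\<close>

lemma Em_quasi_iso:
  fixes C D :: "('x, 'l, ('x, 'l, 'b) univ) cplx"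
  assumes C: "bounded_complex RK X C" and D: "bounded_complex RK X D" and f: "f \<in> quasi_isos RK X C D"
  shows "Em X C D f \<in> quasi_isos L X (ext_cplx L K X C) (ext_cplx L K X D)"
proof (rule quasi_isosI[OF ext_cplx_bounded[OF C] ext_cplx_bounded[OF D]])
  note f' = quasi_isosD[OF C D f] and Cc = bounded_cochain[OF C] and Dc = bounded_cochain[OF D]
  show "Em X C D f \<in> chain_map L X (ext_cplx L K X C) (ext_cplx L K X D)" by (rule Em_chain_map[OF Cc Dc f'(1)])
  interpret C: sheaf_complex RK X C by (rule bounded_sheaf_complex[OF C])
  interpret D: sheaf_complex RK X D by (rule bounded_sheaf_complex[OF D])
  interpret f: complex_map RK X C D f by unfold_locales (rule f')
  note S = C.ob_sheaf and T = D.ob_sheaf and fh = f.f_psheaf_hom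
  fix n
  show "local_quasi_iso X (ext_cplx L K X C) (ext_cplx L K X D) (Em X C D f) n"
    unfolding local_quasi_iso_def
  proof (intro allI impI, elim conjE, intro conjI ballI impI)
    fix U y z assume U: "openin X U" and y: "y \<in> U" and z: "z \<in> cycles (ext_cplx L K X C) n U"
      and fz: "Em X C D f n U z \<in> boundaries (ext_cplx L K X D) n U"
    have zc: "z \<in> carrier (sec (ext_sheaf L K X (ob C n)) U)" using z by (simp add: cycles_def ext_cplx_simps)
    have "\<exists>W. openin X W \<and> y \<in> W \<and> W \<subseteq> U \<and>
        (\<forall>i \<in> set I. rst (ob C n) U W (coordinate X (ob C n) U i z) \<in> boundaries C n W)"
    proof (rule common_neighbourhood[OF U y])
      fix i assume i: "i \<in> set I"
      have "f n U (coordinate X (ob C n) U i z) \<in> boundaries D n U"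
        by (rule ext_boundaries_coordinate[OF Dc U fz i, unfolded coordinate_em[OF S T fh U zc i]])
      then show "\<exists>W. openin X W \<and> y \<in> W \<and> W \<subseteq> U \<and> rst (ob C n) U W (coordinate X (ob C n) U i z) \<in> boundaries C n W"
        by (rule local_quasi_isoD(1)[OF f'(2) U y ext_cycles_coordinate[OF Cc U z i]])
      fix W W' assume W: "openin X W" "W \<subseteq> U" "rst (ob C n) U W (coordinate X (ob C n) U i z) \<in> boundaries C n W"
        and W': "openin X W'" "W' \<subseteq> W"
      show "rst (ob C n) U W' (coordinate X (ob C n) U i z) \<in> boundaries C n W'"
        using C.boundaries_rst[OF W(1) W' W(3)] C.ops.rst_rst[OF U W(1) W' W(2) coordinate_closed[OF S U zc i]] by simp
    qed
    then obtain W where W: "openin X W" "y \<in> W" "W \<subseteq> U"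
      and b: "\<forall>i \<in> set I. rst (ob C n) U W (coordinate X (ob C n) U i z) \<in> boundaries C n W" by blast
    have rz: "rst (ext_sheaf L K X (ob C n)) U W z \<in> carrier (sec (ext_sheaf L K X (ob C n)) W)"
      using operations_presheaf.rst_closed[OF presheaf_operations[OF sheaf_presheaf[OF ext_sheaf_sheaf[OF S]]] U W(1,3) zc] .
    have "rst (ext_sheaf L K X (ob C n)) U W z =
        tens X (ob C n) W (map (\<lambda>i. (x i, coordinate X (ob C n) W i (rst (ext_sheaf L K X (ob C n)) U W z))) I)"
      by (rule coordinate_expand[OF S W(1) rz])
    also have "\<dots> \<in> boundaries (ext_cplx L K X C) n W"
      using b coordinate_rst[OF S U W(1,3) zc] by (intro tens_boundaries[OF Cc W(1)]) simp
    finally show "\<exists>W. openin X W \<and> y \<in> W \<and> W \<subseteq> U \<and> rst (ob (ext_cplx L K X C) n) U W z \<in> boundaries (ext_cplx L K X C) n W"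
      using W unfolding ext_cplx_simps by blast
  next
    fix U y w assume U: "openin X U" and y: "y \<in> U" and w: "w \<in> cycles (ext_cplx L K X D) n U"
    have wc: "w \<in> carrier (sec (ext_sheaf L K X (ob D n)) U)" using w by (simp add: cycles_def ext_cplx_simps)
    have "\<exists>W. openin X W \<and> y \<in> W \<and> W \<subseteq> U \<and> (\<forall>i \<in> set I. \<exists>z b. z \<in> cycles C n W \<and> b \<in> boundaries D n W \<and>
        rst (ob D n) U W (coordinate X (ob D n) U i w) = b \<oplus>\<^bsub>sec (ob D n) W\<^esub> f n W z)"
    proof (rule common_neighbourhood[OF U y])
      fix i assume i: "i \<in> set I"
      note c = ext_cycles_coordinate[OF Dc U w i]
      show "\<exists>W. openin X W \<and> y \<in> W \<and> W \<subseteq> U \<and> (\<exists>z b. z \<in> cycles C n W \<and> b \<in> boundaries D n W \<and>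
          rst (ob D n) U W (coordinate X (ob D n) U i w) = b \<oplus>\<^bsub>sec (ob D n) W\<^esub> f n W z)"
        using local_quasi_isoD(2)[OF f'(2) U y c] by blast
      fix W W' assume W: "openin X W" "W \<subseteq> U" and W': "openin X W'" "W' \<subseteq> W"
        and "\<exists>z b. z \<in> cycles C n W \<and> b \<in> boundaries D n W \<and>
          rst (ob D n) U W (coordinate X (ob D n) U i w) = b \<oplus>\<^bsub>sec (ob D n) W\<^esub> f n W z"
      then obtain z b where z: "z \<in> cycles C n W" and b: "b \<in> boundaries D n W"
        and eq: "rst (ob D n) U W (coordinate X (ob D n) U i w) = b \<oplus>\<^bsub>sec (ob D n) W\<^esub> f n W z" by blast
      have "rst (ob D n) U W' (coordinate X (ob D n) U i w) =
          rst (ob D n) W W' b \<oplus>\<^bsub>sec (ob D n) W'\<^esub> f n W' (rst (ob C n) W W' z)"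
        using D.ops.rst_rst[OF U W(1) W' W(2) D.cycles_carrier[OF c], symmetric] eq
          D.ops.rst_add[OF W(1) W' D.boundaries_carrier[OF W(1) b] f.f_closed[OF W(1) C.cycles_carrier[OF z]]]
          f.f_rst[OF W(1) W' C.cycles_carrier[OF z]] by simp
      then show "\<exists>z b. z \<in> cycles C n W' \<and> b \<in> boundaries D n W' \<and>
          rst (ob D n) U W' (coordinate X (ob D n) U i w) = b \<oplus>\<^bsub>sec (ob D n) W'\<^esub> f n W' z"
        using C.cycles_rst[OF W(1) W' z] D.boundaries_rst[OF W(1) W' b] by blast
    qed
    then obtain W where W: "openin X W" "y \<in> W" "W \<subseteq> U" and "\<forall>i \<in> set I. \<exists>zb. fst zb \<in> cycles C n W \<and> snd zb \<in> boundaries D n W \<and>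
        rst (ob D n) U W (coordinate X (ob D n) U i w) = snd zb \<oplus>\<^bsub>sec (ob D n) W\<^esub> f n W (fst zb)" by auto
    from bchoice[OF this(4)] obtain zb where zb: "\<forall>i \<in> set I. fst (zb i) \<in> cycles C n W \<and> snd (zb i) \<in> boundaries D n W \<and>
        rst (ob D n) U W (coordinate X (ob D n) U i w) = snd (zb i) \<oplus>\<^bsub>sec (ob D n) W\<^esub> f n W (fst (zb i))" by blast
    let ?z = "map (\<lambda>i. (x i, fst (zb i))) I" and ?b = "map (\<lambda>i. (x i, snd (zb i))) I"
    let ?fz = "map (\<lambda>i. (x i, f n W (fst (zb i)))) I"
    have zc: "fst (zb i) \<in> carrier (sec (ob C n) W)" and bc: "snd (zb i) \<in> carrier (sec (ob D n) W)"
      and fc: "f n W (fst (zb i)) \<in> carrier (sec (ob D n) W)" if "i \<in> set I" for i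
      using zb that C.cycles_carrier D.boundaries_carrier[OF W(1)] f.f_closed[OF W(1)] by blast+
    have rw: "rst (ext_sheaf L K X (ob D n)) U W w \<in> carrier (sec (ext_sheaf L K X (ob D n)) W)"
      using operations_presheaf.rst_closed[OF presheaf_operations[OF sheaf_presheaf[OF ext_sheaf_sheaf[OF T]]] U W(1,3) wc] .
    have wf: "?b \<in> formal_sums L (sec (ob D n) W)" "?fz \<in> formal_sums L (sec (ob D n) W)" "?z \<in> formal_sums L (sec (ob C n) W)"
      using x_closed bc fc zc by auto
    have merge: "tensor_eq L K (sec (ob D n) W) (?b @ ?fz) (map (\<lambda>i. (x i, snd (zb i) \<oplus>\<^bsub>sec (ob D n) W\<^esub> f n W (fst (zb i)))) I)"
      by (intro tensor_eq_merge[OF sec_mod[OF T W(1)]] x_closed bc fc)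
    have e: "map (\<lambda>i. (x i, coordinate X (ob D n) W i (rst (ext_sheaf L K X (ob D n)) U W w))) I =
        map (\<lambda>i. (x i, snd (zb i) \<oplus>\<^bsub>sec (ob D n) W\<^esub> f n W (fst (zb i)))) I"
      using zb coordinate_rst[OF T U W(1,3) wc] by simp
    have "rst (ext_sheaf L K X (ob D n)) U W w =
        tens X (ob D n) W (map (\<lambda>i. (x i, snd (zb i) \<oplus>\<^bsub>sec (ob D n) W\<^esub> f n W (fst (zb i)))) I)"
      using coordinate_expand[OF T W(1) rw] unfolding e .
    also have "\<dots> = tens X (ob D n) W (?b @ ?fz)"
      by (rule tens_eq_iff_tensor_eq[OF T W(1) tensor_eq_formal_sums[OF sec_mod[OF T W(1)] merge, THEN conjunct2]
            tensor_eq_formal_sums[OF sec_mod[OF T W(1)] merge, THEN conjunct1], THEN iffD2, OF tensor_eq.sym[OF merge]])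
    also have "\<dots> = tens X (ob D n) W ?b \<oplus>\<^bsub>sec (ext_sheaf L K X (ob D n)) W\<^esub> tens X (ob D n) W ?fz"
      by (rule tens_add[OF T W(1) wf(1,2), symmetric])
    also have "tens X (ob D n) W ?fz = Em X C D f n W (tens X (ob C n) W ?z)"
      unfolding em_tens[OF S T fh W(1) wf(3)] by (simp add: comp_def)
    finally have eq: "rst (ext_sheaf L K X (ob D n)) U W w = tens X (ob D n) W ?b
        \<oplus>\<^bsub>sec (ext_sheaf L K X (ob D n)) W\<^esub> Em X C D f n W (tens X (ob C n) W ?z)" .
    have "tens X (ob C n) W ?z \<in> cycles (ext_cplx L K X C) n W"
      using zb by (intro tens_cycles[OF Cc W(1)]) blast
    moreover have "tens X (ob D n) W ?b \<in> boundaries (ext_cplx L K X D) n W"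
      using zb by (intro tens_boundaries[OF Dc W(1)]) blast
    ultimately show "\<exists>W z b. openin X W \<and> y \<in> W \<and> W \<subseteq> U \<and> z \<in> cycles (ext_cplx L K X C) n W \<and>
        b \<in> boundaries (ext_cplx L K X D) n W \<and>
        rst (ob (ext_cplx L K X D) n) U W w = b \<oplus>\<^bsub>sec (ob (ext_cplx L K X D) n) W\<^esub> Em X C D f n W z"
      using W eq unfolding ext_cplx_simps by blast
  qed
qed

lemma ext_functor:
  fixes X :: "'x topology"
  shows "localizing_functor (Cb RK X :: (('x, 'l, ('x, 'l, 'b) univ) cplx, _) cat) (quasi_isos RK X)
    (Cb L X) (quasi_isos L X) (ext_cplx L K X) (\<lambda>C D f. Em X C D f)"
proof (intro localizing_functor.intro localizing_functor_axioms.intro Cb_localizing;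
    (unfold Cb_simps(1,2) mem_Collect_eq)?)
  show "is_functor (Cb RK X :: (('x, 'l, ('x, 'l, 'b) univ) cplx, _) cat) (Cb L X) (ext_cplx L K X) (\<lambda>C D f. Em X C D f)"
    unfolding is_functor_def Cb_simps(1,2) mem_Collect_eq
  proof (intro conjI ballI)
    fix C :: "('x, 'l, ('x, 'l, 'b) univ) cplx" assume "C \<in> {C. bounded_complex RK X C}"
    then have C: "bounded_complex RK X C" by simp
    interpret C: sheaf_complex RK X C by (rule bounded_sheaf_complex[OF C])
    note Cc = bounded_cochain[OF C]
    show "bounded_complex L X (ext_cplx L K X C)" by (rule ext_cplx_bounded[OF C])
    have idc: "Idt (Cb RK X) C \<in> chain_map RK X C C" by (rule Idt_chain_map[OF Cc])
    show "Em X C C (Idt (Cb RK X) C) = Idt (Cb L X) (ext_cplx L K X C)"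
    proof (rule chain_map_eqI[OF Em_chain_map[OF Cc Cc idc] Idt_chain_map[OF ext_cplx_cochain[OF Cc]]])
      fix n U a assume U: "openin X U" and "a \<in> carrier (sec (ob (ext_cplx L K X C) n) U)"
      then have a: "a \<in> carrier (sec (ext_sheaf L K X (ob C n)) U)" by (simp add: ext_cplx_simps)
      have "em X (ob C n) (ob C n) (Idt (Cb RK X) C n) U a = a"
      proof (rule coordinate_eqI[OF C.ob_sheaf U em_closed[OF C.ob_sheaf C.ob_sheaf chain_mapD(1)[OF idc] U a] a])
        fix i assume i: "i \<in> set I"
        show "coordinate X (ob C n) U i (em X (ob C n) (ob C n) (Idt (Cb RK X) C n) U a) = coordinate X (ob C n) U i a"
          using coordinate_em[OF C.ob_sheaf C.ob_sheaf chain_mapD(1)[OF idc] U a i]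
            Idt_apply[OF U coordinate_closed[OF C.ob_sheaf U a i]] by simp
      qed
      then show "em X (ob C n) (ob C n) (Idt (Cb RK X) C n) U a = Idt (Cb L X) (ext_cplx L K X C) n U a"
        using Idt_apply[OF U, of a "ext_cplx L K X C" n L] a by (simp add: ext_cplx_simps)
    qed
    fix D :: "('x, 'l, ('x, 'l, 'b) univ) cplx" and f
    assume "D \<in> {C. bounded_complex RK X C}" and f: "f \<in> chain_map RK X C D"
    then have D: "bounded_complex RK X D" by simp
    interpret D: sheaf_complex RK X D by (rule bounded_sheaf_complex[OF D])
    note Dc = bounded_cochain[OF D]
    show "Em X C D f \<in> chain_map L X (ext_cplx L K X C) (ext_cplx L K X D)" by (rule Em_chain_map[OF Cc Dc f])
    fix E :: "('x, 'l, ('x, 'l, 'b) univ) cplx" and g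
    assume "E \<in> {C. bounded_complex RK X C}" and g: "g \<in> chain_map RK X D E"
    then have E: "bounded_complex RK X E" by simp
    interpret E: sheaf_complex RK X E by (rule bounded_sheaf_complex[OF E])
    note Ec = bounded_cochain[OF E]
    note gf = Cmp_chain_map[OF Cc f g]
    note Ef = Em_chain_map[OF Cc Dc f] and Eg = Em_chain_map[OF Dc Ec g]
    show "Em X C E (Cmp (Cb RK X) C D E g f) =
        Cmp (Cb L X) (ext_cplx L K X C) (ext_cplx L K X D) (ext_cplx L K X E) (Em X D E g) (Em X C D f)"
    proof (rule chain_map_eqI[OF Em_chain_map[OF Cc Ec gf] Cmp_chain_map[OF ext_cplx_cochain[OF Cc] Ef Eg]])
      fix n U a assume U: "openin X U" and a': "a \<in> carrier (sec (ob (ext_cplx L K X C) n) U)"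
      then have a: "a \<in> carrier (sec (ext_sheaf L K X (ob C n)) U)" by (simp add: ext_cplx_simps)
      note fa = em_closed[OF C.ob_sheaf D.ob_sheaf chain_mapD(1)[OF f] U a]
      have "em X (ob C n) (ob E n) (Cmp (Cb RK X) C D E g f n) U a =
          em X (ob D n) (ob E n) (g n) U (em X (ob C n) (ob D n) (f n) U a)"
      proof (rule coordinate_eqI[OF E.ob_sheaf U em_closed[OF C.ob_sheaf E.ob_sheaf chain_mapD(1)[OF gf] U a]
            em_closed[OF D.ob_sheaf E.ob_sheaf chain_mapD(1)[OF g] U fa]])
        fix i assume i: "i \<in> set I"
        show "coordinate X (ob E n) U i (em X (ob C n) (ob E n) (Cmp (Cb RK X) C D E g f n) U a) =
            coordinate X (ob E n) U i (em X (ob D n) (ob E n) (g n) U (em X (ob C n) (ob D n) (f n) U a))"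
          using coordinate_em[OF C.ob_sheaf E.ob_sheaf chain_mapD(1)[OF gf] U a i]
            coordinate_em[OF D.ob_sheaf E.ob_sheaf chain_mapD(1)[OF g] U fa i]
            coordinate_em[OF C.ob_sheaf D.ob_sheaf chain_mapD(1)[OF f] U a i]
            Cmp_apply[OF U coordinate_closed[OF C.ob_sheaf U a i]] by simp
      qed
      then show "em X (ob C n) (ob E n) (Cmp (Cb RK X) C D E g f n) U a =
          Cmp (Cb L X) (ext_cplx L K X C) (ext_cplx L K X D) (ext_cplx L K X E) (Em X D E g) (Em X C D f) n U a"
        using Cmp_apply[OF U a'] by simp
    qed
  qed
qed (rule Em_quasi_iso)

end


section \<open>The Galois action\<close>

lemma map_map_zstep: "map (map_zstep So Sm) (map (map_zstep To Tm) p) =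
    map (map_zstep (\<lambda>a. So (To a)) (\<lambda>a b f. Sm (To a) (To b) (Tm a b f))) p"
proof -
  have "map_zstep So Sm (map_zstep To Tm s) = map_zstep (\<lambda>a. So (To a)) (\<lambda>a b f. Sm (To a) (To b) (Tm a b f)) s" for s
    by (cases s) simp_all
  then show ?thesis by simp
qed

lemma (in localizing) is_iso_loc_arrow:
  assumes ob: "a \<in> Ob C" "b \<in> Ob C" and f: "f \<in> Hom C a b" and g: "g \<in> Hom C b a"
    and gf: "Cmp C a b a g f = Idt C a" and fg: "Cmp C b a b f g = Idt C b"
  shows "is_iso (localization C W) a b (loc_arrow C W a b f)"
proof -
  note zf = zigzag_Fwd[OF ob f] and zg = zigzag_Fwd[OF ob(2,1) g]
  have 1: "zigzag_eq C W a a ([Fwd a f b] @ [Fwd b g a]) []"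
    using zigzag_eq.trans[OF zigzag_eq_Cmp[OF ob ob(1) f g, unfolded gf] zigzag_eq_Idt[OF ob(1)]] by simp
  have 2: "zigzag_eq C W b b ([Fwd b g a] @ [Fwd a f b]) []"
    using zigzag_eq.trans[OF zigzag_eq_Cmp[OF ob(2,1,2) g f, unfolded fg] zigzag_eq_Idt[OF ob(2)]] by simp
  note e = zigzag_class_eq_iff[OF zigzag_append[OF zf zg], THEN iffD2, OF 1]
    zigzag_class_eq_iff[OF zigzag_append[OF zg zf], THEN iffD2, OF 2]
  show ?thesis unfolding is_iso_def loc_arrow_def
  proof (rule conjI, goal_cases)
    case 1
    show ?case using zf by (auto simp: localization_def)
  next
    case 2
    have "zigzag_class C W b a [Fwd b g a] \<in> Hom (localization C W) b a"
      using zg by (auto simp: localization_def)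
    moreover have "Cmp (localization C W) a b a (zigzag_class C W b a [Fwd b g a]) (zigzag_class C W a b [Fwd a f b]) =
        Idt (localization C W) a"
      unfolding Cmp_localization[OF zf zg] e by (simp add: localization_def)
    moreover have "Cmp (localization C W) b a b (zigzag_class C W a b [Fwd a f b]) (zigzag_class C W b a [Fwd b g a]) =
        Idt (localization C W) b"
      unfolding Cmp_localization[OF zg zf] e by (simp add: localization_def)
    ultimately show ?case by blast
  qed
qed

lemma conj_cycles: "cycles (conj_cplx g C) n = cycles C n" "boundaries (conj_cplx g C) n = boundaries C n"
  by (rule ext, simp add: cycles_def boundaries_def conj_cplx_simps conj_sheaf_simps)+

lemma (in frame) tensor_lift_mod_hom:
  assumes W: "module R W" and W': "module R W'" and f: "f \<in> mod_hom R W W'" and B: "balanced L K V W B"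
    and ts: "ts \<in> formal_sums L V"
  shows "f (tensor_lift W B ts) = tensor_lift W' (\<lambda>a v. f (B a v)) ts"
  unfolding tensor_lift_def
  using ts balancedD(1)[OF B] by (intro mod_hom_lsum[OF W W' f]) auto

lemma lsum_conj: "lsum (sec (conj_sheaf g F) U) f is = lsum (sec F U) f is"
  by (induction "is") (simp_all add: conj_sheaf_simps)

lemma balanced_conj: "balanced L K V (sec (conj_sheaf g F) U) B = balanced L K V (sec F U) B"
  by (simp add: balanced_def conj_sheaf_simps)

context galois_extension
begin

lemma G_linear: "g \<in> G \<Longrightarrow> linear_on_L g"
  unfolding linear_on_L_def by (auto simp: G_closed G_add G_mult G_fix K_carrier)

lemma conj_sheaf_sheaf:
  assumes g: "g \<in> G" and F: "sheaf L X F"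
  shows "sheaf L X (conj_sheaf g F)"
proof -
  note P = sheaf_presheaf[OF F]
  have m: "module L (sec (conj_sheaf g F) U)" if U: "openin X U" for U
  proof -
    interpret V: module L "sec F U" by (rule presheaf_module[OF P U])
    have "abelian_group (sec (conj_sheaf g F) U)"
      using V.abelian_group_axioms
      unfolding conj_sheaf_def abelian_group_def abelian_monoid_def abelian_group_axioms_def by simp
    then show ?thesis
      by (intro module.intro module_axioms.intro L.is_cring)
        (simp_all add: conj_sheaf_simps g G_closed V.smult_l_distr V.smult_r_distr V.smult_assoc1 G_add G_mult G_one)
  qed
  have "presheaf L X (conj_sheaf g F)"
    using P unfolding presheaf_def mod_hom_def by (simp add: m conj_sheaf_simps G_closed[OF g])
  then show ?thesis
    using F[unfolded sheaf_def, THEN conjunct2] unfolding sheaf_def by (simp add: conj_sheaf_simps)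
qed

lemma conj_psheaf_hom: "\<lbrakk>g \<in> G; f \<in> psheaf_hom L X F F'\<rbrakk> \<Longrightarrow> f \<in> psheaf_hom L X (conj_sheaf g F) (conj_sheaf g F')"
  unfolding psheaf_hom_def mod_hom_def ext_mor_def by (simp add: conj_sheaf_simps G_closed)

lemma conj_chain_map: "\<lbrakk>g \<in> G; f \<in> chain_map L X C D\<rbrakk> \<Longrightarrow> f \<in> chain_map L X (conj_cplx g C) (conj_cplx g D)"
  unfolding chain_map_def by (simp add: conj_cplx_simps conj_sheaf_simps conj_psheaf_hom)

lemma conj_cochain: "\<lbrakk>g \<in> G; cochain_complex L X C\<rbrakk> \<Longrightarrow> cochain_complex L X (conj_cplx g C)"
  unfolding cochain_complex_def
  by (simp add: conj_cplx_simps conj_sheaf_simps conj_psheaf_hom conj_sheaf_sheaf)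

lemma conj_bounded: "\<lbrakk>g \<in> G; bounded_complex L X C\<rbrakk> \<Longrightarrow> bounded_complex L X (conj_cplx g C)"
  unfolding bounded_complex_def zero_sheaf_p_def by (simp add: conj_cplx_simps conj_sheaf_simps conj_cochain)

lemma conj_quasi_iso:
  assumes g: "g \<in> G" and C: "bounded_complex L X C" and D: "bounded_complex L X D" and f: "f \<in> quasi_isos L X C D"
  shows "f \<in> quasi_isos L X (conj_cplx g C) (conj_cplx g D)"
proof (rule quasi_isosI[OF conj_bounded[OF g C] conj_bounded[OF g D] conj_chain_map[OF g quasi_isosD(1)[OF C D f]]])
  show "local_quasi_iso X (conj_cplx g C) (conj_cplx g D) f n" for n
    using quasi_isosD(2)[OF C D f, of n] by (simp add: local_quasi_iso_def conj_cplx_simps conj_sheaf_simps conj_cycles)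
qed

lemma conj_functor:
  assumes g: "g \<in> G"
  shows "localizing_functor (Cb L X) (quasi_isos L X) (Cb L X) (quasi_isos L X) (conj_cplx g) (\<lambda>C D f. f)"
proof (intro localizing_functor.intro localizing_functor_axioms.intro Cb_localizing;
    (unfold Cb_simps(1,2) mem_Collect_eq)?)
  show "is_functor (Cb L X) (Cb L X) (conj_cplx g) (\<lambda>C D f. f)"
    unfolding is_functor_def Cb_simps(1,2)
    by (auto simp: Cb_def Shv_def conj_cplx_simps ext_mor_def conj_sheaf_simps conj_bounded[OF g] conj_chain_map[OF g])
qed (rule conj_quasi_iso[OF g])

text \<open>The unit \<open>v \<mapsto> 1 \<otimes> v\<close> of the adjunction between extension and restriction of scalars.\<close>

definition unit_mor where
  "unit_mor X F = ext_mor X F (\<lambda>U v. tens X F U [(\<one>\<^bsub>L\<^esub>, v)])"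

definition trace_mor where
  "trace_mor c X F = ext_lift X F F (\<lambda>U a v. Tr (c \<otimes>\<^bsub>L\<^esub> a) \<odot>\<^bsub>sec F U\<^esub> v)"

text \<open>For \<open>g = 1\<close> this is the multiplication \<open>L \<otimes>\<^sub>K F \<rightarrow> F\<close>; in general it is the component at \<open>g\<close> of the
  isomorphism of \<open>L \<otimes>\<^sub>K F\<close> with the sum of the conjugates of \<open>F\<close>.\<close>

definition act_mor where
  "act_mor g X F = ext_lift X F (conj_sheaf g F) (\<lambda>U a v. g a \<odot>\<^bsub>sec F U\<^esub> v)"

text \<open>The inclusion of the conjugate by \<open>g\<close> as a summand of \<open>L \<otimes>\<^sub>K F\<close>, that is, the action on \<open>1 \<otimes> v\<close> of
  the idempotent \<open>\<Sum> x \<otimes> g(y)\<close>.\<close>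

definition coact_mor where
  "coact_mor g X F = ext_mor X F (\<lambda>U v. tens X F U (map (\<lambda>p. (fst p, g (snd p) \<odot>\<^bsub>sec F U\<^esub> v)) ps))"

text \<open>The component \<open>g \<otimes> id\<close> of the natural \<open>G\<close>-structure.\<close>

definition twist_mor where
  "twist_mor g X F = ext_mor_tensor L K X g F F (\<lambda>U s. s)"

context
  fixes X :: "'x topology" and F :: "('x, 'l, ('x, 'l, 'b) univ) psheaf"
  assumes F: "sheaf RK X F"
begin

interpretation F: operations_presheaf RK X F by (rule presheaf_operations[OF sheaf_presheaf[OF F]])

lemma unit_apply: "\<lbrakk>openin X U; v \<in> carrier (sec F U)\<rbrakk> \<Longrightarrow> unit_mor X F U v = tens X F U [(\<one>\<^bsub>L\<^esub>, v)]"
  by (simp add: unit_mor_def ext_mor_apply)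

lemma unit_psheaf_hom: "unit_mor X F \<in> psheaf_hom RK X F (ext_sheaf L K X F)"
proof -
  have "ext_mor X F (\<lambda>U v. tens X F U (map (\<lambda>j. (\<one>\<^bsub>L\<^esub>, v)) [()])) \<in> psheaf_hom RK X F (ext_sheaf L K X F)"
  proof (rule ext_into_hom[where J = "[()]" and y = "\<lambda>_. \<one>\<^bsub>L\<^esub>" and c = "\<lambda>U j v. v", OF F F])
    fix U k v assume U: "openin X U" and k: "k \<in> carrier RK" and v: "v \<in> carrier (sec F U)"
    then have k: "k \<in> K" by simp
    have "tensor_eq L K (sec F U) [(\<one>\<^bsub>L\<^esub>, k \<odot>\<^bsub>sec F U\<^esub> v)] [(k \<otimes>\<^bsub>L\<^esub> \<one>\<^bsub>L\<^esub>, v)]"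
      using tensor_eq.sym[OF tensor_eq.scal[OF L.one_closed k v]] K_carrier[OF k] by simp
    then show "tens X F U (map (\<lambda>j. (\<one>\<^bsub>L\<^esub>, k \<odot>\<^bsub>sec F U\<^esub> v)) [()]) = tens X F U (map (\<lambda>j. (k \<otimes>\<^bsub>L\<^esub> \<one>\<^bsub>L\<^esub>, v)) [()])"
      using tens_eq_iff_tensor_eq[OF F U, of "[(\<one>\<^bsub>L\<^esub>, k \<odot>\<^bsub>sec F U\<^esub> v)]" "[(k \<otimes>\<^bsub>L\<^esub> \<one>\<^bsub>L\<^esub>, v)]"]
        F.smult_closed[OF U _ v, of k] k v K_carrier[OF k] by simp
  qed (auto simp: K_carrier)
  then show ?thesis by (simp add: unit_mor_def)
qed

lemma unit_closed: "\<lbrakk>openin X U; v \<in> carrier (sec F U)\<rbrakk> \<Longrightarrow> unit_mor X F U v \<in> carrier (sec (ext_sheaf L K X F) U)"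
  using mod_homD(1)[OF psheaf_homD(1)[OF unit_psheaf_hom]] .

lemma balanced_trace:
  assumes c: "c \<in> carrier L" and U: "openin X U"
  shows "balanced L K (sec F U) (sec F U) (\<lambda>a v. Tr (c \<otimes>\<^bsub>L\<^esub> a) \<odot>\<^bsub>sec F U\<^esub> v)"
proof -
  interpret V: module RK "sec F U" by (rule sec_mod[OF F U])
  have t: "Tr (c \<otimes>\<^bsub>L\<^esub> a) \<in> K" if "a \<in> carrier L" for a using that c by (intro Tr_K) simp
  show ?thesis
  proof (rule balancedI)
    fix a b v assume a: "a \<in> carrier L" and b: "b \<in> carrier L" and v: "v \<in> carrier (sec F U)"
    show "Tr (c \<otimes>\<^bsub>L\<^esub> (a \<oplus>\<^bsub>L\<^esub> b)) \<odot>\<^bsub>sec F U\<^esub> v =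
        Tr (c \<otimes>\<^bsub>L\<^esub> a) \<odot>\<^bsub>sec F U\<^esub> v \<oplus>\<^bsub>sec F U\<^esub> Tr (c \<otimes>\<^bsub>L\<^esub> b) \<odot>\<^bsub>sec F U\<^esub> v"
      using V.smult_l_distr[of "Tr (c \<otimes>\<^bsub>L\<^esub> a)" "Tr (c \<otimes>\<^bsub>L\<^esub> b)" v] t a b v c by (simp add: L.r_distr Tr_add)
  next
    fix a k v assume a: "a \<in> carrier L" and k: "k \<in> K" and v: "v \<in> carrier (sec F U)"
    show "Tr (c \<otimes>\<^bsub>L\<^esub> (a \<otimes>\<^bsub>L\<^esub> k)) \<odot>\<^bsub>sec F U\<^esub> v = Tr (c \<otimes>\<^bsub>L\<^esub> a) \<odot>\<^bsub>sec F U\<^esub> (k \<odot>\<^bsub>sec F U\<^esub> v)"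
      using V.smult_assoc1[of "Tr (c \<otimes>\<^bsub>L\<^esub> a)" k v] Tr_scal[of "c \<otimes>\<^bsub>L\<^esub> a" k] t[OF a] a k v c K_carrier[OF k]
      by (simp add: L.m_assoc)
  qed (use t V.smult_closed V.smult_r_distr in simp_all)
qed

lemma trace_tens:
  assumes c: "c \<in> carrier L" and U: "openin X U" and ts: "ts \<in> formal_sums L (sec F U)"
  shows "trace_mor c X F U (tens X F U ts) = tensor_lift (sec F U) (\<lambda>a v. Tr (c \<otimes>\<^bsub>L\<^esub> a) \<odot>\<^bsub>sec F U\<^esub> v) ts"
  unfolding trace_mor_def
  by (rule ext_lift_tens[where H = F and B = "\<lambda>U a v. Tr (c \<otimes>\<^bsub>L\<^esub> a) \<odot>\<^bsub>sec F U\<^esub> v",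
        OF F U ts module.axioms(2)[OF sec_mod[OF F U]] balanced_trace[OF c U]])

lemma trace_psheaf_hom:
  assumes c: "c \<in> carrier L"
  shows "trace_mor c X F \<in> psheaf_hom RK X (ext_sheaf L K X F) F"
  unfolding trace_mor_def
proof (rule ext_lift_hom[OF F F])
  show "carrier RK \<subseteq> carrier L" using K_carrier by auto
  have t: "Tr (c \<otimes>\<^bsub>L\<^esub> a) \<in> K" if "a \<in> carrier L" for a using that c by (intro Tr_K) simp
  show "balanced L K (sec F U) (sec F U) (\<lambda>a v. Tr (c \<otimes>\<^bsub>L\<^esub> a) \<odot>\<^bsub>sec F U\<^esub> v)" if "openin X U" for U
    by (rule balanced_trace[OF c that])
  show "rst F U V (Tr (c \<otimes>\<^bsub>L\<^esub> a) \<odot>\<^bsub>sec F U\<^esub> v) = Tr (c \<otimes>\<^bsub>L\<^esub> a) \<odot>\<^bsub>sec F V\<^esub> rst F U V v"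
    if "openin X U" "openin X V" "V \<subseteq> U" "a \<in> carrier L" "v \<in> carrier (sec F U)" for U V a v
    using mod_homD(3)[OF F.rst_hom[OF that(1-3)] _ that(5), of "Tr (c \<otimes>\<^bsub>L\<^esub> a)"] t[OF that(4)] by simp
  fix U k a v assume U: "openin X U" and k: "k \<in> carrier RK" and a: "a \<in> carrier L" and v: "v \<in> carrier (sec F U)"
  interpret V: module RK "sec F U" by (rule sec_mod[OF F U])
  have k: "k \<in> K" using k by simp
  have "c \<otimes>\<^bsub>L\<^esub> (k \<otimes>\<^bsub>L\<^esub> a) = (c \<otimes>\<^bsub>L\<^esub> a) \<otimes>\<^bsub>L\<^esub> k" using a c K_carrier[OF k] by (simp add: L.m_ac)
  then have "Tr (c \<otimes>\<^bsub>L\<^esub> (k \<otimes>\<^bsub>L\<^esub> a)) = k \<otimes>\<^bsub>L\<^esub> Tr (c \<otimes>\<^bsub>L\<^esub> a)"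
    using Tr_scal[of "c \<otimes>\<^bsub>L\<^esub> a" k] a c k K_carrier[OF k] Tr_closed[of "c \<otimes>\<^bsub>L\<^esub> a"] by (simp add: L.m_comm)
  then show "Tr (c \<otimes>\<^bsub>L\<^esub> (k \<otimes>\<^bsub>L\<^esub> a)) \<odot>\<^bsub>sec F U\<^esub> v = k \<odot>\<^bsub>sec F U\<^esub> (Tr (c \<otimes>\<^bsub>L\<^esub> a) \<odot>\<^bsub>sec F U\<^esub> v)"
    using V.smult_assoc1[of k "Tr (c \<otimes>\<^bsub>L\<^esub> a)" v] k t[OF a] v by simp
qed

text \<open>An element of trace \<open>1\<close> gives a \<open>K\<close>-linear retraction of \<open>v \<mapsto> 1 \<otimes> v\<close>.\<close>

lemma trace_unit:
  assumes c: "c \<in> carrier L" "Tr c = \<one>\<^bsub>L\<^esub>" and U: "openin X U" and v: "v \<in> carrier (sec F U)"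
  shows "trace_mor c X F U (unit_mor X F U v) = v"
proof -
  interpret V: module RK "sec F U" by (rule sec_mod[OF F U])
  show ?thesis
    using trace_tens[OF c(1) U, of "[(\<one>\<^bsub>L\<^esub>, v)]"] unit_apply[OF U v] c v V.smult_one[OF v] by simp
qed

lemma twist_psheaf_hom:
  assumes g: "g \<in> G"
  shows "twist_mor g X F \<in> psheaf_hom L X (ext_sheaf L K X F) (conj_sheaf g (ext_sheaf L K X F))"
proof -
  have "ext_mor X F (\<lambda>U s. s) \<in> psheaf_hom RK X F F"
    by (rule psheaf_homI[OF sheaf_presheaf[OF F] mod_hom_id]) simp
  from ext_mor_tensor_psheaf_hom[OF F F this G_linear[OF g] G_mult[OF g]]
  have h: "ext_mor_tensor L K X g F F (ext_mor X F (\<lambda>U s. s)) \<in>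
    psheaf_hom L X (ext_sheaf L K X F) (conj_sheaf g (ext_sheaf L K X F))" by simp
  have "ext_mor_tensor L K X g F F (ext_mor X F (\<lambda>U s. s)) = ext_mor X (ext_sheaf L K X F) (ext_mor_tensor L K X g F F (ext_mor X F (\<lambda>U s. s)))"
    by (simp add: ext_mor_tensor_def ext_mor_idem)
  also have "\<dots> = ext_mor X (ext_sheaf L K X F) (twist_mor g X F)"
  proof (unfold ext_mor_def[of X "ext_sheaf L K X F"], intro restrict_ext, simp only: mem_Collect_eq)
    fix U a assume U: "openin X U" and "a \<in> carrier (sec (ext_sheaf L K X F) U)"
    then obtain ts where ts: "ts \<in> formal_sums L (sec F U)" "a = tens X F U ts"
      unfolding tens_carrier[OF F U] by blast
    have m1: "map (map_prod g (ext_mor X F (\<lambda>U s. s) U)) ts = map (map_prod g (\<lambda>s. s)) ts"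
      using ts(1) U by (intro map_cong[OF HOL.refl]) (auto simp: ext_mor_apply)
    have m2: "ext_mor_tensor L K X g F F (ext_mor X F (\<lambda>U s. s)) U (tens X F U ts) =
        tens X F U (map (map_prod g (ext_mor X F (\<lambda>U s. s) U)) ts)"
      using \<open>ext_mor X F (\<lambda>U s. s) \<in> psheaf_hom RK X F F\<close>
      by (intro ext_mor_tensor_tens[where f = "ext_mor X F (\<lambda>U s. s)", OF F F G_linear[OF g] _ _ U ts(1)] psheaf_homD(1,2))
    have m3: "twist_mor g X F U (tens X F U ts) = tens X F U (map (map_prod g (\<lambda>s. s)) ts)"
      unfolding twist_mor_def
      by (rule ext_mor_tensor_tens[where f = "\<lambda>U s. s", OF F F G_linear[OF g] mod_hom_id _ U ts(1)]) simp
    show "ext_mor_tensor L K X g F F (ext_mor X F (\<lambda>U s. s)) U a = twist_mor g X F U a"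
      unfolding ts(2) m2 m3 m1 ..
  qed
  also have "\<dots> = twist_mor g X F" by (simp add: twist_mor_def ext_mor_tensor_def ext_mor_idem)
  finally show ?thesis using h by simp
qed

lemma twist_tens:
  assumes g: "g \<in> G" and U: "openin X U" and ts: "ts \<in> formal_sums L (sec F U)"
  shows "twist_mor g X F U (tens X F U ts) = tens X F U (map (map_prod g id) ts)"
  unfolding twist_mor_def id_def
  by (rule ext_mor_tensor_tens[where f = "\<lambda>U s. s", OF F F G_linear[OF g] mod_hom_id _ U ts]) simp

lemma map_twist_formal_sums:
  assumes "g \<in> G" "ts \<in> formal_sums L (sec F U)"
  shows "map (map_prod g id) ts \<in> formal_sums L (sec F U)"
  using assms G_closed by (auto simp: subset_iff)

lemma lsum_tens_single:
  assumes U: "openin X U" and ts: "ts \<in> formal_sums L (sec F U)"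
  shows "lsum (sec (ext_sheaf L K X F) U) (\<lambda>p. tens X F U [p]) ts = tens X F U ts"
  using ts
proof (induction ts)
  case Nil
  then show ?case using tens_zero[OF F U] by simp
next
  case (Cons p ts)
  then show ?case using tens_add[OF F U, of "[p]" ts] by simp
qed

lemma unit_natural:
  assumes F': "sheaf RK X F'" and f: "f \<in> psheaf_hom RK X F F'" and U: "openin X U" and v: "v \<in> carrier (sec F U)"
  shows "em X F F' f U (unit_mor X F U v) = unit_mor X F' U (f U v)"
  using em_tens[OF F F' f U, of "[(\<one>\<^bsub>L\<^esub>, v)]"] unit_apply[OF U v] v U
    mod_homD(1)[OF psheaf_homD(1)[OF f U] v] by (simp add: unit_mor_def ext_mor_apply)

lemma trace_natural:
  assumes c: "c \<in> carrier L" and F': "sheaf RK X F'" and f: "f \<in> psheaf_hom RK X F F'" and U: "openin X U"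
    and a: "a \<in> carrier (sec (ext_sheaf L K X F) U)"
    and trace_tens': "\<And>ts. ts \<in> formal_sums L (sec F' U) \<Longrightarrow> trace_mor c X F' U (tens X F' U ts) =
      tensor_lift (sec F' U) (\<lambda>a v. Tr (c \<otimes>\<^bsub>L\<^esub> a) \<odot>\<^bsub>sec F' U\<^esub> v) ts"
  shows "f U (trace_mor c X F U a) = trace_mor c X F' U (em X F F' f U a)"
proof -
  obtain ts where ts: "ts \<in> formal_sums L (sec F U)" "a = tens X F U ts"
    using a unfolding tens_carrier[OF F U] by blast
  have fh: "f U \<in> mod_hom RK (sec F U) (sec F' U)" by (rule psheaf_homD(1)[OF f U])
  have w: "map (map_prod id (f U)) ts \<in> formal_sums L (sec F' U)"
    using map_prod_formal_sums[OF linear_on_L_id _ ts(1)] mod_homD(1)[OF fh] by blast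
  have "f U (trace_mor c X F U a) = tensor_lift (sec F' U) (\<lambda>a v. f U (Tr (c \<otimes>\<^bsub>L\<^esub> a) \<odot>\<^bsub>sec F U\<^esub> v)) ts"
    unfolding ts(2) trace_tens[OF c U ts(1)]
    by (rule tensor_lift_mod_hom[OF sec_mod[OF F U] sec_mod[OF F' U] fh balanced_trace[OF c U] ts(1)])
  also have "\<dots> = tensor_lift (sec F' U) (\<lambda>a v. Tr (c \<otimes>\<^bsub>L\<^esub> id a) \<odot>\<^bsub>sec F' U\<^esub> f U v) ts"
  proof (rule tensor_lift_cong[OF sec_mod[OF F U] _ ts(1)])
    fix a v assume "a \<in> carrier L" and v: "v \<in> carrier (sec F U)"
    then have "Tr (c \<otimes>\<^bsub>L\<^esub> a) \<in> carrier RK" using Tr_K[of "c \<otimes>\<^bsub>L\<^esub> a"] c by simp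
    then show "f U (Tr (c \<otimes>\<^bsub>L\<^esub> a) \<odot>\<^bsub>sec F U\<^esub> v) = Tr (c \<otimes>\<^bsub>L\<^esub> id a) \<odot>\<^bsub>sec F' U\<^esub> f U v"
      using mod_homD(3)[OF fh _ v] by simp
  qed
  also have "\<dots> = trace_mor c X F' U (em X F F' f U a)"
    unfolding ts(2) em_tens[OF F F' f U ts(1)] trace_tens'[OF w] tensor_lift_map ..
  finally show ?thesis .
qed

lemma twist_natural:
  assumes g: "g \<in> G" and F': "sheaf RK X F'" and f: "f \<in> psheaf_hom RK X F F'" and U: "openin X U"
    and a: "a \<in> carrier (sec (ext_sheaf L K X F) U)"
    and twist_tens': "\<And>ts. ts \<in> formal_sums L (sec F' U) \<Longrightarrow>
      twist_mor g X F' U (tens X F' U ts) = tens X F' U (map (map_prod g id) ts)"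
  shows "em X F F' f U (twist_mor g X F U a) = twist_mor g X F' U (em X F F' f U a)"
proof -
  obtain ts where ts: "ts \<in> formal_sums L (sec F U)" "a = tens X F U ts"
    using a unfolding tens_carrier[OF F U] by blast
  have w: "map (map_prod id (f U)) ts \<in> formal_sums L (sec F' U)"
    using map_prod_formal_sums[OF linear_on_L_id _ ts(1)] mod_homD(1)[OF psheaf_homD(1)[OF f U]] by blast
  show ?thesis
    unfolding ts(2) twist_tens[OF g U ts(1)] em_tens[OF F F' f U ts(1)] twist_tens'[OF w]
      em_tens[OF F F' f U map_twist_formal_sums[OF g ts(1)]]
    by (simp add: map_prod.comp)
qed

lemma twist_comp:
  assumes g: "g \<in> G" and h: "h \<in> G" and U: "openin X U" and a: "a \<in> carrier (sec (ext_sheaf L K X F) U)"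
  shows "twist_mor g X F U (twist_mor h X F U a) = twist_mor (g \<circ> h) X F U a"
proof -
  obtain ts where ts: "ts \<in> formal_sums L (sec F U)" "a = tens X F U ts"
    using a unfolding tens_carrier[OF F U] by blast
  show ?thesis
    unfolding ts(2) twist_tens[OF h U ts(1)] twist_tens[OF G_comp[OF g h] U ts(1)]
      twist_tens[OF g U map_twist_formal_sums[OF h ts(1)]]
    by (simp add: map_prod.comp)
qed

lemma twist_id:
  assumes U: "openin X U" and a: "a \<in> carrier (sec (ext_sheaf L K X F) U)"
  shows "twist_mor id X F U a = a"
proof -
  obtain ts where ts: "ts \<in> formal_sums L (sec F U)" "a = tens X F U ts"
    using a unfolding tens_carrier[OF F U] by blast
  show ?thesis unfolding ts(2) twist_tens[OF G_id U ts(1)] by (simp only: prod.map_id0 list.map_id0 id_apply)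
qed

end

text \<open>Apply \<open>g\<close>, which fixes traces, to the expansion of \<open>y\<close> in the dual pairs.\<close>

lemma lsum_Tr_dual:
  assumes g: "g \<in> G" and y: "y \<in> carrier L"
  shows "lsum L (\<lambda>p. Tr (y \<otimes>\<^bsub>L\<^esub> fst p) \<otimes>\<^bsub>L\<^esub> g (snd p)) ps = g y"
proof -
  have "lsum L (\<lambda>p. Tr (y \<otimes>\<^bsub>L\<^esub> fst p) \<otimes>\<^bsub>L\<^esub> g (snd p)) ps =
      lsum L (\<lambda>p. g (Tr (y \<otimes>\<^bsub>L\<^esub> fst p) \<otimes>\<^bsub>L\<^esub> snd p)) ps"
    using y by (intro lsum_cong) (simp add: G_mult[OF g] G_fix[OF g] Tr_K Tr_closed ps_closed)
  also have "\<dots> = g (lsum L (\<lambda>p. Tr (y \<otimes>\<^bsub>L\<^esub> fst p) \<otimes>\<^bsub>L\<^esub> snd p) ps)"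
    using y by (intro G_lsum[OF g, symmetric]) (simp add: Tr_closed ps_closed)
  finally show ?thesis unfolding Tr_frame_swapped[OF y] .
qed

context
  fixes X :: "'x topology" and F :: "('x, 'l, ('x, 'l, 'b) univ) psheaf"
  assumes F: "sheaf L X F"
begin

interpretation F: operations_presheaf L X F by (rule presheaf_operations[OF sheaf_presheaf[OF F]])

private lemmas RF = sheaf_restrict[OF F]

lemma sec_module_L: "openin X U \<Longrightarrow> module L (sec F U)"
  by (rule presheaf_module[OF sheaf_presheaf[OF F]])

lemma balanced_act:
  assumes g: "g \<in> G" and U: "openin X U"
  shows "balanced L K (sec F U) (sec F U) (\<lambda>a v. g a \<odot>\<^bsub>sec F U\<^esub> v)"
proof -
  interpret V: module L "sec F U" by (rule sec_module_L[OF U])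
  show ?thesis
    by (rule balancedI)
      (simp_all add: G_closed[OF g] G_add[OF g] G_mult[OF g] G_fix[OF g] K_carrier V.smult_l_distr V.smult_r_distr V.smult_assoc1)
qed

lemma act_tens:
  assumes g: "g \<in> G" and U: "openin X U" and ts: "ts \<in> formal_sums L (sec F U)"
  shows "act_mor g X F U (tens X F U ts) = tensor_lift (sec F U) (\<lambda>a v. g a \<odot>\<^bsub>sec F U\<^esub> v) ts"
proof -
  have A: "abelian_group (sec (conj_sheaf g F) U)"
    by (rule module.axioms(2)[OF presheaf_module[OF sheaf_presheaf[OF conj_sheaf_sheaf[OF g F]] U]])
  have B: "balanced L K (sec F U) (sec (conj_sheaf g F) U) (\<lambda>a v. g a \<odot>\<^bsub>sec F U\<^esub> v)"
    unfolding balanced_conj by (rule balanced_act[OF g U])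
  have "act_mor g X F U (tens X F U ts) = tensor_lift (sec (conj_sheaf g F) U) (\<lambda>a v. g a \<odot>\<^bsub>sec F U\<^esub> v) ts"
    unfolding act_mor_def
    by (rule ext_lift_tens[where H = "conj_sheaf g F" and B = "\<lambda>U a v. g a \<odot>\<^bsub>sec F U\<^esub> v", OF RF U ts A B])
  then show ?thesis by (simp add: tensor_lift_def lsum_conj)
qed

lemma act_psheaf_hom:
  assumes g: "g \<in> G"
  shows "act_mor g X F \<in> psheaf_hom L X (ext_sheaf L K X F) (conj_sheaf g F)"
  unfolding act_mor_def
proof (rule ext_lift_hom[OF RF conj_sheaf_sheaf[OF g F]])
  show "balanced L K (sec F U) (sec (conj_sheaf g F) U) (\<lambda>a v. g a \<odot>\<^bsub>sec F U\<^esub> v)" if "openin X U" for U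
    unfolding balanced_conj by (rule balanced_act[OF g that])
  show "rst (conj_sheaf g F) U V (g a \<odot>\<^bsub>sec F U\<^esub> v) = g a \<odot>\<^bsub>sec F V\<^esub> rst F U V v"
    if "openin X U" "openin X V" "V \<subseteq> U" "a \<in> carrier L" "v \<in> carrier (sec F U)" for U V a v
    unfolding conj_sheaf_simps by (rule mod_homD(3)[OF F.rst_hom[OF that(1-3)] G_closed[OF g that(4)] that(5)])
  show "g (k \<otimes>\<^bsub>L\<^esub> a) \<odot>\<^bsub>sec F U\<^esub> v = k \<odot>\<^bsub>sec (conj_sheaf g F) U\<^esub> (g a \<odot>\<^bsub>sec F U\<^esub> v)"
    if "openin X U" "k \<in> carrier L" "a \<in> carrier L" "v \<in> carrier (sec F U)" for U k a v
    unfolding conj_sheaf_simps G_mult[OF g that(2,3)]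
    by (rule module.smult_assoc1[OF sec_module_L[OF that(1)] G_closed[OF g that(2)] G_closed[OF g that(3)] that(4)])
qed simp

lemma act_closed:
  assumes "g \<in> G" "openin X U" "a \<in> carrier (sec (ext_sheaf L K X F) U)"
  shows "act_mor g X F U a \<in> carrier (sec F U)"
  using mod_homD(1)[OF psheaf_homD(1)[OF act_psheaf_hom[OF assms(1)] assms(2)] assms(3)] by (simp add: conj_sheaf_simps)

lemma act_natural:
  assumes g: "g \<in> G" and F': "sheaf L X F'" and f: "f \<in> psheaf_hom L X F F'" and U: "openin X U"
    and a: "a \<in> carrier (sec (ext_sheaf L K X F) U)"
    and act_tens': "\<And>ts. ts \<in> formal_sums L (sec F' U) \<Longrightarrow>
      act_mor g X F' U (tens X F' U ts) = tensor_lift (sec F' U) (\<lambda>a v. g a \<odot>\<^bsub>sec F' U\<^esub> v) ts"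
  shows "f U (act_mor g X F U a) = act_mor g X F' U (em X F F' f U a)"
proof -
  obtain ts where ts: "ts \<in> formal_sums L (sec F U)" "a = tens X F U ts"
    using a unfolding tens_carrier[OF RF U] by blast
  have fh: "f U \<in> mod_hom L (sec F U) (sec F' U)" by (rule psheaf_homD(1)[OF f U])
  have w: "map (map_prod id (f U)) ts \<in> formal_sums L (sec F' U)"
    using map_prod_formal_sums[OF linear_on_L_id _ ts(1)] mod_homD(1)[OF fh] by blast
  have "f U (act_mor g X F U a) = tensor_lift (sec F' U) (\<lambda>a v. f U (g a \<odot>\<^bsub>sec F U\<^esub> v)) ts"
    unfolding ts(2) act_tens[OF g U ts(1)]
    by (rule tensor_lift_mod_hom[OF sec_module_L[OF U] presheaf_module[OF sheaf_presheaf[OF F'] U] fh balanced_act[OF g U] ts(1)])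
  also have "\<dots> = tensor_lift (sec F' U) (\<lambda>a v. g (id a) \<odot>\<^bsub>sec F' U\<^esub> f U v) ts"
    by (rule tensor_lift_cong[OF sec_mod[OF RF U] _ ts(1)]) (simp add: mod_homD(3)[OF fh] G_closed[OF g])
  also have "\<dots> = act_mor g X F' U (em X F F' f U a)"
    unfolding ts(2) em_tens[OF RF sheaf_restrict[OF F'] psheaf_hom_restrict[OF f] U ts(1)] act_tens'[OF w] tensor_lift_map ..
  finally show ?thesis .
qed

lemma coact_apply: "\<lbrakk>openin X U; v \<in> carrier (sec F U)\<rbrakk> \<Longrightarrow>
    coact_mor g X F U v = tens X F U (map (\<lambda>p. (fst p, g (snd p) \<odot>\<^bsub>sec F U\<^esub> v)) ps)"
  by (simp add: coact_mor_def ext_mor_apply)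

lemma coact_formal_sums:
  assumes "g \<in> G" "openin X U" "v \<in> carrier (sec F U)"
  shows "map (\<lambda>p. (fst p, g (snd p) \<odot>\<^bsub>sec F U\<^esub> v)) ps \<in> formal_sums L (sec F U)"
  unfolding mem_Collect_eq set_map
proof (intro image_subsetI SigmaI)
  fix p assume p: "p \<in> set ps"
  show "fst p \<in> carrier L" by (rule ps_closed(1)[OF p])
  show "g (snd p) \<odot>\<^bsub>sec F U\<^esub> v \<in> carrier (sec F U)"
    by (rule F.smult_closed[OF assms(2) G_closed[OF assms(1) ps_closed(2)[OF p]] assms(3)])
qed

lemma lsum_Tr_smult:
  assumes g: "g \<in> G" and y: "y \<in> carrier L" and U: "openin X U" and v: "v \<in> carrier (sec F U)"
  shows "lsum (sec F U) (\<lambda>p. Tr (y \<otimes>\<^bsub>L\<^esub> fst p) \<odot>\<^bsub>sec F U\<^esub> (g (snd p) \<odot>\<^bsub>sec F U\<^esub> v)) ps = g y \<odot>\<^bsub>sec F U\<^esub> v"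
proof -
  interpret V: module L "sec F U" by (rule sec_module_L[OF U])
  have "lsum (sec F U) (\<lambda>p. Tr (y \<otimes>\<^bsub>L\<^esub> fst p) \<odot>\<^bsub>sec F U\<^esub> (g (snd p) \<odot>\<^bsub>sec F U\<^esub> v)) ps =
      lsum (sec F U) (\<lambda>p. (Tr (y \<otimes>\<^bsub>L\<^esub> fst p) \<otimes>\<^bsub>L\<^esub> g (snd p)) \<odot>\<^bsub>sec F U\<^esub> v) ps"
    using y v by (intro lsum_cong) (simp add: V.smult_assoc1 Tr_closed ps_closed G_closed[OF g])
  also have "\<dots> = lsum L (\<lambda>p. Tr (y \<otimes>\<^bsub>L\<^esub> fst p) \<otimes>\<^bsub>L\<^esub> g (snd p)) ps \<odot>\<^bsub>sec F U\<^esub> v"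
    using y v by (intro V.lsum_smult[symmetric]) (simp_all add: Tr_closed ps_closed G_closed[OF g])
  finally show ?thesis unfolding lsum_Tr_dual[OF g y] .
qed

lemma coordinate_coact:
  assumes g: "g \<in> G" and U: "openin X U" and v: "v \<in> carrier (sec F U)" and q: "q \<in> set ps"
  shows "coordinate X F U q (coact_mor g X F U v) = g (snd q) \<odot>\<^bsub>sec F U\<^esub> v"
  unfolding coact_apply[OF U v] coordinate_tens[OF RF U coact_formal_sums[OF g U v] q]
    coord_def[OF sec_mod[OF RF U]] tensor_lift_def lsum_map fst_conv snd_conv
  by (rule lsum_Tr_smult[OF g ps_closed(2)[OF q] U v])

lemma coact_psheaf_hom:
  assumes g: "g \<in> G"
  shows "coact_mor g X F \<in> psheaf_hom L X (conj_sheaf g F) (ext_sheaf L K X F)"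
proof -
  have "ext_mor X (conj_sheaf g F) (\<lambda>U v. tens X F U (map (\<lambda>p. (fst p, g (snd p) \<odot>\<^bsub>sec F U\<^esub> v)) ps))
    \<in> psheaf_hom L X (conj_sheaf g F) (ext_sheaf L K X F)"
  proof (rule ext_into_hom[where J = ps and y = fst and c = "\<lambda>U p v. g (snd p) \<odot>\<^bsub>sec F U\<^esub> v", OF RF conj_sheaf_sheaf[OF g F]];
      (unfold conj_sheaf_simps)?)
    show "carrier L \<subseteq> carrier L" ..
    show "fst p \<in> carrier L" if "p \<in> set ps" for p by (rule ps_closed(1)[OF that])
    show "g (snd p) \<odot>\<^bsub>sec F U\<^esub> v \<in> carrier (sec F U)" if "openin X U" "p \<in> set ps" "v \<in> carrier (sec F U)" for U p v
      by (rule F.smult_closed[OF that(1) G_closed[OF g ps_closed(2)[OF that(2)]] that(3)])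
    show "g (snd p) \<odot>\<^bsub>sec F U\<^esub> (v \<oplus>\<^bsub>sec F U\<^esub> w) =
        g (snd p) \<odot>\<^bsub>sec F U\<^esub> v \<oplus>\<^bsub>sec F U\<^esub> g (snd p) \<odot>\<^bsub>sec F U\<^esub> w"
      if "openin X U" "p \<in> set ps" "v \<in> carrier (sec F U)" "w \<in> carrier (sec F U)" for U p v w
      by (rule module.smult_r_distr[OF sec_module_L[OF that(1)] G_closed[OF g ps_closed(2)[OF that(2)]] that(3,4)])
    show "rst F U V (g (snd p) \<odot>\<^bsub>sec F U\<^esub> v) = g (snd p) \<odot>\<^bsub>sec F V\<^esub> rst F U V v"
      if "openin X U" "openin X V" "V \<subseteq> U" "p \<in> set ps" "v \<in> carrier (sec F U)" for U V p v
      by (rule mod_homD(3)[OF F.rst_hom[OF that(1-3)] G_closed[OF g ps_closed(2)[OF that(4)]] that(5)])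
    fix U k v assume U: "openin X U" and k: "k \<in> carrier L" and v: "v \<in> carrier (sec F U)"
    have kv: "g k \<odot>\<^bsub>sec F U\<^esub> v \<in> carrier (sec F U)" by (rule F.smult_closed[OF U G_closed[OF g k] v])
    have w: "map (\<lambda>p. (k \<otimes>\<^bsub>L\<^esub> fst p, g (snd p) \<odot>\<^bsub>sec F U\<^esub> v)) ps \<in> formal_sums L (sec F U)"
      unfolding mem_Collect_eq set_map
    proof (intro image_subsetI SigmaI)
      fix p assume p: "p \<in> set ps"
      show "k \<otimes>\<^bsub>L\<^esub> fst p \<in> carrier L" by (rule L.m_closed[OF k ps_closed(1)[OF p]])
      show "g (snd p) \<odot>\<^bsub>sec F U\<^esub> v \<in> carrier (sec F U)"
        by (rule F.smult_closed[OF U G_closed[OF g ps_closed(2)[OF p]] v])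
    qed
    show "tens X F U (map (\<lambda>p. (fst p, g (snd p) \<odot>\<^bsub>sec F U\<^esub> (g k \<odot>\<^bsub>sec F U\<^esub> v))) ps) =
        tens X F U (map (\<lambda>p. (k \<otimes>\<^bsub>L\<^esub> fst p, g (snd p) \<odot>\<^bsub>sec F U\<^esub> v)) ps)"
    proof (rule coordinate_eqI[OF RF U tens_mem[OF RF U coact_formal_sums[OF g U kv]] tens_mem[OF RF U w]])
      fix q assume q: "q \<in> set ps"
      note sq = ps_closed(2)[OF q]
      have "lsum (sec F U) (\<lambda>p. Tr (snd q \<otimes>\<^bsub>L\<^esub> (k \<otimes>\<^bsub>L\<^esub> fst p)) \<odot>\<^bsub>sec F U\<^esub> (g (snd p) \<odot>\<^bsub>sec F U\<^esub> v)) ps =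
          lsum (sec F U) (\<lambda>p. Tr ((snd q \<otimes>\<^bsub>L\<^esub> k) \<otimes>\<^bsub>L\<^esub> fst p) \<odot>\<^bsub>sec F U\<^esub> (g (snd p) \<odot>\<^bsub>sec F U\<^esub> v)) ps"
        using sq k by (intro lsum_cong) (simp add: L.m_assoc ps_closed)
      also have "\<dots> = g (snd q \<otimes>\<^bsub>L\<^esub> k) \<odot>\<^bsub>sec F U\<^esub> v" using sq k by (intro lsum_Tr_smult[OF g _ U v]) simp
      also have "\<dots> = g (snd q) \<odot>\<^bsub>sec F U\<^esub> (g k \<odot>\<^bsub>sec F U\<^esub> v)"
        unfolding G_mult[OF g sq k]
        by (rule module.smult_assoc1[OF sec_module_L[OF U] G_closed[OF g sq] G_closed[OF g k] v])
      finally show "coordinate X F U q (tens X F U (map (\<lambda>p. (fst p, g (snd p) \<odot>\<^bsub>sec F U\<^esub> (g k \<odot>\<^bsub>sec F U\<^esub> v))) ps)) =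
          coordinate X F U q (tens X F U (map (\<lambda>p. (k \<otimes>\<^bsub>L\<^esub> fst p, g (snd p) \<odot>\<^bsub>sec F U\<^esub> v)) ps))"
        unfolding coact_apply[OF U kv, symmetric] coordinate_coact[OF g U kv q] coordinate_tens[OF RF U w q]
          coord_def[OF sec_mod[OF RF U]] tensor_lift_def lsum_map fst_conv snd_conv by (rule HOL.sym)
    qed
  qed
  then show ?thesis by (simp add: coact_mor_def ext_mor_def conj_sheaf_simps)
qed

lemma coact_closed:
  assumes "g \<in> G" "openin X U" "v \<in> carrier (sec F U)"
  shows "coact_mor g X F U v \<in> carrier (sec (ext_sheaf L K X F) U)"
  unfolding coact_apply[OF assms(2,3)] by (rule tens_mem[OF RF assms(2) coact_formal_sums[OF assms]])

lemma coact_natural: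
  assumes g: "g \<in> G" and F': "sheaf L X F'" and f: "f \<in> psheaf_hom L X F F'" and U: "openin X U"
    and v: "v \<in> carrier (sec F U)"
  shows "em X F F' f U (coact_mor g X F U v) = coact_mor g X F' U (f U v)"
proof -
  have fh: "f U \<in> mod_hom L (sec F U) (sec F' U)" by (rule psheaf_homD(1)[OF f U])
  have e: "map (map_prod id (f U)) (map (\<lambda>p. (fst p, g (snd p) \<odot>\<^bsub>sec F U\<^esub> v)) ps) =
      map (\<lambda>p. (fst p, g (snd p) \<odot>\<^bsub>sec F' U\<^esub> f U v)) ps"
    using v by (simp add: mod_homD(3)[OF fh] G_closed[OF g] ps_closed)
  show ?thesis
    unfolding coact_apply[OF U v] em_tens[OF RF sheaf_restrict[OF F'] psheaf_hom_restrict[OF f] U coact_formal_sums[OF g U v]] e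
    using mod_homD(1)[OF fh v] U by (simp add: coact_mor_def ext_mor_apply)
qed

text \<open>At the coordinate given by a dual pair with second component \<open>y\<close>, the image of \<open>\<Sum> a \<otimes> v\<close> is
  \<open>\<Sum>\<^sub>g g(y) \<Sum> g(a) v = \<Sum> Tr(y a) v\<close>, which is the coordinate of \<open>\<Sum> a \<otimes> v\<close>.\<close>

lemma sum_coact_act:
  assumes U: "openin X U" and a: "a \<in> carrier (sec (ext_sheaf L K X F) U)"
  shows "lsum (sec (ext_sheaf L K X F) U) (\<lambda>g. coact_mor g X F U (act_mor g X F U a)) gs = a"
proof -
  let ?E = "sec (ext_sheaf L K X F) U"
  interpret V: module L "sec F U" by (rule sec_module_L[OF U])
  interpret E: module L ?E by (rule presheaf_module[OF sheaf_presheaf[OF ext_sheaf_sheaf[OF RF]] U])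
  obtain ts where ts: "ts \<in> formal_sums L (sec F U)" "a = tens X F U ts"
    using a unfolding tens_carrier[OF RF U] by blast
  have ts': "fst p \<in> carrier L" "snd p \<in> carrier (sec F U)" if "p \<in> set ts" for p using ts(1) that by auto
  have c: "coact_mor g X F U (act_mor g X F U a) \<in> carrier ?E" if "g \<in> set gs" for g
    using that gs(1) by (intro coact_closed act_closed U a) simp_all
  show ?thesis
  proof (rule coordinate_eqI[OF RF U E.lsum_closed[OF c] a])
    fix q assume q: "q \<in> set ps"
    note sq = ps_closed(2)[OF q]
    have "coordinate X F U q (lsum ?E (\<lambda>g. coact_mor g X F U (act_mor g X F U a)) gs) =
        lsum (sec F U) (\<lambda>g. coordinate X F U q (coact_mor g X F U (act_mor g X F U a))) gs"
      using coordinate_zero[OF RF U q] coordinate_add[OF RF U _ _ q] c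
      by (intro lsum_hom E.abelian_monoid_axioms) auto
    also have "\<dots> = lsum (sec F U) (\<lambda>g. lsum (sec F U) (\<lambda>p. g (snd q \<otimes>\<^bsub>L\<^esub> fst p) \<odot>\<^bsub>sec F U\<^esub> snd p) ts) gs"
    proof (rule lsum_cong)
      fix g assume "g \<in> set gs"
      then have g: "g \<in> G" using gs(1) by simp
      have "coordinate X F U q (coact_mor g X F U (act_mor g X F U a)) =
          g (snd q) \<odot>\<^bsub>sec F U\<^esub> lsum (sec F U) (\<lambda>p. g (fst p) \<odot>\<^bsub>sec F U\<^esub> snd p) ts"
        using coordinate_coact[OF g U act_closed[OF g U a] q] act_tens[OF g U ts(1)] by (simp add: ts(2) tensor_lift_def)
      also have "\<dots> = lsum (sec F U) (\<lambda>p. g (snd q) \<odot>\<^bsub>sec F U\<^esub> (g (fst p) \<odot>\<^bsub>sec F U\<^esub> snd p)) ts"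
        by (intro V.smult_lsum G_closed[OF g] sq V.smult_closed ts')
      also have "\<dots> = lsum (sec F U) (\<lambda>p. g (snd q \<otimes>\<^bsub>L\<^esub> fst p) \<odot>\<^bsub>sec F U\<^esub> snd p) ts"
        by (intro lsum_cong) (simp add: G_mult[OF g] G_closed[OF g] sq ts' V.smult_assoc1)
      finally show "coordinate X F U q (coact_mor g X F U (act_mor g X F U a)) =
          lsum (sec F U) (\<lambda>p. g (snd q \<otimes>\<^bsub>L\<^esub> fst p) \<odot>\<^bsub>sec F U\<^esub> snd p) ts" .
    qed
    also have "\<dots> = lsum (sec F U) (\<lambda>p. lsum (sec F U) (\<lambda>g. g (snd q \<otimes>\<^bsub>L\<^esub> fst p) \<odot>\<^bsub>sec F U\<^esub> snd p) gs) ts"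
    proof (rule V.lsum_swap)
      fix g p assume "g \<in> set gs" and p: "p \<in> set ts"
      then have g: "g \<in> G" using gs(1) by simp
      show "g (snd q \<otimes>\<^bsub>L\<^esub> fst p) \<odot>\<^bsub>sec F U\<^esub> snd p \<in> carrier (sec F U)"
        by (rule V.smult_closed[OF G_closed[OF g L.m_closed[OF sq ts'(1)[OF p]]] ts'(2)[OF p]])
    qed
    also have "\<dots> = lsum (sec F U) (\<lambda>p. Tr (snd q \<otimes>\<^bsub>L\<^esub> fst p) \<odot>\<^bsub>sec F U\<^esub> snd p) ts"
    proof (rule lsum_cong)
      fix p assume p: "p \<in> set ts"
      have "snd q \<otimes>\<^bsub>L\<^esub> fst p \<in> carrier L" by (intro L.m_closed sq ts'[OF p])
      then show "lsum (sec F U) (\<lambda>g. g (snd q \<otimes>\<^bsub>L\<^esub> fst p) \<odot>\<^bsub>sec F U\<^esub> snd p) gs =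
          Tr (snd q \<otimes>\<^bsub>L\<^esub> fst p) \<odot>\<^bsub>sec F U\<^esub> snd p"
        unfolding Tr_def using gs(1) G_closed
        by (intro V.lsum_smult[where f = "\<lambda>g. g (snd q \<otimes>\<^bsub>L\<^esub> fst p)", OF ts'(2)[OF p], symmetric]) blast
    qed
    also have "\<dots> = coordinate X F U q a"
      unfolding ts(2) coordinate_tens[OF RF U ts(1) q] coord_def[OF sec_mod[OF RF U]] tensor_lift_def ..
    finally show "coordinate X F U q (lsum ?E (\<lambda>g. coact_mor g X F U (act_mor g X F U a)) gs) = coordinate X F U q a" .
  qed
qed

end

text \<open>Both maps send \<open>a \<otimes> v\<close> to \<open>g(a) (1 \<otimes> v) = g(a) \<otimes> v\<close>.\<close>

lemma act_unit:
  fixes F :: "('x, 'l, ('x, 'l, 'b) univ) psheaf"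
  assumes F: "sheaf RK X F" and g: "g \<in> G" and U: "openin X U" and a: "a \<in> carrier (sec (ext_sheaf L K X F) U)"
  shows "act_mor g X (ext_sheaf L K X F) U (em X F (ext_sheaf L K X F) (unit_mor X F) U a) = twist_mor g X F U a"
proof -
  let ?E = "ext_sheaf L K X F"
  note E = ext_sheaf_sheaf[OF F] and u = unit_psheaf_hom[OF F]
  obtain ts where ts: "ts \<in> formal_sums L (sec F U)" "a = tens X F U ts"
    using a unfolding tens_carrier[OF F U] by blast
  have w: "map (map_prod id (unit_mor X F U)) ts \<in> formal_sums L (sec ?E U)"
    using map_prod_formal_sums[OF linear_on_L_id _ ts(1)] unit_closed[OF F U] by blast
  have "act_mor g X ?E U (em X F ?E (unit_mor X F) U a) =
      tensor_lift (sec ?E U) (\<lambda>a v. g (id a) \<odot>\<^bsub>sec ?E U\<^esub> unit_mor X F U v) ts"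
    unfolding ts(2) em_tens[OF F sheaf_restrict[OF E] u U ts(1)] act_tens[OF E g U w] tensor_lift_map ..
  also have "\<dots> = tensor_lift (sec ?E U) (\<lambda>a v. tens X F U [(g a, id v)]) ts"
  proof (rule tensor_lift_cong[OF sec_mod[OF F U] _ ts(1)])
    fix a v assume a: "a \<in> carrier L" and v: "v \<in> carrier (sec F U)"
    have "[(\<one>\<^bsub>L\<^esub>, v)] \<in> formal_sums L (sec F U)" using v by simp
    from tens_smult[OF F U this G_closed[OF g a]]
    show "g (id a) \<odot>\<^bsub>sec ?E U\<^esub> unit_mor X F U v = tens X F U [(g a, id v)]"
      unfolding unit_apply[OF F U v] using G_closed[OF g a] by simp
  qed
  also have "\<dots> = lsum (sec ?E U) (\<lambda>p. tens X F U [p]) (map (map_prod g id) ts)"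
    unfolding tensor_lift_def lsum_map by (simp add: map_prod_def case_prod_beta)
  also have "\<dots> = twist_mor g X F U a"
    unfolding ts(2) twist_tens[OF F g U ts(1)] by (rule lsum_tens_single[OF F U map_twist_formal_sums[OF F g ts(1)]])
  finally show ?thesis .
qed


abbreviation "L_zigzag X \<equiv> zigzag (Cb L X) (quasi_isos L X)"
abbreviation "L_eq X \<equiv> zigzag_eq (Cb L X) (quasi_isos L X)"
abbreviation "L_class X \<equiv> zigzag_class (Cb L X) (quasi_isos L X)"
abbreviation "K_zigzag X \<equiv> zigzag (Cb RK X) (quasi_isos RK X)"
abbreviation "K_eq X \<equiv> zigzag_eq (Cb RK X) (quasi_isos RK X)"
abbreviation "K_class X \<equiv> zigzag_class (Cb RK X) (quasi_isos RK X)"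

abbreviation "unit_map X C \<equiv> \<lambda>n. unit_mor X (ob C n)"
abbreviation "trace_map c X C \<equiv> \<lambda>n. trace_mor c X (ob C n)"
abbreviation "act_map g X C \<equiv> \<lambda>n. act_mor g X (ob C n)"
abbreviation "coact_map g X C \<equiv> \<lambda>n. coact_mor g X (ob C n)"
abbreviation "twist_map g X C \<equiv> \<lambda>n. twist_mor g X (ob C n)"

context
  fixes X :: "'x topology" and C :: "('x, 'l, ('x, 'l, 'b) univ) cplx"
  assumes C: "cochain_complex RK X C"
begin

interpretation C: sheaf_complex RK X C by unfold_locales (rule C)

lemma unit_chain_map: "unit_map X C \<in> chain_map RK X C (ext_cplx L K X C)"
  by (rule chain_mapI; unfold ext_cplx_simps)
    (rule unit_psheaf_hom[OF C.ob_sheaf] unit_natural[OF C.ob_sheaf C.ob_sheaf C.df_psheaf_hom]; assumption)+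

lemma trace_chain_map:
  assumes c: "c \<in> carrier L"
  shows "trace_map c X C \<in> chain_map RK X (ext_cplx L K X C) C"
proof (rule chain_mapI; unfold ext_cplx_simps)
  show "trace_mor c X (ob C n) \<in> psheaf_hom RK X (ext_sheaf L K X (ob C n)) (ob C n)" for n
    by (rule trace_psheaf_hom[OF C.ob_sheaf c])
  show "df C n U (trace_mor c X (ob C n) U a) = trace_mor c X (ob C (n + 1)) U (em X (ob C n) (ob C (n + 1)) (df C n) U a)"
    if "openin X U" "a \<in> carrier (sec (ext_sheaf L K X (ob C n)) U)" for n U a
    by (rule trace_natural[OF C.ob_sheaf c C.ob_sheaf C.df_psheaf_hom that trace_tens[OF C.ob_sheaf c that(1)]])
qed

lemma twist_chain_map:
  assumes g: "g \<in> G"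
  shows "twist_map g X C \<in> chain_map L X (ext_cplx L K X C) (conj_cplx g (ext_cplx L K X C))"
proof (rule chain_mapI; unfold conj_cplx_simps ext_cplx_simps)
  show "twist_mor g X (ob C n) \<in> psheaf_hom L X (ext_sheaf L K X (ob C n)) (conj_sheaf g (ext_sheaf L K X (ob C n)))" for n
    by (rule twist_psheaf_hom[OF C.ob_sheaf g])
  show "em X (ob C n) (ob C (n + 1)) (df C n) U (twist_mor g X (ob C n) U a) =
      twist_mor g X (ob C (n + 1)) U (em X (ob C n) (ob C (n + 1)) (df C n) U a)"
    if "openin X U" "a \<in> carrier (sec (ext_sheaf L K X (ob C n)) U)" for n U a
    by (rule twist_natural[OF C.ob_sheaf g C.ob_sheaf C.df_psheaf_hom that twist_tens[OF C.ob_sheaf g that(1)]])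
qed

end

context
  fixes X :: "'x topology" and M :: "('x, 'l, ('x, 'l, 'b) univ) cplx"
  assumes M: "cochain_complex L X M"
begin

interpretation M: sheaf_complex L X M by unfold_locales (rule M)

lemma act_chain_map:
  assumes g: "g \<in> G"
  shows "act_map g X M \<in> chain_map L X (ext_cplx L K X M) (conj_cplx g M)"
proof (rule chain_mapI; unfold conj_cplx_simps ext_cplx_simps)
  show "act_mor g X (ob M n) \<in> psheaf_hom L X (ext_sheaf L K X (ob M n)) (conj_sheaf g (ob M n))" for n
    by (rule act_psheaf_hom[OF M.ob_sheaf g])
  show "df M n U (act_mor g X (ob M n) U a) =
      act_mor g X (ob M (n + 1)) U (em X (ob M n) (ob M (n + 1)) (df M n) U a)"
    if "openin X U" "a \<in> carrier (sec (ext_sheaf L K X (ob M n)) U)" for n U a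
    by (rule act_natural[OF M.ob_sheaf g M.ob_sheaf M.df_psheaf_hom that act_tens[OF M.ob_sheaf g that(1)]])
qed

lemma coact_chain_map:
  assumes g: "g \<in> G"
  shows "coact_map g X M \<in> chain_map L X (conj_cplx g M) (ext_cplx L K X M)"
proof (rule chain_mapI; unfold conj_cplx_simps ext_cplx_simps conj_sheaf_simps(1))
  show "coact_mor g X (ob M n) \<in> psheaf_hom L X (conj_sheaf g (ob M n)) (ext_sheaf L K X (ob M n))" for n
    by (rule coact_psheaf_hom[OF M.ob_sheaf g])
  show "em X (ob M n) (ob M (n + 1)) (df M n) U (coact_mor g X (ob M n) U v) =
      coact_mor g X (ob M (n + 1)) U (df M n U v)"
    if "openin X U" "v \<in> carrier (sec (ob M n) U)" for n U v
    by (rule coact_natural[OF M.ob_sheaf g M.ob_sheaf M.df_psheaf_hom that])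
qed

end

text \<open>Two zigzags that agree after each \<open>act_map g\<close> agree after each \<open>coact_map g \<circ> act_map g\<close>, hence after
  partial sums of these endomorphisms. The sum over the whole group is the identity.\<close>

lemma act_jointly_monic_partial:
  fixes X :: "'x topology" and M :: "('x, 'l, ('x, 'l, 'b) univ) cplx"
  assumes M: "bounded_complex L X M"
    and \<alpha>: "L_zigzag X A \<alpha> (ext_cplx L K X M)"
    and \<beta>: "L_zigzag X A \<beta> (ext_cplx L K X M)"
    and hs: "hs \<noteq> []" "set hs \<subseteq> G"
    and eq: "\<And>g. g \<in> set hs \<Longrightarrow> L_eq X A (conj_cplx g M)
      (\<alpha> @ [Fwd (ext_cplx L K X M) (act_map g X M) (conj_cplx g M)])
      (\<beta> @ [Fwd (ext_cplx L K X M) (act_map g X M) (conj_cplx g M)])"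
  shows "\<exists>u \<in> chain_map L X (ext_cplx L K X M) (ext_cplx L K X M).
    (\<forall>n U a. openin X U \<and> a \<in> carrier (sec (ext_sheaf L K X (ob M n)) U) \<longrightarrow>
      u n U a = lsum (sec (ext_sheaf L K X (ob M n)) U) (\<lambda>g. coact_map g X M n U (act_map g X M n U a)) hs) \<and>
    L_eq X A (ext_cplx L K X M)
      (\<alpha> @ [Fwd (ext_cplx L K X M) u (ext_cplx L K X M)]) (\<beta> @ [Fwd (ext_cplx L K X M) u (ext_cplx L K X M)])"
proof -
  let ?E = "ext_cplx L K X M" and ?C = "Cb L X" and ?W = "quasi_isos L X"
  note Mc = bounded_cochain[OF M]
  note Eb = ext_cplx_bounded[OF bounded_restrict[OF M]] and Ec = bounded_cochain[OF ext_cplx_bounded[OF bounded_restrict[OF M]]]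
  interpret M: sheaf_complex L X M by (rule bounded_sheaf_complex[OF M])
  interpret E: sheaf_complex L X ?E by (rule bounded_sheaf_complex[OF Eb])
  interpret localizing_with_sums ?C ?W "dsum_cplx X"
    "\<lambda>D C C' f. dmap X C D f (Idt ?C D)" "\<lambda>C D D' g. dmap X C D (Idt ?C C) g" "diag X" by (rule Cb_sums)
  have EO: "?E \<in> Ob ?C" using Eb by (simp add: Cb_simps)
  let ?c = "\<lambda>g. Cmp ?C ?E (conj_cplx g M) ?E (coact_map g X M) (act_map g X M)"
  have c_hom: "?c g \<in> chain_map L X ?E ?E" if "g \<in> G" for g
    by (rule Cmp_chain_map[OF Ec act_chain_map[OF Mc that] coact_chain_map[OF Mc that]])
  have c_apply: "?c g n U a = coact_map g X M n U (act_map g X M n U a)"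
    if "openin X U" "a \<in> carrier (sec (ext_sheaf L K X (ob M n)) U)" for g n U a
    using that by (intro Cmp_apply) (simp_all add: ext_cplx_simps)
  have c_eq: "zigzag_eq ?C ?W A ?E (\<alpha> @ [Fwd ?E (?c g) ?E]) (\<beta> @ [Fwd ?E (?c g) ?E])"
    if g: "g \<in> G" and eq: "zigzag_eq ?C ?W A (conj_cplx g M)
      (\<alpha> @ [Fwd ?E (act_map g X M) (conj_cplx g M)]) (\<beta> @ [Fwd ?E (act_map g X M) (conj_cplx g M)])" for g
  proof -
    have MO: "conj_cplx g M \<in> Ob ?C" using conj_bounded[OF g M] by (simp add: Cb_simps)
    have h: "act_map g X M \<in> Hom ?C ?E (conj_cplx g M)" "coact_map g X M \<in> Hom ?C (conj_cplx g M) ?E"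
      unfolding Cb_simps(2) by (rule act_chain_map[OF Mc g] coact_chain_map[OF Mc g])+
    note k = zigzag_eq_Cmp[OF EO MO EO h]
    have "zigzag_eq ?C ?W A ?E (\<alpha> @ [Fwd ?E (?c g) ?E])
        (\<alpha> @ [Fwd ?E (act_map g X M) (conj_cplx g M), Fwd (conj_cplx g M) (coact_map g X M) ?E])"
      by (rule zigzag_eq_append_left[OF zigzag_eq.sym[OF k] \<alpha>])
    also have "zigzag_eq ?C ?W A ?E \<dots>
        (\<beta> @ [Fwd ?E (act_map g X M) (conj_cplx g M), Fwd (conj_cplx g M) (coact_map g X M) ?E])"
      using zigzag_eq_append_right[OF eq zigzag_Fwd[OF MO EO h(2)]] by simp
    also have "zigzag_eq ?C ?W A ?E \<dots> (\<beta> @ [Fwd ?E (?c g) ?E])"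
      by (rule zigzag_eq_append_left[OF k \<beta>])
    finally show ?thesis .
  qed
  have mod: "module L (sec (ext_sheaf L K X (ob M n)) U)" if "openin X U" for n U
    using E.sec_module[OF that, of n] by (simp add: ext_cplx_simps)
  show ?thesis
    using hs eq
  proof (induction hs rule: list_nonempty_induct)
    case (single g)
    then have g: "g \<in> G" by simp
    have "?c g n U a = lsum (sec (ext_sheaf L K X (ob M n)) U) (\<lambda>g. coact_map g X M n U (act_map g X M n U a)) [g]"
      if U: "openin X U" and a: "a \<in> carrier (sec (ext_sheaf L K X (ob M n)) U)" for n U a
    proof -
      interpret V: module L "sec (ext_sheaf L K X (ob M n)) U" by (rule mod[OF U])
      have "?c g n U a \<in> carrier (sec (ext_sheaf L K X (ob M n)) U)"
        using chain_map_closed[OF c_hom[OF g] U, of a n] a by (simp add: ext_cplx_simps)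
      then show ?thesis unfolding c_apply[OF U a] by simp
    qed
    then have "\<forall>n U a. openin X U \<and> a \<in> carrier (sec (ext_sheaf L K X (ob M n)) U) \<longrightarrow>
        ?c g n U a = lsum (sec (ext_sheaf L K X (ob M n)) U) (\<lambda>g. coact_map g X M n U (act_map g X M n U a)) [g]"
      by (intro allI impI, elim conjE)
    moreover have "zigzag_eq ?C ?W A ?E (\<alpha> @ [Fwd ?E (?c g) ?E]) (\<beta> @ [Fwd ?E (?c g) ?E])"
      by (rule c_eq[OF g single(2)]) simp
    ultimately show ?case by (intro bexI[OF _ c_hom[OF g]] conjI)
  next
    case (cons g hs)
    then have g: "g \<in> G" and hs: "set hs \<subseteq> G" by simp_all
    have eqs: "zigzag_eq ?C ?W A (conj_cplx h M) (\<alpha> @ [Fwd ?E (act_map h X M) (conj_cplx h M)])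
        (\<beta> @ [Fwd ?E (act_map h X M) (conj_cplx h M)])" if "h \<in> set hs" for h
      by (rule cons.prems(2)) (use that in simp)
    obtain v where v: "v \<in> chain_map L X ?E ?E"
      and va: "\<forall>n U a. openin X U \<and> a \<in> carrier (sec (ext_sheaf L K X (ob M n)) U) \<longrightarrow>
        v n U a = lsum (sec (ext_sheaf L K X (ob M n)) U) (\<lambda>g. coact_map g X M n U (act_map g X M n U a)) hs"
      and veq: "zigzag_eq ?C ?W A ?E (\<alpha> @ [Fwd ?E v ?E]) (\<beta> @ [Fwd ?E v ?E])"
      by (rule bexE[OF cons.IH[OF hs eqs]], assumption, elim conjE, rule that)
    define s where "s = Cmp ?C ?E (dsum_cplx X ?E ?E) ?E (codiag X ?E)
      (Cmp ?C ?E (dsum_cplx X ?E ?E) (dsum_cplx X ?E ?E) (dmap X ?E ?E (Idt ?C ?E) v)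
        (Cmp ?C ?E (dsum_cplx X ?E ?E) (dsum_cplx X ?E ?E) (dmap X ?E ?E (?c g) (Idt ?C ?E)) (diag X ?E)))"
    have "zigzag_eq ?C ?W A ?E (\<alpha> @ [Fwd ?E s ?E]) (\<beta> @ [Fwd ?E s ?E])"
      using codiag_chain_map[OF Ec] c_hom[OF g] v
      by (intro zigzag_eq_sum[OF EO EO _ _ _ s_def \<alpha> \<beta> c_eq[OF g cons.prems(2)] veq]) (simp_all add: Cb_simps(2))
    moreover have "s \<in> chain_map L X ?E ?E"
      unfolding s_def
      by (rule Cmp_chain_map[OF Ec Cmp_chain_map[OF Ec Cmp_chain_map[OF Ec diag_chain_map[OF Ec]
        dmap_chain_map[OF Ec Ec c_hom[OF g] Idt_chain_map[OF Ec]]] dmap_chain_map[OF Ec Ec Idt_chain_map[OF Ec] v]]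
        codiag_chain_map[OF Ec]])
    moreover have "s n U a = lsum (sec (ext_sheaf L K X (ob M n)) U) (\<lambda>g. coact_map g X M n U (act_map g X M n U a)) (g # hs)"
      if U: "openin X U" and a: "a \<in> carrier (sec (ext_sheaf L K X (ob M n)) U)" for n U a
    proof -
      have a': "a \<in> carrier (sec (ob ?E n) U)" using a by (simp add: ext_cplx_simps)
      note ca = chain_map_closed[OF c_hom[OF g] U a'] and vc = chain_map_closed[OF v U a']
      have "s n U a = codiag X ?E n U (dmap X ?E ?E (Idt ?C ?E) v n U
          (dmap X ?E ?E (?c g) (Idt ?C ?E) n U (diag X ?E n U a)))"
        unfolding s_def Cmp_apply[OF U a'] ..
      also have "\<dots> = ?c g n U a \<oplus>\<^bsub>sec (ob ?E n) U\<^esub> v n U a"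
        using U a' ca vc
        by (simp add: diag_def codiag_def ext_mor_apply dmap_apply Idt_apply pair_mem)
      finally show ?thesis unfolding c_apply[OF U a] va[rule_format, OF conjI[OF U a]] by (simp add: ext_cplx_simps)
    qed
    ultimately show ?case by blast
  qed
qed

lemma act_jointly_monic:
  fixes X :: "'x topology" and M :: "('x, 'l, ('x, 'l, 'b) univ) cplx"
  assumes M: "bounded_complex L X M"
    and \<alpha>: "L_zigzag X A \<alpha> (ext_cplx L K X M)"
    and \<beta>: "L_zigzag X A \<beta> (ext_cplx L K X M)"
    and eq: "\<And>g. g \<in> G \<Longrightarrow> L_eq X A (conj_cplx g M)
      (\<alpha> @ [Fwd (ext_cplx L K X M) (act_map g X M) (conj_cplx g M)])
      (\<beta> @ [Fwd (ext_cplx L K X M) (act_map g X M) (conj_cplx g M)])"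
  shows "L_eq X A (ext_cplx L K X M) \<alpha> \<beta>"
proof -
  let ?E = "ext_cplx L K X M" and ?C = "Cb L X" and ?W = "quasi_isos L X"
  note Eb = ext_cplx_bounded[OF bounded_restrict[OF M]]
  interpret M: sheaf_complex L X M by (rule bounded_sheaf_complex[OF M])
  interpret localizing ?C ?W by (rule Cb_localizing)
  have EO: "?E \<in> Ob ?C" using Eb by (simp add: Cb_simps)
  have "gs \<noteq> []" "set gs \<subseteq> G" using G_id gs(1) by auto
  then have gs': "gs \<noteq> []" "set gs \<subseteq> G" by blast+
  have eqs: "zigzag_eq ?C ?W A (conj_cplx g M) (\<alpha> @ [Fwd ?E (act_map g X M) (conj_cplx g M)])
      (\<beta> @ [Fwd ?E (act_map g X M) (conj_cplx g M)])" if "g \<in> set gs" for g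
    by (rule eq) (use that gs(1) in simp)
  obtain u where u: "u \<in> chain_map L X ?E ?E"
    and ua: "\<forall>n U a. openin X U \<and> a \<in> carrier (sec (ext_sheaf L K X (ob M n)) U) \<longrightarrow>
      u n U a = lsum (sec (ext_sheaf L K X (ob M n)) U) (\<lambda>g. coact_map g X M n U (act_map g X M n U a)) gs"
    and ueq: "zigzag_eq ?C ?W A ?E (\<alpha> @ [Fwd ?E u ?E]) (\<beta> @ [Fwd ?E u ?E])"
    by (rule bexE[OF act_jointly_monic_partial[OF M \<alpha> \<beta> gs' eqs]], assumption, elim conjE, rule that)
  have "u = Idt ?C ?E"
    by (rule chain_map_eqI[OF u Idt_chain_map[OF bounded_cochain[OF Eb]]])
      (simp add: Idt_apply ext_cplx_simps ua sum_coact_act[OF M.ob_sheaf])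
  with zigzag_eq_Idt[OF EO] have id: "zigzag_eq ?C ?W ?E ?E [Fwd ?E u ?E] []" by simp
  show ?thesis
    using zigzag_eq.trans[OF zigzag_eq.trans[OF zigzag_eq.sym[OF zigzag_eq_append_left[OF id \<alpha>]] ueq]
      zigzag_eq_append_left[OF id \<beta>]] by simp
qed

end


section \<open>Full faithfulness\<close>

lemma localizing_functor_id:
  assumes "localizing C W"
  shows "localizing_functor C W C W (\<lambda>a. a) (\<lambda>a b f. f)"
  using assms by (simp add: localizing_functor_def localizing_functor_axioms_def is_functor_def)

context galois_extension
begin

lemma natural_G_structure_eq: "natural_G_structure L K X C g = loc_arrow (Cb L X) (quasi_isos L X)
    (ext_cplx L K X C) (conj_cplx g (ext_cplx L K X C)) (twist_map g X C)"
  by (simp add: natural_G_structure_def twist_mor_def)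

context
  fixes X :: "'x topology" and C :: "('x, 'l, ('x, 'l, 'b) univ) cplx"
  assumes C: "bounded_complex RK X C"
begin

interpretation C: sheaf_complex RK X C by (rule bounded_sheaf_complex[OF C])

private abbreviation "LC \<equiv> ext_cplx L K X C"

private lemmas Eb = ext_cplx_bounded[OF C]
private lemmas Ec = bounded_cochain[OF ext_cplx_bounded[OF C]]

lemma ext_Ob: "LC \<in> Ob (Cb L X)"
  using Eb by (simp add: Cb_simps)

lemma conj_ext_Ob: "g \<in> G \<Longrightarrow> conj_cplx g LC \<in> Ob (Cb L X)"
  using conj_bounded[OF _ Eb] by (simp add: Cb_simps)

lemma twist_Hom: "g \<in> G \<Longrightarrow> twist_map g X C \<in> Hom (Cb L X) LC (conj_cplx g LC)"
  unfolding Cb_simps by (rule twist_chain_map[OF bounded_cochain[OF C]])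

lemma twist_Hom_conj:
  assumes g: "g \<in> G" and h: "h \<in> G"
  shows "twist_map g X C \<in> Hom (Cb L X) (conj_cplx h LC) (conj_cplx (g \<circ> h) LC)"
  using conj_chain_map[OF h twist_chain_map[OF bounded_cochain[OF C] g]]
  unfolding Cb_simps conj_cplx_conj_cplx .

lemma Cmp_twist:
  assumes g: "g \<in> G" and h: "h \<in> G"
  shows "Cmp (Cb L X) LC (conj_cplx h LC) (conj_cplx (g \<circ> h) LC) (twist_map g X C) (twist_map h X C) = twist_map (g \<circ> h) X C"
proof (rule chain_map_eqI[OF Cmp_chain_map[OF Ec] twist_chain_map[OF bounded_cochain[OF C] G_comp[OF g h]]])
  show "twist_map h X C \<in> chain_map L X LC (conj_cplx h LC)"
    "twist_map g X C \<in> chain_map L X (conj_cplx h LC) (conj_cplx (g \<circ> h) LC)"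
    using twist_Hom[OF h] twist_Hom_conj[OF g h] by (simp_all add: Cb_simps)
  show "Cmp (Cb L X) LC (conj_cplx h LC) (conj_cplx (g \<circ> h) LC) (twist_map g X C) (twist_map h X C) n U a =
      twist_mor (g \<circ> h) X (ob C n) U a" if U: "openin X U" and a: "a \<in> carrier (sec (ob LC n) U)" for n U a
    unfolding Cmp_apply[OF U a] using twist_comp[OF C.ob_sheaf g h U] a by (simp add: ext_cplx_simps)
qed

text \<open>The inverse is \<open>g\<^sup>-\<^sup>1 \<otimes> id\<close>, conjugated by \<open>g\<close>.\<close>

lemma twist_is_iso:
  assumes g: "g \<in> G"
  shows "is_iso (Db L X) LC (conj_cplx g LC) (natural_G_structure L K X C g)"
proof -
  let ?h = "inv_into UNIV g"
  interpret localizing "Cb L X" "quasi_isos L X" by (rule Cb_localizing)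
  note h = G_inv[OF g]
  have hg: "?h \<circ> g = id" "g \<circ> ?h = id" using G_inv_apply[OF g] by (auto simp: fun_eq_iff)
  have b: "twist_map ?h X C \<in> Hom (Cb L X) (conj_cplx g LC) LC"
    using twist_Hom_conj[OF h g] by (simp add: hg conj_cplx_id)
  have tid: "twist_map (f \<circ> f') X C n U a = a"
    if "f \<circ> f' = id" "openin X U" "a \<in> carrier (sec (ob LC n) U)" for f f' n U a
    using twist_id[OF C.ob_sheaf that(2)] that(1,3) by (simp add: ext_cplx_simps)
  have "Cmp (Cb L X) LC (conj_cplx g LC) LC (twist_map ?h X C) (twist_map g X C) = Idt (Cb L X) LC"
    using b twist_Hom[OF g]
    by (intro chain_map_eqI[OF Cmp_chain_map[OF Ec] Idt_chain_map[OF Ec]])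
      (simp_all add: Cb_simps(2) Cmp_apply Idt_apply ext_cplx_simps twist_comp[OF C.ob_sheaf h g] hg twist_id[OF C.ob_sheaf])
  moreover have "Cmp (Cb L X) (conj_cplx g LC) LC (conj_cplx g LC) (twist_map g X C) (twist_map ?h X C) = Idt (Cb L X) (conj_cplx g LC)"
    using b twist_Hom[OF g]
    by (intro chain_map_eqI[OF Cmp_chain_map[OF conj_cochain[OF g Ec]] Idt_chain_map[OF conj_cochain[OF g Ec]]])
      (simp_all add: Cb_simps(2) Cmp_apply Idt_apply conj_cplx_simps conj_sheaf_simps ext_cplx_simps
        twist_comp[OF C.ob_sheaf g h] hg twist_id[OF C.ob_sheaf])
  ultimately show ?thesis
    unfolding Db_def natural_G_structure_eq by (rule is_iso_loc_arrow[OF ext_Ob conj_ext_Ob[OF g] twist_Hom[OF g] b])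
qed

lemma Phi_ob_Ob: "Phi_ob L K X C \<in> Ob (DbG L K X)"
proof -
  interpret localizing "Cb L X" "quasi_isos L X" by (rule Cb_localizing)
  have "natural_G_structure L K X C (g \<circ> h) = Cmp (Db L X) LC (conj_cplx h LC) (conj_cplx (g \<circ> h) LC)
      (conj_Db L X h LC (conj_cplx g LC) (natural_G_structure L K X C g)) (natural_G_structure L K X C h)"
    if g: "g \<in> G" and h: "h \<in> G" for g h
  proof -
    note zg = zigzag_Fwd[OF ext_Ob conj_ext_Ob[OF g] twist_Hom[OF g]]
      and zh = zigzag_Fwd[OF ext_Ob conj_ext_Ob[OF h] twist_Hom[OF h]]
      and zgh = zigzag_Fwd[OF conj_ext_Ob[OF h] conj_ext_Ob[OF G_comp[OF g h]] twist_Hom_conj[OF g h]]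
    have c: "conj_Db L X h LC (conj_cplx g LC)
          (L_class X LC (conj_cplx g LC) [Fwd LC (twist_map g X C) (conj_cplx g LC)]) =
        L_class X (conj_cplx h LC) (conj_cplx (g \<circ> h) LC)
          [Fwd (conj_cplx h LC) (twist_map g X C) (conj_cplx (g \<circ> h) LC)]"
      unfolding conj_Db_def localizing_functor.loc_map_class[OF conj_functor[OF h] zg]
      by (simp add: conj_cplx_conj_cplx)
    have e: "L_eq X LC (conj_cplx (g \<circ> h) LC)
        ([Fwd LC (twist_map h X C) (conj_cplx h LC)] @ [Fwd (conj_cplx h LC) (twist_map g X C) (conj_cplx (g \<circ> h) LC)])
        [Fwd LC (twist_map (g \<circ> h) X C) (conj_cplx (g \<circ> h) LC)]"
      using zigzag_eq_Cmp[OF ext_Ob conj_ext_Ob[OF h] conj_ext_Ob[OF G_comp[OF g h]] twist_Hom[OF h] twist_Hom_conj[OF g h]]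
      by (simp add: Cmp_twist[OF g h])
    show ?thesis
      unfolding Db_def natural_G_structure_eq loc_arrow_def c Cmp_localization[OF zh zgh]
      by (rule zigzag_class_eq_iff[OF zigzag_append[OF zh zgh], THEN iffD2, OF e, symmetric])
  qed
  then show ?thesis
    using twist_is_iso Eb by (simp add: DbG_def Phi_ob_def G_structure_def Db_def localization_def Cb_simps(1))
qed

end

context
  fixes X :: "'x topology" and C D :: "('x, 'l, ('x, 'l, 'b) univ) cplx"
  assumes C: "bounded_complex RK X C" and D: "bounded_complex RK X D"
begin

private abbreviation "EC \<equiv> ext_cplx L K X C"
private abbreviation "ED \<equiv> ext_cplx L K X D"

interpretation K: localizing "Cb RK X :: (('x, 'l, ('x, 'l, 'b) univ) cplx, _) cat" "quasi_isos RK X" by (rule Cb_localizing)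
interpretation L: localizing "Cb L X :: (('x, 'l, ('x, 'l, 'b) univ) cplx, _) cat" "quasi_isos L X" by (rule Cb_localizing)
interpretation Em: localizing_functor "Cb RK X :: (('x, 'l, ('x, 'l, 'b) univ) cplx, _) cat" "quasi_isos RK X"
  "Cb L X" "quasi_isos L X" "ext_cplx L K X" "\<lambda>C D f. Em X C D f" by (rule ext_functor)

abbreviation "conj_zigzag g \<equiv> map (map_zstep (conj_cplx g) (\<lambda>C D f. f))"
abbreviation "ext_zigzag \<equiv> map (map_zstep (ext_cplx L K X) (\<lambda>C D f. Em X C D f))"

text \<open>Compatibility with the \<open>G\<close>-structures, on representing zigzags.\<close>

lemma Hom_DbG_eq:
  "Hom (DbG L K X) (Phi_ob L K X C) (Phi_ob L K X D) =
    {L_class X EC ED p | p. L_zigzag X EC p ED \<and>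
      (\<forall>g \<in> G. L_eq X EC (conj_cplx g ED)
        (p @ [Fwd ED (twist_map g X D) (conj_cplx g ED)])
        (Fwd EC (twist_map g X C) (conj_cplx g EC) # conj_zigzag g p))}"
proof -
  have equivariant: "Cmp (Db L X) EC ED (conj_cplx g ED) (natural_G_structure L K X D g) (L_class X EC ED p) =
      Cmp (Db L X) EC (conj_cplx g EC) (conj_cplx g ED)
        (conj_Db L X g EC ED (L_class X EC ED p)) (natural_G_structure L K X C g) \<longleftrightarrow>
    L_eq X EC (conj_cplx g ED)
        (p @ [Fwd ED (twist_map g X D) (conj_cplx g ED)])
        (Fwd EC (twist_map g X C) (conj_cplx g EC) # conj_zigzag g p)"
    if p: "L_zigzag X EC p ED" and g: "g \<in> G" for p g
  proof -
    note zC = L.zigzag_Fwd[OF ext_Ob[OF C] conj_ext_Ob[OF C g] twist_Hom[OF C g]]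
      and zD = L.zigzag_Fwd[OF ext_Ob[OF D] conj_ext_Ob[OF D g] twist_Hom[OF D g]]
      and cp = localizing_functor.zigzag_map[OF conj_functor[OF g] p]
    show ?thesis
      unfolding Db_def natural_G_structure_eq loc_arrow_def conj_Db_def
        localizing_functor.loc_map_class[OF conj_functor[OF g] p] L.Cmp_localization[OF p zD] L.Cmp_localization[OF zC cp]
        L.zigzag_class_eq_iff[OF L.zigzag_append[OF p zD]] by simp
  qed
  have 1: "Hom (DbG L K X) (Phi_ob L K X C) (Phi_ob L K X D) = {f \<in> Hom (Db L X) EC ED. \<forall>g \<in> G.
      Cmp (Db L X) EC ED (conj_cplx g ED) (natural_G_structure L K X D g) f =
      Cmp (Db L X) EC (conj_cplx g EC) (conj_cplx g ED) (conj_Db L X g EC ED f) (natural_G_structure L K X C g)}"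
    by (simp add: DbG_def Phi_ob_def)
  have 2: "Hom (Db L X) EC ED =
      {L_class X EC ED p | p. L_zigzag X EC p ED}"
    by (simp add: Db_def localization_def)
  show ?thesis
    unfolding 1 2
  proof (intro subset_antisym subsetI, goal_cases)
    case (1 f)
    then obtain p where p: "L_zigzag X EC p ED"
      and f: "f = L_class X EC ED p" by blast
    from 1 show ?case using equivariant[OF p] p unfolding f by blast
  next
    case (2 f)
    then obtain p where p: "L_zigzag X EC p ED"
      and f: "f = L_class X EC ED p"
      and e: "\<forall>g \<in> G. L_eq X EC (conj_cplx g ED)
        (p @ [Fwd ED (twist_map g X D) (conj_cplx g ED)])
        (Fwd EC (twist_map g X C) (conj_cplx g EC) # conj_zigzag g p)" by blast
    show ?case using equivariant[OF p] p e unfolding f by blast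
  qed
qed

lemma Phi_mor_class:
  assumes "K_zigzag X C p D"
  shows "Phi_mor L K X C D (K_class X C D p) =
    L_class X EC ED (ext_zigzag p)"
  unfolding Phi_mor_def ext_Db_def by (rule Em.loc_map_class[OF assms])

lemma Phi_mor_Hom:
  assumes "f \<in> Hom (Db RK X) C D"
  shows "Phi_mor L K X C D f \<in> Hom (DbG L K X) (Phi_ob L K X C) (Phi_ob L K X D)"
proof -
  obtain p where p: "K_zigzag X C p D"
    and f: "f = K_class X C D p" using assms by (auto simp: Db_def localization_def)
  have "L_eq X EC (conj_cplx g ED)
      (ext_zigzag p @ [Fwd ED (twist_map g X D) (conj_cplx g ED)])
      (Fwd EC (twist_map g X C) (conj_cplx g EC) # conj_zigzag g (ext_zigzag p))" if g: "g \<in> G" for g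
    unfolding map_map_zstep
  proof (rule zigzag_eq_natural[OF ext_functor localizing_functor_comp[OF ext_functor conj_functor[OF g]] _ _ p])
    show "twist_map g X A \<in> Hom (Cb L X) (ext_cplx L K X A) (conj_cplx g (ext_cplx L K X A))" if "A \<in> Ob (Cb RK X)"
      for A :: "('x, 'l, ('x, 'l, 'b) univ) cplx"
      using that by (intro twist_Hom g) (simp add: Cb_simps)
    fix A B :: "('x, 'l, ('x, 'l, 'b) univ) cplx" and f
    assume "A \<in> Ob (Cb RK X)" "B \<in> Ob (Cb RK X)" "f \<in> Hom (Cb RK X) A B"
    then have A: "bounded_complex RK X A" and B: "bounded_complex RK X B" and f: "f \<in> chain_map RK X A B"
      by (simp_all add: Cb_simps)
    interpret A: sheaf_complex RK X A by (rule bounded_sheaf_complex[OF A])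
    interpret B: sheaf_complex RK X B by (rule bounded_sheaf_complex[OF B])
    note Ef = Em_chain_map[OF bounded_cochain[OF A] bounded_cochain[OF B] f]
    show "Cmp (Cb L X) (ext_cplx L K X A) (ext_cplx L K X B) (conj_cplx g (ext_cplx L K X B)) (twist_map g X B) (Em X A B f) =
        Cmp (Cb L X) (ext_cplx L K X A) (conj_cplx g (ext_cplx L K X A)) (conj_cplx g (ext_cplx L K X B)) (Em X A B f) (twist_map g X A)"
    proof (rule Cmp_eqI[OF bounded_cochain[OF ext_cplx_bounded[OF A]] Ef twist_chain_map[OF bounded_cochain[OF B] g]
          twist_chain_map[OF bounded_cochain[OF A] g] conj_chain_map[OF g Ef]])
      fix n U a assume U: "openin X U" and a: "a \<in> carrier (sec (ob (ext_cplx L K X A) n) U)"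
      show "twist_mor g X (ob B n) U (em X (ob A n) (ob B n) (f n) U a) = em X (ob A n) (ob B n) (f n) U (twist_mor g X (ob A n) U a)"
        by (rule twist_natural[OF A.ob_sheaf g B.ob_sheaf chain_mapD(1)[OF f] U a[unfolded ext_cplx_simps]
          twist_tens[OF B.ob_sheaf g U], symmetric])
    qed
  qed
  then show ?thesis
    unfolding Hom_DbG_eq f Phi_mor_class[OF p] using Em.zigzag_map[OF p] by blast
qed

lemma unit_Hom: "bounded_complex RK X A \<Longrightarrow> unit_map X A \<in> Hom (Cb RK X) A (ext_cplx L K X A)"
  unfolding Cb_simps by (rule unit_chain_map[OF bounded_cochain])

lemma ext_Ob_restrict: "bounded_complex RK X A \<Longrightarrow> ext_cplx L K X A \<in> Ob (Cb RK X)"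
  for A :: "('x, 'l, ('x, 'l, 'b) univ) cplx"
  using bounded_restrict[OF ext_cplx_bounded] by (simp add: Cb_simps)

lemma ext_zigzag_unit:
  assumes p: "K_zigzag X C p D"
  shows "K_eq X C ED
    (p @ [Fwd D (unit_map X D) ED]) (Fwd C (unit_map X C) EC # ext_zigzag p)"
proof -
  note res = localizing_functor_comp[OF ext_functor restrict_functor]
  have "K_eq X C ED
    (map (map_zstep (\<lambda>a. a) (\<lambda>a b f. f)) p @ [Fwd D (unit_map X D) ED]) (Fwd C (unit_map X C) EC # ext_zigzag p)"
  proof (rule zigzag_eq_natural[OF localizing_functor_id[OF Cb_localizing] res _ _ p])
    show "unit_map X A \<in> Hom (Cb RK X) A (ext_cplx L K X A)" if "A \<in> Ob (Cb RK X)" for A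
      using that by (intro unit_Hom) (simp add: Cb_simps)
    fix A B :: "('x, 'l, ('x, 'l, 'b) univ) cplx" and f
    assume "A \<in> Ob (Cb RK X)" "B \<in> Ob (Cb RK X)" "f \<in> Hom (Cb RK X) A B"
    then have A: "bounded_complex RK X A" and B: "bounded_complex RK X B" and f: "f \<in> chain_map RK X A B"
      by (simp_all add: Cb_simps)
    interpret A: sheaf_complex RK X A by (rule bounded_sheaf_complex[OF A])
    interpret B: sheaf_complex RK X B by (rule bounded_sheaf_complex[OF B])
    show "Cmp (Cb RK X) A B (ext_cplx L K X B) (unit_map X B) f =
        Cmp (Cb RK X) A (ext_cplx L K X A) (ext_cplx L K X B) (Em X A B f) (unit_map X A)"
      by (rule Cmp_eqI[OF bounded_cochain[OF A] f unit_chain_map[OF bounded_cochain[OF B]] unit_chain_map[OF bounded_cochain[OF A]]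
        chain_map_restrict[OF Em_chain_map[OF bounded_cochain[OF A] bounded_cochain[OF B] f]]])
        (rule unit_natural[OF A.ob_sheaf B.ob_sheaf chain_mapD(1)[OF f], symmetric])
  qed
  then show ?thesis by (simp add: map_zstep_ident)
qed

lemma trace_unit_Idt:
  fixes A :: "('x, 'l, ('x, 'l, 'b) univ) cplx"
  assumes A: "bounded_complex RK X A" and c: "c \<in> carrier L" "Tr c = \<one>\<^bsub>L\<^esub>"
  shows "Cmp (Cb RK X) A (ext_cplx L K X A) A (trace_map c X A) (unit_map X A) = Idt (Cb RK X) A"
proof -
  interpret A: sheaf_complex RK X A by (rule bounded_sheaf_complex[OF A])
  note Ac = bounded_cochain[OF A]
  show ?thesis
    by (rule chain_map_eqI[OF Cmp_chain_map[OF Ac unit_chain_map[OF Ac] trace_chain_map[OF Ac c(1)]] Idt_chain_map[OF Ac]])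
      (simp add: Cmp_apply Idt_apply trace_unit[OF A.ob_sheaf c])
qed

text \<open>By naturality of the unit, \<open>p\<close> is equivalent to the unit, \<open>E(p)\<close> and the trace retraction in
  succession, so it depends on the class of \<open>E(p)\<close> only.\<close>

lemma Phi_mor_inj:
  assumes p: "K_zigzag X C p D" and q: "K_zigzag X C q D"
    and eq: "L_eq X EC ED (ext_zigzag p) (ext_zigzag q)"
  shows "K_eq X C D p q"
proof -
  obtain c where c: "c \<in> carrier L" "Tr c = \<one>\<^bsub>L\<^esub>" using ex_Tr_one by blast
  have O: "C \<in> Ob (Cb RK X)" "D \<in> Ob (Cb RK X)" using C D by (simp_all add: Cb_simps)
  have tr: "trace_map c X D \<in> Hom (Cb RK X) ED D"
    unfolding Cb_simps by (rule trace_chain_map[OF bounded_cochain[OF D] c(1)])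
  note zt = K.zigzag_Fwd[OF ext_Ob_restrict[OF D] O(2) tr]
  have retract: "K_eq X D D [Fwd D (unit_map X D) ED, Fwd ED (trace_map c X D) D] []"
    using zigzag_eq.trans[OF K.zigzag_eq_Cmp[OF O(2) ext_Ob_restrict[OF D] O(2) unit_Hom[OF D] tr,
      unfolded trace_unit_Idt[OF D c]] K.zigzag_eq_Idt[OF O(2)]] .
  have expand: "K_eq X C D r
      ((Fwd C (unit_map X C) EC # ext_zigzag r) @ [Fwd ED (trace_map c X D) D])"
    if r: "K_zigzag X C r D" for r
    using zigzag_eq.trans[OF zigzag_eq.sym[OF K.zigzag_eq_append_left[OF retract r]]]
      K.zigzag_eq_append_right[OF ext_zigzag_unit[OF r] zt] by simp
  have "K_eq X EC ED (ext_zigzag p) (ext_zigzag q)"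
    using localizing_functor.zigzag_eq_map[OF restrict_functor eq] unfolding map_zstep_ident by simp
  from K.zigzag_eq_mid[OF this K.zigzag_Fwd[OF O(1) ext_Ob_restrict[OF C] unit_Hom[OF C]] zt]
  have "K_eq X C D
      ((Fwd C (unit_map X C) EC # ext_zigzag p) @ [Fwd ED (trace_map c X D) D])
      ((Fwd C (unit_map X C) EC # ext_zigzag q) @ [Fwd ED (trace_map c X D) D])" by simp
  from zigzag_eq.trans[OF zigzag_eq.trans[OF expand[OF p] this] zigzag_eq.sym[OF expand[OF q]]] show ?thesis .
qed

text \<open>The preimage \<open>q\<close> is \<open>p\<close>, considered over \<open>K\<close>, between the unit of \<open>C\<close> and the trace retraction of
  \<open>D\<close>. The equality \<open>E(q) = p\<close> is tested on the conjugates of \<open>E(D)\<close>.\<close>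

lemma Phi_mor_surj:
  assumes p: "L_zigzag X EC p ED"
    and equivariant: "\<And>g. g \<in> G \<Longrightarrow> L_eq X EC (conj_cplx g ED)
        (p @ [Fwd ED (twist_map g X D) (conj_cplx g ED)])
        (Fwd EC (twist_map g X C) (conj_cplx g EC) # conj_zigzag g p)"
  shows "\<exists>q. K_zigzag X C q D \<and>
    L_eq X EC ED (ext_zigzag q) p"
proof -
  obtain c where c: "c \<in> carrier L" "Tr c = \<one>\<^bsub>L\<^esub>" using ex_Tr_one by blast
  let ?EEC = "ext_cplx L K X EC" and ?EED = "ext_cplx L K X ED"
  have O: "C \<in> Ob (Cb RK X)" "D \<in> Ob (Cb RK X)" using C D by (simp_all add: Cb_simps)
  note rO = ext_Ob_restrict[OF C] ext_Ob_restrict[OF D]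
  note EO = Em.To_Ob[OF O(1)] Em.To_Ob[OF O(2)] and EEO = Em.To_Ob[OF rO(1)] Em.To_Ob[OF rO(2)]
  have Eb: "bounded_complex L X EC" "bounded_complex L X ED" by (rule ext_cplx_bounded[OF C] ext_cplx_bounded[OF D])+
  have tr: "trace_map c X D \<in> Hom (Cb RK X) ED D"
    unfolding Cb_simps by (rule trace_chain_map[OF bounded_cochain[OF D] c(1)])
  have rp: "K_zigzag X EC p ED"
    using localizing_functor.zigzag_map[OF restrict_functor p] unfolding map_zstep_ident by simp
  \<comment> \<open>A zigzag over \<open>L\<close> is one over \<open>K\<close> as it stands.\<close>
  define q where "q = [Fwd C (unit_map X C) EC] @ p @ [Fwd ED (trace_map c X D) D]"
  have q: "K_zigzag X C q D"
    unfolding q_def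
    by (intro K.zigzag_append[OF K.zigzag_Fwd[OF O(1) rO(1) unit_Hom[OF C]] K.zigzag_append[OF rp K.zigzag_Fwd[OF rO(2) O(2) tr]]])
  let ?u = "\<lambda>A. Em X A (ext_cplx L K X A) (unit_map X A)"
  have u: "?u C \<in> Hom (Cb L X) EC ?EEC" "?u D \<in> Hom (Cb L X) ED ?EED"
    by (rule Em.Tm_Hom[OF O(1) rO(1) unit_Hom[OF C]] Em.Tm_Hom[OF O(2) rO(2) unit_Hom[OF D]])+
  note zu = L.zigzag_Fwd[OF EO(1) EEO(1) u(1)] L.zigzag_Fwd[OF EO(2) EEO(2) u(2)]
  have act_unit_eq: "L_eq X (ext_cplx L K X A) (conj_cplx g (ext_cplx L K X A))
      [Fwd (ext_cplx L K X A) (?u A) (ext_cplx L K X (ext_cplx L K X A)),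
       Fwd (ext_cplx L K X (ext_cplx L K X A)) (act_map g X (ext_cplx L K X A)) (conj_cplx g (ext_cplx L K X A))]
      [Fwd (ext_cplx L K X A) (twist_map g X A) (conj_cplx g (ext_cplx L K X A))]"
    if g: "g \<in> G" and A: "bounded_complex RK X A" for g and A :: "('x, 'l, ('x, 'l, 'b) univ) cplx"
  proof -
    interpret A: sheaf_complex RK X A by (rule bounded_sheaf_complex[OF A])
    have AO: "A \<in> Ob (Cb RK X)" using A by (simp add: Cb_simps)
    note uA = Em.Tm_Hom[OF AO ext_Ob_restrict[OF A] unit_Hom[OF A]]
    have aA: "act_map g X (ext_cplx L K X A) \<in> Hom (Cb L X) (ext_cplx L K X (ext_cplx L K X A)) (conj_cplx g (ext_cplx L K X A))"
      unfolding Cb_simps by (rule act_chain_map[OF bounded_cochain[OF ext_cplx_bounded[OF A]] g])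
    have "Cmp (Cb L X) (ext_cplx L K X A) (ext_cplx L K X (ext_cplx L K X A)) (conj_cplx g (ext_cplx L K X A))
        (act_map g X (ext_cplx L K X A)) (?u A) = twist_map g X A"
      by (rule chain_map_eqI[OF Cmp_chain_map[OF bounded_cochain[OF ext_cplx_bounded[OF A]] uA[unfolded Cb_simps] aA[unfolded Cb_simps]]
        twist_chain_map[OF bounded_cochain[OF A] g]])
        (simp add: Cmp_apply ext_cplx_simps act_unit[OF A.ob_sheaf g])
    then show ?thesis
      using L.zigzag_eq_Cmp[OF ext_Ob[OF A] Em.To_Ob[OF ext_Ob_restrict[OF A]] conj_ext_Ob[OF A g] uA aA] by simp
  qed
  note extp = Em.zigzag_map[OF rp]
  have "L_eq X EC ?EED
      (Fwd EC (?u C) ?EEC # ext_zigzag p) (p @ [Fwd ED (?u D) ?EED])"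
  proof (rule act_jointly_monic[OF Eb(2)])
    show "L_zigzag X EC (Fwd EC (?u C) ?EEC # ext_zigzag p) ?EED"
      using L.zigzag_append[OF zu(1) extp] by simp
    show "L_zigzag X EC (p @ [Fwd ED (?u D) ?EED]) ?EED"
      by (rule L.zigzag_append[OF p zu(2)])
    fix g assume g: "g \<in> G"
    let ?a = "\<lambda>A. Fwd (ext_cplx L K X A) (act_map g X A) (conj_cplx g A)"
    have natural: "L_eq X ?EEC (conj_cplx g ED) (ext_zigzag p @ [?a ED]) (?a EC # conj_zigzag g p)"
    proof (rule zigzag_eq_natural[OF localizing_functor_comp[OF restrict_functor ext_functor] conj_functor[OF g] _ _ p])
      show "act_map g X A \<in> Hom (Cb L X) (ext_cplx L K X A) (conj_cplx g A)" if "A \<in> Ob (Cb L X)"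
        for A :: "('x, 'l, ('x, 'l, 'b) univ) cplx"
        using that act_chain_map[OF bounded_cochain g] by (simp add: Cb_simps)
      fix A B :: "('x, 'l, ('x, 'l, 'b) univ) cplx" and f
      assume "A \<in> Ob (Cb L X)" "B \<in> Ob (Cb L X)" "f \<in> Hom (Cb L X) A B"
      then have A: "bounded_complex L X A" and B: "bounded_complex L X B" and f: "f \<in> chain_map L X A B"
        by (simp_all add: Cb_simps)
      interpret A: sheaf_complex L X A by (rule bounded_sheaf_complex[OF A])
      interpret B: sheaf_complex L X B by (rule bounded_sheaf_complex[OF B])
      note rA = bounded_restrict[OF A] and rB = bounded_restrict[OF B]
      note Ef = Em_chain_map[OF bounded_cochain[OF rA] bounded_cochain[OF rB] chain_map_restrict[OF f]]
      show "Cmp (Cb L X) (ext_cplx L K X A) (ext_cplx L K X B) (conj_cplx g B) (act_map g X B) (Em X A B f) =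
          Cmp (Cb L X) (ext_cplx L K X A) (conj_cplx g A) (conj_cplx g B) f (act_map g X A)"
      proof (rule Cmp_eqI[OF bounded_cochain[OF ext_cplx_bounded[OF rA]] Ef act_chain_map[OF bounded_cochain[OF B] g]
            act_chain_map[OF bounded_cochain[OF A] g] conj_chain_map[OF g f]])
        fix n U a assume U: "openin X U" and a: "a \<in> carrier (sec (ob (ext_cplx L K X A) n) U)"
        show "act_mor g X (ob B n) U (em X (ob A n) (ob B n) (f n) U a) = f n U (act_mor g X (ob A n) U a)"
          by (rule act_natural[OF A.ob_sheaf g B.ob_sheaf chain_mapD(1)[OF f] U a[unfolded ext_cplx_simps]
            act_tens[OF B.ob_sheaf g U], symmetric])
      qed
    qed
    note cp = localizing_functor.zigzag_map[OF conj_functor[OF g] p]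
    have "L_eq X EC (conj_cplx g ED)
        ((Fwd EC (?u C) ?EEC # ext_zigzag p) @ [?a ED]) ([Fwd EC (?u C) ?EEC, ?a EC] @ conj_zigzag g p)"
      using L.zigzag_eq_append_left[OF natural zu(1)] by simp
    also have "L_eq X EC (conj_cplx g ED) \<dots>
        ([Fwd EC (twist_map g X C) (conj_cplx g EC)] @ conj_zigzag g p)"
      by (rule L.zigzag_eq_append_right[OF act_unit_eq[OF g C] cp])
    also have "L_eq X EC (conj_cplx g ED) \<dots> (p @ [Fwd ED (twist_map g X D) (conj_cplx g ED)])"
      using zigzag_eq.sym[OF equivariant[OF g]] by simp
    also have "L_eq X EC (conj_cplx g ED) \<dots> (p @ [Fwd ED (?u D) ?EED, ?a ED])"
      by (rule L.zigzag_eq_append_left[OF zigzag_eq.sym[OF act_unit_eq[OF g D]] p])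
    finally show "L_eq X EC (conj_cplx g ED)
        ((Fwd EC (?u C) ?EEC # ext_zigzag p) @ [?a ED]) ((p @ [Fwd ED (?u D) ?EED]) @ [?a ED])" by simp
  qed
  note unit_p = this
  let ?t = "Em X ED D (trace_map c X D)"
  have t: "?t \<in> Hom (Cb L X) ?EED ED" by (rule Em.Tm_Hom[OF rO(2) O(2) tr])
  have "Cmp (Cb L X) ED ?EED ED ?t (?u D) = Em X D D (Cmp (Cb RK X) D ED D (trace_map c X D) (unit_map X D))"
    using Em.is_functor[unfolded is_functor_def, THEN conjunct2, THEN conjunct2, THEN conjunct2,
      rule_format, OF O(2) rO(2) O(2) unit_Hom[OF D] tr] by (rule HOL.sym)
  also have "\<dots> = Idt (Cb L X) ED"
    unfolding trace_unit_Idt[OF D c]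
    by (rule Em.is_functor[unfolded is_functor_def, THEN conjunct2, THEN conjunct2, THEN conjunct1, rule_format, OF O(2)])
  finally have retract: "L_eq X ED ED [Fwd ED (?u D) ?EED, Fwd ?EED ?t ED] []"
    using zigzag_eq.trans[OF L.zigzag_eq_Cmp[OF EO(2) EEO(2) EO(2) u(2) t]] L.zigzag_eq_Idt[OF EO(2)] by simp
  have "L_eq X EC ED (ext_zigzag q) (p @ [Fwd ED (?u D) ?EED, Fwd ?EED ?t ED])"
    using L.zigzag_eq_append_right[OF unit_p L.zigzag_Fwd[OF EEO(2) EO(2) t]] by (simp add: q_def)
  moreover have "L_eq X EC ED (p @ [Fwd ED (?u D) ?EED, Fwd ?EED ?t ED]) p"
    using L.zigzag_eq_append_left[OF retract p] by simp
  ultimately have "L_eq X EC ED (ext_zigzag q) p" by (rule zigzag_eq.trans)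
  then show ?thesis using q by blast
qed

lemma Phi_mor_bij: "bij_betw (Phi_mor L K X C D) (Hom (Db RK X) C D) (Hom (DbG L K X) (Phi_ob L K X C) (Phi_ob L K X D))"
proof (rule bij_betw_imageI)
  have Hom: "Hom (Db RK X) C D = {K_class X C D p | p. K_zigzag X C p D}"
    by (simp add: Db_def localization_def)
  show "inj_on (Phi_mor L K X C D) (Hom (Db RK X) C D)"
  proof (rule inj_onI)
    fix f f' assume "f \<in> Hom (Db RK X) C D" "f' \<in> Hom (Db RK X) C D" and eq: "Phi_mor L K X C D f = Phi_mor L K X C D f'"
    then obtain p q where p: "K_zigzag X C p D" "f = K_class X C D p"
      and q: "K_zigzag X C q D" "f' = K_class X C D q"
      unfolding Hom by blast
    have "L_eq X EC ED (ext_zigzag p) (ext_zigzag q)"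
      using eq unfolding p(2) q(2) Phi_mor_class[OF p(1)] Phi_mor_class[OF q(1)] L.zigzag_class_eq_iff[OF Em.zigzag_map[OF p(1)]] .
    from Phi_mor_inj[OF p(1) q(1) this] show "f = f'" unfolding p(2) q(2) K.zigzag_class_eq_iff[OF p(1)] .
  qed
  show "Phi_mor L K X C D ` Hom (Db RK X) C D = Hom (DbG L K X) (Phi_ob L K X C) (Phi_ob L K X D)"
  proof (intro subset_antisym image_subsetI Phi_mor_Hom subsetI)
    fix f assume "f \<in> Hom (DbG L K X) (Phi_ob L K X C) (Phi_ob L K X D)"
    then obtain p where p: "L_zigzag X EC p ED" and f: "f = L_class X EC ED p"
      and equivariant: "\<And>g. g \<in> G \<Longrightarrow> L_eq X EC (conj_cplx g ED)
        (p @ [Fwd ED (twist_map g X D) (conj_cplx g ED)])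
        (Fwd EC (twist_map g X C) (conj_cplx g EC) # conj_zigzag g p)"
      unfolding Hom_DbG_eq by blast
    obtain q where q: "K_zigzag X C q D"
      and eq: "L_eq X EC ED (ext_zigzag q) p"
      using Phi_mor_surj[OF p equivariant] by blast
    have "f = Phi_mor L K X C D (K_class X C D q)"
      unfolding f Phi_mor_class[OF q]
      by (rule L.zigzag_class_eq_iff[OF Em.zigzag_map[OF q], THEN iffD2, OF eq, symmetric])
    then show "f \<in> Phi_mor L K X C D ` Hom (Db RK X) C D" unfolding Hom using q by blast
  qed
qed

end

lemma Phi_functor:
  fixes X :: "'x topology"
  shows "is_functor (Db RK X :: (('x, 'l, ('x, 'l, 'b) univ) cplx, ('x, 'l, ('x, 'l, 'b) univ) dmor) cat)
    (DbG L K X) (Phi_ob L K X) (Phi_mor L K X)"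
proof -
  interpret K: localizing "Cb RK X :: (('x, 'l, ('x, 'l, 'b) univ) cplx, _) cat" "quasi_isos RK X" by (rule Cb_localizing)
  interpret L: localizing "Cb L X :: (('x, 'l, ('x, 'l, 'b) univ) cplx, _) cat" "quasi_isos L X" by (rule Cb_localizing)
  interpret Em: localizing_functor "Cb RK X :: (('x, 'l, ('x, 'l, 'b) univ) cplx, _) cat" "quasi_isos RK X"
    "Cb L X" "quasi_isos L X" "ext_cplx L K X" "\<lambda>C D f. Em X C D f" by (rule ext_functor)
  have Ob: "Ob (Db RK X :: (('x, 'l, ('x, 'l, 'b) univ) cplx, _) cat) = {C. bounded_complex RK X C}"
    by (simp add: Db_def localization_def Cb_simps)
  show ?thesis
    unfolding is_functor_def Ob mem_Collect_eq
  proof (intro conjI ballI, unfold mem_Collect_eq)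
    fix A :: "('x, 'l, ('x, 'l, 'b) univ) cplx" assume A: "bounded_complex RK X A"
    then have AO: "A \<in> Ob (Cb RK X)" by (simp add: Cb_simps)
    show "Phi_ob L K X A \<in> Ob (DbG L K X)" by (rule Phi_ob_Ob[OF A])
    have "K_zigzag X A [] A" by (rule zigzag.nil[OF AO])
    from Phi_mor_class[OF A A this]
    show "Phi_mor L K X A A (Idt (Db RK X) A) = Idt (DbG L K X) (Phi_ob L K X A)"
      by (simp add: DbG_def Phi_ob_def Db_def localization_def)
    fix B :: "('x, 'l, ('x, 'l, 'b) univ) cplx" and f assume B: "bounded_complex RK X B" and f: "f \<in> Hom (Db RK X) A B"
    show "Phi_mor L K X A B f \<in> Hom (DbG L K X) (Phi_ob L K X A) (Phi_ob L K X B)" by (rule Phi_mor_Hom[OF A B f])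
    fix D :: "('x, 'l, ('x, 'l, 'b) univ) cplx" and g assume D: "bounded_complex RK X D" and g: "g \<in> Hom (Db RK X) B D"
    obtain p where p: "K_zigzag X A p B" "f = K_class X A B p"
      using f by (auto simp: Db_def localization_def)
    obtain q where q: "K_zigzag X B q D" "g = K_class X B D q"
      using g by (auto simp: Db_def localization_def)
    have "Cmp (DbG L K X) (Phi_ob L K X A) (Phi_ob L K X B) (Phi_ob L K X D) = Cmp (Db L X) (ext_cplx L K X A) (ext_cplx L K X B) (ext_cplx L K X D)"
      by (simp add: DbG_def Phi_ob_def)
    then show "Phi_mor L K X A D (Cmp (Db RK X) A B D g f) =
        Cmp (DbG L K X) (Phi_ob L K X A) (Phi_ob L K X B) (Phi_ob L K X D) (Phi_mor L K X B D g) (Phi_mor L K X A B f)"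
      using L.Cmp_localization[OF Em.zigzag_map[OF p(1)] Em.zigzag_map[OF q(1)]]
        Phi_mor_class[OF A D K.zigzag_append[OF p(1) q(1)]] Phi_mor_class[OF A B p(1)] Phi_mor_class[OF B D q(1)]
        K.Cmp_localization[OF p(1) q(1)] p(2) q(2) by (simp add: Db_def)
  qed
qed

end

theorem proposition5p3:
  fixes L :: "'l ring" and K :: "'l set" and X :: "'x topology"
  assumes "finite_galois_extension L K"
    and "good_space X"
  shows "fully_faithful_functor
    (Db (L\<lparr>carrier := K\<rparr>) X ::
       (('x, 'l, ('x, 'l, 'b) univ) cplx, ('x, 'l, ('x, 'l, 'b) univ) dmor) cat)
    (DbG L K X)
    (Phi_ob L K X) (Phi_mor L K X)"
proof -
  interpret galois_extension L K by unfold_locales (rule assms(1))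
  show ?thesis
    unfolding fully_faithful_functor_def
    by (intro conjI ballI Phi_functor Phi_mor_bij) (simp_all add: Db_def localization_def Cb_simps)
qed

end
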